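(* Let $\mathcal B$ be a bounding class, and $(G,L)$ a $\mathcal B$-duality group of dimension $n$ with duality module $D_{\mathcal B}$ and fundamental class $\mu^{\mathcal B}\in\mathcal BH_n(G,D_{\mathcal B})$. Suppose $\mu^{\mathcal B}$ is in the image of the homology comparison map $\Phi_*^{\mathcal B}:H_n(G,D_{\mathcal B})\to\mathcal BH_n(G,D_{\mathcal B})$. Then: (i) If $D_{\mathcal B}$ is finite-dimensional over $\mathbb C$, then $(G,L)$ is strongly monocohomological, that is, the comparison map $\mathcal BH^*(G;V)\to H^*(G;V)$ is injective for all bornological $\mathcal H_{\mathcal B,L}(G)$-modules $V$. (ii) If $D_{\mathcal B}$ is infinite-dimensional over $\mathbb C$, then $(G,L)$ is monocohomological (the comparison map $\mathcal BH^*(G;V)\to H^*(G;V)$ is injective) for all bornological $\mathcal H_{\mathcal B,L}(G)$-modules $V$ which are finite-dimensional over $\mathbb C$.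
   Context: Bounding classes. Let $\mathcal S$ be the set of non-decreasing functions $\mathbb R_+=[0,\infty)\to\mathbb R^+=(0,\infty)$. A set $\mathcal B\subset\mathcal S$ is weakly closed under an operation $\phi:\mathcal S^n\to\mathcal S$ if for all $f_1,\dots,f_n\in\mathcal B$ there is $f\in\mathcal B$ with $\phi(f_1,\dots,f_n)<f$. A bounding class is a set $\mathcal B\subset\mathcal S$ containing the constant function $1$ and weakly closed under positive rational linear combinations and under $f\mapsto f\circ g$ for every $g\in\mathcal L=\{ax+b\mid a,b\in\mathbb Q_+\}$. All bounding classes are assumed weakly countable: there is a countable bounding class $\mathcal B'$ such that each element of $\mathcal B'$ is bounded above by an element of $\mathcal B$ and conversely. (Co)homology. $(G,L)$ is a group with word-length function. $\mathcal H_{\mathcal B,L}(G)=\{f:G\to\mathbb C\mid\sum_g|f(g)|\lambda(L(g))<\infty\ \forall\lambda\in\mathcal B\}$, a bornological (Fréchet) convolution algebra. $EG$ is the homogeneous bar complex with weight $w(g_0,\dots,g_n)=L(g_0)+\sum_{i=1}^nL(g_{i-1}^{-1}g_i)$; $\mathcal BC_n(EG)$ is the completion of $\mathbb C[G^{n+1}]$ in the seminorms $|\sum\alpha_s s|_f=\sum|\alpha_s|f(w(s))$, $f\in\mathcal B$. For a bornological $\mathcal H_{\mathcal B,L}(G)$-module $V$: $\mathcal BH^*(G;V)$ is the algebraic cohomology of the complex of bounded $\mathcal H_{\mathcal B,L}(G)$-module homomorphisms $\mathcal BC_*(EG)\to V$, and $\mathcal BH_*(G,V)$ is the algebraic homology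 of $\mathcal BC_*(EG)\,\widehat\otimes_{\mathcal H_{\mathcal B,L}(G)}V$, $\widehat\otimes$ being the completed projective bornological tensor product. The inclusion $C_*(EG)\hookrightarrow\mathcal BC_*(EG)$ induces comparison maps $\Phi^*_{\mathcal B}:\mathcal BH^*(G;V)\to H^*(G;V)$ and $\Phi^{\mathcal B}_*:H_*(G,V)\to\mathcal BH_*(G,V)$. The usual cap product extends to the $\mathcal B$-bounded setting. $\mathcal B$-duality group. $(G,L)$ is a $\mathcal B$-duality group of dimension $n$ if there are a bornological $\mathcal H_{\mathcal B,L}(G)$-module $D_{\mathcal B}$ (the duality module) and a fundamental class $\mu^{\mathcal B}\in\mathcal BH_n(G,D_{\mathcal B})$ such that cap product with $\mu^{\mathcal B}$ is an isomorphism $\mathcal BH^i(G,V)\to\mathcal BH_{n-i}(G,D_{\mathcal B}\widehat\otimes V)$ for all $i$ and all bornological $\mathcal H_{\mathcal B,L}(G)$-modules $V$. *)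

theory Defs
  imports "HOL-Analysis.Analysis" "HOL-Algebra.AbelCoset" "HOL-Algebra.Module"
begin

section \<open>Bounding classes\<close>

text \<open>A function on $[0,\infty)$ is represented by a function on all reals whose values at negative
  arguments are irrelevant; no condition below refers to them.\<close>

definition positive_nondecreasing :: "(real \<Rightarrow> real) \<Rightarrow> bool" where
  "positive_nondecreasing f \<longleftrightarrow> mono_on {0..} f \<and> (\<forall>x\<ge>0. 0 < f x)"

definition pre_bounding_class :: "(real \<Rightarrow> real) set \<Rightarrow> bool" where
  "pre_bounding_class B \<longleftrightarrow>
     (\<forall>f\<in>B. positive_nondecreasing f) \<and>
     (\<exists>f\<in>B. \<forall>x\<ge>0. f x = 1) \<and>
     (\<forall>n>0. \<forall>f q. (\<forall>i<n. f i \<in> B \<and> q i \<in> \<rat> \<and> 0 < q i) \<longrightarrow>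
        (\<exists>h\<in>B. \<forall>x\<ge>0. (\<Sum>i<(n::nat). q i * f i x) < h x)) \<and>
     (\<forall>f\<in>B. \<forall>a\<in>\<rat>. \<forall>b\<in>\<rat>. 0 \<le> a \<longrightarrow> 0 \<le> b \<longrightarrow> (\<exists>h\<in>B. \<forall>x\<ge>0. f (a * x + b) < h x))"

definition bounding_class :: "(real \<Rightarrow> real) set \<Rightarrow> bool" where
  "bounding_class B \<longleftrightarrow> pre_bounding_class B \<and>
     (\<exists>B'. countable B' \<and> pre_bounding_class B' \<and>
        (\<forall>f\<in>B'. \<exists>h\<in>B. \<forall>x\<ge>0. f x \<le> h x) \<and>
        (\<forall>h\<in>B. \<exists>f\<in>B'. \<forall>x\<ge>0. h x \<le> f x))"

section \<open>Groups with a word-length function\<close>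

text \<open>\<open>L\<close> is the word length for a symmetric generating set \<open>S\<close> whose elements carry
  positive weights \<open>\<phi>\<close>; the usual word length is the case \<open>\<phi> = 1\<close>.\<close>

definition word_length_function :: "('g, 'r) monoid_scheme \<Rightarrow> ('g \<Rightarrow> real) \<Rightarrow> bool" where
  "word_length_function G L \<longleftrightarrow>
     (\<exists>S \<phi>. S \<subseteq> carrier G \<and>
        (\<forall>s\<in>S. 0 < \<phi> s \<and> inv\<^bsub>G\<^esub> s \<in> S \<and> \<phi> (inv\<^bsub>G\<^esub> s) = \<phi> s) \<and>
        (\<forall>g\<in>carrier G.
           (\<exists>ws. set ws \<subseteq> S \<and> foldr (\<otimes>\<^bsub>G\<^esub>) ws \<one>\<^bsub>G\<^esub> = g \<and> L g = sum_list (map \<phi> ws)) \<and>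
           (\<forall>ws. set ws \<subseteq> S \<and> foldr (\<otimes>\<^bsub>G\<^esub>) ws \<one>\<^bsub>G\<^esub> = g \<longrightarrow> L g \<le> sum_list (map \<phi> ws))))"

section \<open>Complex vector spaces and subquotients\<close>

definition complex_field :: "complex ring" where
  "complex_field = \<lparr>carrier = UNIV, mult = (*), one = 1, zero = 0, add = (+)\<rparr>"

abbreviation vector_space_C :: "(complex, 'v, 'm) module_scheme \<Rightarrow> bool" where
  "vector_space_C V \<equiv> Module.module complex_field V"

abbreviation subspace_C :: "(complex, 'v, 'm) module_scheme \<Rightarrow> 'v set \<Rightarrow> bool" where
  "subspace_C V W \<equiv> Module.submodule W complex_field V"

definition vspan :: "(complex, 'v, 'm) module_scheme \<Rightarrow> 'v set \<Rightarrow> 'v set" where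
  "vspan V S = \<Inter> {W. subspace_C V W \<and> S \<subseteq> W}"

definition finite_dimensional :: "(complex, 'v, 'm) module_scheme \<Rightarrow> bool" where
  "finite_dimensional V \<longleftrightarrow> (\<exists>S. finite S \<and> S \<subseteq> carrier V \<and> vspan V S = carrier V)"

definition lin_maps ::
  "(complex, 'v, 'm) module_scheme \<Rightarrow> (complex, 'w, 'k) module_scheme \<Rightarrow> ('v \<Rightarrow> 'w) set" where
  "lin_maps V W = {f \<in> carrier V \<rightarrow>\<^sub>E carrier W.
     (\<forall>x\<in>carrier V. \<forall>y\<in>carrier V. f (x \<oplus>\<^bsub>V\<^esub> y) = f x \<oplus>\<^bsub>W\<^esub> f y) \<and>
     (\<forall>a. \<forall>x\<in>carrier V. f (a \<odot>\<^bsub>V\<^esub> x) = a \<odot>\<^bsub>W\<^esub> f x)}"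

definition lin_iso ::
  "(complex, 'v, 'm) module_scheme \<Rightarrow> (complex, 'w, 'k) module_scheme \<Rightarrow> ('v \<Rightarrow> 'w) \<Rightarrow> bool" where
  "lin_iso V W f \<longleftrightarrow>
     restrict f (carrier V) \<in> lin_maps V W \<and> bij_betw f (carrier V) (carrier W)"

text \<open>The vector space \<open>Z / W\<close>, for subspaces \<open>W \<subseteq> Z\<close> of \<open>V\<close>, with cosets as elements. The
  fields \<open>mult\<close> and \<open>one\<close>, which the record type of modules inherits from rings, play no role
  for vector spaces and are left undefined here and below.\<close>

definition subquotient ::
  "(complex, 'v, 'm) module_scheme \<Rightarrow> 'v set \<Rightarrow> 'v set \<Rightarrow> (complex, 'v set) module" where
  "subquotient V Z W =
     \<lparr>carrier = (\<lambda>z. W +>\<^bsub>V\<^esub> z) ` Z, mult = undefined, one = undefined, zero = W,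
      add = set_add V, smult = (\<lambda>a X. set_add V W ((\<lambda>x. a \<odot>\<^bsub>V\<^esub> x) ` X))\<rparr>"

text \<open>The map on cosets induced by a map \<open>f\<close> into \<open>V\<close>: the class modulo \<open>W\<close> of the image of any
  representative.\<close>

definition induced_map ::
  "(complex, 'w, 'm) module_scheme \<Rightarrow> 'w set \<Rightarrow> ('v \<Rightarrow> 'w) \<Rightarrow> 'v set \<Rightarrow> 'w set" where
  "induced_map V W f X = the_elem ((\<lambda>x. W +>\<^bsub>V\<^esub> f x) ` X)"

subsection \<open>Spaces of complex functions\<close>

definition fun_space :: "('x \<Rightarrow> complex) set \<Rightarrow> (complex, 'x \<Rightarrow> complex) module" where
  "fun_space F = \<lparr>carrier = F, mult = undefined, one = undefined, zero = (\<lambda>x. 0),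
     add = (\<lambda>f h x. f x + h x), smult = (\<lambda>a f x. a * f x)\<rparr>"

definition dirac :: "'x \<Rightarrow> 'x \<Rightarrow> complex" where
  "dirac p = (\<lambda>q. if q = p then 1 else 0)"

definition finsupp_funs :: "'x set \<Rightarrow> ('x \<Rightarrow> complex) set" where
  "finsupp_funs X = {f. finite {x. f x \<noteq> 0} \<and> {x. f x \<noteq> 0} \<subseteq> X}"

text \<open>The linear extension of \<open>p \<mapsto> h p\<close> to finite or absolutely convergent combinations of points.\<close>

definition pushforward :: "('p \<Rightarrow> 'q) \<Rightarrow> ('p \<Rightarrow> complex) \<Rightarrow> 'q \<Rightarrow> complex" where
  "pushforward h c = (\<lambda>q. \<Sum>\<^sub>\<infinity>p\<in>h -` {q}. c p)"

subsection \<open>Complexes\<close>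

definition homology ::
  "(nat \<Rightarrow> (complex, 'v, 'm) module_scheme) \<Rightarrow> (nat \<Rightarrow> 'v \<Rightarrow> 'v) \<Rightarrow> nat \<Rightarrow> (complex, 'v set) module"
  where
  "homology C d n = subquotient (C n)
     {x \<in> carrier (C n). n = 0 \<or> d n x = \<zero>\<^bsub>C (n - 1)\<^esub>}
     (d (Suc n) ` carrier (C (Suc n)))"

definition cohomology ::
  "(nat \<Rightarrow> (complex, 'v, 'm) module_scheme) \<Rightarrow> (nat \<Rightarrow> 'v \<Rightarrow> 'v) \<Rightarrow> nat \<Rightarrow> (complex, 'v set) module"
  where
  "cohomology C d n = subquotient (C n)
     {x \<in> carrier (C n). d n x = \<zero>\<^bsub>C (Suc n)\<^esub>}
     (if n = 0 then {\<zero>\<^bsub>C 0\<^esub>} else d (n - 1) ` carrier (C (n - 1)))"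

section \<open>Bornological vector spaces\<close>

record 'v born_space = "(complex, 'v) module" +
  bornology :: "'v set set"

definition disk :: "(complex, 'v, 'm) module_scheme \<Rightarrow> 'v set \<Rightarrow> bool" where
  "disk V A \<longleftrightarrow> A \<subseteq> carrier V \<and>
     (\<forall>x\<in>A. \<forall>a. cmod a \<le> 1 \<longrightarrow> a \<odot>\<^bsub>V\<^esub> x \<in> A) \<and>
     (\<forall>x\<in>A. \<forall>y\<in>A. \<forall>t::real. 0 \<le> t \<and> t \<le> 1 \<longrightarrow>
        (of_real (1 - t) \<odot>\<^bsub>V\<^esub> x) \<oplus>\<^bsub>V\<^esub> (of_real t \<odot>\<^bsub>V\<^esub> y) \<in> A)"

definition disked_hull :: "(complex, 'v, 'm) module_scheme \<Rightarrow> 'v set \<Rightarrow> 'v set" where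
  "disked_hull V A = \<Inter> {D. disk V D \<and> A \<subseteq> D}"

definition convex_bornology :: "('v, 'm) born_space_scheme \<Rightarrow> bool" where
  "convex_bornology V \<longleftrightarrow>
     (\<forall>A\<in>bornology V. A \<subseteq> carrier V) \<and>
     (\<forall>x\<in>carrier V. {x} \<in> bornology V) \<and>
     (\<forall>A\<in>bornology V. \<forall>A'. A' \<subseteq> A \<longrightarrow> A' \<in> bornology V) \<and>
     (\<forall>A\<in>bornology V. \<forall>A'\<in>bornology V. \<forall>a. set_add V A ((\<lambda>x. a \<odot>\<^bsub>V\<^esub> x) ` A') \<in> bornology V) \<and>
     (\<forall>A\<in>bornology V. disked_hull V A \<in> bornology V)"

text \<open>The span of a disk, and its Minkowski functional on that span.\<close>

definition disk_span :: "(complex, 'v, 'm) module_scheme \<Rightarrow> 'v set \<Rightarrow> 'v set" where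
  "disk_span V A = {of_real t \<odot>\<^bsub>V\<^esub> x | t x. 0 < t \<and> x \<in> A}"

definition gauge_of :: "(complex, 'v, 'm) module_scheme \<Rightarrow> 'v set \<Rightarrow> 'v \<Rightarrow> real" where
  "gauge_of V A v = Inf {t. 0 < t \<and> (\<exists>x\<in>A. v = of_real t \<odot>\<^bsub>V\<^esub> x)}"

definition disk_dist :: "(complex, 'v, 'm) module_scheme \<Rightarrow> 'v set \<Rightarrow> 'v \<Rightarrow> 'v \<Rightarrow> real" where
  "disk_dist V A x y =
     (if x \<in> disk_span V A \<and> y \<in> disk_span V A then gauge_of V A (x \<ominus>\<^bsub>V\<^esub> y) else 0)"

text \<open>A disk is completant if its span is a Banach space for the gauge.\<close>

definition completant_disk :: "(complex, 'v, 'm) module_scheme \<Rightarrow> 'v set \<Rightarrow> bool" where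
  "completant_disk V A \<longleftrightarrow> disk V A \<and>
     Metric_space (disk_span V A) (disk_dist V A) \<and>
     Metric_space.mcomplete (disk_span V A) (disk_dist V A)"

definition complete_bornological_space :: "('v, 'm) born_space_scheme \<Rightarrow> bool" where
  "complete_bornological_space V \<longleftrightarrow> vector_space_C V \<and> convex_bornology V \<and>
     (\<forall>A\<in>bornology V. \<exists>D\<in>bornology V. A \<subseteq> D \<and> completant_disk V D)"

definition bounded_lin_maps ::
  "('v, 'm) born_space_scheme \<Rightarrow> ('w, 'k) born_space_scheme \<Rightarrow> ('v \<Rightarrow> 'w) set" where
  "bounded_lin_maps V W = {f \<in> lin_maps V W. \<forall>A\<in>bornology V. f ` A \<in> bornology W}"

definition mackey_limit :: "('v, 'm) born_space_scheme \<Rightarrow> (nat \<Rightarrow> 'v) \<Rightarrow> 'v \<Rightarrow> bool" where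
  "mackey_limit V u l \<longleftrightarrow> (\<forall>k. u k \<in> carrier V) \<and> l \<in> carrier V \<and>
     (\<exists>A\<in>bornology V. \<exists>e::nat \<Rightarrow> real. e \<longlonglongrightarrow> 0 \<and>
        (\<forall>k. \<exists>x\<in>A. u k \<ominus>\<^bsub>V\<^esub> l = of_real (e k) \<odot>\<^bsub>V\<^esub> x))"

definition mackey_closed :: "('v, 'm) born_space_scheme \<Rightarrow> 'v set \<Rightarrow> bool" where
  "mackey_closed V W \<longleftrightarrow> (\<forall>u l. (\<forall>k. u k \<in> W) \<and> mackey_limit V u l \<longrightarrow> l \<in> W)"

definition closed_span :: "('v, 'm) born_space_scheme \<Rightarrow> 'v set \<Rightarrow> 'v set" where
  "closed_span V S = \<Inter> {W. subspace_C V W \<and> mackey_closed V W \<and> S \<subseteq> W}"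

definition born_quotient :: "('v, 'm) born_space_scheme \<Rightarrow> 'v set \<Rightarrow> 'v set born_space" where
  "born_quotient V W = module.extend (subquotient V (carrier V) W)
     (born_space.fields {(\<lambda>x. W +>\<^bsub>V\<^esub> x) ` A | A. A \<in> bornology V})"

section \<open>Weighted spaces and the convolution algebra\<close>

text \<open>The completion of the finitely supported functions on \<open>X\<close> in the norms
  $\sum_x |f(x)|\,\lambda(w(x))$, $\lambda\in B$, with its von Neumann bornology.\<close>

definition weighted_l1 ::
  "(real \<Rightarrow> real) set \<Rightarrow> 'x set \<Rightarrow> ('x \<Rightarrow> real) \<Rightarrow> ('x \<Rightarrow> complex) born_space" where
  "weighted_l1 B X w =
     (let F = {f. (\<forall>x. x \<notin> X \<longrightarrow> f x = 0) \<and> (\<forall>l\<in>B. (\<lambda>x. cmod (f x) * l (w x)) summable_on X)}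
      in module.extend (fun_space F)
           (born_space.fields
             {A. A \<subseteq> F \<and> (\<forall>l\<in>B. \<exists>K. \<forall>f\<in>A. (\<Sum>\<^sub>\<infinity>x\<in>X. cmod (f x) * l (w x)) \<le> K)}))"

definition convolution ::
  "('g, 'r) monoid_scheme \<Rightarrow> ('g \<Rightarrow> complex) \<Rightarrow> ('g \<Rightarrow> complex) \<Rightarrow> 'g \<Rightarrow> complex" where
  "convolution G f h =
     (\<lambda>g. if g \<in> carrier G then \<Sum>\<^sub>\<infinity>x\<in>carrier G. f x * h (inv\<^bsub>G\<^esub> x \<otimes>\<^bsub>G\<^esub> g) else 0)"

definition H_alg ::
  "(real \<Rightarrow> real) set \<Rightarrow> ('g, 'r) monoid_scheme \<Rightarrow> ('g \<Rightarrow> real) \<Rightarrow> ('g \<Rightarrow> complex) born_space" where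
  "H_alg B G L =
     (weighted_l1 B (carrier G) L)\<lparr>mult := convolution G, one := dirac \<one>\<^bsub>G\<^esub>\<rparr>"

abbreviation group_algebra :: "('g, 'r) monoid_scheme \<Rightarrow> ('g \<Rightarrow> complex) set" where
  "group_algebra G \<equiv> finsupp_funs (carrier G)"

section \<open>Bornological modules\<close>

record ('a, 'v) born_module = "'v born_space" +
  act :: "'a \<Rightarrow> 'v \<Rightarrow> 'v"

definition bornological_module ::
  "('a, 's) born_space_scheme \<Rightarrow> ('a, 'v, 'm) born_module_scheme \<Rightarrow> bool" where
  "bornological_module A V \<longleftrightarrow>
     complete_bornological_space V \<and>
     (\<forall>a\<in>carrier A. \<forall>x\<in>carrier V. act V a x \<in> carrier V) \<and>
     (\<forall>a\<in>carrier A. \<forall>b\<in>carrier A. \<forall>x\<in>carrier V.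
        act V (a \<oplus>\<^bsub>A\<^esub> b) x = act V a x \<oplus>\<^bsub>V\<^esub> act V b x) \<and>
     (\<forall>a\<in>carrier A. \<forall>x\<in>carrier V. \<forall>y\<in>carrier V.
        act V a (x \<oplus>\<^bsub>V\<^esub> y) = act V a x \<oplus>\<^bsub>V\<^esub> act V a y) \<and>
     (\<forall>z. \<forall>a\<in>carrier A. \<forall>x\<in>carrier V.
        act V (z \<odot>\<^bsub>A\<^esub> a) x = z \<odot>\<^bsub>V\<^esub> act V a x \<and> act V a (z \<odot>\<^bsub>V\<^esub> x) = z \<odot>\<^bsub>V\<^esub> act V a x) \<and>
     (\<forall>a\<in>carrier A. \<forall>b\<in>carrier A. \<forall>x\<in>carrier V. act V (a \<otimes>\<^bsub>A\<^esub> b) x = act V a (act V b x)) \<and>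
     (\<forall>x\<in>carrier V. act V \<one>\<^bsub>A\<^esub> x = x) \<and>
     (\<forall>S\<in>bornology A. \<forall>T\<in>bornology V. {act V a x | a x. a \<in> S \<and> x \<in> T} \<in> bornology V)"

section \<open>Tensor products\<close>

definition bilinear_rels ::
  "(complex, 'v, 'm) module_scheme \<Rightarrow> (complex, 'w, 'k) module_scheme \<Rightarrow> ('v \<times> 'w \<Rightarrow> complex) set"
  where
  "bilinear_rels V W =
     {\<lambda>p. dirac (x \<oplus>\<^bsub>V\<^esub> x', y) p - dirac (x, y) p - dirac (x', y) p | x x' y.
        x \<in> carrier V \<and> x' \<in> carrier V \<and> y \<in> carrier W} \<union>
     {\<lambda>p. dirac (x, y \<oplus>\<^bsub>W\<^esub> y') p - dirac (x, y) p - dirac (x, y') p | x y y'.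
        x \<in> carrier V \<and> y \<in> carrier W \<and> y' \<in> carrier W} \<union>
     {\<lambda>p. dirac (z \<odot>\<^bsub>V\<^esub> x, y) p - z * dirac (x, y) p | z x y. x \<in> carrier V \<and> y \<in> carrier W} \<union>
     {\<lambda>p. dirac (x, z \<odot>\<^bsub>W\<^esub> y) p - z * dirac (x, y) p | z x y. x \<in> carrier V \<and> y \<in> carrier W}"

text \<open>Here \<open>r\<close> is a right action of the algebra elements \<open>A\<close> on \<open>V\<close>.\<close>

definition balanced_rels ::
  "'a set \<Rightarrow> (complex, 'v, 'm) module_scheme \<Rightarrow> ('v \<Rightarrow> 'a \<Rightarrow> 'v) \<Rightarrow> ('a, 'w, 'k) born_module_scheme
     \<Rightarrow> ('v \<times> 'w \<Rightarrow> complex) set" where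
  "balanced_rels A V r W =
     {\<lambda>p. dirac (r x a, y) p - dirac (x, act W a y) p | a x y.
        a \<in> A \<and> x \<in> carrier V \<and> y \<in> carrier W}"

definition alg_tensor_rels ::
  "(complex, 'v, 'm) module_scheme \<Rightarrow> (complex, 'w, 'k) module_scheme \<Rightarrow> ('v \<times> 'w \<Rightarrow> complex) set
     \<Rightarrow> ('v \<times> 'w \<Rightarrow> complex) set" where
  "alg_tensor_rels V W R =
     vspan (fun_space (finsupp_funs (carrier V \<times> carrier W))) (bilinear_rels V W \<union> R)"

definition alg_tensor ::
  "(complex, 'v, 'm) module_scheme \<Rightarrow> (complex, 'w, 'k) module_scheme \<Rightarrow> ('v \<times> 'w \<Rightarrow> complex) set
     \<Rightarrow> (complex, ('v \<times> 'w \<Rightarrow> complex) set) module" where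
  "alg_tensor V W R = subquotient (fun_space (finsupp_funs (carrier V \<times> carrier W)))
     (finsupp_funs (carrier V \<times> carrier W)) (alg_tensor_rels V W R)"

text \<open>The completed projective tensor product. The space \<open>bounded_l1 V W\<close> of absolutely summable
  families supported on a product of bounded sets is the inductive limit of the Banach spaces
  $\ell^1(S\times T)$, so it is the universal complete bornological space receiving a map from
  \<open>carrier V \<times> carrier W\<close> that is bounded on every such product. Dividing by the Mackey-closed span
  of the bilinearity relations gives the complete bornological space through which every bounded
  bilinear map into a complete space factors uniquely; additional relations \<open>R\<close> give the balanced
  tensor product over an algebra.\<close>

definition bounded_l1 ::
  "('v, 'm) born_space_scheme \<Rightarrow> ('w, 'k) born_space_scheme \<Rightarrow> ('v \<times> 'w \<Rightarrow> complex) born_space" where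
  "bounded_l1 V W = module.extend
     (fun_space {c. \<exists>S\<in>bornology V. \<exists>T\<in>bornology W.
        (\<forall>p. p \<notin> S \<times> T \<longrightarrow> c p = 0) \<and> (\<lambda>p. cmod (c p)) summable_on UNIV})
     (born_space.fields {A. \<exists>S\<in>bornology V. \<exists>T\<in>bornology W. \<exists>K. \<forall>c\<in>A.
        (\<forall>p. p \<notin> S \<times> T \<longrightarrow> c p = 0) \<and> (\<lambda>p. cmod (c p)) summable_on UNIV \<and>
        (\<Sum>\<^sub>\<infinity>p. cmod (c p)) \<le> K})"

definition tensor_rels ::
  "('v, 'm) born_space_scheme \<Rightarrow> ('w, 'k) born_space_scheme \<Rightarrow> ('v \<times> 'w \<Rightarrow> complex) set
     \<Rightarrow> ('v \<times> 'w \<Rightarrow> complex) set" where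
  "tensor_rels V W R = closed_span (bounded_l1 V W) (bilinear_rels V W \<union> R)"

definition completed_tensor ::
  "('v, 'm) born_space_scheme \<Rightarrow> ('w, 'k) born_space_scheme \<Rightarrow> ('v \<times> 'w \<Rightarrow> complex) set
     \<Rightarrow> ('v \<times> 'w \<Rightarrow> complex) set born_space" where
  "completed_tensor V W R = born_quotient (bounded_l1 V W) (tensor_rels V W R)"

definition pure_tensor ::
  "('v, 'm) born_space_scheme \<Rightarrow> ('w, 'k) born_space_scheme \<Rightarrow> ('v \<times> 'w \<Rightarrow> complex) set
     \<Rightarrow> 'v \<Rightarrow> 'w \<Rightarrow> ('v \<times> 'w \<Rightarrow> complex) set" where
  "pure_tensor V W R x y = tensor_rels V W R +>\<^bsub>bounded_l1 V W\<^esub> dirac (x, y)"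

section \<open>The homogeneous bar complex\<close>

definition tuples :: "('g, 'r) monoid_scheme \<Rightarrow> nat \<Rightarrow> 'g list set" where
  "tuples G n = {s. length s = Suc n \<and> set s \<subseteq> carrier G}"

definition tuple_weight :: "('g, 'r) monoid_scheme \<Rightarrow> ('g \<Rightarrow> real) \<Rightarrow> 'g list \<Rightarrow> real" where
  "tuple_weight G L s =
     L (s ! 0) + (\<Sum>i=1..<length s. L (inv\<^bsub>G\<^esub> (s ! (i - 1)) \<otimes>\<^bsub>G\<^esub> (s ! i)))"

definition BC ::
  "(real \<Rightarrow> real) set \<Rightarrow> ('g, 'r) monoid_scheme \<Rightarrow> ('g \<Rightarrow> real) \<Rightarrow> nat
     \<Rightarrow> ('g list \<Rightarrow> complex) born_space" where
  "BC B G L n = weighted_l1 B (tuples G n) (tuple_weight G L)"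

definition C_alg :: "('g, 'r) monoid_scheme \<Rightarrow> nat \<Rightarrow> (complex, 'g list \<Rightarrow> complex) module" where
  "C_alg G n = fun_space (finsupp_funs (tuples G n))"

text \<open>The left action by convolution that extends the diagonal action
  $g\cdot(g_0,\dots,g_n)=(gg_0,\dots,gg_n)$, and the right action obtained from it by inverting group
  elements.\<close>

definition chain_act ::
  "('g, 'r) monoid_scheme \<Rightarrow> ('g \<Rightarrow> complex) \<Rightarrow> ('g list \<Rightarrow> complex) \<Rightarrow> 'g list \<Rightarrow> complex" where
  "chain_act G f c = (\<lambda>s. if set s \<subseteq> carrier G
     then \<Sum>\<^sub>\<infinity>x\<in>carrier G. f x * c (map (\<lambda>y. inv\<^bsub>G\<^esub> x \<otimes>\<^bsub>G\<^esub> y) s) else 0)"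

definition chain_ract ::
  "('g, 'r) monoid_scheme \<Rightarrow> ('g list \<Rightarrow> complex) \<Rightarrow> ('g \<Rightarrow> complex) \<Rightarrow> 'g list \<Rightarrow> complex" where
  "chain_ract G c f = chain_act G (\<lambda>g. if g \<in> carrier G then f (inv\<^bsub>G\<^esub> g) else 0) c"

definition face :: "nat \<Rightarrow> 'g list \<Rightarrow> 'g list" where
  "face i s = take i s @ drop (Suc i) s"

text \<open>The differential from degree \<open>n\<close> to degree \<open>n - 1\<close>, for \<open>n \<ge> 1\<close>.\<close>

definition bar_bd :: "nat \<Rightarrow> ('g list \<Rightarrow> complex) \<Rightarrow> 'g list \<Rightarrow> complex" where
  "bar_bd n c = (\<lambda>s. \<Sum>i\<le>n. (-1) ^ i * pushforward (face i) c s)"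

section \<open>Bounded and ordinary (co)homology\<close>

subsection \<open>Cohomology\<close>

text \<open>Elements of homomorphism spaces are extensional functions.\<close>

definition hom_space ::
  "('c \<Rightarrow> 'v) set \<Rightarrow> 'c set \<Rightarrow> (complex, 'v, 'm) module_scheme \<Rightarrow> (complex, 'c \<Rightarrow> 'v) module" where
  "hom_space F C V = \<lparr>carrier = F, mult = undefined, one = undefined,
     zero = (\<lambda>c\<in>C. \<zero>\<^bsub>V\<^esub>), add = (\<lambda>\<phi> \<psi>. \<lambda>c\<in>C. \<phi> c \<oplus>\<^bsub>V\<^esub> \<psi> c),
     smult = (\<lambda>a \<phi>. \<lambda>c\<in>C. a \<odot>\<^bsub>V\<^esub> \<phi> c)\<rparr>"

definition B_cochains ::
  "(real \<Rightarrow> real) set \<Rightarrow> ('g, 'r) monoid_scheme \<Rightarrow> ('g \<Rightarrow> real)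
     \<Rightarrow> ('g \<Rightarrow> complex, 'v, 'm) born_module_scheme \<Rightarrow> nat
     \<Rightarrow> (complex, ('g list \<Rightarrow> complex) \<Rightarrow> 'v) module" where
  "B_cochains B G L V n = hom_space
     {\<phi> \<in> bounded_lin_maps (BC B G L n) V.
        \<forall>f\<in>carrier (H_alg B G L). \<forall>c\<in>carrier (BC B G L n). \<phi> (chain_act G f c) = act V f (\<phi> c)}
     (carrier (BC B G L n)) V"

definition BH_co ::
  "(real \<Rightarrow> real) set \<Rightarrow> ('g, 'r) monoid_scheme \<Rightarrow> ('g \<Rightarrow> real)
     \<Rightarrow> ('g \<Rightarrow> complex, 'v, 'm) born_module_scheme \<Rightarrow> nat
     \<Rightarrow> (complex, (('g list \<Rightarrow> complex) \<Rightarrow> 'v) set) module" where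
  "BH_co B G L V = cohomology (B_cochains B G L V)
     (\<lambda>n \<phi>. \<lambda>c\<in>carrier (BC B G L (Suc n)). \<phi> (bar_bd (Suc n) c))"

definition cochains ::
  "('g, 'r) monoid_scheme \<Rightarrow> ('g \<Rightarrow> complex, 'v, 'm) born_module_scheme \<Rightarrow> nat
     \<Rightarrow> (complex, ('g list \<Rightarrow> complex) \<Rightarrow> 'v) module" where
  "cochains G V n = hom_space
     {\<phi> \<in> lin_maps (C_alg G n) V.
        \<forall>f\<in>group_algebra G. \<forall>c\<in>carrier (C_alg G n). \<phi> (chain_act G f c) = act V f (\<phi> c)}
     (carrier (C_alg G n)) V"

definition H_co ::
  "('g, 'r) monoid_scheme \<Rightarrow> ('g \<Rightarrow> complex, 'v, 'm) born_module_scheme \<Rightarrow> nat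
     \<Rightarrow> (complex, (('g list \<Rightarrow> complex) \<Rightarrow> 'v) set) module" where
  "H_co G V = cohomology (cochains G V)
     (\<lambda>n \<phi>. \<lambda>c\<in>carrier (C_alg G (Suc n)). \<phi> (bar_bd (Suc n) c))"

text \<open>The comparison map restricts cochains to the finitely supported chains. The subspace by which
  \<open>H_co\<close> divides is its zero element.\<close>

definition comparison_co ::
  "('g, 'r) monoid_scheme \<Rightarrow> ('g \<Rightarrow> complex, 'v, 'm) born_module_scheme \<Rightarrow> nat
     \<Rightarrow> (('g list \<Rightarrow> complex) \<Rightarrow> 'v) set \<Rightarrow> (('g list \<Rightarrow> complex) \<Rightarrow> 'v) set" where
  "comparison_co G V n =
     induced_map (cochains G V n) \<zero>\<^bsub>H_co G V n\<^esub> (\<lambda>\<phi>. restrict \<phi> (carrier (C_alg G n)))"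

subsection \<open>Homology\<close>

abbreviation H_rels ::
  "(real \<Rightarrow> real) set \<Rightarrow> ('g, 'r) monoid_scheme \<Rightarrow> ('g \<Rightarrow> real)
     \<Rightarrow> ('g \<Rightarrow> complex, 'v, 'm) born_module_scheme \<Rightarrow> nat
     \<Rightarrow> (('g list \<Rightarrow> complex) \<times> 'v \<Rightarrow> complex) set" where
  "H_rels B G L V n \<equiv>
     balanced_rels (carrier (H_alg B G L)) (BC B G L n) (chain_ract G) V"

definition B_chains ::
  "(real \<Rightarrow> real) set \<Rightarrow> ('g, 'r) monoid_scheme \<Rightarrow> ('g \<Rightarrow> real)
     \<Rightarrow> ('g \<Rightarrow> complex, 'v, 'm) born_module_scheme \<Rightarrow> nat
     \<Rightarrow> (('g list \<Rightarrow> complex) \<times> 'v \<Rightarrow> complex) set born_space" where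
  "B_chains B G L V n = completed_tensor (BC B G L n) V (H_rels B G L V n)"

abbreviation B_pure ::
  "(real \<Rightarrow> real) set \<Rightarrow> ('g, 'r) monoid_scheme \<Rightarrow> ('g \<Rightarrow> real)
     \<Rightarrow> ('g \<Rightarrow> complex, 'v, 'm) born_module_scheme \<Rightarrow> nat
     \<Rightarrow> ('g list \<Rightarrow> complex) \<Rightarrow> 'v \<Rightarrow> (('g list \<Rightarrow> complex) \<times> 'v \<Rightarrow> complex) set" where
  "B_pure B G L V n \<equiv> pure_tensor (BC B G L n) V (H_rels B G L V n)"

definition BH ::
  "(real \<Rightarrow> real) set \<Rightarrow> ('g, 'r) monoid_scheme \<Rightarrow> ('g \<Rightarrow> real)
     \<Rightarrow> ('g \<Rightarrow> complex, 'v, 'm) born_module_scheme \<Rightarrow> nat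
     \<Rightarrow> (complex, (('g list \<Rightarrow> complex) \<times> 'v \<Rightarrow> complex) set set) module" where
  "BH B G L V = homology (B_chains B G L V)
     (\<lambda>n. induced_map (bounded_l1 (BC B G L (n - 1)) V)
            (tensor_rels (BC B G L (n - 1)) V (H_rels B G L V (n - 1)))
            (pushforward (map_prod (bar_bd n) id)))"

abbreviation CG_rels ::
  "('g, 'r) monoid_scheme \<Rightarrow> ('g \<Rightarrow> complex, 'v, 'm) born_module_scheme \<Rightarrow> nat
     \<Rightarrow> (('g list \<Rightarrow> complex) \<times> 'v \<Rightarrow> complex) set" where
  "CG_rels G V n \<equiv> balanced_rels (group_algebra G) (C_alg G n) (chain_ract G) V"

definition chains ::
  "('g, 'r) monoid_scheme \<Rightarrow> ('g \<Rightarrow> complex, 'v, 'm) born_module_scheme \<Rightarrow> nat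
     \<Rightarrow> (complex, (('g list \<Rightarrow> complex) \<times> 'v \<Rightarrow> complex) set) module" where
  "chains G V n = alg_tensor (C_alg G n) V (CG_rels G V n)"

definition H_ord ::
  "('g, 'r) monoid_scheme \<Rightarrow> ('g \<Rightarrow> complex, 'v, 'm) born_module_scheme \<Rightarrow> nat
     \<Rightarrow> (complex, (('g list \<Rightarrow> complex) \<times> 'v \<Rightarrow> complex) set set) module" where
  "H_ord G V = homology (chains G V)
     (\<lambda>n. induced_map (fun_space (finsupp_funs (carrier (C_alg G (n - 1)) \<times> carrier V)))
            (alg_tensor_rels (C_alg G (n - 1)) V (CG_rels G V (n - 1)))
            (pushforward (map_prod (bar_bd n) id)))"

text \<open>On chains, the comparison map sends the class of a finite combination of pairs in the
  algebraic tensor product to its class in the completed one.\<close>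

definition comparison ::
  "(real \<Rightarrow> real) set \<Rightarrow> ('g, 'r) monoid_scheme \<Rightarrow> ('g \<Rightarrow> real)
     \<Rightarrow> ('g \<Rightarrow> complex, 'v, 'm) born_module_scheme \<Rightarrow> nat
     \<Rightarrow> (('g list \<Rightarrow> complex) \<times> 'v \<Rightarrow> complex) set set
     \<Rightarrow> (('g list \<Rightarrow> complex) \<times> 'v \<Rightarrow> complex) set set" where
  "comparison B G L V n = induced_map (B_chains B G L V n) \<zero>\<^bsub>BH B G L V n\<^esub>
     (induced_map (bounded_l1 (BC B G L n) V) (tensor_rels (BC B G L n) V (H_rels B G L V n)) id)"

section \<open>The cap product and duality groups\<close>

text \<open>\<open>a\<close> is an action making the completed tensor product (over the complex numbers) of \<open>D\<close> and \<open>V\<close>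
  a bornological module on which group elements act diagonally. Such an action is unique on the
  carriers. It need not exist for an arbitrary bounding class (it does when the class is weakly
  closed under products), so its existence is part of the definition of a duality group.\<close>

definition with_action :: "'v born_space \<Rightarrow> ('a \<Rightarrow> 'v \<Rightarrow> 'v) \<Rightarrow> ('a, 'v) born_module" where
  "with_action V a = born_space.extend V (born_module.fields a)"

definition diagonal_action ::
  "(real \<Rightarrow> real) set \<Rightarrow> ('g, 'r) monoid_scheme \<Rightarrow> ('g \<Rightarrow> real)
     \<Rightarrow> ('g \<Rightarrow> complex, 'd, 'm) born_module_scheme \<Rightarrow> ('g \<Rightarrow> complex, 'v, 'k) born_module_scheme
     \<Rightarrow> (('g \<Rightarrow> complex) \<Rightarrow> ('d \<times> 'v \<Rightarrow> complex) set \<Rightarrow> ('d \<times> 'v \<Rightarrow> complex) set) \<Rightarrow> bool" where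
  "diagonal_action B G L D V a \<longleftrightarrow>
     bornological_module (H_alg B G L) (with_action (completed_tensor D V {}) a) \<and>
     (\<forall>g\<in>carrier G. \<forall>x\<in>carrier D. \<forall>v\<in>carrier V.
        a (dirac g) (pure_tensor D V {} x v) =
        pure_tensor D V {} (act D (dirac g) x) (act V (dirac g) v))"

definition tensor_module ::
  "(real \<Rightarrow> real) set \<Rightarrow> ('g, 'r) monoid_scheme \<Rightarrow> ('g \<Rightarrow> real)
     \<Rightarrow> ('g \<Rightarrow> complex, 'd, 'm) born_module_scheme \<Rightarrow> ('g \<Rightarrow> complex, 'v, 'k) born_module_scheme
     \<Rightarrow> ('g \<Rightarrow> complex, ('d \<times> 'v \<Rightarrow> complex) set) born_module" where
  "tensor_module B G L D V =
     with_action (completed_tensor D V {}) (SOME a. diagonal_action B G L D V a)"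

text \<open>\<open>T\<close> is the bounded extension to $m$-chains with coefficients in \<open>D\<close> of the usual cap product
  with an $i$-cochain \<open>\<phi>\<close>,
  $((g_0,\dots,g_m)\otimes x)\cap\phi=(g_i,\dots,g_m)\otimes(x\otimes\phi(g_0,\dots,g_i))$. The
  elements on the left span a dense subspace, so \<open>T\<close> is unique.\<close>

definition is_cap ::
  "(real \<Rightarrow> real) set \<Rightarrow> ('g, 'r) monoid_scheme \<Rightarrow> ('g \<Rightarrow> real)
     \<Rightarrow> ('g \<Rightarrow> complex, 'd, 'm) born_module_scheme \<Rightarrow> ('g \<Rightarrow> complex, 'v, 'k) born_module_scheme
     \<Rightarrow> nat \<Rightarrow> nat \<Rightarrow> (('g list \<Rightarrow> complex) \<Rightarrow> 'v)
     \<Rightarrow> ((('g list \<Rightarrow> complex) \<times> 'd \<Rightarrow> complex) set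
          \<Rightarrow> (('g list \<Rightarrow> complex) \<times> ('d \<times> 'v \<Rightarrow> complex) set \<Rightarrow> complex) set) \<Rightarrow> bool" where
  "is_cap B G L D V m i \<phi> T \<longleftrightarrow>
     T \<in> bounded_lin_maps (B_chains B G L D m) (B_chains B G L (tensor_module B G L D V) (m - i)) \<and>
     (\<forall>s\<in>tuples G m. \<forall>x\<in>carrier D.
        T (B_pure B G L D m (dirac s) x) =
        B_pure B G L (tensor_module B G L D V) (m - i) (dirac (drop i s))
          (pure_tensor D V {} x (\<phi> (dirac (take (Suc i) s)))))"

definition cap_chain ::
  "(real \<Rightarrow> real) set \<Rightarrow> ('g, 'r) monoid_scheme \<Rightarrow> ('g \<Rightarrow> real)
     \<Rightarrow> ('g \<Rightarrow> complex, 'd, 'm) born_module_scheme \<Rightarrow> ('g \<Rightarrow> complex, 'v, 'k) born_module_scheme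
     \<Rightarrow> nat \<Rightarrow> nat \<Rightarrow> (('g list \<Rightarrow> complex) \<Rightarrow> 'v)
     \<Rightarrow> (('g list \<Rightarrow> complex) \<times> 'd \<Rightarrow> complex) set
     \<Rightarrow> (('g list \<Rightarrow> complex) \<times> ('d \<times> 'v \<Rightarrow> complex) set \<Rightarrow> complex) set" where
  "cap_chain B G L D V m i \<phi> = (THE T. is_cap B G L D V m i \<phi> T)"

definition cap_extends ::
  "(real \<Rightarrow> real) set \<Rightarrow> ('g, 'r) monoid_scheme \<Rightarrow> ('g \<Rightarrow> real)
     \<Rightarrow> ('g \<Rightarrow> complex, 'd, 'm) born_module_scheme \<Rightarrow> ('g \<Rightarrow> complex, 'v, 'k) born_module_scheme
     \<Rightarrow> bool" where
  "cap_extends B G L D V \<longleftrightarrow>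
     (\<exists>a. diagonal_action B G L D V a) \<and>
     (\<forall>i. \<forall>m\<ge>i. \<forall>\<phi>\<in>carrier (B_cochains B G L V i). \<exists>T. is_cap B G L D V m i \<phi> T)"

definition cap_product ::
  "(real \<Rightarrow> real) set \<Rightarrow> ('g, 'r) monoid_scheme \<Rightarrow> ('g \<Rightarrow> real)
     \<Rightarrow> ('g \<Rightarrow> complex, 'd, 'm) born_module_scheme \<Rightarrow> ('g \<Rightarrow> complex, 'v, 'k) born_module_scheme
     \<Rightarrow> nat \<Rightarrow> nat \<Rightarrow> (('g list \<Rightarrow> complex) \<times> 'd \<Rightarrow> complex) set set
     \<Rightarrow> (('g list \<Rightarrow> complex) \<Rightarrow> 'v) set
     \<Rightarrow> (('g list \<Rightarrow> complex) \<times> ('d \<times> 'v \<Rightarrow> complex) set \<Rightarrow> complex) set set" where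
  "cap_product B G L D V m i \<mu> X = the_elem
     {\<zero>\<^bsub>BH B G L (tensor_module B G L D V) (m - i)\<^esub>
        +>\<^bsub>B_chains B G L (tensor_module B G L D V) (m - i)\<^esub> cap_chain B G L D V m i \<phi> z
      | \<phi> z. \<phi> \<in> X \<and> z \<in> \<mu>}"

text \<open>The type argument is the type over which the modules \<open>V\<close> are taken: a module is given by an
  arbitrary carrier set in that type, with arbitrary operations and bornology. In degrees
  \<open>i > n\<close> the target of the cap product is the zero space.\<close>

definition B_duality_group ::
  "'v itself \<Rightarrow> (real \<Rightarrow> real) set \<Rightarrow> ('g, 'r) monoid_scheme \<Rightarrow> ('g \<Rightarrow> real) \<Rightarrow> nat
     \<Rightarrow> ('g \<Rightarrow> complex, 'd) born_module
     \<Rightarrow> (('g list \<Rightarrow> complex) \<times> 'd \<Rightarrow> complex) set set \<Rightarrow> bool" where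
  "B_duality_group _ B G L n D \<mu> \<longleftrightarrow>
     bornological_module (H_alg B G L) D \<and>
     \<mu> \<in> carrier (BH B G L D n) \<and>
     (\<forall>V :: ('g \<Rightarrow> complex, 'v) born_module. bornological_module (H_alg B G L) V \<longrightarrow>
        cap_extends B G L D V \<and>
        (\<forall>i\<le>n. lin_iso (BH_co B G L V i) (BH B G L (tensor_module B G L D V) (n - i))
                  (cap_product B G L D V n i \<mu>)) \<and>
        (\<forall>i>n. carrier (BH_co B G L V i) = {\<zero>\<^bsub>BH_co B G L V i\<^esub>}))"

definition monocohomological_for ::
  "(real \<Rightarrow> real) set \<Rightarrow> ('g, 'r) monoid_scheme \<Rightarrow> ('g \<Rightarrow> real)
     \<Rightarrow> ('g \<Rightarrow> complex, 'v) born_module \<Rightarrow> bool" where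
  "monocohomological_for B G L V \<longleftrightarrow>
     (\<forall>i. inj_on (comparison_co G V i) (carrier (BH_co B G L V i)))"

definition strongly_monocohomological ::
  "'v itself \<Rightarrow> (real \<Rightarrow> real) set \<Rightarrow> ('g, 'r) monoid_scheme \<Rightarrow> ('g \<Rightarrow> real) \<Rightarrow> bool" where
  "strongly_monocohomological _ B G L \<longleftrightarrow>
     (\<forall>V :: ('g \<Rightarrow> complex, 'v) born_module. bornological_module (H_alg B G L) V \<longrightarrow>
        monocohomological_for B G L V)"

end

theory Submission
  imports Defs "HOL-Library.Function_Algebras"
begin

text \<open>
  The fundamental class \<open>\<mu>\<close> has a finitely supported representative \<open>c\<close>. If two bounded cocycles
  \<open>\<phi>\<close>, \<open>\<phi>'\<close> differ by an algebraic coboundary \<open>\<delta>\<psi>\<close>, then \<open>c \<inter> \<phi> - c \<inter> \<phi>' = c \<inter> \<delta>\<psi>\<close> is up to sign the boundary of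
  \<open>c \<inter> \<psi>\<close>, which makes sense although \<open>\<psi>\<close> is unbounded, because \<open>c\<close> is a finite chain. Hence \<open>\<mu>\<close> has the
  same cap product with the classes of \<open>\<phi>\<close> and \<open>\<phi>'\<close>, and duality identifies the two classes.

  That the extended cap product is determined by its values on finite chains, and inherits their
  Leibniz rule, rests on the Mackey density of finite chains. This is where weak countability of
  the bounding class enters: a diagonal choice of finite truncations converges for countably many
  weights at once.
\<close>

section \<open>Spaces of complex functions and their quotients\<close>

text \<open>The representative \<open>c\<close> has to be a cycle of the ordinary complex: its
  boundary is then a finite combination of bilinearity relations and balancing relations over the
  group algebra, and an equivariant \<psi> carries these to relations. A boundary known only to lie
  in the Mackey-closed relations could not be controlled, since \<psi> need not respect Mackey
  limits.

  No map on completed chains is attached to \<psi>. Cap products are therefore computed on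
  representatives, which are functions on pairs (chain, coefficient). In this free space a point
  mass is linear in neither entry, so every identity takes the form that a difference lies in
  \<open>chain_rels\<close>.

  For a bounded cochain the cap product is prescribed on point masses, and \<open>cap_chain\<close>
  is a definite description. Two facts make it usable: the relations are Mackey closed, so the
  quotient separates points, and a Mackey-closed subspace that contains the bilinearity relations
  and the point masses on tuples is everything. For the latter, tails of truncations rescaled by
  \<open>2 ^ k\<close> must stay bounded; hence the null sequence \<open>(1/2) ^ k\<close>.\<close>

definition scl :: "complex \<Rightarrow> ('x \<Rightarrow> complex) \<Rightarrow> 'x \<Rightarrow> complex" where
  "scl a f = (\<lambda>x. a * f x)"

lemma scl_apply [simp]: "scl a f x = a * f x"
  by (simp add: scl_def)

lemma scl_simps [simp]:
  "scl 0 f = 0" "scl a 0 = 0" "scl 1 f = f" "scl a (scl b f) = scl (a * b) f"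
  by (auto simp: fun_eq_iff)

lemma scl_add: "scl a (f + g) = scl a f + scl a g"
  and scl_diff: "scl a (f - g) = scl a f - scl a g"
  and scl_add_left: "scl (a + b) f = scl a f + scl b f"
  and scl_minus_one: "scl (-1) f = - f"
  by (auto simp: fun_eq_iff algebra_simps)

definition fun_subspace :: "('x \<Rightarrow> complex) set \<Rightarrow> bool" where
  "fun_subspace F \<longleftrightarrow> 0 \<in> F \<and> (\<forall>f\<in>F. \<forall>g\<in>F. f + g \<in> F) \<and> (\<forall>a. \<forall>f\<in>F. scl a f \<in> F)"

lemma fun_subspaceD:
  assumes "fun_subspace F"
  shows "0 \<in> F" "f \<in> F \<Longrightarrow> g \<in> F \<Longrightarrow> f + g \<in> F" "f \<in> F \<Longrightarrow> scl a f \<in> F"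
    "f \<in> F \<Longrightarrow> - f \<in> F" "f \<in> F \<Longrightarrow> g \<in> F \<Longrightarrow> f - g \<in> F"
proof -
  have m: "- f \<in> F" if "f \<in> F" for f
    using assms that scl_minus_one[of f] unfolding fun_subspace_def by metis
  show "0 \<in> F" "f \<in> F \<Longrightarrow> g \<in> F \<Longrightarrow> f + g \<in> F" "f \<in> F \<Longrightarrow> scl a f \<in> F"
    using assms by (auto simp: fun_subspace_def)
  show "f \<in> F \<Longrightarrow> - f \<in> F" by (rule m)
  show "f - g \<in> F" if "f \<in> F" "g \<in> F"
    using assms that(1) m[OF that(2)] unfolding fun_subspace_def
    by (metis diff_conv_add_uminus)
qed

text \<open>Replaces the operations of a record by \<open>+\<close>, \<open>0\<close> and
  \<open>scl\<close>, so that arithmetic in \<open>fun_space\<close>, \<open>weighted_l1\<close> and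
  \<open>bounded_l1\<close> becomes arithmetic of functions, open to the simplifier. The conditions
  on \<open>add\<close> and \<open>smult\<close> are equations between operations and hold off the
  carrier too.\<close>

definition function_space :: "(complex, 'x \<Rightarrow> complex, 'm) module_scheme \<Rightarrow> bool" where
  "function_space V \<longleftrightarrow> fun_subspace (carrier V) \<and> \<zero>\<^bsub>V\<^esub> = 0 \<and> add V = (+) \<and> smult V = scl"

lemma function_spaceD:
  assumes "function_space V"
  shows "fun_subspace (carrier V)" "\<zero>\<^bsub>V\<^esub> = 0" "x \<oplus>\<^bsub>V\<^esub> y = x + y" "a \<odot>\<^bsub>V\<^esub> x = scl a x"
  using assms by (auto simp: function_space_def)

lemma function_space_fun_space [simp]: "function_space (fun_space F) \<longleftrightarrow> fun_subspace F"
  by (auto simp: function_space_def fun_space_def scl_def fun_eq_iff zero_fun_def plus_fun_def)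

lemma carrier_fun_space [simp]: "carrier (fun_space F) = F"
  by (simp add: fun_space_def)

section \<open>Complex vector spaces as records\<close>

lemma cring_complex_field: "cring complex_field"
proof (rule cringI)
  show "abelian_group complex_field"
    by (rule abelian_groupI) (auto simp: complex_field_def intro: exI[of _ "- _"] add.left_inverse)
  show "Group.comm_monoid complex_field"
    by (rule comm_monoidI) (auto simp: complex_field_def)
qed (auto simp: complex_field_def algebra_simps)

lemma complex_field_simps [simp]:
  "carrier complex_field = UNIV" "\<one>\<^bsub>complex_field\<^esub> = 1" "\<zero>\<^bsub>complex_field\<^esub> = 0"
  "x \<oplus>\<^bsub>complex_field\<^esub> y = x + y" "x \<otimes>\<^bsub>complex_field\<^esub> y = x * y"
  by (auto simp: complex_field_def)

text \<open>Stating inverses through the scalar -1 turns an existence claim into an equation, which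
  can be checked by rewriting in function spaces and their quotients.\<close>

lemma vector_space_CI:
  assumes "\<zero>\<^bsub>V\<^esub> \<in> carrier V"
    and "\<And>x y. x \<in> carrier V \<Longrightarrow> y \<in> carrier V \<Longrightarrow> x \<oplus>\<^bsub>V\<^esub> y \<in> carrier V"
    and "\<And>a x. x \<in> carrier V \<Longrightarrow> a \<odot>\<^bsub>V\<^esub> x \<in> carrier V"
    and "\<And>x y z. x \<in> carrier V \<Longrightarrow> y \<in> carrier V \<Longrightarrow> z \<in> carrier V \<Longrightarrow>
           (x \<oplus>\<^bsub>V\<^esub> y) \<oplus>\<^bsub>V\<^esub> z = x \<oplus>\<^bsub>V\<^esub> (y \<oplus>\<^bsub>V\<^esub> z)"
    and "\<And>x y. x \<in> carrier V \<Longrightarrow> y \<in> carrier V \<Longrightarrow> x \<oplus>\<^bsub>V\<^esub> y = y \<oplus>\<^bsub>V\<^esub> x"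
    and "\<And>x. x \<in> carrier V \<Longrightarrow> \<zero>\<^bsub>V\<^esub> \<oplus>\<^bsub>V\<^esub> x = x"
    and "\<And>x. x \<in> carrier V \<Longrightarrow> ((-1) \<odot>\<^bsub>V\<^esub> x) \<oplus>\<^bsub>V\<^esub> x = \<zero>\<^bsub>V\<^esub>"
    and "\<And>a b x. x \<in> carrier V \<Longrightarrow> (a + b) \<odot>\<^bsub>V\<^esub> x = a \<odot>\<^bsub>V\<^esub> x \<oplus>\<^bsub>V\<^esub> b \<odot>\<^bsub>V\<^esub> x"
    and "\<And>a x y. x \<in> carrier V \<Longrightarrow> y \<in> carrier V \<Longrightarrow>
           a \<odot>\<^bsub>V\<^esub> (x \<oplus>\<^bsub>V\<^esub> y) = a \<odot>\<^bsub>V\<^esub> x \<oplus>\<^bsub>V\<^esub> a \<odot>\<^bsub>V\<^esub> y"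
    and "\<And>a b x. x \<in> carrier V \<Longrightarrow> (a * b) \<odot>\<^bsub>V\<^esub> x = a \<odot>\<^bsub>V\<^esub> (b \<odot>\<^bsub>V\<^esub> x)"
    and "\<And>x. x \<in> carrier V \<Longrightarrow> 1 \<odot>\<^bsub>V\<^esub> x = x"
  shows "vector_space_C V"
proof (rule moduleI)
  show "abelian_group V"
  proof (rule abelian_groupI)
    show "\<exists>y\<in>carrier V. y \<oplus>\<^bsub>V\<^esub> x = \<zero>\<^bsub>V\<^esub>" if "x \<in> carrier V" for x
      using assms(3,7)[OF that] by blast
  qed (use assms in auto)
qed (use assms cring_complex_field in auto)

lemma function_space_vector_space:
  assumes "function_space V" shows "vector_space_C V"
proof -
  note D = function_spaceD[OF assms]
  show ?thesis
    by (rule vector_space_CI)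
      (use fun_subspaceD[OF D(1)] D(2-) in \<open>auto simp: scl_add scl_add_left algebra_simps scl_minus_one\<close>)
qed

lemma vector_space_simps:
  assumes "vector_space_C V"
  shows "abelian_group V" "\<zero>\<^bsub>V\<^esub> \<in> carrier V"
    "x \<in> carrier V \<Longrightarrow> y \<in> carrier V \<Longrightarrow> x \<oplus>\<^bsub>V\<^esub> y \<in> carrier V"
    "x \<in> carrier V \<Longrightarrow> a \<odot>\<^bsub>V\<^esub> x \<in> carrier V"
    "x \<in> carrier V \<Longrightarrow> 0 \<odot>\<^bsub>V\<^esub> x = \<zero>\<^bsub>V\<^esub>"
    "a \<odot>\<^bsub>V\<^esub> \<zero>\<^bsub>V\<^esub> = \<zero>\<^bsub>V\<^esub>"
    "x \<in> carrier V \<Longrightarrow> 1 \<odot>\<^bsub>V\<^esub> x = x"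
    "x \<in> carrier V \<Longrightarrow> (a * b) \<odot>\<^bsub>V\<^esub> x = a \<odot>\<^bsub>V\<^esub> (b \<odot>\<^bsub>V\<^esub> x)"
    "x \<in> carrier V \<Longrightarrow> (a + b) \<odot>\<^bsub>V\<^esub> x = a \<odot>\<^bsub>V\<^esub> x \<oplus>\<^bsub>V\<^esub> b \<odot>\<^bsub>V\<^esub> x"
    "x \<in> carrier V \<Longrightarrow> y \<in> carrier V \<Longrightarrow> a \<odot>\<^bsub>V\<^esub> (x \<oplus>\<^bsub>V\<^esub> y) = a \<odot>\<^bsub>V\<^esub> x \<oplus>\<^bsub>V\<^esub> a \<odot>\<^bsub>V\<^esub> y"
proof -
  interpret module complex_field V by fact
  show "abelian_group V" by (rule M.abelian_group_axioms)
  show "\<zero>\<^bsub>V\<^esub> \<in> carrier V" by simp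
  show "x \<in> carrier V \<Longrightarrow> y \<in> carrier V \<Longrightarrow> x \<oplus>\<^bsub>V\<^esub> y \<in> carrier V" by simp
  show "x \<in> carrier V \<Longrightarrow> a \<odot>\<^bsub>V\<^esub> x \<in> carrier V" by simp
  show "x \<in> carrier V \<Longrightarrow> 0 \<odot>\<^bsub>V\<^esub> x = \<zero>\<^bsub>V\<^esub>" using smult_l_null[of x] by simp
  show "a \<odot>\<^bsub>V\<^esub> \<zero>\<^bsub>V\<^esub> = \<zero>\<^bsub>V\<^esub>" using smult_r_null[of a] by simp
  show "x \<in> carrier V \<Longrightarrow> 1 \<odot>\<^bsub>V\<^esub> x = x" using smult_one[of x] by simp
  show "x \<in> carrier V \<Longrightarrow> (a * b) \<odot>\<^bsub>V\<^esub> x = a \<odot>\<^bsub>V\<^esub> (b \<odot>\<^bsub>V\<^esub> x)"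
    using smult_assoc1[of a b x] by simp
  show "x \<in> carrier V \<Longrightarrow> (a + b) \<odot>\<^bsub>V\<^esub> x = a \<odot>\<^bsub>V\<^esub> x \<oplus>\<^bsub>V\<^esub> b \<odot>\<^bsub>V\<^esub> x"
    using smult_l_distr[of a b x] by simp
  show "x \<in> carrier V \<Longrightarrow> y \<in> carrier V \<Longrightarrow> a \<odot>\<^bsub>V\<^esub> (x \<oplus>\<^bsub>V\<^esub> y) = a \<odot>\<^bsub>V\<^esub> x \<oplus>\<^bsub>V\<^esub> a \<odot>\<^bsub>V\<^esub> y"
    using smult_r_distr[of a x y] by simp
qed

lemma vector_space_minus:
  assumes "vector_space_C V" "x \<in> carrier V"
  shows "\<ominus>\<^bsub>V\<^esub> x = (-1) \<odot>\<^bsub>V\<^esub> x"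
proof -
  interpret module complex_field V by fact
  have "(-1) \<odot>\<^bsub>V\<^esub> x \<oplus>\<^bsub>V\<^esub> x = \<zero>\<^bsub>V\<^esub>"
    using vector_space_simps(9)[OF assms(1), of x "-1" 1] vector_space_simps(5)[OF assms]
      vector_space_simps(7)[OF assms] assms(2) by simp
  then show ?thesis
    using assms(2) vector_space_simps(4)[OF assms] M.minus_equality by blast
qed

lemma function_space_minus:
  assumes "function_space V" "f \<in> carrier V" "g \<in> carrier V"
  shows "f \<ominus>\<^bsub>V\<^esub> g = f - g"
  using vector_space_minus[OF function_space_vector_space[OF assms(1)] assms(3)]
  by (simp add: a_minus_def function_spaceD[OF assms(1)] scl_minus_one)

lemma subspace_C_iff:
  assumes "function_space V"
  shows "subspace_C V W \<longleftrightarrow> W \<subseteq> carrier V \<and> fun_subspace W"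
proof -
  note D = function_spaceD[OF assms]
  have inv: "m_inv (add_monoid V) x = - x" if "x \<in> carrier V" for x
    using vector_space_minus[OF function_space_vector_space[OF assms] that] D
    by (simp add: a_inv_def scl_minus_one)
  show ?thesis
  proof
    assume W: "subspace_C V W"
    then show "W \<subseteq> carrier V \<and> fun_subspace W"
      unfolding submodule_def submodule_axioms_def subgroup_def fun_subspace_def
      using D by auto
  next
    assume W: "W \<subseteq> carrier V \<and> fun_subspace W"
    then show "subspace_C V W"
      unfolding submodule_def submodule_axioms_def subgroup_def
      using D inv fun_subspaceD[of W] by (auto simp: subset_iff)
  qed
qed

section \<open>Cosets in function spaces and the maps induced on them\<close>

lemma coset_eq_image:
  assumes "function_space V" shows "W +>\<^bsub>V\<^esub> f = (\<lambda>w. w + f) ` W"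
  by (auto simp: a_r_coset_def' function_spaceD[OF assms])

lemma coset_eq_iff:
  assumes "function_space V" "fun_subspace W"
  shows "W +>\<^bsub>V\<^esub> f = W +>\<^bsub>V\<^esub> g \<longleftrightarrow> f - g \<in> W"
proof
  assume "W +>\<^bsub>V\<^esub> f = W +>\<^bsub>V\<^esub> g"
  then have "0 + f \<in> (\<lambda>w. w + g) ` W"
    using fun_subspaceD(1)[OF assms(2)] unfolding coset_eq_image[OF assms(1)] by blast
  then show "f - g \<in> W" by (auto simp: algebra_simps)
next
  assume fg: "f - g \<in> W"
  have "w + f \<in> (\<lambda>w. w + g) ` W" if "w \<in> W" for w
    using fun_subspaceD(2)[OF assms(2) that fg] by (auto intro!: image_eqI[of _ _ "w + (f - g)"])
  moreover have "w + g \<in> (\<lambda>w. w + f) ` W" if "w \<in> W" for w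
    using fun_subspaceD(5)[OF assms(2) that fg] by (auto intro!: image_eqI[of _ _ "w - (f - g)"])
  ultimately show "W +>\<^bsub>V\<^esub> f = W +>\<^bsub>V\<^esub> g"
    unfolding coset_eq_image[OF assms(1)] by blast
qed

lemma coset_add:
  assumes "function_space V" "fun_subspace W"
  shows "(W +>\<^bsub>V\<^esub> f) <+>\<^bsub>V\<^esub> (W +>\<^bsub>V\<^esub> g) = W +>\<^bsub>V\<^esub> (f + g)"
proof -
  have "\<exists>w\<in>W. w1 + f + (w2 + g) = w + (f + g)" if "w1 \<in> W" "w2 \<in> W" for w1 w2
    using fun_subspaceD(2)[OF assms(2) that] by (intro bexI[of _ "w1 + w2"]) auto
  moreover have "\<exists>w1\<in>W. \<exists>w2\<in>W. w + (f + g) = w1 + f + (w2 + g)" if "w \<in> W" for w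
    using fun_subspaceD(1)[OF assms(2)] that by (intro bexI[of _ w] bexI[of _ 0]) (auto simp: algebra_simps)
  ultimately show ?thesis
    unfolding coset_eq_image[OF assms(1)] set_add_def' function_spaceD[OF assms(1)] by auto
qed

lemma coset_scl:
  assumes "function_space V" "fun_subspace W"
  shows "W <+>\<^bsub>V\<^esub> ((\<lambda>x. a \<odot>\<^bsub>V\<^esub> x) ` (W +>\<^bsub>V\<^esub> f)) = W +>\<^bsub>V\<^esub> (scl a f)"
proof -
  have "\<exists>w\<in>W. w1 + scl a (w2 + f) = w + scl a f" if "w1 \<in> W" "w2 \<in> W" for w1 w2
    using fun_subspaceD(2,3)[OF assms(2)] that
    by (intro bexI[of _ "w1 + scl a w2"]) (auto simp: scl_add)
  moreover have "\<exists>w1\<in>W. \<exists>w2\<in>W. w + scl a f = w1 + scl a (w2 + f)" if "w \<in> W" for w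
    using fun_subspaceD(1)[OF assms(2)] that by (intro bexI[of _ w] bexI[of _ 0]) auto
  ultimately show ?thesis
    unfolding coset_eq_image[OF assms(1)] set_add_def' function_spaceD[OF assms(1)]
    by (auto simp: image_iff)
qed

lemma quotient_vector_space:
  fixes Q :: "(complex, ('x \<Rightarrow> complex) set, 'k) module_scheme"
  assumes V: "function_space V" and W: "fun_subspace W"
    and Q: "carrier Q = (\<lambda>f. W +>\<^bsub>V\<^esub> f) ` carrier V" "\<zero>\<^bsub>Q\<^esub> = W" "add Q = set_add V"
      "smult Q = (\<lambda>a X. set_add V W ((\<lambda>x. a \<odot>\<^bsub>V\<^esub> x) ` X))"
  shows "vector_space_C Q"
proof -
  note D = fun_subspaceD[OF function_spaceD(1)[OF V]]
  have W0: "W = W +>\<^bsub>V\<^esub> 0" by (auto simp: coset_eq_image[OF V])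
  have car: "\<exists>f\<in>carrier V. X = W +>\<^bsub>V\<^esub> f" if "X \<in> carrier Q" for X
    using that by (auto simp: Q)
  note ops = Q(2-) coset_add[OF V W] coset_scl[OF V W]
  have zero: "\<zero>\<^bsub>Q\<^esub> = W +>\<^bsub>V\<^esub> 0" using W0 Q(2) by simp
  have add: "(W +>\<^bsub>V\<^esub> f) \<oplus>\<^bsub>Q\<^esub> (W +>\<^bsub>V\<^esub> g) = W +>\<^bsub>V\<^esub> (f + g)" for f g
    by (simp add: ops)
  have smult: "a \<odot>\<^bsub>Q\<^esub> (W +>\<^bsub>V\<^esub> f) = W +>\<^bsub>V\<^esub> (scl a f)" for a f
    by (simp add: ops)
  have mem: "W +>\<^bsub>V\<^esub> f \<in> carrier Q" if "f \<in> carrier V" for f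
    using that by (simp add: Q)
  show ?thesis
    by (rule vector_space_CI)
      (use D in \<open>auto dest!: car simp: zero add smult mem scl_add scl_add_left algebra_simps scl_minus_one\<close>)
qed

text \<open>\<open>the_elem\<close> is meaningful because all points of the coset have images in one
  coset of \<open>W\<close>. The condition is imposed at \<open>x\<close> alone and \<open>V\<close>
  is any abelian group, since the lemma is also applied to a map into a quotient, whose elements are
  sets rather than functions.\<close>

lemma induced_map_coset:
  assumes "abelian_group V" "additive_subgroup W V" "f x \<in> carrier V" "U \<noteq> {}"
    and "\<And>u. u \<in> U \<Longrightarrow> f (u \<oplus>\<^bsub>V0\<^esub> x) \<in> W +>\<^bsub>V\<^esub> f x"
  shows "induced_map V W f (U +>\<^bsub>V0\<^esub> x) = W +>\<^bsub>V\<^esub> f x"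
proof -
  have eq: "W +>\<^bsub>V\<^esub> y = W +>\<^bsub>V\<^esub> f x" if "y \<in> W +>\<^bsub>V\<^esub> f x" for y
    using abelian_group.a_repr_independence[OF assms(1) that assms(3)]
      additive_subgroup.a_subgroup[OF assms(2)] by simp
  have "(\<lambda>y. W +>\<^bsub>V\<^esub> f y) ` (U +>\<^bsub>V0\<^esub> x) = {W +>\<^bsub>V\<^esub> f x}"
  proof -
    have "(\<lambda>y. W +>\<^bsub>V\<^esub> f y) z = W +>\<^bsub>V\<^esub> f x" if z: "z \<in> U +>\<^bsub>V0\<^esub> x" for z
    proof -
      obtain u where u: "u \<in> U" "z = u \<oplus>\<^bsub>V0\<^esub> x" using z unfolding a_r_coset_def' by blast
      show ?thesis using eq[OF assms(5)[OF u(1)]] u(2) by simp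
    qed
    moreover have "U +>\<^bsub>V0\<^esub> x \<noteq> {}" using assms(4) by (auto simp: a_r_coset_def')
    ultimately show ?thesis by blast
  qed
  then show ?thesis by (simp add: induced_map_def)
qed

lemma function_space_additive_subgroup:
  assumes "function_space V" "W \<subseteq> carrier V" "fun_subspace W"
  shows "additive_subgroup W V"
  using assms subspace_C_iff[OF assms(1), of W]
  by (auto simp: additive_subgroup_def submodule_def)

lemma induced_map_fun_coset:
  assumes V0: "function_space V0" and V: "function_space V"
    and U: "fun_subspace U" "U \<subseteq> carrier V0" and W: "fun_subspace W" "W \<subseteq> carrier V"
    and f: "\<And>c. c \<in> carrier V0 \<Longrightarrow> f c \<in> carrier V"
      "\<And>c c'. c \<in> carrier V0 \<Longrightarrow> c' \<in> carrier V0 \<Longrightarrow> f (c + c') = f c + f c'"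
      "\<And>u. u \<in> U \<Longrightarrow> f u \<in> W"
    and c: "c \<in> carrier V0"
  shows "induced_map V W f (U +>\<^bsub>V0\<^esub> c) = W +>\<^bsub>V\<^esub> f c"
proof (rule induced_map_coset)
  show "abelian_group V"
    by (rule vector_space_simps(1)[OF function_space_vector_space[OF V]])
  show "additive_subgroup W V"
    by (rule function_space_additive_subgroup[OF V W(2,1)])
  show "U \<noteq> {}" using fun_subspaceD(1)[OF U(1)] by blast
  show "f (u \<oplus>\<^bsub>V0\<^esub> c) \<in> W +>\<^bsub>V\<^esub> f c" if "u \<in> U" for u
    using that U(2) c f(2,3) by (auto simp: coset_eq_image[OF V] function_spaceD[OF V0])
qed (use f c in auto)

lemma fun_subspace_Int: "fun_subspace A \<Longrightarrow> fun_subspace B \<Longrightarrow> fun_subspace (A \<inter> B)"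
  by (auto simp: fun_subspace_def)

section \<open>Finitely supported functions\<close>

lemma fun_subspace_finsupp: "fun_subspace (finsupp_funs X)"
  unfolding fun_subspace_def
proof (intro conjI ballI allI)
  show "0 \<in> finsupp_funs X" by (simp add: finsupp_funs_def)
next
  fix f g :: "'a \<Rightarrow> complex" assume fg: "f \<in> finsupp_funs X" "g \<in> finsupp_funs X"
  have "{x. (f + g) x \<noteq> 0} \<subseteq> {x. f x \<noteq> 0} \<union> {x. g x \<noteq> 0}" by auto
  with fg show "f + g \<in> finsupp_funs X"
    unfolding finsupp_funs_def mem_Collect_eq by (meson finite_subset finite_Un Un_least subset_trans)
next
  fix a and f :: "'a \<Rightarrow> complex" assume f: "f \<in> finsupp_funs X"
  have "{x. scl a f x \<noteq> 0} \<subseteq> {x. f x \<noteq> 0}" by auto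
  with f show "scl a f \<in> finsupp_funs X"
    unfolding finsupp_funs_def mem_Collect_eq by (meson finite_subset subset_trans)
qed

lemma dirac_finsupp [simp]: "dirac p \<in> finsupp_funs X \<longleftrightarrow> p \<in> X"
  by (auto simp: finsupp_funs_def dirac_def)

text \<open>The restriction of \<open>c\<close> to finite sets grows by one point mass at a time.
  The summands come back with their finite support, because additivity of \<open>lin_ext\<close> and
  \<open>pushforward\<close> is available only under finiteness or summability conditions.\<close>

lemma finsupp_induct [consumes 1, case_names zero dirac add scl]:
  assumes c: "c \<in> finsupp_funs X"
    and zero: "P 0" and dirac: "\<And>p. p \<in> X \<Longrightarrow> P (dirac p)"
    and add: "\<And>c c'. c \<in> finsupp_funs X \<Longrightarrow> c' \<in> finsupp_funs X \<Longrightarrow> P c \<Longrightarrow> P c' \<Longrightarrow> P (c + c')"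
    and scl: "\<And>a c. c \<in> finsupp_funs X \<Longrightarrow> P c \<Longrightarrow> P (scl a c)"
  shows "P c"
proof -
  let ?r = "\<lambda>F p. if p \<in> F then c p else 0"
  have "?r F \<in> finsupp_funs X \<and> P (?r F)" if "finite F" "F \<subseteq> X" for F
    using that
  proof (induction F)
    case empty
    have "?r {} = 0" by (auto simp: fun_eq_iff)
    with zero show ?case by (simp add: fun_subspaceD(1)[OF fun_subspace_finsupp])
  next
    case (insert p F)
    have "?r (insert p F) = ?r F + scl (c p) (dirac p)"
      using insert.hyps by (auto simp: fun_eq_iff dirac_def)
    moreover have "?r F \<in> finsupp_funs X" "P (?r F)" "p \<in> X" using insert by auto
    moreover from \<open>p \<in> X\<close> have "dirac p \<in> finsupp_funs X" "P (dirac p)" by (simp_all add: dirac)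
    then have "scl (c p) (dirac p) \<in> finsupp_funs X" "P (scl (c p) (dirac p))"
      using scl fun_subspaceD(3)[OF fun_subspace_finsupp] by blast+
    ultimately show ?case
      using add[of "?r F" "scl (c p) (dirac p)"]
        fun_subspaceD(2)[OF fun_subspace_finsupp, of "?r F" X "scl (c p) (dirac p)"] by simp
  qed
  from this[of "{x. c x \<noteq> 0}"] c have "P (?r {x. c x \<noteq> 0})"
    by (auto simp: finsupp_funs_def)
  moreover have "?r {x. c x \<noteq> 0} = c" by auto
  ultimately show ?thesis by simp
qed

text \<open>The linear extension of a map from points to functions. \<open>pushforward\<close>
  covers maps from points to points; the cap product sends a pair (chain, coefficient) to a whole
  combination of pairs.\<close>

definition lin_ext :: "('p \<Rightarrow> 'q \<Rightarrow> complex) \<Rightarrow> ('p \<Rightarrow> complex) \<Rightarrow> 'q \<Rightarrow> complex" where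
  "lin_ext e c = (\<Sum>p | c p \<noteq> 0. scl (c p) (e p))"

lemma lin_ext_supset:
  assumes "finite A" "{p. c p \<noteq> 0} \<subseteq> A"
  shows "lin_ext e c = (\<Sum>p\<in>A. scl (c p) (e p))"
  unfolding lin_ext_def using assms by (intro sum.mono_neutral_left) auto

lemma lin_ext_zero [simp]: "lin_ext e 0 = 0"
  by (simp add: lin_ext_def)

lemma lin_ext_add:
  assumes "c \<in> finsupp_funs X" "c' \<in> finsupp_funs Y"
  shows "lin_ext e (c + c') = lin_ext e c + lin_ext e c'"
proof -
  let ?A = "{p. c p \<noteq> 0} \<union> {p. c' p \<noteq> 0}"
  have "finite ?A" using assms by (auto simp: finsupp_funs_def)
  moreover have "{p. (c + c') p \<noteq> 0} \<subseteq> ?A" by auto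
  ultimately show ?thesis
    by (simp add: lin_ext_supset[of ?A] scl_add_left sum.distrib)
qed

lemma lin_ext_scl:
  assumes "c \<in> finsupp_funs X"
  shows "lin_ext e (scl a c) = scl a (lin_ext e c)"
proof -
  let ?A = "{p. c p \<noteq> 0}"
  have "scl a (sum h S) = (\<Sum>p\<in>S. scl a (h p))" for h :: "'a \<Rightarrow> 'b \<Rightarrow> complex" and S
    by (rule infinite_finite_induct[where P = "\<lambda>S. scl a (sum h S) = (\<Sum>p\<in>S. scl a (h p))"])
      (simp_all add: scl_add)
  moreover have "finite ?A" using assms by (auto simp: finsupp_funs_def)
  moreover have "{p. (scl a c) p \<noteq> 0} \<subseteq> ?A" by auto
  ultimately show ?thesis
    by (simp add: lin_ext_supset[of ?A] sum_distrib_left)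
qed

lemma lin_ext_diff:
  assumes "c \<in> finsupp_funs X" "c' \<in> finsupp_funs X"
  shows "lin_ext e (c - c') = lin_ext e c - lin_ext e c'"
proof -
  have "scl (-1) c' \<in> finsupp_funs X"
    using fun_subspaceD(3)[OF fun_subspace_finsupp assms(2)] .
  then show ?thesis
    using lin_ext_add[OF assms(1), of "scl (-1) c'" X e] lin_ext_scl[OF assms(2), of e "-1"]
    by (simp add: scl_minus_one)
qed

lemma lin_ext_dirac [simp]: "lin_ext e (dirac p) = e p"
proof -
  have "{q. dirac p q \<noteq> (0::complex)} = {p}" by (auto simp: dirac_def)
  then show ?thesis by (simp add: lin_ext_def) (simp add: dirac_def)
qed

lemma lin_ext_mem:
  assumes "c \<in> finsupp_funs X" "fun_subspace W" "\<And>p. p \<in> X \<Longrightarrow> e p \<in> W"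
  shows "lin_ext e c \<in> W"
  by (rule finsupp_induct[where P = "\<lambda>c. lin_ext e c \<in> W", OF assms(1)])
    (use fun_subspaceD(1-3)[OF assms(2)] assms(3) in \<open>simp_all add: lin_ext_add lin_ext_scl\<close>)

lemma lin_ext_diff_mem:
  assumes "c \<in> finsupp_funs X" "fun_subspace W" "\<And>p. p \<in> X \<Longrightarrow> e p - e' p \<in> W"
  shows "lin_ext e c - lin_ext e' c \<in> W"
proof (rule finsupp_induct[where P = "\<lambda>c. lin_ext e c - lin_ext e' c \<in> W", OF assms(1)])
  fix c c' assume c: "c \<in> finsupp_funs X" "c' \<in> finsupp_funs X"
    "lin_ext e c - lin_ext e' c \<in> W" "lin_ext e c' - lin_ext e' c' \<in> W"
  have "lin_ext e (c + c') - lin_ext e' (c + c') =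
      (lin_ext e c - lin_ext e' c) + (lin_ext e c' - lin_ext e' c')"
    by (simp add: lin_ext_add[OF c(1,2)])
  then show "lin_ext e (c + c') - lin_ext e' (c + c') \<in> W"
    using fun_subspaceD(2)[OF assms(2) c(3,4)] by simp
next
  fix a c assume c: "c \<in> finsupp_funs X" "lin_ext e c - lin_ext e' c \<in> W"
  show "lin_ext e (scl a c) - lin_ext e' (scl a c) \<in> W"
    using fun_subspaceD(3)[OF assms(2) c(2), of a]
    by (simp add: lin_ext_scl[OF c(1)] scl_diff)
qed (use fun_subspaceD(1)[OF assms(2)] assms(3) in simp_all)

section \<open>Bornologies and Mackey closure\<close>

text \<open>The fragment of the bornology axioms that makes \<open>bounded_l1\<close> a vector
  space: adding families supported in two products of bounded sets calls for unions. The weighted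
  spaces and all complete bornological spaces satisfy it, so both tensor factors are covered at
  once.\<close>

definition directed_bornology :: "('v, 'm) born_space_scheme \<Rightarrow> bool" where
  "directed_bornology V \<longleftrightarrow> {} \<in> bornology V \<and>
     (\<forall>A\<in>bornology V. A \<subseteq> carrier V) \<and>
     (\<forall>x\<in>carrier V. {x} \<in> bornology V) \<and>
     (\<forall>A\<in>bornology V. \<forall>A'\<in>bornology V. A \<union> A' \<in> bornology V)"

lemma subset_disked_hull: "A \<subseteq> disked_hull V A"
  by (auto simp: disked_hull_def)

text \<open>\<open>convex_bornology\<close> speaks of sums of bounded sets, not of unions. Two
  nonempty sets lie in the sum of their disked hulls, since each hull contains zero, and a subset of
  a bounded set is bounded.\<close>

lemma complete_directed_bornology:
  assumes "complete_bornological_space V"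
  shows "directed_bornology V"
  unfolding directed_bornology_def
proof (intro conjI ballI)
  have V: "vector_space_C V" and C: "convex_bornology V"
    using assms by (auto simp: complete_bornological_space_def)
  note C = C[unfolded convex_bornology_def]
  show single: "{x} \<in> bornology V" if "x \<in> carrier V" for x using C that by blast
  show empty: "{} \<in> bornology V"
    using C single[OF vector_space_simps(2)[OF V]] by blast
  show sub: "A \<subseteq> carrier V" if "A \<in> bornology V" for A using C that by blast
  fix A A' assume A: "A \<in> bornology V" "A' \<in> bornology V"
  define H H' where "H = disked_hull V A" and "H' = disked_hull V A'"
  have H: "H \<in> bornology V" "H' \<in> bornology V" using C A by (auto simp: H_def H'_def)
  have AH: "A \<subseteq> H" "A' \<subseteq> H'" by (auto simp: H_def H'_def subset_disked_hull)
  \<comment> \<open>A nonempty disk contains zero because it is stable under the scalar 0. The hull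
    of the empty set is empty, which forces the case distinction below.\<close>
  have zero: "\<zero>\<^bsub>V\<^esub> \<in> disked_hull V S" if S: "S \<noteq> {}" "S \<subseteq> carrier V" for S
  proof -
    obtain x where x: "x \<in> S" using S(1) by blast
    have "\<zero>\<^bsub>V\<^esub> \<in> E" if E: "disk V E" "S \<subseteq> E" for E
    proof -
      have "0 \<odot>\<^bsub>V\<^esub> x \<in> E" using E x unfolding disk_def by (metis norm_zero zero_le_one subsetD)
      moreover have "0 \<odot>\<^bsub>V\<^esub> x = \<zero>\<^bsub>V\<^esub>"
        using vector_space_simps(5)[OF V, of x] x S(2) by blast
      ultimately show ?thesis by simp
    qed
    then show ?thesis by (auto simp: disked_hull_def)
  qed
  show "A \<union> A' \<in> bornology V"
  proof (cases "A = {} \<or> A' = {}")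
    case True then show ?thesis using A by auto
  next
    case False
    have z: "\<zero>\<^bsub>V\<^esub> \<in> H" "\<zero>\<^bsub>V\<^esub> \<in> H'" using zero False sub A by (auto simp: H_def H'_def)
    let ?S = "set_add V H ((\<lambda>x. 1 \<odot>\<^bsub>V\<^esub> x) ` H')"
    have one: "1 \<odot>\<^bsub>V\<^esub> x = x" if "x \<in> carrier V" for x by (rule vector_space_simps(7)[OF V that])
    interpret abelian_group V by (rule vector_space_simps(1)[OF V])
    have S: "x \<oplus>\<^bsub>V\<^esub> 1 \<odot>\<^bsub>V\<^esub> y \<in> ?S" if "x \<in> H" "y \<in> H'" for x y
      using that unfolding set_add_def' by blast
    have "x \<in> ?S" if "x \<in> A" for x
    proof -
      have "x \<in> H" "x \<in> carrier V" using that AH sub[OF A(1)] by auto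
      then show ?thesis using S[of x "\<zero>\<^bsub>V\<^esub>"] z one[of "\<zero>\<^bsub>V\<^esub>"] by simp
    qed
    moreover have "x \<in> ?S" if "x \<in> A'" for x
    proof -
      have "x \<in> H'" "x \<in> carrier V" using that AH sub[OF A(2)] by auto
      then show ?thesis using S[of "\<zero>\<^bsub>V\<^esub>" x] z one[of x] by simp
    qed
    moreover have "?S \<in> bornology V" using C H by blast
    ultimately show ?thesis using C by (metis (no_types, lifting) Un_iff subsetI)
  qed
qed

text \<open>\<open>bounded_lin_maps\<close> without extensionality, so that composites and lambda
  terms qualify.\<close>

definition bdd_linear :: "('v, 'm) born_space_scheme \<Rightarrow> ('w, 'k) born_space_scheme \<Rightarrow> ('v \<Rightarrow> 'w) \<Rightarrow> bool" where
  "bdd_linear V W f \<longleftrightarrow>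
     (\<forall>x\<in>carrier V. f x \<in> carrier W) \<and>
     (\<forall>x\<in>carrier V. \<forall>y\<in>carrier V. f (x \<oplus>\<^bsub>V\<^esub> y) = f x \<oplus>\<^bsub>W\<^esub> f y) \<and>
     (\<forall>a. \<forall>x\<in>carrier V. f (a \<odot>\<^bsub>V\<^esub> x) = a \<odot>\<^bsub>W\<^esub> f x) \<and>
     (\<forall>A\<in>bornology V. f ` A \<in> bornology W)"

lemma bounded_lin_maps_bdd_linear:
  "f \<in> bounded_lin_maps V W \<Longrightarrow> bdd_linear V W f"
  by (auto simp: bounded_lin_maps_def lin_maps_def bdd_linear_def)

lemma bdd_linear_comp:
  "bdd_linear U V f \<Longrightarrow> bdd_linear V W g \<Longrightarrow> bdd_linear U W (\<lambda>x. g (f x))"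
  unfolding bdd_linear_def by (simp add: image_image[symmetric])

lemma born_quotient_simps:
  "carrier (born_quotient V W) = (\<lambda>z. W +>\<^bsub>V\<^esub> z) ` carrier V"
  "\<zero>\<^bsub>born_quotient V W\<^esub> = W" "add (born_quotient V W) = set_add V"
  "smult (born_quotient V W) = (\<lambda>a X. set_add V W ((\<lambda>x. a \<odot>\<^bsub>V\<^esub> x) ` X))"
  "bornology (born_quotient V W) = {(\<lambda>x. W +>\<^bsub>V\<^esub> x) ` A | A. A \<in> bornology V}"
  by (auto simp: born_quotient_def subquotient_def module.defs born_space.defs)

lemma born_quotient_add:
  assumes "function_space V" "fun_subspace W"
  shows "(W +>\<^bsub>V\<^esub> f) \<oplus>\<^bsub>born_quotient V W\<^esub> (W +>\<^bsub>V\<^esub> g) = W +>\<^bsub>V\<^esub> (f + g)"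
  using coset_add[OF assms] by (simp add: born_quotient_simps)

lemma born_quotient_smult:
  assumes "function_space V" "fun_subspace W"
  shows "a \<odot>\<^bsub>born_quotient V W\<^esub> (W +>\<^bsub>V\<^esub> f) = W +>\<^bsub>V\<^esub> (scl a f)"
  using coset_scl[OF assms] by (simp add: born_quotient_simps)

lemma born_quotient_vector_space:
  "function_space V \<Longrightarrow> fun_subspace W \<Longrightarrow> vector_space_C (born_quotient V W)"
  by (rule quotient_vector_space) (simp_all add: born_quotient_simps)

lemma bdd_linear_quotient:
  assumes "function_space V" "fun_subspace W"
  shows "bdd_linear V (born_quotient V W) (\<lambda>c. W +>\<^bsub>V\<^esub> c)"
  unfolding bdd_linear_def
  using born_quotient_add[OF assms] born_quotient_smult[OF assms] function_spaceD[OF assms(1)]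
  by (auto simp: born_quotient_simps(1,5))

lemma mackey_limit_fun:
  assumes "function_space V"
  shows "mackey_limit V u l \<longleftrightarrow> (\<forall>k. u k \<in> carrier V) \<and> l \<in> carrier V \<and>
     (\<exists>A\<in>bornology V. \<exists>e::nat \<Rightarrow> real. e \<longlonglongrightarrow> 0 \<and> (\<forall>k. \<exists>x\<in>A. u k - l = scl (of_real (e k)) x))"
  unfolding mackey_limit_def using function_space_minus[OF assms] function_spaceD[OF assms]
  by (metis (no_types, lifting))

text \<open>A bounded linear map preserves Mackey limits with the same null sequence: if
  \<open>u k - l\<close> is \<open>e k\<close> times an element of \<open>A\<close>, then its image
  is \<open>e k\<close> times an element of the bounded image of \<open>A\<close>.\<close>

lemma mackey_closed_preimage:
  assumes Y: "function_space Y" and Z: "function_space Z" and f: "bdd_linear Y Z f"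
    and Yb: "\<And>A. A \<in> bornology Y \<Longrightarrow> A \<subseteq> carrier Y"
    and W: "fun_subspace W" "mackey_closed Z W"
  shows "fun_subspace {c \<in> carrier Y. f c \<in> W}" "mackey_closed Y {c \<in> carrier Y. f c \<in> W}"
proof -
  note DY = function_spaceD[OF Y] and DZ = function_spaceD[OF Z]
  have add: "f (c + c') = f c + f c'" if "c \<in> carrier Y" "c' \<in> carrier Y" for c c'
    using f that by (auto simp: bdd_linear_def DY DZ)
  have sc: "f (scl a c) = scl a (f c)" if "c \<in> carrier Y" for a c
    using f that by (auto simp: bdd_linear_def DY DZ)
  have zero: "f 0 = 0" using sc[of 0 0] fun_subspaceD(1)[OF DY(1)] by simp
  show "fun_subspace {c \<in> carrier Y. f c \<in> W}"
    using fun_subspaceD[OF W(1)] fun_subspaceD[OF DY(1)] zero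
    by (auto simp: fun_subspace_def add sc)
  show "mackey_closed Y {c \<in> carrier Y. f c \<in> W}"
    unfolding mackey_closed_def
  proof (intro allI impI, elim conjE)
    fix u l assume u: "\<forall>k. u k \<in> {c \<in> carrier Y. f c \<in> W}" and "mackey_limit Y u l"
    then obtain A e where l: "l \<in> carrier Y" and A: "A \<in> bornology Y" and e: "e \<longlonglongrightarrow> 0"
      and x: "\<And>k. \<exists>x\<in>A. u k - l = scl (of_real (e k)) x"
      by (auto simp: mackey_limit_fun[OF Y])
    have "\<exists>y\<in>f ` A. f (u k) - f l = scl (of_real (e k)) y" for k
    proof -
      obtain x where x: "x \<in> A" "u k - l = scl (of_real (e k)) x" using x by blast
      then have "u k = l + scl (of_real (e k)) x" by (simp add: algebra_simps)
      moreover have "x \<in> carrier Y" using x Yb[OF A] by blast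
      ultimately have "f (u k) = f l + scl (of_real (e k)) (f x)"
        using l fun_subspaceD(3)[OF DY(1)] by (simp add: add sc)
      then show ?thesis using x by auto
    qed
    moreover have "f ` A \<in> bornology Z" "\<forall>k. f (u k) \<in> carrier Z" "f l \<in> carrier Z"
      using f A u l by (auto simp: bdd_linear_def)
    ultimately have "mackey_limit Z (\<lambda>k. f (u k)) (f l)"
      using e unfolding mackey_limit_fun[OF Z] by blast
    then have "f l \<in> W"
      using W(2)[unfolded mackey_closed_def, rule_format, of "\<lambda>k. f (u k)" "f l"] u by blast
    then show "l \<in> {c \<in> carrier Y. f c \<in> W}"
      using l by simp
  qed
qed

text \<open>Quotients by Mackey-closed subspaces are separated, so bounded linear maps into them are
  determined on Mackey-dense subspaces.\<close>

lemma mackey_closed_equalizer: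
  assumes Y: "function_space Y" and Z: "function_space Z"
    and Yb: "\<And>A. A \<in> bornology Y \<Longrightarrow> A \<subseteq> carrier Y"
    and W: "W \<subseteq> carrier Z" "fun_subspace W" "mackey_closed Z W"
    and Zb: "\<And>A A'. A \<in> bornology Z \<Longrightarrow> A' \<in> bornology Z \<Longrightarrow>
        \<exists>A''\<in>bornology Z. \<forall>x\<in>A. \<forall>y\<in>A'. x - scl a y \<in> A''"
    and f: "bdd_linear Y (born_quotient Z W) f" and h: "bdd_linear Y (born_quotient Z W) h"
  defines "K \<equiv> {c \<in> carrier Y. f c = a \<odot>\<^bsub>born_quotient Z W\<^esub> h c}"
  shows "fun_subspace K" "mackey_closed Y K"
proof -
  let ?Q = "born_quotient Z W"
  note DY = function_spaceD[OF Y] and DZ = function_spaceD[OF Z]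
  note ops = born_quotient_add[OF Z W(2)] born_quotient_smult[OF Z W(2)]
  have Q: "vector_space_C ?Q" by (rule born_quotient_vector_space[OF Z W(2)])
  note lin = f[unfolded bdd_linear_def DY] h[unfolded bdd_linear_def DY]
  have z: "\<zero>\<^bsub>?Q\<^esub> = f 0" "\<zero>\<^bsub>?Q\<^esub> = h 0"
  proof -
    have "0 \<in> carrier Y" by (rule fun_subspaceD(1)[OF DY(1)])
    then show "\<zero>\<^bsub>?Q\<^esub> = f 0" "\<zero>\<^bsub>?Q\<^esub> = h 0"
      using lin vector_space_simps(5)[OF Q] by (metis scl_simps(2))+
  qed
  have zero: "0 \<in> K"
    using fun_subspaceD(1)[OF DY(1)] z vector_space_simps(6)[OF Q, of a] by (simp add: K_def)
  have add: "c + c' \<in> K" if "c \<in> K" "c' \<in> K" for c c'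
  proof -
    have c: "c \<in> carrier Y" "c' \<in> carrier Y" "f c = a \<odot>\<^bsub>?Q\<^esub> h c" "f c' = a \<odot>\<^bsub>?Q\<^esub> h c'"
      using that by (auto simp: K_def)
    then have "f (c + c') = a \<odot>\<^bsub>?Q\<^esub> h c \<oplus>\<^bsub>?Q\<^esub> a \<odot>\<^bsub>?Q\<^esub> h c'" using lin by simp
    also have "\<dots> = a \<odot>\<^bsub>?Q\<^esub> (h c \<oplus>\<^bsub>?Q\<^esub> h c')"
      using vector_space_simps(10)[OF Q] lin c(1,2) by metis
    also have "\<dots> = a \<odot>\<^bsub>?Q\<^esub> h (c + c')" using lin c(1,2) by simp
    finally show ?thesis using c(1,2) fun_subspaceD(2)[OF DY(1)] by (auto simp: K_def)
  qed
  have sc: "scl b c \<in> K" if "c \<in> K" for b c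
  proof -
    have c: "c \<in> carrier Y" "f c = a \<odot>\<^bsub>?Q\<^esub> h c"
      using that by (auto simp: K_def)
    then have hc: "h c \<in> carrier ?Q" using lin by blast
    have "f (scl b c) = b \<odot>\<^bsub>?Q\<^esub> (a \<odot>\<^bsub>?Q\<^esub> h c)" using lin c by simp
    also have "\<dots> = a \<odot>\<^bsub>?Q\<^esub> (b \<odot>\<^bsub>?Q\<^esub> h c)"
      using vector_space_simps(8)[OF Q hc] by (metis mult.commute)
    also have "\<dots> = a \<odot>\<^bsub>?Q\<^esub> h (scl b c)" using lin c by simp
    finally show ?thesis using c fun_subspaceD(3)[OF DY(1)] by (auto simp: K_def)
  qed
  show "fun_subspace K" using zero add sc by (auto simp: fun_subspace_def)
  show "mackey_closed Y K"
    unfolding mackey_closed_def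
  proof (intro allI impI, elim conjE)
    fix u l assume u: "\<forall>k. u k \<in> K" and "mackey_limit Y u l"
    then obtain A e where l: "l \<in> carrier Y" and A: "A \<in> bornology Y" and e: "e \<longlonglongrightarrow> 0"
      and x: "\<And>k. \<exists>x\<in>A. u k - l = scl (of_real (e k)) x"
      by (auto simp: mackey_limit_fun[OF Y])
    have "f ` A \<in> bornology ?Q" "h ` A \<in> bornology ?Q" using lin A by blast+
    then obtain B1 B2 where B1: "B1 \<in> bornology Z" "f ` A = (\<lambda>x. W +>\<^bsub>Z\<^esub> x) ` B1"
      and B2: "B2 \<in> bornology Z" "h ` A = (\<lambda>x. W +>\<^bsub>Z\<^esub> x) ` B2"
      unfolding born_quotient_simps(5) mem_Collect_eq by metis
    obtain B3 where B3: "B3 \<in> bornology Z" "\<And>x y. x \<in> B1 \<Longrightarrow> y \<in> B2 \<Longrightarrow> x - scl a y \<in> B3"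
      using Zb[OF B1(1) B2(1)] by blast
    have "f l \<in> carrier ?Q" "h l \<in> carrier ?Q" using lin l by auto
    then obtain F H where F: "F \<in> carrier Z" "f l = W +>\<^bsub>Z\<^esub> F" and H: "H \<in> carrier Z" "h l = W +>\<^bsub>Z\<^esub> H"
      by (auto simp: born_quotient_simps(1))
    \<comment> \<open>Equality at \<open>u k\<close> compares two cosets, so
      \<open>F - scl a H\<close> lies in \<open>W\<close> up to \<open>e k\<close> times an element
      of the bounded set \<open>B3\<close>. Thus \<open>F - scl a H\<close> is itself a Mackey limit
      of elements of \<open>W\<close>, and closedness of \<open>W\<close> puts it there.\<close>
    have "\<exists>y\<in>B3. F - scl a H + scl (of_real (e k)) y \<in> W" for k
    proof -
      obtain x where x: "x \<in> A" "u k - l = scl (of_real (e k)) x" using x by blast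
      then have uk: "u k = l + scl (of_real (e k)) x" by (simp add: algebra_simps)
      have xY: "x \<in> carrier Y" "scl (of_real (e k)) x \<in> carrier Y"
        using x Yb[OF A] fun_subspaceD(3)[OF DY(1)] by auto
      obtain \<alpha> where \<alpha>: "\<alpha> \<in> B1" "f x = W +>\<^bsub>Z\<^esub> \<alpha>" using x(1) B1(2) by blast
      obtain \<beta> where \<beta>: "\<beta> \<in> B2" "h x = W +>\<^bsub>Z\<^esub> \<beta>" using x(1) B2(2) by blast
      have "f (u k) = W +>\<^bsub>Z\<^esub> (F + scl (of_real (e k)) \<alpha>)"
        "h (u k) = W +>\<^bsub>Z\<^esub> (H + scl (of_real (e k)) \<beta>)"
        using lin l xY F(2) H(2) \<alpha>(2) \<beta>(2) by (simp_all add: uk ops)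
      moreover have "f (u k) = a \<odot>\<^bsub>?Q\<^esub> h (u k)" using u by (auto simp: K_def)
      ultimately have "W +>\<^bsub>Z\<^esub> (F + scl (of_real (e k)) \<alpha>)
          = W +>\<^bsub>Z\<^esub> (scl a (H + scl (of_real (e k)) \<beta>))"
        by (simp only: ops)
      then have "F + scl (of_real (e k)) \<alpha> - scl a (H + scl (of_real (e k)) \<beta>) \<in> W"
        unfolding coset_eq_iff[OF Z W(2)] .
      also have "F + scl (of_real (e k)) \<alpha> - scl a (H + scl (of_real (e k)) \<beta>)
          = F - scl a H + scl (of_real (e k)) (\<alpha> - scl a \<beta>)"
        by (auto simp: fun_eq_iff algebra_simps)
      finally show ?thesis using B3(2)[OF \<alpha>(1) \<beta>(1)] by blast
    qed
    then obtain y where y: "\<And>k. y k \<in> B3" "\<And>k. F - scl a H + scl (of_real (e k)) (y k) \<in> W"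
      by metis
    have FH: "F - scl a H \<in> carrier Z"
      using F(1) H(1) fun_subspaceD[OF DZ(1)] by blast
    have "mackey_limit Z (\<lambda>k. F - scl a H + scl (of_real (e k)) (y k)) (F - scl a H)"
      unfolding mackey_limit_fun[OF Z] using y B3(1) e W(1) FH by (auto intro!: bexI[of _ B3] exI[of _ e])
    then have "F - scl a H \<in> W"
      using W(3)[unfolded mackey_closed_def, rule_format,
          of "\<lambda>k. F - scl a H + scl (of_real (e k)) (y k)" "F - scl a H"] y(2) by simp
    then have "f l = a \<odot>\<^bsub>?Q\<^esub> h l"
      by (simp add: F H ops coset_eq_iff[OF Z W(2)])
    then show "l \<in> K" using l by (simp add: K_def)
  qed
qed

lemma closed_span_properties:
  assumes "function_space V" "S \<subseteq> carrier V"
  shows "S \<subseteq> closed_span V S" "closed_span V S \<subseteq> carrier V" "fun_subspace (closed_span V S)"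
    "mackey_closed V (closed_span V S)"
proof -
  have c: "subspace_C V (carrier V)"
    using function_spaceD(1)[OF assms(1)] by (simp add: subspace_C_iff[OF assms(1)])
  have m: "mackey_closed V (carrier V)" by (auto simp: mackey_closed_def mackey_limit_def)
  show "S \<subseteq> closed_span V S" by (auto simp: closed_span_def)
  show "closed_span V S \<subseteq> carrier V" using c m assms(2) by (auto simp: closed_span_def)
  show "fun_subspace (closed_span V S)"
    unfolding closed_span_def subspace_C_iff[OF assms(1)] by (auto simp: fun_subspace_def)
  show "mackey_closed V (closed_span V S)"
    unfolding closed_span_def mackey_closed_def by blast
qed

lemma closed_span_minimal:
  assumes "function_space V" "W \<subseteq> carrier V" "fun_subspace W" "mackey_closed V W" "S \<subseteq> W"
  shows "closed_span V S \<subseteq> W"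
  unfolding closed_span_def using assms subspace_C_iff[OF assms(1), of W] by blast

lemma vspan_properties:
  assumes "function_space V" "S \<subseteq> carrier V"
  shows "S \<subseteq> vspan V S" "vspan V S \<subseteq> carrier V" "fun_subspace (vspan V S)"
proof -
  have c: "subspace_C V (carrier V)"
    using function_spaceD(1)[OF assms(1)] by (simp add: subspace_C_iff[OF assms(1)])
  show "S \<subseteq> vspan V S" by (auto simp: vspan_def)
  show "vspan V S \<subseteq> carrier V" using c assms(2) by (auto simp: vspan_def)
  show "fun_subspace (vspan V S)"
    unfolding vspan_def subspace_C_iff[OF assms(1)] by (auto simp: fun_subspace_def)
qed

lemma vspan_minimal:
  assumes "function_space V" "W \<subseteq> carrier V" "fun_subspace W" "S \<subseteq> W"
  shows "vspan V S \<subseteq> W"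
  unfolding vspan_def using assms subspace_C_iff[OF assms(1), of W] by blast

section \<open>Absolutely summable functions and their push-forwards\<close>

lemma sum_fun_apply [simp]: "(\<Sum>i\<in>A. f i) x = (\<Sum>i\<in>A. f i x)"
  for f :: "'i \<Rightarrow> 'x \<Rightarrow> 'a::comm_monoid_add"
  by (induction A rule: infinite_finite_induct) auto

lemma fun_subspace_sum:
  assumes "fun_subspace W" "\<And>i. i \<in> A \<Longrightarrow> f i \<in> W"
  shows "(\<Sum>i\<in>A. f i) \<in> W"
proof -
  have "(\<forall>i\<in>A. f i \<in> W) \<longrightarrow> sum f A \<in> W"
    by (rule infinite_finite_induct[where P = "\<lambda>A. (\<forall>i\<in>A. f i \<in> W) \<longrightarrow> sum f A \<in> W"])
      (use fun_subspaceD(1,2)[OF assms(1)] in simp_all)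
  with assms(2) show ?thesis by simp
qed

definition l1 :: "('x \<Rightarrow> complex) \<Rightarrow> bool" where
  "l1 c \<longleftrightarrow> (\<lambda>p. cmod (c p)) summable_on UNIV"

lemma summable_on_finite_support:
  fixes f :: "'x \<Rightarrow> 'a::{comm_monoid_add, topological_space}"
  assumes "finite {p. c p \<noteq> 0}" "\<And>p. c p = 0 \<Longrightarrow> f p = 0"
  shows "f summable_on A"
proof -
  have "f summable_on ({p. c p \<noteq> 0} \<inter> A)" using assms(1) by (intro summable_on_finite) auto
  then show ?thesis
    by (subst summable_on_cong_neutral[where T = "{p. c p \<noteq> 0} \<inter> A" and g = f]) (auto simp: assms(2))
qed

lemma l1_finsupp: "c \<in> finsupp_funs X \<Longrightarrow> l1 c"
  unfolding l1_def by (rule summable_on_finite_support[of c]) (auto simp: finsupp_funs_def)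

lemma l1_summable_on: "l1 c \<Longrightarrow> c summable_on A"
  unfolding l1_def using abs_summable_summable summable_on_subset_banach subset_UNIV by metis

lemma fun_subspace_l1: "fun_subspace {c. l1 c}"
  unfolding fun_subspace_def
proof (intro conjI ballI allI)
  show "0 \<in> {c::'a \<Rightarrow> complex. l1 c}" by (simp add: l1_def)
next
  fix c c' :: "'a \<Rightarrow> complex" assume "c \<in> {c. l1 c}" "c' \<in> {c. l1 c}"
  then have "(\<lambda>p. cmod (c p) + cmod (c' p)) summable_on UNIV"
    by (auto simp: l1_def intro: summable_on_add)
  then have "(\<lambda>p. cmod ((c + c') p)) summable_on UNIV"
    by (rule summable_on_comparison_test) (auto intro: norm_triangle_ineq)
  then show "c + c' \<in> {c. l1 c}" by (simp add: l1_def)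
next
  fix a and c :: "'a \<Rightarrow> complex" assume "c \<in> {c. l1 c}"
  then show "scl a c \<in> {c. l1 c}"
    by (auto simp: l1_def norm_mult intro: summable_on_cmult_right)
qed

text \<open>Fubini: the preimage of \<open>A\<close> is the disjoint union of the fibres, and
  \<open>snd\<close> identifies the dependent sum with it.\<close>

lemma infsum_fibres:
  fixes f :: "'p \<Rightarrow> 'a::banach"
  assumes "f summable_on (h -` A)"
  shows "(\<lambda>q. \<Sum>\<^sub>\<infinity>p\<in>h -` {q}. f p) summable_on A"
    and "(\<Sum>\<^sub>\<infinity>q\<in>A. \<Sum>\<^sub>\<infinity>p\<in>h -` {q}. f p) = (\<Sum>\<^sub>\<infinity>p\<in>h -` A. f p)"
proof -
  have bij: "bij_betw snd (Sigma A (\<lambda>q. h -` {q})) (h -` A)"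
    by (auto simp: bij_betw_def inj_on_def image_iff)
  have "(\<lambda>x. f (snd x)) summable_on Sigma A (\<lambda>q. h -` {q})"
    using assms by (simp add: summable_on_reindex_bij_betw[OF bij])
  then have S: "(\<lambda>(x, y). f y) summable_on Sigma A (\<lambda>q. h -` {q})"
    by (simp add: case_prod_unfold)
  show "(\<lambda>q. \<Sum>\<^sub>\<infinity>p\<in>h -` {q}. f p) summable_on A"
    by (rule summable_on_Sigma_banach[OF S])
  have "(\<Sum>\<^sub>\<infinity>q\<in>A. \<Sum>\<^sub>\<infinity>p\<in>h -` {q}. f p) = (\<Sum>\<^sub>\<infinity>x\<in>Sigma A (\<lambda>q. h -` {q}). f (snd x))"
    using infsum_Sigma'_banach[OF S] by (simp add: case_prod_unfold)
  also have "\<dots> = (\<Sum>\<^sub>\<infinity>p\<in>h -` A. f p)"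
    by (rule infsum_reindex_bij_betw[OF bij])
  finally show "(\<Sum>\<^sub>\<infinity>q\<in>A. \<Sum>\<^sub>\<infinity>p\<in>h -` {q}. f p) = (\<Sum>\<^sub>\<infinity>p\<in>h -` A. f p)" .
qed

lemma pushforward_add: "l1 c \<Longrightarrow> l1 c' \<Longrightarrow> pushforward h (c + c') = pushforward h c + pushforward h c'"
  by (auto simp: pushforward_def fun_eq_iff intro!: infsum_add l1_summable_on)

lemma pushforward_scl: "pushforward h (scl a c) = scl a (pushforward h c)"
  by (auto simp: pushforward_def fun_eq_iff infsum_cmult_right')

lemma pushforward_zero [simp]: "pushforward h 0 = 0"
  by (auto simp: pushforward_def fun_eq_iff)

lemma pushforward_dirac [simp]: "pushforward h (dirac p) = dirac (h p)"
proof
  fix q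
  have "pushforward h (dirac p) q = (\<Sum>\<^sub>\<infinity>x\<in>{p} \<inter> h -` {q}. 1)"
    unfolding pushforward_def by (rule infsum_cong_neutral) (auto simp: dirac_def)
  also have "\<dots> = dirac (h p) q" by (cases "q = h p") (auto simp: dirac_def)
  finally show "pushforward h (dirac p) q = dirac (h p) q" .
qed

lemma pushforward_support:
  assumes "\<And>p. c p \<noteq> 0 \<Longrightarrow> h p \<noteq> q" shows "pushforward h c q = 0"
proof -
  have "pushforward h c q = (\<Sum>\<^sub>\<infinity>p\<in>h -` {q}. 0)"
    unfolding pushforward_def by (rule infsum_cong) (use assms in auto)
  then show ?thesis by simp
qed

lemma pushforward_comp:
  assumes "l1 c"
  shows "pushforward h (pushforward k c) = pushforward (h \<circ> k) c"
proof
  fix q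
  show "pushforward h (pushforward k c) q = pushforward (h \<circ> k) c q"
    using infsum_fibres(2)[OF l1_summable_on[OF assms], of k "h -` {q}"]
    by (simp add: pushforward_def vimage_comp)
qed

text \<open>The triangle inequality in each fibre, then Fubini over the fibres. This one estimate
  lies behind the boundedness of the face maps, the convolution action on completed chains and the
  plain l1 bound. Weights are compared on the support of \<open>c\<close> only, because word lengths
  are under control only on group elements.\<close>

lemma pushforward_weighted:
  assumes c: "l1 c" "(\<lambda>p. cmod (c p) * u p) summable_on UNIV"
    and uv: "\<And>p. c p \<noteq> 0 \<Longrightarrow> 0 \<le> v (h p) \<and> v (h p) \<le> u p"
  shows "(\<lambda>q. cmod (pushforward h c q) * v q) summable_on UNIV"
    and "(\<Sum>\<^sub>\<infinity>q. cmod (pushforward h c q) * v q) \<le> (\<Sum>\<^sub>\<infinity>p. cmod (c p) * u p)"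
proof -
  define g where "g q = (\<Sum>\<^sub>\<infinity>p\<in>h -` {q}. cmod (c p) * u p)" for q
  have sub: "(\<lambda>p. cmod (c p) * u p) summable_on A" "(\<lambda>p. cmod (c p)) summable_on A" for A
    using c summable_on_subset_banach subset_UNIV unfolding l1_def by blast+
  have le: "0 \<le> cmod (pushforward h c q) * v q \<and> cmod (pushforward h c q) * v q \<le> g q" for q
  proof (cases "\<exists>p. c p \<noteq> 0 \<and> h p = q")
    case False
    then have "pushforward h c q = 0" using pushforward_support[of c h q] by blast
    moreover have "0 \<le> g q"
      unfolding g_def
    proof (rule infsum_nonneg)
      fix p assume "p \<in> h -` {q}"
      then have "c p = 0" using False by auto
      then show "0 \<le> cmod (c p) * u p" by simp
    qed
    ultimately show ?thesis by simp
  next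
    case True
    then have v: "0 \<le> v q" using uv by blast
    have "cmod (pushforward h c q) * v q \<le> (\<Sum>\<^sub>\<infinity>p\<in>h -` {q}. cmod (c p)) * v q"
      unfolding pushforward_def using v sub(2) by (intro mult_right_mono norm_infsum_bound) auto
    also have "\<dots> = (\<Sum>\<^sub>\<infinity>p\<in>h -` {q}. cmod (c p) * v q)"
      by (simp add: infsum_cmult_left')
    also have "\<dots> \<le> g q"
      unfolding g_def
    proof (rule infsum_mono)
      show "(\<lambda>p. cmod (c p) * v q) summable_on h -` {q}"
        by (rule summable_on_cmult_left[OF sub(2)])
      show "cmod (c p) * v q \<le> cmod (c p) * u p" if "p \<in> h -` {q}" for p
        using uv[of p] that by (cases "c p = 0") (auto intro: mult_left_mono)
    qed (rule sub)
    finally show ?thesis using v by simp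
  qed
  have g: "g summable_on UNIV" "(\<Sum>\<^sub>\<infinity>q. g q) = (\<Sum>\<^sub>\<infinity>p. cmod (c p) * u p)"
    using infsum_fibres[of "\<lambda>p. cmod (c p) * u p" h UNIV] sub(1) unfolding g_def by simp_all
  show S: "(\<lambda>q. cmod (pushforward h c q) * v q) summable_on UNIV"
    by (rule summable_on_comparison_test[OF g(1)]) (use le in auto)
  show "(\<Sum>\<^sub>\<infinity>q. cmod (pushforward h c q) * v q) \<le> (\<Sum>\<^sub>\<infinity>p. cmod (c p) * u p)"
    unfolding g(2)[symmetric] by (rule infsum_mono[OF S g(1)]) (use le in auto)
qed

lemma pushforward_l1:
  assumes "l1 c"
  shows "l1 (pushforward h c)" "(\<Sum>\<^sub>\<infinity>q. cmod (pushforward h c q)) \<le> (\<Sum>\<^sub>\<infinity>p. cmod (c p))"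
  using pushforward_weighted[of c "\<lambda>_. 1" "\<lambda>_. 1" h] assms by (auto simp: l1_def)

text \<open>With it the convolution of \<open>f\<close> and \<open>c\<close> becomes the
  push-forward of \<open>ext_prod f c\<close> along the group action, so that Fubini and
  \<open>pushforward_weighted\<close> apply.\<close>

definition ext_prod :: "('x \<Rightarrow> complex) \<Rightarrow> ('y \<Rightarrow> complex) \<Rightarrow> 'x \<times> 'y \<Rightarrow> complex" where
  "ext_prod f c = (\<lambda>(x, y). f x * c y)"

lemma summable_on_product_nonneg:
  fixes f :: "'x \<Rightarrow> real" and g :: "'y \<Rightarrow> real"
  assumes "f summable_on UNIV" "g summable_on UNIV" "\<And>x. f x \<ge> 0" "\<And>y. g y \<ge> 0"
  shows "(\<lambda>(x, y). f x * g y) summable_on UNIV"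
proof -
  have "(\<lambda>p. (case p of (x, y) \<Rightarrow> f x * g y)) summable_on Sigma UNIV (\<lambda>_. UNIV)"
  proof (rule summable_on_SigmaI)
    show "((\<lambda>y. case (x, y) of (x, y) \<Rightarrow> f x * g y) has_sum (f x * infsum g UNIV)) UNIV" for x
      using has_sum_cmult_right[OF has_sum_infsum[OF assms(2)], of "f x"] by simp
    show "(\<lambda>x. f x * infsum g UNIV) summable_on UNIV"
      by (rule summable_on_cmult_left[OF assms(1)])
  qed (use assms in auto)
  then show ?thesis by simp
qed

lemma l1_ext_prod:
  assumes "l1 f" "l1 c" shows "l1 (ext_prod f c)"
  using summable_on_product_nonneg[of "\<lambda>x. cmod (f x)" "\<lambda>y. cmod (c y)"] assms
  by (simp add: l1_def ext_prod_def norm_mult case_prod_unfold)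

text \<open>The fibre of the product map over a pair is a copy of the fibre of \<open>h\<close>,
  along which the factor from \<open>f\<close> is constant.\<close>

lemma pushforward_ext_prod:
  fixes f :: "'x \<Rightarrow> complex" and h :: "'y \<Rightarrow> 'z"
  shows "pushforward (map_prod id h) (ext_prod f c) = ext_prod f (pushforward h c)"
proof
  fix q :: "'x \<times> 'z"
  obtain x t where q: "q = (x, t)" by (cases q)
  have bij: "bij_betw (\<lambda>s. (x, s)) (h -` {t}) (map_prod id h -` {q})"
    by (auto simp: bij_betw_def inj_on_def q image_iff)
  have "pushforward (map_prod id h) (ext_prod f c) q = (\<Sum>\<^sub>\<infinity>s\<in>h -` {t}. f x * c s)"
    unfolding pushforward_def
    using infsum_reindex_bij_betw[OF bij, of "ext_prod f c"] by (simp add: ext_prod_def)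
  also have "\<dots> = ext_prod f (pushforward h c) q"
    by (simp add: q ext_prod_def pushforward_def infsum_cmult_right')
  finally show "pushforward (map_prod id h) (ext_prod f c) q = ext_prod f (pushforward h c) q" .
qed

text \<open>A diagonal choice of finite sets makes the tails small for countably many weights at once.\<close>

lemma finite_truncations:
  fixes c :: "'x \<Rightarrow> complex" and u :: "nat \<Rightarrow> 'x \<Rightarrow> real"
  assumes u: "\<And>j. (\<lambda>x. cmod (c x) * u j x) summable_on UNIV" "\<And>j x. c x \<noteq> 0 \<Longrightarrow> 0 \<le> u j x"
  shows "\<exists>F. \<forall>k. finite (F k) \<and> (\<forall>x\<in>F k. c x \<noteq> 0) \<and>
    (\<forall>j\<le>k. (\<Sum>\<^sub>\<infinity>x\<in>- F k. cmod (c x) * u j x) \<le> (1/2) ^ k)"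
proof (rule choice, rule allI)
  fix k :: nat
  show "\<exists>F. finite F \<and> (\<forall>x\<in>F. c x \<noteq> 0) \<and> (\<forall>j\<le>k. (\<Sum>\<^sub>\<infinity>x\<in>- F. cmod (c x) * u j x) \<le> (1/2) ^ k)"
  proof -
    have nn: "0 \<le> cmod (c x) * u j x" for j x using u(2)[of x j] by (cases "c x = 0") auto
    \<comment> \<open>One nonnegative function dominates all weights up to \<open>k\<close>: a
      finite set that nearly exhausts its sum serves these weights simultaneously.\<close>
    define g where "g x = (\<Sum>j\<le>k. cmod (c x) * u j x)" for x
    have g: "g summable_on UNIV"
      unfolding g_def by (induction k) (use u(1) in \<open>auto intro: summable_on_add\<close>)
    obtain F0 where F0: "finite F0" "dist (sum g F0) (infsum g UNIV) \<le> (1/2) ^ k"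
      using infsum_finite_approximation[OF g, of "(1/2) ^ k"] by auto
    \<comment> \<open>Points where \<open>c\<close> vanishes contribute nothing; discarding them
      forces \<open>F\<close> into any set that contains the support of \<open>c\<close>, such as
      the tuples.\<close>
    define F where "F = {x \<in> F0. c x \<noteq> 0}"
    have F: "finite F" using F0 by (simp add: F_def)
    have sF: "sum g F = sum g F0"
      unfolding F_def using F0(1) by (intro sum.mono_neutral_left) (auto simp: g_def)
    have "infsum g UNIV = infsum g (F \<union> - F)" by simp
    also have "\<dots> = infsum g F + infsum g (- F)"
      using F g by (intro infsum_Un_disjoint) (auto intro: summable_on_subset_banach)
    finally have "infsum g (- F) \<le> (1/2) ^ k"
      using F F0(2) sF by (auto simp: dist_real_def)
    moreover have "(\<Sum>\<^sub>\<infinity>x\<in>- F. cmod (c x) * u j x) \<le> infsum g (- F)" if "j \<le> k" for j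
    proof (rule infsum_mono)
      show "cmod (c x) * u j x \<le> g x" for x
        unfolding g_def using that nn by (intro member_le_sum) auto
    qed (use u g in \<open>auto intro: summable_on_subset_banach[where A = UNIV]\<close>)
    ultimately show ?thesis using F by (intro exI[of _ F]) (force simp: F_def)
  qed
qed

section \<open>Weighted chains\<close>

text \<open>The seminorm of \<open>weighted_l1\<close>, but summed over the whole type. For
  functions vanishing off \<open>X\<close> the value is the same, and push-forward estimates apply
  without tracking domains.\<close>

definition wsum :: "(real \<Rightarrow> real) \<Rightarrow> ('x \<Rightarrow> real) \<Rightarrow> ('x \<Rightarrow> complex) \<Rightarrow> real" where
  "wsum l w f = (\<Sum>\<^sub>\<infinity>x. cmod (f x) * l (w x))"

lemma bar_bd_alt: "bar_bd n c = (\<Sum>i\<le>n. scl ((-1) ^ i) (pushforward (face i) c))"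
  by (auto simp: bar_bd_def fun_eq_iff)

lemma bar_bd_add: "l1 c \<Longrightarrow> l1 c' \<Longrightarrow> bar_bd n (c + c') = bar_bd n c + bar_bd n c'"
  by (simp add: bar_bd_alt pushforward_add scl_add sum.distrib)

lemma scl_sum: "scl a (sum h S) = (\<Sum>p\<in>S. scl a (h p))"
  by (auto simp: fun_eq_iff sum_distrib_left)

lemma bar_bd_scl: "bar_bd n (scl a c) = scl a (bar_bd n c)"
  by (simp add: bar_bd_alt pushforward_scl scl_sum mult.commute)

lemma bar_bd_zero [simp]: "bar_bd n 0 = 0"
  by (simp add: bar_bd_alt)

lemma bar_bd_dirac: "bar_bd n (dirac s) = (\<Sum>i\<le>n. scl ((-1) ^ i) (dirac (face i s)))"
  by (simp add: bar_bd_alt)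

lemma ext_prod_add: "ext_prod f (c + c') = ext_prod f c + ext_prod f c'"
  and ext_prod_scl: "ext_prod f (scl a c) = scl a (ext_prod f c)"
  and ext_prod_zero: "ext_prod f 0 = 0"
  by (auto simp: ext_prod_def fun_eq_iff algebra_simps)

lemma pushforward_sum:
  assumes "finite A" "\<And>i. i \<in> A \<Longrightarrow> l1 (c i)"
  shows "pushforward h (\<Sum>i\<in>A. c i) = (\<Sum>i\<in>A. pushforward h (c i))"
proof -
  have "(\<forall>i\<in>A. l1 (c i)) \<longrightarrow> pushforward h (sum c A) = (\<Sum>i\<in>A. pushforward h (c i))"
  proof (rule finite_induct[OF assms(1), where P = "\<lambda>A. (\<forall>i\<in>A. l1 (c i)) \<longrightarrow>
      pushforward h (sum c A) = (\<Sum>i\<in>A. pushforward h (c i))"])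
    fix x F assume F: "finite F" "x \<notin> F" "(\<forall>i\<in>F. l1 (c i)) \<longrightarrow>
      pushforward h (sum c F) = (\<Sum>i\<in>F. pushforward h (c i))"
    show "(\<forall>i\<in>insert x F. l1 (c i)) \<longrightarrow>
        pushforward h (sum c (insert x F)) = (\<Sum>i\<in>insert x F. pushforward h (c i))"
    proof
      assume l: "\<forall>i\<in>insert x F. l1 (c i)"
      then have "l1 (sum c F)" using fun_subspace_sum[OF fun_subspace_l1, of F c] by simp
      with F l show "pushforward h (sum c (insert x F)) = (\<Sum>i\<in>insert x F. pushforward h (c i))"
        by (simp add: pushforward_add)
    qed
  qed simp
  with assms(2) show ?thesis by simp
qed

lemma bdd_linear_add_scl:
  assumes V: "function_space V" and W: "function_space W"
    and Wb: "\<And>A A'. A \<in> bornology W \<Longrightarrow> A' \<in> bornology W \<Longrightarrow>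
        \<exists>A''\<in>bornology W. \<forall>x\<in>A. \<forall>y\<in>A'. x + scl a y \<in> A''"
    and Ws: "\<And>A A'. A \<in> bornology W \<Longrightarrow> A' \<subseteq> A \<Longrightarrow> A' \<in> bornology W"
    and f: "bdd_linear V W f" and g: "bdd_linear V W g"
  shows "bdd_linear V W (\<lambda>x. f x + scl a (g x))"
proof -
  note D = function_spaceD[OF V] function_spaceD[OF W]
  note lin = f[unfolded bdd_linear_def D] g[unfolded bdd_linear_def D]
  show ?thesis
    unfolding bdd_linear_def D
  proof (intro conjI ballI allI)
    show "f x + scl a (g x) \<in> carrier W" if "x \<in> carrier V" for x
      using lin that fun_subspaceD[OF D(5)] by blast
    show "(\<lambda>x. f x + scl a (g x)) ` A \<in> bornology W" if "A \<in> bornology V" for A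
    proof -
      have "f ` A \<in> bornology W" "g ` A \<in> bornology W" using lin that by blast+
      from Wb[OF this] obtain A'' where A'': "A'' \<in> bornology W"
        "\<forall>x\<in>f ` A. \<forall>y\<in>g ` A. x + scl a y \<in> A''" by blast
      show ?thesis by (rule Ws[OF A''(1)]) (use A''(2) in auto)
    qed
  qed (use lin in \<open>auto simp: scl_add algebra_simps\<close>)
qed

section \<open>Bounding classes and word length\<close>

locale bounded_group = group G for G :: "('g, 'r) monoid_scheme" (structure) +
  fixes B :: "(real \<Rightarrow> real) set" and L :: "'g \<Rightarrow> real"
  assumes bounding: "bounding_class B" and word_length: "word_length_function G L"
begin

lemma pre_bounding: "pre_bounding_class B"
  using bounding by (simp add: bounding_class_def)

lemma B_pos: "l \<in> B \<Longrightarrow> 0 \<le> x \<Longrightarrow> 0 < l x"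
  and B_mono: "l \<in> B \<Longrightarrow> 0 \<le> x \<Longrightarrow> x \<le> y \<Longrightarrow> l x \<le> l y"
proof -
  assume "l \<in> B" "0 \<le> x"
  then have "mono_on {0..} l" "\<forall>x\<ge>0. 0 < l x"
    using conjunct1[OF pre_bounding[unfolded pre_bounding_class_def]]
    by (simp_all add: positive_nondecreasing_def)
  then show "0 < l x" "x \<le> y \<Longrightarrow> l x \<le> l y"
    using \<open>0 \<le> x\<close> by (auto dest: mono_onD[of _ l x y])
qed

lemma B_one: "\<exists>l\<in>B. \<forall>x\<ge>0. l x = 1"
  by (rule conjunct1[OF conjunct2[OF pre_bounding[unfolded pre_bounding_class_def]]])

text \<open>A substitute for submultiplicativity: from \<open>a + b \<le> 2 * max a b\<close> it
  follows that \<open>l (a + b)\<close> is at most \<open>h a + h b\<close>, which is how the weight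
  of a translated tuple is bounded.\<close>

lemma B_double:
  assumes "l \<in> B" shows "\<exists>h\<in>B. \<forall>x\<ge>0. l (2 * x) \<le> h x"
proof -
  note * = conjunct2[OF conjunct2[OF conjunct2[OF pre_bounding[unfolded pre_bounding_class_def]]]]
  obtain h where "h \<in> B" "\<forall>x\<ge>0. l (2 * x + 0) < h x"
    using *[rule_format, OF assms, of 2 0] by auto
  then show ?thesis by (intro bexI[of _ h]) (auto intro: less_imp_le)
qed

text \<open>An enumeration of the countable class equivalent to \<open>B\<close>. Each member is
  dominated in \<open>B\<close>, so chains are summable against it; conversely each weight of
  \<open>B\<close> is dominated by a member, so bounds along the sequence control all seminorms. The
  class is nonempty because it has to dominate the constant 1.\<close>

lemma B_sequence:
  "\<exists>lam :: nat \<Rightarrow> real \<Rightarrow> real. (\<forall>j. \<forall>x\<ge>0. 0 < lam j x) \<and> (\<forall>j. \<exists>h\<in>B. \<forall>x\<ge>0. lam j x \<le> h x) \<and>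
    (\<forall>l\<in>B. \<exists>j. \<forall>x\<ge>0. l x \<le> lam j x)"
proof -
  obtain B' where B': "countable B'" "pre_bounding_class B'"
    "\<And>f. f \<in> B' \<Longrightarrow> \<exists>h\<in>B. \<forall>x\<ge>0. f x \<le> h x" "\<And>h. h \<in> B \<Longrightarrow> \<exists>f\<in>B'. \<forall>x\<ge>0. h x \<le> f x"
    using conjunct2[OF bounding[unfolded bounding_class_def]] by metis
  have ne: "B' \<noteq> {}" using B'(4) B_one by blast
  have mem: "from_nat_into B' j \<in> B'" for j by (rule from_nat_into[OF ne])
  show ?thesis
  proof (rule exI[of _ "from_nat_into B'"], intro conjI allI impI ballI)
    show "0 < from_nat_into B' j x" if "0 \<le> x" for j x
      using conjunct1[OF B'(2)[unfolded pre_bounding_class_def]] mem[of j] that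
      by (simp add: positive_nondecreasing_def)
    show "\<exists>h\<in>B. \<forall>x\<ge>0. from_nat_into B' j x \<le> h x" for j by (rule B'(3)[OF mem])
    show "\<exists>j. \<forall>x\<ge>0. l x \<le> from_nat_into B' j x" if l: "l \<in> B" for l
    proof -
      obtain f where f: "f \<in> B'" "\<forall>x\<ge>0. l x \<le> f x" using B'(4)[OF l] by blast
      then show ?thesis using from_nat_into_surj[OF B'(1) f(1)] by auto
    qed
  qed
qed

lemma foldr_mult_closed: "set ws \<subseteq> carrier G \<Longrightarrow> foldr (\<otimes>) ws \<one> \<in> carrier G"
  by (induction ws) auto

lemma foldr_mult_append:
  "set ws \<subseteq> carrier G \<Longrightarrow> set vs \<subseteq> carrier G \<Longrightarrow>
    foldr (\<otimes>) (ws @ vs) \<one> = foldr (\<otimes>) ws \<one> \<otimes> foldr (\<otimes>) vs \<one>"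
  by (induction ws) (auto simp: foldr_mult_closed m_assoc)

lemma foldr_mult_inv:
  "set ws \<subseteq> carrier G \<Longrightarrow> foldr (\<otimes>) (map (m_inv G) (rev ws)) \<one> = inv (foldr (\<otimes>) ws \<one>)"
proof (induction ws)
  case (Cons a ws)
  then have "foldr (\<otimes>) (map (m_inv G) (rev ws) @ [inv a]) \<one> =
      foldr (\<otimes>) (map (m_inv G) (rev ws)) \<one> \<otimes> foldr (\<otimes>) [inv a] \<one>"
    by (intro foldr_mult_append) auto
  with Cons show ?case by (simp add: inv_mult_group foldr_mult_closed)
qed simp

text \<open>Shortest words are concatenated for products. For inverses a shortest word is reversed
  and its letters inverted, at equal total weight by the symmetry of \<phi>; using this inequality
  for \<open>g\<close> and for \<open>inv g\<close> gives equality.\<close>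

lemma L_nonneg: "g \<in> carrier G \<Longrightarrow> 0 \<le> L g"
  and L_mult: "g \<in> carrier G \<Longrightarrow> h \<in> carrier G \<Longrightarrow> L (g \<otimes> h) \<le> L g + L h"
  and L_inv: "g \<in> carrier G \<Longrightarrow> L (inv g) = L g"
proof -
  obtain S \<phi> where *: "S \<subseteq> carrier G \<and>
      (\<forall>s\<in>S. 0 < \<phi> s \<and> inv s \<in> S \<and> \<phi> (inv s) = \<phi> s) \<and>
      (\<forall>g\<in>carrier G.
         (\<exists>ws. set ws \<subseteq> S \<and> foldr (\<otimes>) ws \<one> = g \<and> L g = sum_list (map \<phi> ws)) \<and>
         (\<forall>ws. set ws \<subseteq> S \<and> foldr (\<otimes>) ws \<one> = g \<longrightarrow> L g \<le> sum_list (map \<phi> ws)))"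
    using word_length unfolding word_length_function_def by (elim exE)
  have S: "S \<subseteq> carrier G" "\<And>s. s \<in> S \<Longrightarrow> 0 < \<phi> s \<and> inv s \<in> S \<and> \<phi> (inv s) = \<phi> s"
    and ex: "\<And>g. g \<in> carrier G \<Longrightarrow>
      \<exists>ws. set ws \<subseteq> S \<and> foldr (\<otimes>) ws \<one> = g \<and> L g = sum_list (map \<phi> ws)"
    and le: "\<And>g ws. g \<in> carrier G \<Longrightarrow> set ws \<subseteq> S \<Longrightarrow> foldr (\<otimes>) ws \<one> = g \<Longrightarrow>
      L g \<le> sum_list (map \<phi> ws)"
    using * by simp_all
  show "0 \<le> L g" if g: "g \<in> carrier G" for g
  proof -
    obtain ws where ws: "set ws \<subseteq> S" "L g = sum_list (map \<phi> ws)" using ex[OF g] by auto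
    then have "\<forall>x\<in>set (map \<phi> ws). 0 \<le> x" using S(2) by (auto intro: less_imp_le)
    then have "0 \<le> sum_list (map \<phi> ws)" by (intro sum_list_nonneg) blast
    then show ?thesis using ws(2) by simp
  qed
  show "L (g \<otimes> h) \<le> L g + L h" if gh: "g \<in> carrier G" "h \<in> carrier G" for g h
  proof -
    obtain ws where ws: "set ws \<subseteq> S" "foldr (\<otimes>) ws \<one> = g" "L g = sum_list (map \<phi> ws)" using ex[OF gh(1)] by auto
    obtain vs where vs: "set vs \<subseteq> S" "foldr (\<otimes>) vs \<one> = h" "L h = sum_list (map \<phi> vs)" using ex[OF gh(2)] by auto
    have "foldr (\<otimes>) (ws @ vs) \<one> = g \<otimes> h"
      using foldr_mult_append[of ws vs] ws vs S(1) by auto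
    then show ?thesis using le[of "g \<otimes> h" "ws @ vs"] ws vs gh by simp
  qed
  have inv_le: "L (inv g) \<le> L g" if g: "g \<in> carrier G" for g
  proof -
    obtain ws where ws: "set ws \<subseteq> S" "foldr (\<otimes>) ws \<one> = g" "L g = sum_list (map \<phi> ws)" using ex[OF g] by auto
    have "foldr (\<otimes>) (map (m_inv G) (rev ws)) \<one> = inv g"
      using foldr_mult_inv[of ws] ws S(1) by auto
    moreover have "set (map (m_inv G) (rev ws)) \<subseteq> S" using ws(1) S(2) by auto
    moreover have "sum_list (map \<phi> (map (m_inv G) (rev ws))) = sum_list (map \<phi> ws)"
    proof -
      have "map \<phi> (map (m_inv G) (rev ws)) = rev (map \<phi> ws)"
        using ws(1) S(2) by (auto simp: rev_map)
      then show ?thesis by (simp only: sum_list_rev)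
    qed
    ultimately show ?thesis using le[of "inv g" "map (m_inv G) (rev ws)"] ws g by simp
  qed
  show "L (inv g) = L g" if "g \<in> carrier G" for g
    using inv_le[OF that] inv_le[of "inv g"] that by simp
qed

section \<open>Weighted l1 spaces and bounded maps between them\<close>

lemma weighted_carrier_iff:
  "f \<in> carrier (weighted_l1 B X w) \<longleftrightarrow>
     (\<forall>x. x \<notin> X \<longrightarrow> f x = 0) \<and> (\<forall>l\<in>B. (\<lambda>x. cmod (f x) * l (w x)) summable_on UNIV)"
proof -
  have "(\<lambda>x. cmod (f x) * l (w x)) summable_on X \<longleftrightarrow> (\<lambda>x. cmod (f x) * l (w x)) summable_on UNIV"
    if "\<forall>x. x \<notin> X \<longrightarrow> f x = 0" for l
    by (rule summable_on_cong_neutral) (use that in auto)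
  then show ?thesis by (auto simp: weighted_l1_def Let_def module.defs fun_space_def)
qed

lemma weighted_bornology_iff:
  "A \<in> bornology (weighted_l1 B X w) \<longleftrightarrow>
     A \<subseteq> carrier (weighted_l1 B X w) \<and> (\<forall>l\<in>B. \<exists>K. \<forall>f\<in>A. wsum l w f \<le> K)"
proof -
  have "(\<Sum>\<^sub>\<infinity>x\<in>X. cmod (f x) * l (w x)) = wsum l w f" if "\<forall>x. x \<notin> X \<longrightarrow> f x = 0" for f l
    unfolding wsum_def by (rule infsum_cong_neutral) (use that in auto)
  then show ?thesis
    unfolding weighted_l1_def Let_def
    by (auto simp: module.defs born_space.defs fun_space_def subset_iff)
qed

text \<open>The class contains the constant weight 1, though constant on nonnegative arguments only;
  hence the condition on \<open>w\<close>.\<close>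

lemma l1_weighted:
  assumes "\<And>x. x \<in> X \<Longrightarrow> 0 \<le> w x" "f \<in> carrier (weighted_l1 B X w)"
  shows "l1 f"
proof -
  obtain l where l: "l \<in> B" "\<forall>x\<ge>0. l x = 1" using B_one by blast
  have "cmod (f x) * l (w x) = cmod (f x)" for x
    using assms l(2) by (cases "x \<in> X") (auto simp: weighted_carrier_iff)
  then have "(\<lambda>x. cmod (f x) * l (w x)) = (\<lambda>x. cmod (f x))" by (rule ext)
  moreover have "(\<lambda>x. cmod (f x) * l (w x)) summable_on UNIV"
    using assms(2) l(1) by (simp add: weighted_carrier_iff)
  ultimately show ?thesis by (simp add: l1_def)
qed

lemma weighted_add_bound:
  assumes w: "\<And>x. x \<in> X \<Longrightarrow> 0 \<le> w x" and l: "l \<in> B"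
    and f: "f \<in> carrier (weighted_l1 B X w)" "g \<in> carrier (weighted_l1 B X w)"
  shows "(\<lambda>x. cmod ((f + scl a g) x) * l (w x)) summable_on UNIV"
    "wsum l w (f + scl a g) \<le> wsum l w f + cmod a * wsum l w g"
proof -
  have S: "(\<lambda>x. cmod (f x) * l (w x)) summable_on UNIV" "(\<lambda>x. cmod (g x) * l (w x)) summable_on UNIV"
    using f l by (auto simp: weighted_carrier_iff)
  let ?h = "\<lambda>x. cmod (f x) * l (w x) + cmod a * (cmod (g x) * l (w x))"
  have H: "?h summable_on UNIV"
    by (intro summable_on_add summable_on_cmult_right S)
  have le: "cmod ((f + scl a g) x) * l (w x) \<le> ?h x \<and> 0 \<le> cmod ((f + scl a g) x) * l (w x)" for x
  proof (cases "x \<in> X")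
    case True
    then have "0 < l (w x)" using B_pos[OF l] w by blast
    moreover have "cmod (f x + a * g x) \<le> cmod (f x) + cmod a * cmod (g x)"
      by (metis norm_mult norm_triangle_ineq)
    ultimately show ?thesis
      using mult_right_mono[of "cmod (f x + a * g x)" "cmod (f x) + cmod a * cmod (g x)" "l (w x)"]
      by (simp add: algebra_simps)
  qed (use f in \<open>auto simp: weighted_carrier_iff\<close>)
  show S': "(\<lambda>x. cmod ((f + scl a g) x) * l (w x)) summable_on UNIV"
    by (rule summable_on_comparison_test[OF H]) (use le in auto)
  have "wsum l w (f + scl a g) \<le> infsum ?h UNIV"
    unfolding wsum_def by (rule infsum_mono[OF S' H]) (use le in auto)
  also have "\<dots> = wsum l w f + cmod a * wsum l w g"
    unfolding wsum_def using S
    by (subst infsum_add) (auto intro: summable_on_cmult_right simp: infsum_cmult_right')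
  finally show "wsum l w (f + scl a g) \<le> wsum l w f + cmod a * wsum l w g" .
qed

lemma finsupp_weighted: "finsupp_funs X \<subseteq> carrier (weighted_l1 B X w)"
proof
  fix f assume f: "f \<in> finsupp_funs X"
  have "(\<lambda>x. cmod (f x) * l (w x)) summable_on UNIV" for l
    by (rule summable_on_finite_support[of f]) (use f in \<open>auto simp: finsupp_funs_def\<close>)
  then show "f \<in> carrier (weighted_l1 B X w)"
    using f unfolding weighted_carrier_iff finsupp_funs_def by blast
qed

lemma function_space_weighted:
  assumes w: "\<And>x. x \<in> X \<Longrightarrow> 0 \<le> w x"
  shows "function_space (weighted_l1 B X w)"
proof -
  let ?F = "carrier (weighted_l1 B X w)"
  have add: "f + scl a g \<in> ?F" if "f \<in> ?F" "g \<in> ?F" for f g a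
    using that weighted_add_bound(1)[OF w _ that] by (auto simp: weighted_carrier_iff)
  have zero: "0 \<in> ?F" by (simp add: weighted_carrier_iff)
  have "fun_subspace ?F"
    unfolding fun_subspace_def using zero add[of _ _ 1] add[OF zero] by simp
  then show ?thesis
    by (auto simp: function_space_def weighted_l1_def Let_def module.defs fun_space_def fun_eq_iff)
qed

lemma weighted_bornology_add:
  assumes w: "\<And>x. x \<in> X \<Longrightarrow> 0 \<le> w x"
    and A: "A \<in> bornology (weighted_l1 B X w)" "A' \<in> bornology (weighted_l1 B X w)"
  shows "\<exists>A''\<in>bornology (weighted_l1 B X w). \<forall>x\<in>A. \<forall>y\<in>A'. x + scl a y \<in> A''"
proof
  let ?V = "weighted_l1 B X w"
  let ?S = "{x + scl a y | x y. x \<in> A \<and> y \<in> A'}"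
  have A': "A \<subseteq> carrier ?V" "A' \<subseteq> carrier ?V" using A by (auto simp: weighted_bornology_iff)
  show "?S \<in> bornology ?V"
    unfolding weighted_bornology_iff
  proof (intro conjI ballI)
    show "?S \<subseteq> carrier ?V"
      using A' fun_subspaceD[OF function_spaceD(1)[OF function_space_weighted[of X w, OF w]]] by blast
    fix l assume l: "l \<in> B"
    obtain K K' where K: "\<forall>f\<in>A. wsum l w f \<le> K" "\<forall>f\<in>A'. wsum l w f \<le> K'"
      using A l by (auto simp: weighted_bornology_iff) metis
    have "wsum l w (x + scl a y) \<le> K + cmod a * K'" if xy: "x \<in> A" "y \<in> A'" for x y
    proof -
      have c: "x \<in> carrier ?V" "y \<in> carrier ?V" using A' xy by auto
      have "wsum l w (x + scl a y) \<le> wsum l w x + cmod a * wsum l w y"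
        by (rule weighted_add_bound(2)[OF w l c])
      also have "\<dots> \<le> K + cmod a * K'"
        using K xy by (intro add_mono mult_left_mono) auto
      finally show ?thesis .
    qed
    then show "\<exists>K. \<forall>f\<in>?S. wsum l w f \<le> K" by blast
  qed
qed blast

lemma weighted_bornology_subset:
  "A \<in> bornology (weighted_l1 B X w) \<Longrightarrow> A' \<subseteq> A \<Longrightarrow> A' \<in> bornology (weighted_l1 B X w)"
  unfolding weighted_bornology_iff by (meson subset_iff)

lemma directed_bornology_weighted: "directed_bornology (weighted_l1 B X w)"
  unfolding directed_bornology_def
proof (intro conjI ballI)
  fix A A' assume A: "A \<in> bornology (weighted_l1 B X w)" "A' \<in> bornology (weighted_l1 B X w)"
  show "A \<union> A' \<in> bornology (weighted_l1 B X w)"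
    unfolding weighted_bornology_iff
  proof (intro conjI ballI)
    fix l assume "l \<in> B"
    then obtain K K' where "\<forall>f\<in>A. wsum l w f \<le> K" "\<forall>f\<in>A'. wsum l w f \<le> K'"
      using A by (auto simp: weighted_bornology_iff) metis
    then show "\<exists>K. \<forall>f\<in>A \<union> A'. wsum l w f \<le> K"
      by (intro exI[of _ "max K K'"]) (auto simp: le_max_iff_disj)
  qed (use A in \<open>auto simp: weighted_bornology_iff\<close>)
qed (auto simp: weighted_bornology_iff)

text \<open>Monotonicity of the weights turns \<open>w' (h x) \<le> w x\<close> into an inequality
  for every seminorm, so a map that does not increase weight is bounded with constant 1.\<close>

lemma weighted_pushforward:
  assumes w: "\<And>x. x \<in> X \<Longrightarrow> h x \<in> Y \<and> 0 \<le> w' (h x) \<and> w' (h x) \<le> w x"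
  shows "bdd_linear (weighted_l1 B X w) (weighted_l1 B Y w') (pushforward h)"
proof -
  let ?V = "weighted_l1 B X w" and ?W = "weighted_l1 B Y w'"
  have w0: "0 \<le> w x" if "x \<in> X" for x using w[OF that] by linarith
  have l1: "l1 f" if "f \<in> carrier ?V" for f using l1_weighted[OF w0 that] .
  have supp: "x \<in> X" if "f \<in> carrier ?V" "f x \<noteq> 0" for f x
    using that by (auto simp: weighted_carrier_iff)
  have main: "(\<lambda>q. cmod (pushforward h f q) * l (w' q)) summable_on UNIV"
      "wsum l w' (pushforward h f) \<le> wsum l w f" if f: "f \<in> carrier ?V" and l: "l \<in> B" for f l
  proof -
    have "0 \<le> l (w' (h p)) \<and> l (w' (h p)) \<le> l (w p)" if "f p \<noteq> 0" for p
      using w[OF supp[OF f that]] B_pos[OF l] B_mono[OF l] by (auto intro: less_imp_le)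
    from pushforward_weighted[of f "\<lambda>p. l (w p)" "\<lambda>q. l (w' q)" h, OF l1[OF f] _ this]
    show "(\<lambda>q. cmod (pushforward h f q) * l (w' q)) summable_on UNIV"
      "wsum l w' (pushforward h f) \<le> wsum l w f"
      using f l by (auto simp: weighted_carrier_iff wsum_def)
  qed
  have mem: "pushforward h f \<in> carrier ?W" if f: "f \<in> carrier ?V" for f
    unfolding weighted_carrier_iff
  proof (intro conjI allI impI ballI)
    fix q assume "q \<notin> Y"
    then show "pushforward h f q = 0"
      using supp[OF f] w by (intro pushforward_support) blast
  qed (rule main(1)[OF f])
  have fs: "add ?V = (+)" "add ?W = (+)" "smult ?V = scl" "smult ?W = scl"
    by (auto simp: weighted_l1_def Let_def module.defs fun_space_def fun_eq_iff)
  show ?thesis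
    unfolding bdd_linear_def fs
  proof (intro conjI ballI allI)
    show "pushforward h ` A \<in> bornology ?W" if A: "A \<in> bornology ?V" for A
      unfolding weighted_bornology_iff
    proof (intro conjI ballI)
      show "pushforward h ` A \<subseteq> carrier ?W" using A mem by (auto simp: weighted_bornology_iff)
      fix l assume l: "l \<in> B"
      then obtain K where "\<forall>f\<in>A. wsum l w f \<le> K" using A by (auto simp: weighted_bornology_iff)
      then have "\<forall>f\<in>pushforward h ` A. wsum l w' f \<le> K"
        using main(2)[OF _ l] A by (force simp: weighted_bornology_iff)
      then show "\<exists>K. \<forall>f\<in>pushforward h ` A. wsum l w' f \<le> K" by blast
    qed
  qed (use l1 mem in \<open>auto simp: pushforward_add pushforward_scl\<close>)
qed

section \<open>Weights of tuples under faces and translations\<close>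

primrec path_length :: "'g \<Rightarrow> 'g list \<Rightarrow> real" where
  "path_length x [] = 0"
| "path_length x (y # ys) = L (inv x \<otimes> y) + path_length y ys"

text \<open>Recasts the indexed sum in \<open>tuple_weight\<close> as a recursion on the list, so
  that faces and translations can be treated by induction.\<close>

lemma path_length_eq_sum:
  "path_length x xs = (\<Sum>i = 1..<length (x # xs). L (inv ((x # xs) ! (i - 1)) \<otimes> ((x # xs) ! i)))"
proof (induction xs arbitrary: x)
  case (Cons y ys)
  let ?f = "\<lambda>zs i. L (inv (zs ! (i - 1)) \<otimes> (zs ! i))"
  have "(\<Sum>i = 1..<length (x # y # ys). ?f (x # y # ys) i) =
      ?f (x # y # ys) 1 + (\<Sum>i = Suc 1..<Suc (length (y # ys)). ?f (x # y # ys) i)"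
    by (simp add: sum.atLeast_Suc_lessThan)
  also have "(\<Sum>i = Suc 1..<Suc (length (y # ys)). ?f (x # y # ys) i) =
      (\<Sum>i = 1..<length (y # ys). ?f (x # y # ys) (Suc i))"
    by (rule sum.shift_bounds_Suc_ivl)
  also have "\<dots> = (\<Sum>i = 1..<length (y # ys). ?f (y # ys) i)"
    by (rule sum.cong) (auto simp: nth_Cons' )
  finally show ?case using Cons by simp
qed simp

lemma tuple_weight_Cons: "tuple_weight G L (x # xs) = L x + path_length x xs"
  by (simp add: tuple_weight_def path_length_eq_sum)

lemma path_length_nonneg: "x \<in> carrier G \<Longrightarrow> set xs \<subseteq> carrier G \<Longrightarrow> 0 \<le> path_length x xs"
  by (induction xs arbitrary: x) (auto intro!: add_nonneg_nonneg L_nonneg)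

lemma L_inv_mult_triangle:
  assumes "x \<in> carrier G" "y \<in> carrier G" "z \<in> carrier G"
  shows "L (inv x \<otimes> z) \<le> L (inv x \<otimes> y) + L (inv y \<otimes> z)"
proof -
  have "inv x \<otimes> z = (inv x \<otimes> y) \<otimes> (inv y \<otimes> z)"
    using assms by (simp add: m_assoc inv_solve_left r_inv)
      (metis assms inv_closed l_one m_assoc r_inv)
  then show ?thesis using L_mult[of "inv x \<otimes> y" "inv y \<otimes> z"] assms by simp
qed

text \<open>The initial vertex \<open>x\<close> is kept. Deleting an inner vertex is the triangle
  inequality \<open>L_inv_mult_triangle\<close>; deleting the last one drops a nonnegative
  term.\<close>

lemma path_length_face:
  "x \<in> carrier G \<Longrightarrow> set xs \<subseteq> carrier G \<Longrightarrow> path_length x (face i xs) \<le> path_length x xs"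
proof (induction xs arbitrary: x i)
  case (Cons y ys)
  show ?case
  proof (cases i)
    case 0
    show ?thesis
    proof (cases ys)
      case Nil then show ?thesis using Cons.prems 0 L_nonneg by (simp add: face_def)
    next
      case (Cons z zs)
      then show ?thesis
        using L_inv_mult_triangle[of x y z] \<open>x \<in> carrier G\<close> \<open>set (y # ys) \<subseteq> carrier G\<close> 0
        by (simp add: face_def)
    qed
  next
    case (Suc j)
    then show ?thesis using Cons by (simp add: face_def)
  qed
qed (simp add: face_def)

lemma tuple_weight_nonneg: "s \<in> tuples G n \<Longrightarrow> 0 \<le> tuple_weight G L s"
  by (cases s) (auto simp: tuples_def tuple_weight_Cons intro!: add_nonneg_nonneg L_nonneg path_length_nonneg)

lemma face_tuples: "s \<in> tuples G (Suc n) \<Longrightarrow> i \<le> Suc n \<Longrightarrow> face i s \<in> tuples G n"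
  by (auto simp: tuples_def face_def dest: in_set_takeD in_set_dropD)

lemma tuple_weight_face:
  assumes "s \<in> tuples G (Suc n)"
  shows "tuple_weight G L (face i s) \<le> tuple_weight G L s"
proof -
  obtain x y ys where s: "s = x # y # ys" and c: "x \<in> carrier G" "y \<in> carrier G" "set ys \<subseteq> carrier G"
    using assms by (cases s; cases "tl s") (auto simp: tuples_def)
  show ?thesis
  proof (cases i)
    \<comment> \<open>Deleting the first vertex replaces \<open>L x + L (inv x \<otimes> y)\<close>
      by \<open>L y\<close>, which is the triangle inequality for \<open>y\<close> written as
      \<open>x \<otimes> (inv x \<otimes> y)\<close>.\<close>
    case 0
    have "x \<otimes> (inv x \<otimes> y) = y" using c by (simp add: m_assoc[symmetric])
    then show ?thesis
      using L_mult[of x "inv x \<otimes> y"] c by (simp add: 0 s face_def tuple_weight_Cons)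
  next
    case (Suc j)
    have "face i s = x # face j (y # ys)" by (simp add: Suc s face_def)
    then show ?thesis using path_length_face[of x "y # ys" j] c by (simp add: s tuple_weight_Cons)
  qed
qed

lemma path_length_translate:
  assumes "g \<in> carrier G"
  shows "x \<in> carrier G \<Longrightarrow> set xs \<subseteq> carrier G \<Longrightarrow>
    path_length (g \<otimes> x) (map (\<lambda>y. g \<otimes> y) xs) = path_length x xs"
proof (induction xs arbitrary: x)
  case (Cons y ys)
  have "inv (g \<otimes> x) \<otimes> (g \<otimes> y) = inv x \<otimes> y"
    using Cons.prems assms by (simp add: inv_mult_group m_assoc) (metis inv_closed l_inv l_one m_assoc)
  with Cons show ?case by simp
qed simp

lemma translate_tuples:
  "g \<in> carrier G \<Longrightarrow> s \<in> tuples G n \<Longrightarrow> map (\<lambda>y. g \<otimes> y) s \<in> tuples G n"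
  by (auto simp: tuples_def)

text \<open>Left translation leaves all differences \<open>inv x \<otimes> y\<close> unchanged, so
  only the length of the first vertex grows, by at most \<open>L g\<close>.\<close>

lemma tuple_weight_translate:
  assumes "g \<in> carrier G" "s \<in> tuples G n"
  shows "tuple_weight G L (map (\<lambda>y. g \<otimes> y) s) \<le> L g + tuple_weight G L s"
proof (cases s)
  case (Cons x xs)
  then have "x \<in> carrier G" "set xs \<subseteq> carrier G" using assms by (auto simp: tuples_def)
  then show ?thesis
    using path_length_translate[OF assms(1), of x xs] L_mult[OF assms(1), of x]
    by (simp add: Cons tuple_weight_Cons)
qed (use assms in \<open>auto simp: tuples_def\<close>)

subsection \<open>The completed bar complex\<close>

lemma function_space_BC: "function_space (BC B G L n)"
  unfolding BC_def by (rule function_space_weighted[OF tuple_weight_nonneg])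

lemma directed_bornology_BC: "directed_bornology (BC B G L n)"
  unfolding BC_def by (rule directed_bornology_weighted)

lemma BC_bornology_subset: "A \<in> bornology (BC B G L n) \<Longrightarrow> A' \<subseteq> A \<Longrightarrow> A' \<in> bornology (BC B G L n)"
  unfolding BC_def by (rule weighted_bornology_subset)

lemma BC_bornology_add:
  assumes "A \<in> bornology (BC B G L n)" "A' \<in> bornology (BC B G L n)"
  shows "\<exists>A''\<in>bornology (BC B G L n). \<forall>x\<in>A. \<forall>y\<in>A'. x + scl a y \<in> A''"
  unfolding BC_def
  by (rule weighted_bornology_add) (use assms tuple_weight_nonneg in \<open>auto simp: BC_def\<close>)

lemma l1_BC: "c \<in> carrier (BC B G L n) \<Longrightarrow> l1 c"
  unfolding BC_def by (rule l1_weighted[OF tuple_weight_nonneg])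

lemma finsupp_BC: "finsupp_funs (tuples G n) \<subseteq> carrier (BC B G L n)"
  unfolding BC_def by (rule finsupp_weighted)

lemma carrier_C_alg [simp]: "carrier (C_alg G n) = finsupp_funs (tuples G n)"
  by (simp add: C_alg_def)

lemma function_space_C_alg: "function_space (C_alg G n)"
  by (simp add: C_alg_def fun_subspace_finsupp)

lemma H_alg_simps:
  "carrier (H_alg B G L) = carrier (weighted_l1 B (carrier G) L)"
  "bornology (H_alg B G L) = bornology (weighted_l1 B (carrier G) L)"
  "add (H_alg B G L) = (+)" "smult (H_alg B G L) = scl" "\<zero>\<^bsub>H_alg B G L\<^esub> = 0"
  "\<one>\<^bsub>H_alg B G L\<^esub> = dirac \<one>" "f \<otimes>\<^bsub>H_alg B G L\<^esub> h = convolution G f h"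
  by (auto simp: H_alg_def weighted_l1_def Let_def module.defs born_space.defs fun_space_def fun_eq_iff)

lemma group_algebra_H_alg: "group_algebra G \<subseteq> carrier (H_alg B G L)"
  unfolding H_alg_simps by (rule finsupp_weighted)

lemma l1_H_alg: "f \<in> carrier (H_alg B G L) \<Longrightarrow> l1 f"
  unfolding H_alg_simps by (rule l1_weighted[OF L_nonneg])

lemma bdd_linear_pushforward_face:
  assumes "i \<le> Suc n"
  shows "bdd_linear (BC B G L (Suc n)) (BC B G L n) (pushforward (face i))"
  unfolding BC_def
  by (rule weighted_pushforward)
    (use assms face_tuples tuple_weight_face tuple_weight_nonneg in blast)

lemma bdd_linear_zero:
  assumes "function_space V" "function_space W" "directed_bornology W"
    "\<And>A A'. A \<in> bornology W \<Longrightarrow> A' \<subseteq> A \<Longrightarrow> A' \<in> bornology W"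
  shows "bdd_linear V W (\<lambda>x. 0)"
proof -
  have z: "0 \<in> carrier W" using fun_subspaceD(1)[OF function_spaceD(1)[OF assms(2)]] .
  then have "{0} \<in> bornology W" using assms(3) by (simp add: directed_bornology_def)
  then have "(\<lambda>x. 0) ` A \<in> bornology W" if "A \<in> bornology V" for A
    by (rule assms(4)) auto
  with z show ?thesis
    by (simp add: bdd_linear_def function_spaceD[OF assms(1)] function_spaceD[OF assms(2)])
qed

lemma bdd_linear_bar_bd: "bdd_linear (BC B G L (Suc n)) (BC B G L n) (bar_bd (Suc n))"
proof -
  \<comment> \<open>Partial alternating sums permit an induction that adds one face at a time; the
    differential out of degree \<open>Suc n\<close> has \<open>Suc (Suc n)\<close> faces.\<close>
  define F where "F k c = (\<Sum>i<k. scl ((-1) ^ i) (pushforward (face i) c))"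
    for k :: nat and c :: "'g list \<Rightarrow> complex"
  have "bdd_linear (BC B G L (Suc n)) (BC B G L n) (F k)" if "k \<le> Suc (Suc n)" for k
    using that
  proof (induction k)
    case 0
    have "F 0 = (\<lambda>c. 0)" unfolding F_def by (simp only: lessThan_0 sum.empty)
    moreover have "bdd_linear (BC B G L (Suc n)) (BC B G L n) (\<lambda>c. 0)"
      by (rule bdd_linear_zero[OF function_space_BC function_space_BC directed_bornology_BC])
        (rule BC_bornology_subset)
    ultimately show ?case by (simp only:)
  next
    case (Suc k)
    have "bdd_linear (BC B G L (Suc n)) (BC B G L n)
      (\<lambda>c. F k c + scl ((-1) ^ k) (pushforward (face k) c))"
    proof (rule bdd_linear_add_scl[OF function_space_BC function_space_BC BC_bornology_add])
      show "bdd_linear (BC B G L (Suc n)) (BC B G L n) (F k)" using Suc by simp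
      show "bdd_linear (BC B G L (Suc n)) (BC B G L n) (pushforward (face k))"
        using Suc by (intro bdd_linear_pushforward_face) simp
    qed (use BC_bornology_subset in blast)+
    moreover have "F (Suc k) = (\<lambda>c. F k c + scl ((-1) ^ k) (pushforward (face k) c))"
      unfolding F_def by (rule ext) (simp only: sum.lessThan_Suc)
    ultimately show ?case by (simp only:)
  qed
  moreover have "F (Suc (Suc n)) = bar_bd (Suc n)"
    by (rule ext) (simp only: F_def bar_bd_alt lessThan_Suc_atMost)
  ultimately show ?thesis by (metis order_refl)
qed

text \<open>The sum in \<open>chain_act\<close> runs over the fibre above \<open>s\<close> of the
  action map on pairs (group element, tuple). Within the support this fibre is parametrised by
  \<open>x\<close>, the tuple being \<open>s\<close> translated by \<open>inv x\<close>.\<close>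

lemma chain_act_eq_pushforward:
  assumes f: "\<And>x. x \<notin> carrier G \<Longrightarrow> f x = 0" and c: "\<And>s. s \<notin> tuples G n \<Longrightarrow> c s = 0"
  shows "chain_act G f c = pushforward (\<lambda>(x, s). map (\<lambda>y. x \<otimes> y) s) (ext_prod f c)"
proof
  fix s
  let ?m = "\<lambda>(x, s). map (\<lambda>y. x \<otimes> y) s"
  show "chain_act G f c s = pushforward ?m (ext_prod f c) s"
  proof (cases "set s \<subseteq> carrier G")
    case False
    have "pushforward ?m (ext_prod f c) s = 0"
    proof (rule pushforward_support)
      fix p assume p: "ext_prod f c p \<noteq> 0"
      obtain x t where xt: "p = (x, t)" by (cases p)
      then have "x \<in> carrier G" "t \<in> tuples G n" using p f c by (auto simp: ext_prod_def)
      then show "?m p \<noteq> s" using False by (auto simp: xt tuples_def subset_iff)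
    qed
    then show ?thesis using False by (simp add: chain_act_def)
  next
    case True
    let ?j = "\<lambda>x. (x, map (\<lambda>y. inv x \<otimes> y) s)"
    have j: "?m (?j x) = s" if "x \<in> carrier G" for x
    proof -
      have "map (\<lambda>y. x \<otimes> (inv x \<otimes> y)) s = map (\<lambda>y. y) s"
        by (rule map_cong) (use that True in \<open>auto simp: m_assoc[symmetric]\<close>)
      then show ?thesis by (simp add: comp_def)
    qed
    have bij: "bij_betw ?j (carrier G) (?j ` carrier G)"
      by (auto simp: bij_betw_def inj_on_def)
    have "pushforward ?m (ext_prod f c) s = infsum (ext_prod f c) (?j ` carrier G)"
      unfolding pushforward_def
    proof (rule infsum_cong_neutral)
      show "ext_prod f c p = 0" if "p \<in> ?j ` carrier G - ?m -` {s}" for p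
        using that j by auto
      fix p assume p: "p \<in> ?m -` {s} - ?j ` carrier G"
      obtain x t where xt: "p = (x, t)" by (cases p)
      show "ext_prod f c p = 0"
      proof (rule ccontr)
        assume "ext_prod f c p \<noteq> 0"
        then have "x \<in> carrier G" "t \<in> tuples G n" using f c by (auto simp: ext_prod_def xt)
        moreover have "s = map (\<lambda>y. x \<otimes> y) t" using p by (simp add: xt)
        moreover have "map (\<lambda>y. inv x \<otimes> (x \<otimes> y)) t = map (\<lambda>y. y) t"
          by (rule map_cong) (use calculation in \<open>auto simp: m_assoc[symmetric] tuples_def subset_iff\<close>)
        ultimately have "p = ?j x" by (simp add: xt comp_def)
        then show False using p \<open>x \<in> carrier G\<close> by blast
      qed
    qed simp
    also have "\<dots> = (\<Sum>\<^sub>\<infinity>x\<in>carrier G. ext_prod f c (?j x))"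
      by (rule infsum_reindex_bij_betw[OF bij, symmetric])
    finally show ?thesis using True by (simp add: chain_act_def ext_prod_def)
  qed
qed

lemma H_alg_zero: "f \<in> carrier (H_alg B G L) \<Longrightarrow> x \<notin> carrier G \<Longrightarrow> f x = 0"
  by (auto simp: H_alg_simps weighted_carrier_iff)

lemma BC_zero: "c \<in> carrier (BC B G L n) \<Longrightarrow> s \<notin> tuples G n \<Longrightarrow> c s = 0"
  by (auto simp: BC_def weighted_carrier_iff)

lemma H_alg_chain_act_eq:
  assumes "f \<in> carrier (H_alg B G L)" "c \<in> carrier (BC B G L n)"
  shows "chain_act G f c = pushforward (\<lambda>(x, s). map (\<lambda>y. x \<otimes> y) s) (ext_prod f c)"
  by (rule chain_act_eq_pushforward) (use assms H_alg_zero BC_zero in auto)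

lemma chain_act_BC:
  assumes f: "f \<in> carrier (H_alg B G L)" and c: "c \<in> carrier (BC B G L n)"
  shows "chain_act G f c \<in> carrier (BC B G L n)"
proof -
  let ?m = "\<lambda>(x, s). map (\<lambda>y. x \<otimes> y) s" and ?w = "tuple_weight G L"
  have supp: "x \<in> carrier G \<and> s \<in> tuples G n" if "ext_prod f c (x, s) \<noteq> 0" for x s
    using that H_alg_zero[OF f] BC_zero[OF c] by (auto simp: ext_prod_def)
  have "(\<lambda>q. cmod (pushforward ?m (ext_prod f c) q) * l (?w q)) summable_on UNIV" if l: "l \<in> B" for l
  proof -
    obtain h where h: "h \<in> B" "\<forall>x\<ge>0. l (2 * x) \<le> h x" using B_double[OF l] by blast
    \<comment> \<open>By \<open>B_double\<close> a sum of two weights, one for each factor,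
      dominates the weight of the translated tuple. Against \<open>ext_prod f c\<close> it splits
      into two products of summable families.\<close>
    let ?u = "\<lambda>(x, s). h (L x) + h (?w s)"
    have fn: "0 \<le> cmod (f x) * h (L x)" for x
      using H_alg_zero[OF f, of x] less_imp_le[OF B_pos[OF h(1) L_nonneg[of x]]]
      by (cases "x \<in> carrier G") auto
    have cn: "0 \<le> cmod (c s) * h (?w s)" for s
      using BC_zero[OF c, of s] less_imp_le[OF B_pos[OF h(1) tuple_weight_nonneg[of s n]]]
      by (cases "s \<in> tuples G n") auto
    have fs: "(\<lambda>x. cmod (f x) * h (L x)) summable_on UNIV" "(\<lambda>x. cmod (f x)) summable_on UNIV"
      using f h(1) l1_H_alg[OF f] by (auto simp: H_alg_simps weighted_carrier_iff l1_def)
    have cs: "(\<lambda>s. cmod (c s) * h (?w s)) summable_on UNIV" "(\<lambda>s. cmod (c s)) summable_on UNIV"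
      using c h(1) l1_BC[OF c] by (auto simp: BC_def weighted_carrier_iff l1_def)
    have "(\<lambda>p. (case p of (x, s) \<Rightarrow> (cmod (f x) * h (L x)) * cmod (c s)) +
        (case p of (x, s) \<Rightarrow> cmod (f x) * (cmod (c s) * h (?w s)))) summable_on UNIV"
      by (intro summable_on_add summable_on_product_nonneg fs cs fn cn norm_ge_zero)
    then have "(\<lambda>p. cmod (ext_prod f c p) * ?u p) summable_on UNIV"
      by (simp add: ext_prod_def case_prod_unfold norm_mult algebra_simps)
    moreover have "0 \<le> l (?w (?m p)) \<and> l (?w (?m p)) \<le> ?u p" if "ext_prod f c p \<noteq> 0" for p
    proof -
      obtain x s where p: "p = (x, s)" by (cases p)
      then have xs: "x \<in> carrier G" "s \<in> tuples G n" using supp that by auto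
      have "?w (?m p) \<le> L x + ?w s" using tuple_weight_translate[OF xs] by (simp add: p)
      also have "\<dots> \<le> 2 * max (L x) (?w s)" by simp
      finally have "l (?w (?m p)) \<le> l (2 * max (L x) (?w s))"
        using tuple_weight_nonneg[OF translate_tuples[OF xs]] by (intro B_mono[OF l]) (auto simp: p)
      also have "\<dots> \<le> h (max (L x) (?w s))" using h(2) L_nonneg[OF xs(1)] by (simp add: le_max_iff_disj)
      also have "\<dots> \<le> h (L x) + h (?w s)"
        using B_pos[OF h(1) L_nonneg[OF xs(1)]] B_pos[OF h(1) tuple_weight_nonneg[OF xs(2)]]
        by (simp add: max_def)
      finally show ?thesis
        using B_pos[OF l tuple_weight_nonneg[OF translate_tuples[OF xs]]] by (simp add: p)
    qed
    ultimately show ?thesis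
      by (intro pushforward_weighted(1)[where u = ?u] l1_ext_prod l1_H_alg[OF f] l1_BC[OF c])
  qed
  moreover have "pushforward ?m (ext_prod f c) q = 0" if q: "q \<notin> tuples G n" for q
  proof (rule pushforward_support)
    fix p assume "ext_prod f c p \<noteq> 0"
    then show "?m p \<noteq> q" using supp[of "fst p" "snd p"] translate_tuples[of "fst p" "snd p" n] q
      by (auto simp: case_prod_unfold)
  qed
  ultimately show ?thesis
    unfolding H_alg_chain_act_eq[OF f c] by (simp add: BC_def weighted_carrier_iff)
qed

lemma face_translate: "face i (map h s) = map h (face i s)"
  by (simp add: face_def take_map drop_map)

text \<open>Faces commute with translation of tuples, so face by face both sides are push-forwards
  of \<open>ext_prod f c\<close> along equal composites.\<close>

lemma bar_bd_chain_act:
  assumes f: "f \<in> carrier (H_alg B G L)" and c: "c \<in> carrier (BC B G L (Suc n))"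
  shows "bar_bd (Suc n) (chain_act G f c) = chain_act G f (bar_bd (Suc n) c)"
proof -
  let ?m = "\<lambda>(x, s). map (\<lambda>y. x \<otimes> y) s"
  have l1f: "l1 f" and l1c: "l1 c" using l1_H_alg[OF f] l1_BC[OF c] .
  have bd: "bar_bd (Suc n) c \<in> carrier (BC B G L n)"
    using bdd_linear_bar_bd c unfolding bdd_linear_def by blast
  have E: "ext_prod f (sum h S) = (\<Sum>i\<in>S. ext_prod f (h i))" for h :: "nat \<Rightarrow> 'g list \<Rightarrow> complex" and S
    by (auto simp: fun_eq_iff ext_prod_def sum_distrib_left)
  have "chain_act G f (bar_bd (Suc n) c) = pushforward ?m (ext_prod f (bar_bd (Suc n) c))"
    by (rule H_alg_chain_act_eq[OF f bd])
  also have "\<dots> = (\<Sum>i\<le>Suc n. scl ((-1) ^ i) (pushforward ?m (ext_prod f (pushforward (face i) c))))"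
    unfolding bar_bd_alt E ext_prod_scl
    by (subst pushforward_sum)
      (auto simp: pushforward_scl intro!: fun_subspaceD(3)[OF fun_subspace_l1, simplified]
        l1_ext_prod l1f pushforward_l1(1) l1c)
  also have "\<dots> = (\<Sum>i\<le>Suc n. scl ((-1) ^ i) (pushforward (face i) (pushforward ?m (ext_prod f c))))"
  proof (rule sum.cong[OF refl])
    fix i
    have "?m \<circ> map_prod id (face i) = face i \<circ> ?m"
      by (auto simp: fun_eq_iff face_translate)
    then have "pushforward ?m (ext_prod f (pushforward (face i) c)) =
        pushforward (face i) (pushforward ?m (ext_prod f c))"
      by (simp add: pushforward_ext_prod[symmetric] pushforward_comp[OF l1_ext_prod[OF l1f l1c]])
    then show "scl ((-1) ^ i) (pushforward ?m (ext_prod f (pushforward (face i) c))) =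
        scl ((-1) ^ i) (pushforward (face i) (pushforward ?m (ext_prod f c)))" by simp
  qed
  also have "\<dots> = bar_bd (Suc n) (chain_act G f c)"
    by (simp add: bar_bd_alt H_alg_chain_act_eq[OF f c])
  finally show ?thesis ..
qed

text \<open>Inversion permutes the group and preserves word length, hence every seminorm. This is
  what makes \<open>chain_ract\<close> act on the completed chains.\<close>

lemma inverse_H_alg:
  assumes f: "f \<in> carrier (H_alg B G L)"
  shows "(\<lambda>g. if g \<in> carrier G then f (inv g) else 0) \<in> carrier (H_alg B G L)"
proof -
  have bij: "bij_betw (m_inv G) (carrier G) (carrier G)"
    by (rule bij_betwI[where g = "m_inv G"]) auto
  have "(\<lambda>g. cmod (if g \<in> carrier G then f (inv g) else 0) * l (L g)) summable_on UNIV" if l: "l \<in> B" for l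
  proof -
    have "(\<lambda>g. cmod (f g) * l (L g)) summable_on UNIV"
      using f l by (simp add: H_alg_simps weighted_carrier_iff)
    then have "(\<lambda>g. cmod (f g) * l (L g)) summable_on carrier G"
      by (rule summable_on_subset_banach) auto
    then have "(\<lambda>g. cmod (f (inv g)) * l (L (inv g))) summable_on carrier G"
      using summable_on_reindex_bij_betw[OF bij, of "\<lambda>g. cmod (f g) * l (L g)"] by simp
    then show ?thesis
      by (subst summable_on_cong_neutral[where T = "carrier G"
            and g = "\<lambda>g. cmod (f (inv g)) * l (L (inv g))"]) (auto simp: L_inv)
  qed
  then show ?thesis by (simp add: H_alg_simps weighted_carrier_iff)
qed

lemma chain_ract_BC:
  "f \<in> carrier (H_alg B G L) \<Longrightarrow> c \<in> carrier (BC B G L n) \<Longrightarrow> chain_ract G c f \<in> carrier (BC B G L n)"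
  unfolding chain_ract_def by (intro chain_act_BC inverse_H_alg)

lemma bar_bd_chain_ract:
  "f \<in> carrier (H_alg B G L) \<Longrightarrow> c \<in> carrier (BC B G L (Suc n)) \<Longrightarrow>
    bar_bd (Suc n) (chain_ract G c f) = chain_ract G (bar_bd (Suc n) c) f"
  unfolding chain_ract_def by (intro bar_bd_chain_act inverse_H_alg)

lemma chain_act_dirac:
  assumes "g \<in> carrier G" "s \<in> tuples G n"
  shows "chain_act G (dirac g) (dirac s) = dirac (map (\<lambda>y. g \<otimes> y) s)"
proof -
  have "ext_prod (dirac g) (dirac s) = dirac (g, s)"
    by (auto simp: ext_prod_def dirac_def fun_eq_iff)
  moreover have "chain_act G (dirac g) (dirac s) =
      pushforward (\<lambda>(x, s). map (\<lambda>y. x \<otimes> y) s) (ext_prod (dirac g) (dirac s))"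
    by (rule chain_act_eq_pushforward[where n = n]) (use assms in \<open>auto simp: dirac_def\<close>)
  ultimately show ?thesis by (simp add: pushforward_dirac)
qed

lemma finsupp_chain_act:
  assumes f: "f \<in> group_algebra G" and c: "c \<in> finsupp_funs (tuples G n)"
  shows "chain_act G f c \<in> finsupp_funs (tuples G n)"
proof -
  let ?m = "\<lambda>(x, s). map (\<lambda>y. x \<otimes> y) s"
  let ?S = "{x. f x \<noteq> 0} \<times> {s. c s \<noteq> 0}"
  have eq: "chain_act G f c = pushforward ?m (ext_prod f c)"
    by (rule chain_act_eq_pushforward[where n = n]) (use f c in \<open>auto simp: finsupp_funs_def\<close>)
  have "q \<in> ?m ` ?S" if q: "chain_act G f c q \<noteq> 0" for q
  proof (rule ccontr)
    assume n: "q \<notin> ?m ` ?S"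
    have "pushforward ?m (ext_prod f c) q = 0"
    proof (rule pushforward_support)
      fix p assume "ext_prod f c p \<noteq> 0"
      then have "p \<in> ?S" by (auto simp: ext_prod_def split: prod.splits)
      then show "?m p \<noteq> q" using n by blast
    qed
    with q eq show False by simp
  qed
  then have sub: "{q. chain_act G f c q \<noteq> 0} \<subseteq> ?m ` ?S" by blast
  moreover have "finite (?m ` ?S)" using f c by (auto simp: finsupp_funs_def)
  moreover have "?m ` ?S \<subseteq> tuples G n"
  proof
    fix q assume "q \<in> ?m ` ?S"
    then obtain x s where "q = map (\<lambda>y. x \<otimes> y) s" "f x \<noteq> 0" "c s \<noteq> 0" by auto
    moreover from this have "x \<in> carrier G" "s \<in> tuples G n" using f c by (auto simp: finsupp_funs_def)
    ultimately show "q \<in> tuples G n" using translate_tuples by blast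
  qed
  ultimately show ?thesis
    unfolding finsupp_funs_def using finite_subset[OF sub] by blast
qed

end

section \<open>Completed tensor products\<close>

lemma bounded_l1_carrier_iff:
  "c \<in> carrier (bounded_l1 V W) \<longleftrightarrow>
     (\<exists>S\<in>bornology V. \<exists>T\<in>bornology W. (\<forall>p. p \<notin> S \<times> T \<longrightarrow> c p = 0) \<and> l1 c)"
  by (simp add: bounded_l1_def module.defs fun_space_def l1_def)

lemma bounded_l1_bornology_iff:
  "A \<in> bornology (bounded_l1 V W) \<longleftrightarrow>
     (\<exists>S\<in>bornology V. \<exists>T\<in>bornology W. \<exists>K. \<forall>c\<in>A.
        (\<forall>p. p \<notin> S \<times> T \<longrightarrow> c p = 0) \<and> l1 c \<and> (\<Sum>\<^sub>\<infinity>p. cmod (c p)) \<le> K)"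
  by (simp add: bounded_l1_def module.defs born_space.defs fun_space_def l1_def)

lemma bounded_l1I:
  "S \<in> bornology V \<Longrightarrow> T \<in> bornology W \<Longrightarrow> (\<And>p. p \<notin> S \<times> T \<Longrightarrow> c p = 0) \<Longrightarrow> l1 c \<Longrightarrow>
    c \<in> carrier (bounded_l1 V W)"
  unfolding bounded_l1_carrier_iff by (rule bexI, rule bexI, rule conjI, rule allI, rule impI) simp_all

lemma bounded_l1E:
  assumes "c \<in> carrier (bounded_l1 V W)"
  obtains S T where "S \<in> bornology V" "T \<in> bornology W" "\<forall>p. p \<notin> S \<times> T \<longrightarrow> c p = 0" "l1 c"
  using assms[unfolded bounded_l1_carrier_iff] by (elim bexE conjE) (rule that)

lemma bounded_l1_bornologyI:
  "S \<in> bornology V \<Longrightarrow> T \<in> bornology W \<Longrightarrow> (\<And>c p. c \<in> A \<Longrightarrow> p \<notin> S \<times> T \<Longrightarrow> c p = 0) \<Longrightarrow>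
    (\<And>c. c \<in> A \<Longrightarrow> l1 c) \<Longrightarrow> (\<And>c. c \<in> A \<Longrightarrow> (\<Sum>\<^sub>\<infinity>p. cmod (c p)) \<le> K) \<Longrightarrow>
    A \<in> bornology (bounded_l1 V W)"
  unfolding bounded_l1_bornology_iff
  by (rule bexI, rule bexI, rule exI[of _ K], rule ballI, intro conjI allI impI) simp_all

lemma bounded_l1_bornologyE:
  assumes "A \<in> bornology (bounded_l1 V W)"
  obtains S T K where "S \<in> bornology V" "T \<in> bornology W"
    "\<forall>c\<in>A. (\<forall>p. p \<notin> S \<times> T \<longrightarrow> c p = 0) \<and> l1 c \<and> (\<Sum>\<^sub>\<infinity>p. cmod (c p)) \<le> K"
  using assms[unfolded bounded_l1_bornology_iff] by (elim bexE exE) (rule that)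

lemma bounded_l1_l1: "c \<in> carrier (bounded_l1 V W) \<Longrightarrow> l1 c"
  by (auto simp: bounded_l1_carrier_iff)

lemma directed_bornologyD:
  assumes "directed_bornology V"
  shows "{} \<in> bornology V" "A \<in> bornology V \<Longrightarrow> A \<subseteq> carrier V" "x \<in> carrier V \<Longrightarrow> {x} \<in> bornology V"
    "A \<in> bornology V \<Longrightarrow> A' \<in> bornology V \<Longrightarrow> A \<union> A' \<in> bornology V"
  using assms by (auto simp: directed_bornology_def)

lemma bounded_l1_bornology_subset: "A \<in> bornology (bounded_l1 V W) \<Longrightarrow> A \<subseteq> carrier (bounded_l1 V W)"
  unfolding bounded_l1_bornology_iff bounded_l1_carrier_iff subset_iff by blast

lemma function_space_bounded_l1:
  assumes V: "directed_bornology V" and W: "directed_bornology W"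
  shows "function_space (bounded_l1 V W)"
proof -
  let ?F = "carrier (bounded_l1 V W)"
  have "fun_subspace ?F"
    unfolding fun_subspace_def
  proof (intro conjI ballI allI)
    show "0 \<in> ?F"
      by (rule bounded_l1I[OF directed_bornologyD(1)[OF V] directed_bornologyD(1)[OF W]])
        (use fun_subspaceD(1)[OF fun_subspace_l1] in simp_all)
  next
    fix c c' assume c: "c \<in> ?F" and c': "c' \<in> ?F"
    from c obtain S T where S: "S \<in> bornology V" "T \<in> bornology W" "\<forall>p. p \<notin> S \<times> T \<longrightarrow> c p = 0" "l1 c"
      by (rule bounded_l1E)
    note S = S(1,2) S(3)[rule_format] S(4)
    from c' obtain S' T' where S': "S' \<in> bornology V" "T' \<in> bornology W"
      "\<forall>p. p \<notin> S' \<times> T' \<longrightarrow> c' p = 0" "l1 c'"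
      by (rule bounded_l1E)
    note S' = S'(1,2) S'(3)[rule_format] S'(4)
    show "c + c' \<in> ?F"
    proof (rule bounded_l1I[OF directed_bornologyD(4)[OF V S(1) S'(1)] directed_bornologyD(4)[OF W S(2) S'(2)]])
      show "(c + c') p = 0" if "p \<notin> (S \<union> S') \<times> (T \<union> T')" for p
      proof -
        have "p \<notin> S \<times> T" "p \<notin> S' \<times> T'" using that by auto
        then show ?thesis using S(3) S'(3) by simp
      qed
      show "l1 (c + c')" using fun_subspaceD(2)[OF fun_subspace_l1, of c c'] S(4) S'(4) by simp
    qed
  next
    fix a c assume "c \<in> ?F"
    then obtain S T where S: "S \<in> bornology V" "T \<in> bornology W" "\<forall>p. p \<notin> S \<times> T \<longrightarrow> c p = 0" "l1 c"
      by (rule bounded_l1E)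
    note S = S(1,2) S(3)[rule_format] S(4)
    show "scl a c \<in> ?F"
      by (rule bounded_l1I[OF S(1,2)]) (use S(3,4) fun_subspaceD(3)[OF fun_subspace_l1, of c a] in simp_all)
  qed
  then show ?thesis
    by (auto simp: function_space_def bounded_l1_def module.defs fun_space_def fun_eq_iff)
qed

lemma l1_norm_add_scl:
  assumes "l1 c" "l1 c'"
  shows "l1 (c + scl a c')"
    "(\<Sum>\<^sub>\<infinity>p. cmod ((c + scl a c') p)) \<le> (\<Sum>\<^sub>\<infinity>p. cmod (c p)) + cmod a * (\<Sum>\<^sub>\<infinity>p. cmod (c' p))"
proof -
  have S: "(\<lambda>p. cmod (c p)) summable_on UNIV" "(\<lambda>p. cmod (c' p)) summable_on UNIV"
    using assms by (auto simp: l1_def)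
  show l: "l1 (c + scl a c')"
    using fun_subspaceD(2)[OF fun_subspace_l1, of c "scl a c'"]
      fun_subspaceD(3)[OF fun_subspace_l1, of c' a] assms by simp
  have "(\<Sum>\<^sub>\<infinity>p. cmod ((c + scl a c') p)) \<le> (\<Sum>\<^sub>\<infinity>p. cmod (c p) + cmod a * cmod (c' p))"
  proof (rule infsum_mono)
    show "(\<lambda>p. cmod ((c + scl a c') p)) summable_on UNIV" using l by (simp add: l1_def)
    show "(\<lambda>p. cmod (c p) + cmod a * cmod (c' p)) summable_on UNIV"
      by (intro summable_on_add summable_on_cmult_right S)
    show "cmod ((c + scl a c') p) \<le> cmod (c p) + cmod a * cmod (c' p)" for p
      by (simp add: norm_mult[symmetric] norm_triangle_ineq)
  qed
  also have "\<dots> = (\<Sum>\<^sub>\<infinity>p. cmod (c p)) + cmod a * (\<Sum>\<^sub>\<infinity>p. cmod (c' p))"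
    by (subst infsum_add) (auto intro: S summable_on_cmult_right simp: infsum_cmult_right')
  finally show "(\<Sum>\<^sub>\<infinity>p. cmod ((c + scl a c') p)) \<le> (\<Sum>\<^sub>\<infinity>p. cmod (c p)) + cmod a * (\<Sum>\<^sub>\<infinity>p. cmod (c' p))" .
qed

lemma bounded_l1_bornology_add:
  assumes V: "directed_bornology V" and W: "directed_bornology W"
    and A: "A \<in> bornology (bounded_l1 V W)" "A' \<in> bornology (bounded_l1 V W)"
  shows "\<exists>A''\<in>bornology (bounded_l1 V W). \<forall>x\<in>A. \<forall>y\<in>A'. x + scl a y \<in> A''"
proof -
  from A(1) obtain S T K where S: "S \<in> bornology V" "T \<in> bornology W"
    "\<forall>c\<in>A. (\<forall>p. p \<notin> S \<times> T \<longrightarrow> c p = 0) \<and> l1 c \<and> (\<Sum>\<^sub>\<infinity>p. cmod (c p)) \<le> K"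
    by (rule bounded_l1_bornologyE)
  note S = S(1,2) S(3)[THEN bspec, THEN conjunct1, rule_format]
    S(3)[THEN bspec, THEN conjunct2, THEN conjunct1] S(3)[THEN bspec, THEN conjunct2, THEN conjunct2]
  from A(2) obtain S' T' K' where S': "S' \<in> bornology V" "T' \<in> bornology W"
    "\<forall>c\<in>A'. (\<forall>p. p \<notin> S' \<times> T' \<longrightarrow> c p = 0) \<and> l1 c \<and> (\<Sum>\<^sub>\<infinity>p. cmod (c p)) \<le> K'"
    by (rule bounded_l1_bornologyE)
  note S' = S'(1,2) S'(3)[THEN bspec, THEN conjunct1, rule_format]
    S'(3)[THEN bspec, THEN conjunct2, THEN conjunct1] S'(3)[THEN bspec, THEN conjunct2, THEN conjunct2]
  let ?A = "(\<lambda>(x, y). x + scl a y) ` (A \<times> A')"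
  have "?A \<in> bornology (bounded_l1 V W)"
  proof (rule bounded_l1_bornologyI[OF directed_bornologyD(4)[OF V S(1) S'(1)]
        directed_bornologyD(4)[OF W S(2) S'(2)]])
    fix c assume "c \<in> ?A"
    then obtain x y where c: "c = x + scl a y" and xy: "x \<in> A" "y \<in> A'" by auto
    show "c p = 0" if "p \<notin> (S \<union> S') \<times> (T \<union> T')" for p
    proof -
      have "p \<notin> S \<times> T" "p \<notin> S' \<times> T'" using that by auto
      then show ?thesis using S(3)[OF xy(1)] S'(3)[OF xy(2)] by (simp add: c)
    qed
    note l = S(4)[OF xy(1)] S'(4)[OF xy(2)]
    show "l1 c" unfolding c by (rule l1_norm_add_scl(1)[OF l])
    have "(\<Sum>\<^sub>\<infinity>p. cmod (c p)) \<le> (\<Sum>\<^sub>\<infinity>p. cmod (x p)) + cmod a * (\<Sum>\<^sub>\<infinity>p. cmod (y p))"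
      unfolding c by (rule l1_norm_add_scl(2)[OF l])
    also have "\<dots> \<le> K + cmod a * K'"
      using S(5)[OF xy(1)] S'(5)[OF xy(2)] by (intro add_mono mult_left_mono) auto
    finally show "(\<Sum>\<^sub>\<infinity>p. cmod (c p)) \<le> K + cmod a * K'" .
  qed
  then show ?thesis by (rule rev_bexI) auto
qed

lemma dirac_bounded_l1:
  assumes "directed_bornology V" "directed_bornology W" "x \<in> carrier V" "y \<in> carrier W"
  shows "dirac (x, y) \<in> carrier (bounded_l1 V W)"
  unfolding bounded_l1_carrier_iff
proof (intro bexI conjI)
  show "{x} \<in> bornology V" "{y} \<in> bornology W"
    using directed_bornologyD(3)[OF assms(1,3)] directed_bornologyD(3)[OF assms(2,4)] .
  show "l1 (dirac (x, y))" by (rule l1_finsupp[of _ UNIV]) simp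
qed (auto simp: dirac_def)

lemma finsupp_bounded_l1:
  assumes "directed_bornology V" "directed_bornology W" "X \<subseteq> carrier V" "Y \<subseteq> carrier W"
  shows "finsupp_funs (X \<times> Y) \<subseteq> carrier (bounded_l1 V W)"
proof
  fix c assume "c \<in> finsupp_funs (X \<times> Y)"
  then show "c \<in> carrier (bounded_l1 V W)"
    by (rule finsupp_induct[where P = "\<lambda>c. c \<in> carrier (bounded_l1 V W)"])
      (use fun_subspaceD(1-3)[OF function_spaceD(1)[OF function_space_bounded_l1[OF assms(1,2)]]]
        dirac_bounded_l1[OF assms(1,2)] assms(3,4) in \<open>auto simp: subset_iff\<close>)
qed

text \<open>The image family is supported on the image of \<open>S\<close> times \<open>T\<close>,
  and its total mass does not grow; boundedness in \<open>bounded_l1\<close> refers to these two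
  data.\<close>

lemma pushforward_bounded_l1:
  assumes h: "\<And>x. x \<in> carrier V \<Longrightarrow> h x \<in> carrier V'" "\<And>A. A \<in> bornology V \<Longrightarrow> h ` A \<in> bornology V'"
    and V: "directed_bornology V" and V': "directed_bornology V'" and W: "directed_bornology W"
  shows "bdd_linear (bounded_l1 V W) (bounded_l1 V' W) (pushforward (map_prod h id))"
    (is "bdd_linear _ _ ?h")
proof -
  note D = function_spaceD[OF function_space_bounded_l1[OF V W]]
    function_spaceD[OF function_space_bounded_l1[OF V' W]]
  have supp: "?h c p = 0" if "\<forall>p. p \<notin> S \<times> T \<longrightarrow> c p = 0" "p \<notin> h ` S \<times> T" for c p S T
    by (rule pushforward_support) (use that in auto)
  show ?thesis
    unfolding bdd_linear_def D
  proof (intro conjI ballI allI)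
    show "?h c \<in> carrier (bounded_l1 V' W)" if c: "c \<in> carrier (bounded_l1 V W)" for c
    proof -
      from c obtain S T where S: "S \<in> bornology V" "T \<in> bornology W" "\<forall>p. p \<notin> S \<times> T \<longrightarrow> c p = 0" "l1 c"
        by (rule bounded_l1E)
      note S = S(1,2) S(3)[rule_format] S(4)
      show ?thesis
      proof (rule bounded_l1I[OF h(2)[OF S(1)] S(2)])
        show "?h c p = 0" if p: "p \<notin> h ` S \<times> T" for p
          by (rule supp[rotated, OF p]) (use S(3) in blast)
        show "l1 (?h c)" by (rule pushforward_l1(1)[OF S(4)])
      qed
    qed
    show "?h ` A \<in> bornology (bounded_l1 V' W)" if A: "A \<in> bornology (bounded_l1 V W)" for A
    proof -
      from A obtain S T K where S: "S \<in> bornology V" "T \<in> bornology W"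
        "\<forall>c\<in>A. (\<forall>p. p \<notin> S \<times> T \<longrightarrow> c p = 0) \<and> l1 c \<and> (\<Sum>\<^sub>\<infinity>p. cmod (c p)) \<le> K"
        by (rule bounded_l1_bornologyE)
      note S = S(1,2) S(3)[THEN bspec, THEN conjunct1, rule_format]
        S(3)[THEN bspec, THEN conjunct2, THEN conjunct1] S(3)[THEN bspec, THEN conjunct2, THEN conjunct2]
      show ?thesis
      proof (rule bounded_l1_bornologyI[OF h(2)[OF S(1)] S(2)])
        fix c' assume "c' \<in> ?h ` A"
        then obtain c where c: "c \<in> A" "c' = ?h c" by blast
        show "c' p = 0" if p: "p \<notin> h ` S \<times> T" for p
          unfolding c(2) by (rule supp[rotated, OF p]) (use S(3)[OF c(1)] in blast)
        show "l1 c'" unfolding c(2) by (rule pushforward_l1(1)[OF S(4)[OF c(1)]])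
        show "(\<Sum>\<^sub>\<infinity>p. cmod (c' p)) \<le> K"
          unfolding c(2) using pushforward_l1(2)[OF S(4)[OF c(1)], of "map_prod h id"] S(5)[OF c(1)] by linarith
      qed
    qed
  qed (auto simp: pushforward_scl bounded_l1_l1 pushforward_add)
qed

lemma bilinear_rels_bounded_l1:
  assumes "directed_bornology V" "directed_bornology W" "vector_space_C V" "vector_space_C W"
  shows "bilinear_rels V W \<subseteq> carrier (bounded_l1 V W)"
proof -
  note D = fun_subspaceD[OF function_spaceD(1)[OF function_space_bounded_l1[OF assms(1,2)]]]
  note d = dirac_bounded_l1[OF assms(1,2)]
  note v = vector_space_simps[OF assms(3)] vector_space_simps[OF assms(4)]
  have diff: "(\<lambda>p. f p - g p) \<in> carrier (bounded_l1 V W)"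
    if "f \<in> carrier (bounded_l1 V W)" "g \<in> carrier (bounded_l1 V W)" for f g
    using D(5)[OF that] by (simp add: fun_diff_def)
  have sc: "(\<lambda>p. a * f p) \<in> carrier (bounded_l1 V W)" if "f \<in> carrier (bounded_l1 V W)" for f a
    using D(3)[OF that, of a] by (simp add: scl_def)
  show ?thesis
    unfolding bilinear_rels_def by (auto intro!: diff sc d v)
qed

lemma tensor_rels_properties:
  assumes V: "directed_bornology V" "vector_space_C V" and W: "directed_bornology W" "vector_space_C W"
    and R: "R \<subseteq> carrier (bounded_l1 V W)"
  shows "bilinear_rels V W \<subseteq> tensor_rels V W R" "R \<subseteq> tensor_rels V W R"
    "tensor_rels V W R \<subseteq> carrier (bounded_l1 V W)" "fun_subspace (tensor_rels V W R)"
    "mackey_closed (bounded_l1 V W) (tensor_rels V W R)"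
proof -
  have "bilinear_rels V W \<union> R \<subseteq> carrier (bounded_l1 V W)"
    using bilinear_rels_bounded_l1[OF V(1) W(1) V(2) W(2)] R by blast
  note P = closed_span_properties[OF function_space_bounded_l1[OF V(1) W(1)] this]
  show "bilinear_rels V W \<subseteq> tensor_rels V W R" "R \<subseteq> tensor_rels V W R"
    "tensor_rels V W R \<subseteq> carrier (bounded_l1 V W)" "fun_subspace (tensor_rels V W R)"
    "mackey_closed (bounded_l1 V W) (tensor_rels V W R)"
    using P by (auto simp: tensor_rels_def)
qed

lemma bilinear_relsD:
  assumes "bilinear_rels V W \<subseteq> R"
  shows "x \<in> carrier V \<Longrightarrow> x' \<in> carrier V \<Longrightarrow> y \<in> carrier W \<Longrightarrow>
      dirac (x \<oplus>\<^bsub>V\<^esub> x', y) - dirac (x, y) - dirac (x', y) \<in> R"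
    and "x \<in> carrier V \<Longrightarrow> y \<in> carrier W \<Longrightarrow> y' \<in> carrier W \<Longrightarrow>
      dirac (x, y \<oplus>\<^bsub>W\<^esub> y') - dirac (x, y) - dirac (x, y') \<in> R"
    and "x \<in> carrier V \<Longrightarrow> y \<in> carrier W \<Longrightarrow> dirac (z \<odot>\<^bsub>V\<^esub> x, y) - scl z (dirac (x, y)) \<in> R"
    and "x \<in> carrier V \<Longrightarrow> y \<in> carrier W \<Longrightarrow> dirac (x, z \<odot>\<^bsub>W\<^esub> y) - scl z (dirac (x, y)) \<in> R"
proof -
  have R: "r \<in> R" if "r \<in> bilinear_rels V W" for r using assms that by blast
  show "dirac (x \<oplus>\<^bsub>V\<^esub> x', y) - dirac (x, y) - dirac (x', y) \<in> R"
    if "x \<in> carrier V" "x' \<in> carrier V" "y \<in> carrier W"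
    by (rule R) (unfold fun_diff_def bilinear_rels_def, use that in blast)
  show "dirac (x, y \<oplus>\<^bsub>W\<^esub> y') - dirac (x, y) - dirac (x, y') \<in> R"
    if "x \<in> carrier V" "y \<in> carrier W" "y' \<in> carrier W"
    by (rule R) (unfold fun_diff_def bilinear_rels_def, use that in blast)
  show "dirac (z \<odot>\<^bsub>V\<^esub> x, y) - scl z (dirac (x, y)) \<in> R" if "x \<in> carrier V" "y \<in> carrier W"
    by (rule R) (unfold fun_diff_def scl_def bilinear_rels_def, use that in blast)
  show "dirac (x, z \<odot>\<^bsub>W\<^esub> y) - scl z (dirac (x, y)) \<in> R" if "x \<in> carrier V" "y \<in> carrier W"
    by (rule R) (unfold fun_diff_def scl_def bilinear_rels_def, use that in blast)
qed

lemma bilinear_rels_cases: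
  assumes "r \<in> bilinear_rels V W"
  obtains (add1) x x' y where "x \<in> carrier V" "x' \<in> carrier V" "y \<in> carrier W"
      "r = dirac (x \<oplus>\<^bsub>V\<^esub> x', y) - dirac (x, y) - dirac (x', y)"
  | (add2) x y y' where "x \<in> carrier V" "y \<in> carrier W" "y' \<in> carrier W"
      "r = dirac (x, y \<oplus>\<^bsub>W\<^esub> y') - dirac (x, y) - dirac (x, y')"
  | (scl1) z x y where "x \<in> carrier V" "y \<in> carrier W" "r = dirac (z \<odot>\<^bsub>V\<^esub> x, y) - scl z (dirac (x, y))"
  | (scl2) z x y where "x \<in> carrier V" "y \<in> carrier W" "r = dirac (x, z \<odot>\<^bsub>W\<^esub> y) - scl z (dirac (x, y))"
  using assms unfolding bilinear_rels_def fun_diff_def scl_def by blast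

lemma bilinear_rels_mono:
  assumes "carrier V' \<subseteq> carrier V" "add V' = add V" "smult V' = smult V"
  shows "bilinear_rels V' W \<subseteq> bilinear_rels V W"
  unfolding bilinear_rels_def assms(2,3) using assms(1) by blast

section \<open>Completed chains with coefficients and the density of finite chains\<close>

context bounded_group
begin

lemma born_moduleD:
  assumes "bornological_module (H_alg B G L) M"
  shows "vector_space_C M" "directed_bornology M"
    "f \<in> carrier (H_alg B G L) \<Longrightarrow> x \<in> carrier M \<Longrightarrow> act M f x \<in> carrier M"
    "f \<in> carrier (H_alg B G L) \<Longrightarrow> h \<in> carrier (H_alg B G L) \<Longrightarrow> x \<in> carrier M \<Longrightarrow>
      act M (f + h) x = act M f x \<oplus>\<^bsub>M\<^esub> act M h x"
    "f \<in> carrier (H_alg B G L) \<Longrightarrow> x \<in> carrier M \<Longrightarrow> act M (scl z f) x = z \<odot>\<^bsub>M\<^esub> act M f x"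
    "g \<in> carrier G \<Longrightarrow> g' \<in> carrier G \<Longrightarrow> x \<in> carrier M \<Longrightarrow>
      act M (dirac (g \<otimes> g')) x = act M (dirac g) (act M (dirac g') x)"
    "x \<in> carrier M \<Longrightarrow> act M (dirac \<one>) x = x"
proof -
  note * = assms[unfolded bornological_module_def]
  have c: "complete_bornological_space M"
    and a: "\<forall>f\<in>carrier (H_alg B G L). \<forall>x\<in>carrier M. act M f x \<in> carrier M"
    and add: "\<forall>f\<in>carrier (H_alg B G L). \<forall>h\<in>carrier (H_alg B G L). \<forall>x\<in>carrier M.
        act M (f \<oplus>\<^bsub>H_alg B G L\<^esub> h) x = act M f x \<oplus>\<^bsub>M\<^esub> act M h x"
    and sm: "\<forall>z. \<forall>f\<in>carrier (H_alg B G L). \<forall>x\<in>carrier M.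
        act M (z \<odot>\<^bsub>H_alg B G L\<^esub> f) x = z \<odot>\<^bsub>M\<^esub> act M f x \<and> act M f (z \<odot>\<^bsub>M\<^esub> x) = z \<odot>\<^bsub>M\<^esub> act M f x"
    and mu: "\<forall>f\<in>carrier (H_alg B G L). \<forall>h\<in>carrier (H_alg B G L). \<forall>x\<in>carrier M.
        act M (f \<otimes>\<^bsub>H_alg B G L\<^esub> h) x = act M f (act M h x)"
    and one: "\<forall>x\<in>carrier M. act M \<one>\<^bsub>H_alg B G L\<^esub> x = x"
    using conjunct1[OF *] conjunct1[OF conjunct2[OF *]] conjunct1[OF conjunct2[OF conjunct2[OF *]]]
      conjunct1[OF conjunct2[OF conjunct2[OF conjunct2[OF conjunct2[OF *]]]]]
      conjunct1[OF conjunct2[OF conjunct2[OF conjunct2[OF conjunct2[OF conjunct2[OF *]]]]]]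
      conjunct1[OF conjunct2[OF conjunct2[OF conjunct2[OF conjunct2[OF conjunct2[OF conjunct2[OF *]]]]]]]
    by - assumption+
  show "vector_space_C M" using c by (simp add: complete_bornological_space_def)
  show "directed_bornology M" by (rule complete_directed_bornology[OF c])
  show "act M f x \<in> carrier M" if "f \<in> carrier (H_alg B G L)" "x \<in> carrier M"
    using a that by simp
  show "act M (f + h) x = act M f x \<oplus>\<^bsub>M\<^esub> act M h x"
    if "f \<in> carrier (H_alg B G L)" "h \<in> carrier (H_alg B G L)" "x \<in> carrier M"
    using add that by (simp add: H_alg_simps(3))
  show "act M (scl z f) x = z \<odot>\<^bsub>M\<^esub> act M f x" if "f \<in> carrier (H_alg B G L)" "x \<in> carrier M"
    using sm that by (simp add: H_alg_simps(4))
  show "act M (dirac \<one>) x = x" if "x \<in> carrier M"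
    using one that by (simp add: H_alg_simps(6))
  show "act M (dirac (g \<otimes> g')) x = act M (dirac g) (act M (dirac g') x)"
    if gh: "g \<in> carrier G" "g' \<in> carrier G" and x: "x \<in> carrier M"
  proof -
    have d: "dirac k \<in> carrier (H_alg B G L)" if "k \<in> carrier G" for k
      using group_algebra_H_alg that by (simp add: subset_iff)
    have "convolution G (dirac g) (dirac g') = dirac (g \<otimes> g')"
    proof
      fix k
      have "(\<Sum>\<^sub>\<infinity>x\<in>carrier G. dirac g x * dirac g' (inv x \<otimes> k)) = (\<Sum>\<^sub>\<infinity>x\<in>{g}. dirac g' (inv x \<otimes> k))"
        by (rule infsum_cong_neutral) (use gh in \<open>auto simp: dirac_def\<close>)
      also have "\<dots> = dirac g' (inv g \<otimes> k)" by simp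
      finally have sum: "(\<Sum>\<^sub>\<infinity>x\<in>carrier G. dirac g x * dirac g' (inv x \<otimes> k)) = dirac g' (inv g \<otimes> k)" .
      show "convolution G (dirac g) (dirac g') k = dirac (g \<otimes> g') k"
      proof (cases "k \<in> carrier G")
        case True
        then have "inv g \<otimes> k = g' \<longleftrightarrow> k = g \<otimes> g'"
          using inv_solve_left[of g' g k] gh by auto
        then have "dirac g' (inv g \<otimes> k) = dirac (g \<otimes> g') k" by (simp add: dirac_def)
        with True sum show ?thesis by (simp add: convolution_def)
      qed (use gh in \<open>auto simp: convolution_def dirac_def\<close>)
    qed
    then show ?thesis
      using mu[rule_format, OF d[OF gh(1)] d[OF gh(2)] x] by (simp add: H_alg_simps(7))
  qed
qed

lemma BC_vector_space: "vector_space_C (BC B G L n)"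
  by (rule function_space_vector_space[OF function_space_BC])

lemma H_rels_sub:
  assumes M: "bornological_module (H_alg B G L) M"
  shows "H_rels B G L M n \<subseteq> carrier (bounded_l1 (BC B G L n) M)"
proof
  fix r assume "r \<in> H_rels B G L M n"
  then obtain f x y where r: "r = (\<lambda>p. dirac (chain_ract G x f, y) p - dirac (x, act M f y) p)"
    and f: "f \<in> carrier (H_alg B G L)" "x \<in> carrier (BC B G L n)" "y \<in> carrier M"
    unfolding balanced_rels_def by blast
  have "dirac (chain_ract G x f, y) - dirac (x, act M f y) \<in> carrier (bounded_l1 (BC B G L n) M)"
    by (intro fun_subspaceD(5)[OF function_spaceD(1)[OF function_space_bounded_l1]] dirac_bounded_l1
        directed_bornology_BC born_moduleD(2,3)[OF M] chain_ract_BC f)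
  then show "r \<in> carrier (bounded_l1 (BC B G L n) M)" by (simp add: r fun_diff_def)
qed

abbreviation chain_reps where
  "chain_reps n M \<equiv> bounded_l1 (BC B G L n) M"

abbreviation chain_rels where
  "chain_rels n M \<equiv> tensor_rels (BC B G L n) M (H_rels B G L M n)"

lemma function_space_chain_reps:
  "bornological_module (H_alg B G L) M \<Longrightarrow> function_space (chain_reps n M)"
  by (intro function_space_bounded_l1 directed_bornology_BC born_moduleD(2))

lemma chain_rels_properties:
  assumes "bornological_module (H_alg B G L) M"
  shows "bilinear_rels (BC B G L n) M \<subseteq> chain_rels n M" "H_rels B G L M n \<subseteq> chain_rels n M"
    "chain_rels n M \<subseteq> carrier (chain_reps n M)" "fun_subspace (chain_rels n M)"
    "mackey_closed (chain_reps n M) (chain_rels n M)"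
  using tensor_rels_properties[OF directed_bornology_BC BC_vector_space born_moduleD(2,1)[OF assms]
      H_rels_sub[OF assms]] by blast+

lemma B_chains_eq: "B_chains B G L M n = born_quotient (chain_reps n M) (chain_rels n M)"
  by (simp add: B_chains_def completed_tensor_def)

text \<open>Prepares \<open>y\<close> as a Mackey limit of finite chains: its tails times
  \<open>2 ^ k\<close> have to stay bounded for each weight. Against \<open>lam j\<close> the tail
  is at most \<open>(1/2) ^ k\<close> as soon as \<open>k\<close> reaches \<open>j\<close>, which is
  what the diagonal choice provides.\<close>

lemma truncation_bounded:
  assumes y: "y \<in> carrier (BC B G L n)"
  shows "\<exists>F. (\<forall>k. finite (F k) \<and> F k \<subseteq> tuples G n) \<and>
    range (\<lambda>k. scl (2 ^ k) (y - (\<lambda>s. if s \<in> F k then y s else 0))) \<in> bornology (BC B G L n)"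
proof -
  let ?w = "tuple_weight G L"
  from B_sequence obtain lam :: "nat \<Rightarrow> real \<Rightarrow> real"
    where lam: "\<forall>j. \<forall>x\<ge>0. 0 < lam j x" "\<forall>j. \<exists>h\<in>B. \<forall>x\<ge>0. lam j x \<le> h x"
      "\<forall>l\<in>B. \<exists>j. \<forall>x\<ge>0. l x \<le> lam j x"
    by (elim exE conjE)
  note lam = lam[rule_format]
  have w: "0 \<le> ?w s" if "y s \<noteq> 0" for s
    using BC_zero[OF y] that tuple_weight_nonneg by blast
  have S: "(\<lambda>s. cmod (y s) * lam j (?w s)) summable_on UNIV" for j
  proof -
    obtain h where h: "h \<in> B" "\<forall>x\<ge>0. lam j x \<le> h x" using lam(2) by blast
    have "(\<lambda>s. cmod (y s) * h (?w s)) summable_on UNIV"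
      using y h(1) by (simp add: BC_def weighted_carrier_iff)
    then show ?thesis
    proof (rule summable_on_comparison_test)
      show "cmod (y s) * lam j (?w s) \<le> cmod (y s) * h (?w s)" for s
        using w[of s] h(2) by (cases "y s = 0") (auto intro: mult_left_mono)
      show "0 \<le> cmod (y s) * lam j (?w s)" for s
        using w[of s] lam(1)[of "?w s" j] by (cases "y s = 0") auto
    qed
  qed
  have nn: "0 \<le> lam j (?w s)" if "y s \<noteq> 0" for j s
    using lam(1)[OF w[OF that], of j] by linarith
  have "\<exists>F. \<forall>k. finite (F k) \<and> (\<forall>s\<in>F k. y s \<noteq> 0) \<and>
      (\<forall>j\<le>k. (\<Sum>\<^sub>\<infinity>s\<in>- F k. cmod (y s) * lam j (?w s)) \<le> (1/2) ^ k)"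
    by (rule finite_truncations[OF S]) (rule nn)
  then obtain F where F: "\<forall>k. finite (F k) \<and> (\<forall>s\<in>F k. y s \<noteq> 0) \<and>
      (\<forall>j\<le>k. (\<Sum>\<^sub>\<infinity>s\<in>- F k. cmod (y s) * lam j (?w s)) \<le> (1/2) ^ k)"
    by (elim exE)
  then have F: "\<And>k. finite (F k)" "\<And>k s. s \<in> F k \<Longrightarrow> y s \<noteq> 0"
    "\<And>j k. j \<le> k \<Longrightarrow> (\<Sum>\<^sub>\<infinity>s\<in>- F k. cmod (y s) * lam j (?w s)) \<le> (1/2) ^ k"
    by simp_all
  have FT: "F k \<subseteq> tuples G n" for k using F(2) BC_zero[OF y] by blast
  define z where "z k = scl (2 ^ k) (y - (\<lambda>s. if s \<in> F k then y s else 0))" for k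
  have zB: "z k \<in> carrier (BC B G L n)" for k
  proof -
    have "(\<lambda>s. if s \<in> F k then y s else 0) \<in> finsupp_funs (tuples G n)"
      using F(1)[of k] FT[of k] by (auto simp: finsupp_funs_def intro: finite_subset[of _ "F k"] split: if_splits)
    then show ?thesis
      unfolding z_def using finsupp_BC y fun_subspaceD(3,5)[OF function_spaceD(1)[OF function_space_BC]] by blast
  qed
  have "\<exists>K. \<forall>f\<in>range z. wsum l ?w f \<le> K" if l: "l \<in> B" for l
  proof -
    obtain j where j: "\<forall>x\<ge>0. l x \<le> lam j x" using lam(3)[OF l] by blast
    define N where "N = (\<Sum>\<^sub>\<infinity>s. cmod (y s) * lam j (?w s))"
    have sub: "(\<lambda>s. cmod (y s) * lam j (?w s)) summable_on A" for A
      using S[of j] by (rule summable_on_subset_banach) simp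
    have Sl: "(\<lambda>s. cmod (y s) * l (?w s)) summable_on A" for A
    proof -
      have "(\<lambda>s. cmod (y s) * l (?w s)) summable_on UNIV"
        using y l by (simp add: BC_def weighted_carrier_iff)
      then show ?thesis by (rule summable_on_subset_banach) simp
    qed
    have tail_le_N: "(\<Sum>\<^sub>\<infinity>s\<in>- F k. cmod (y s) * lam j (?w s)) \<le> N" for k
      unfolding N_def
    proof (rule infsum_mono_neutral[OF sub S])
      show "0 \<le> cmod (y s) * lam j (?w s)" for s using nn[of s j] by (cases "y s = 0") auto
    qed auto
    \<comment> \<open>The bound 1 serves the indices from \<open>j\<close> on. For the finitely many
      earlier ones the tail is at most the full sum \<open>N\<close> and the factor at most
      \<open>2 ^ j\<close>.\<close>
    have "wsum l ?w (z k) \<le> max 1 (2 ^ j * N)" for k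
    proof -
      have "wsum l ?w (z k) = (\<Sum>\<^sub>\<infinity>s\<in>- F k. 2 ^ k * (cmod (y s) * l (?w s)))"
        unfolding wsum_def by (rule infsum_cong_neutral) (auto simp: z_def norm_mult norm_power)
      also have "\<dots> = 2 ^ k * (\<Sum>\<^sub>\<infinity>s\<in>- F k. cmod (y s) * l (?w s))"
        by (rule infsum_cmult_right')
      also have "\<dots> \<le> 2 ^ k * (\<Sum>\<^sub>\<infinity>s\<in>- F k. cmod (y s) * lam j (?w s))"
      proof (rule mult_left_mono[OF infsum_mono[OF Sl sub]])
        show "cmod (y s) * l (?w s) \<le> cmod (y s) * lam j (?w s)" for s
          using w[of s] j by (cases "y s = 0") (auto intro: mult_left_mono)
      qed simp
      also have "\<dots> \<le> max 1 (2 ^ j * N)"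
      proof (cases "j \<le> k")
        case True
        have "2 ^ k * (\<Sum>\<^sub>\<infinity>s\<in>- F k. cmod (y s) * lam j (?w s)) \<le> 2 ^ k * (1/2) ^ k"
          by (intro mult_left_mono F(3)[OF True]) simp
        also have "\<dots> = (1::real)" by (simp add: power_divide)
        finally show ?thesis by simp
      next
        case False
        have N0: "0 \<le> N"
          unfolding N_def
        proof (rule infsum_nonneg)
          show "0 \<le> cmod (y s) * lam j (?w s)" for s using nn[of s j] by (cases "y s = 0") auto
        qed
        have "2 ^ k * (\<Sum>\<^sub>\<infinity>s\<in>- F k. cmod (y s) * lam j (?w s)) \<le> 2 ^ k * N"
          by (intro mult_left_mono tail_le_N) simp
        also have "\<dots> \<le> 2 ^ j * N"
          using False N0 by (intro mult_right_mono power_increasing) auto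
        finally show ?thesis by simp
      qed
      finally show ?thesis .
    qed
    then show ?thesis by blast
  qed
  then have "range z \<in> bornology (BC B G L n)"
    using zB unfolding BC_def weighted_bornology_iff by blast
  then show ?thesis
    unfolding z_def using F(1) FT by (intro exI[of _ F] conjI allI)
qed

text \<open>Bilinearity leads from tuples to \<open>dirac (y, x)\<close> with \<open>y\<close>
  finite, truncating \<open>y\<close> leads to all \<open>y\<close> in \<open>BC\<close>, and
  truncating the family of pairs leads to all of \<open>bounded_l1\<close>.\<close>

lemma chain_reps_dense:
  assumes M: "bornological_module (H_alg B G L) M"
    and K: "fun_subspace K" "mackey_closed (chain_reps n M) K" "K \<subseteq> carrier (chain_reps n M)"
      "bilinear_rels (BC B G L n) M \<subseteq> K"
      "\<And>s x. s \<in> tuples G n \<Longrightarrow> x \<in> carrier M \<Longrightarrow> dirac (dirac s, x) \<in> K"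
  shows "carrier (chain_reps n M) \<subseteq> K"
proof -
  note Y = function_space_chain_reps[OF M, of n]
  note KD = fun_subspaceD[OF K(1)] and rel = bilinear_relsD[OF K(4)]
  note BCs = function_spaceD[OF function_space_BC[of n]]
  have half: "(\<lambda>k. (1/2) ^ k) \<longlonglongrightarrow> (0::real)" by (rule LIMSEQ_power_zero) simp
  have step1: "dirac (y, x) \<in> K" if y: "y \<in> finsupp_funs (tuples G n)" and x: "x \<in> carrier M" for y x
  proof (rule finsupp_induct[where P = "\<lambda>y. dirac (y, x) \<in> K", OF y])
    have z: "0 \<in> carrier (BC B G L n)" by (rule fun_subspaceD(1)[OF BCs(1)])
    show "dirac (0, x) \<in> K"
      using rel(3)[OF z x, of 0] by (simp add: BCs)
  next
    fix c c' assume c: "c \<in> finsupp_funs (tuples G n)" "c' \<in> finsupp_funs (tuples G n)"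
      "dirac (c, x) \<in> K" "dirac (c', x) \<in> K"
    have "dirac (c + c', x) - dirac (c, x) - dirac (c', x) \<in> K"
      using rel(1)[of c c' x] c(1,2) x finsupp_BC[of n] by (auto simp: BCs)
    from KD(2)[OF KD(2)[OF this c(4)] c(3)] show "dirac (c + c', x) \<in> K" by simp
  next
    fix a c assume c: "c \<in> finsupp_funs (tuples G n)" "dirac (c, x) \<in> K"
    have "dirac (scl a c, x) - scl a (dirac (c, x)) \<in> K"
      using rel(3)[of c x a] c(1) x finsupp_BC[of n] by (auto simp: BCs)
    from KD(2)[OF this KD(3)[OF c(2), of a]] show "dirac (scl a c, x) \<in> K" by simp
  qed (use K(5) x in auto)
  have step2: "dirac (y, x) \<in> K" if y: "y \<in> carrier (BC B G L n)" and x: "x \<in> carrier M" for y x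
  proof -
    from truncation_bounded[OF y] obtain F where F: "\<forall>k. finite (F k) \<and> F k \<subseteq> tuples G n"
      and S: "range (\<lambda>k. scl (2 ^ k) (y - (\<lambda>s. if s \<in> F k then y s else 0))) \<in> bornology (BC B G L n)"
      by (elim exE conjE)
    have F: "\<And>k. finite (F k)" "\<And>k. F k \<subseteq> tuples G n" using F by simp_all
    define yk where "yk k = (\<lambda>s. if s \<in> F k then y s else 0)" for k
    define z where "z k = scl (2 ^ k) (y - yk k)" for k
    have S: "range z \<in> bornology (BC B G L n)" using S by (simp add: z_def[abs_def] yk_def)
    have zB: "z k \<in> carrier (BC B G L n)" for k
      using directed_bornologyD(2)[OF directed_bornology_BC S] by blast
    have ykf: "yk k \<in> finsupp_funs (tuples G n)" for k
      using F(1,2)[of k] by (auto simp: finsupp_funs_def yk_def intro: finite_subset[of _ "F k"] split: if_splits)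
    have y_eq: "y = yk k + scl ((1/2) ^ k) (z k)" for k
      by (auto simp: z_def fun_eq_iff power_divide)
    \<comment> \<open>The masses \<open>dirac (yk k, x)\<close> need not converge: distinct point
      masses are at l1 distance 2 however close their entries are. Modulo bilinearity
      \<open>dirac (yk k, x)\<close> agrees with \<open>u k\<close>, and \<open>u k\<close> differs
      from \<open>dirac (y, x)\<close> by \<open>(1/2) ^ k\<close> times an element of a bounded
      set.\<close>
    define u where "u k = dirac (y, x) - scl ((1/2) ^ k) (dirac (z k, x))" for k
    have dz: "dirac (z k, x) \<in> carrier (chain_reps n M)" for k
      by (rule dirac_bounded_l1[OF directed_bornology_BC born_moduleD(2)[OF M] zB x])
    have dy: "dirac (y, x) \<in> carrier (chain_reps n M)"
      by (rule dirac_bounded_l1[OF directed_bornology_BC born_moduleD(2)[OF M] y x])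
    have uK: "u k \<in> K" for k
    proof -
      have s: "scl ((1/2) ^ k) (z k) \<in> carrier (BC B G L n)"
        by (rule fun_subspaceD(3)[OF BCs(1) zB])
      have ykB: "yk k \<in> carrier (BC B G L n)" using finsupp_BC ykf by blast
      have 1: "dirac (y, x) - dirac (yk k, x) - dirac (scl ((1/2) ^ k) (z k), x) \<in> K"
        using rel(1)[OF ykB s x] y_eq[of k] by (simp add: BCs)
      have 2: "dirac (scl ((1/2) ^ k) (z k), x) - scl ((1/2) ^ k) (dirac (z k, x)) \<in> K"
        using rel(3)[OF zB x] by (simp add: BCs)
      have "dirac (y, x) - dirac (yk k, x) - dirac (scl ((1/2) ^ k) (z k), x) +
          (dirac (scl ((1/2) ^ k) (z k), x) - scl ((1/2) ^ k) (dirac (z k, x))) + dirac (yk k, x) = u k"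
        unfolding u_def by simp
      then show ?thesis using KD(2)[OF KD(2)[OF 1 2] step1[OF ykf[of k] x]] by simp
    qed
    have A: "range (\<lambda>k. - dirac (z k, x)) \<in> bornology (chain_reps n M)"
    proof (rule bounded_l1_bornologyI[OF S directed_bornologyD(3)[OF born_moduleD(2)[OF M] x], where K = 1])
      fix c assume "c \<in> range (\<lambda>k. - dirac (z k, x))"
      then obtain k where c: "c = - dirac (z k, x)" by blast
      show "c p = 0" if "p \<notin> range z \<times> {x}" for p using that by (auto simp: c dirac_def)
      show "l1 c"
        unfolding c by (rule l1_finsupp[of _ UNIV], rule fun_subspaceD(4)[OF fun_subspace_finsupp]) simp
      have "(\<Sum>\<^sub>\<infinity>p. cmod (c p)) = (\<Sum>\<^sub>\<infinity>p\<in>{(z k, x)}. 1)"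
        by (rule infsum_cong_neutral) (auto simp: c dirac_def)
      then show "(\<Sum>\<^sub>\<infinity>p. cmod (c p)) \<le> 1" by simp
    qed
    have "mackey_limit (chain_reps n M) u (dirac (y, x))"
      unfolding mackey_limit_fun[OF Y]
    proof (intro conjI allI bexI[OF _ A] exI[of _ "\<lambda>k. (1/2) ^ k"] half)
      show "u k \<in> carrier (chain_reps n M)" for k using uK K(3) by blast
      show "\<exists>w\<in>range (\<lambda>k. - dirac (z k, x)). u k - dirac (y, x) = scl (of_real ((1/2) ^ k)) w" for k
        by (rule bexI[of _ "- dirac (z k, x)"]) (auto simp: u_def fun_eq_iff)
    qed (rule dy)
    then show ?thesis using K(2) uK unfolding mackey_closed_def by blast
  qed
  show ?thesis
  proof
    fix c assume c: "c \<in> carrier (chain_reps n M)"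
    from c obtain S T where S: "S \<in> bornology (BC B G L n)" "T \<in> bornology M"
      "\<forall>p. p \<notin> S \<times> T \<longrightarrow> c p = 0" "l1 c"
      by (rule bounded_l1E)
    have ST: "S \<subseteq> carrier (BC B G L n)" "T \<subseteq> carrier M"
      using directed_bornologyD(2)[OF directed_bornology_BC S(1)]
        directed_bornologyD(2)[OF born_moduleD(2)[OF M] S(2)] .
    have cs: "(\<lambda>p. cmod (c p)) summable_on A" for A
    proof -
      have "(\<lambda>p. cmod (c p)) summable_on UNIV" using S(4) by (simp add: l1_def)
      then show ?thesis by (rule summable_on_subset_banach) simp
    qed
    \<comment> \<open>A single constant weight suffices here: with supports inside \<open>S\<close>
      times \<open>T\<close>, only the total mass has to be controlled.\<close>
    have "\<exists>F. \<forall>k. finite (F k) \<and> (\<forall>p\<in>F k. c p \<noteq> 0) \<and>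
        (\<forall>j\<le>k. (\<Sum>\<^sub>\<infinity>p\<in>- F k. cmod (c p) * (\<lambda>_ _. 1) j p) \<le> (1/2) ^ k)"
      by (rule finite_truncations) (use cs in simp_all)
    then obtain F where F: "\<forall>k. finite (F k) \<and> (\<forall>p\<in>F k. c p \<noteq> 0) \<and>
        (\<forall>j\<le>k. (\<Sum>\<^sub>\<infinity>p\<in>- F k. cmod (c p) * 1) \<le> (1/2) ^ k)"
      by (elim exE)
    then have F: "\<And>k. finite (F k)" "\<And>k p. p \<in> F k \<Longrightarrow> c p \<noteq> 0"
      "\<And>k. (\<Sum>\<^sub>\<infinity>p\<in>- F k. cmod (c p) * 1) \<le> (1/2) ^ k"
      using le_refl by blast+
    define ck where "ck k = (\<lambda>p. if p \<in> F k then c p else 0)" for k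
    define z where "z k = scl (- (2 ^ k)) (c - ck k)" for k
    have FS: "F k \<subseteq> S \<times> T" for k using F(2) S(3) by blast
    have ckf: "ck k \<in> finsupp_funs (S \<times> T)" for k
      using F(1)[of k] FS[of k] by (auto simp: finsupp_funs_def ck_def intro: finite_subset[of _ "F k"] split: if_splits)
    have ckK: "ck k \<in> K" for k
      by (rule finsupp_induct[where P = "\<lambda>c. c \<in> K", OF ckf[of k]])
        (use KD step2 ST in \<open>auto simp: subset_iff\<close>)
    have A: "range z \<in> bornology (chain_reps n M)"
    proof (rule bounded_l1_bornologyI[OF S(1,2), where K = 1])
      fix d assume "d \<in> range z"
      then obtain k where d: "d = z k" by blast
      show "d p = 0" if "p \<notin> S \<times> T" for p using S(3)[rule_format, OF that] by (simp add: d z_def ck_def)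
      show "l1 d"
        unfolding d z_def
        by (intro fun_subspaceD(3,5)[OF fun_subspace_l1, simplified] S(4) l1_finsupp[OF ckf])
      have "(\<Sum>\<^sub>\<infinity>p. cmod (d p)) = (\<Sum>\<^sub>\<infinity>p\<in>- F k. 2 ^ k * (cmod (c p) * 1))"
        by (rule infsum_cong_neutral) (auto simp: d z_def ck_def norm_mult norm_power)
      also have "\<dots> = 2 ^ k * (\<Sum>\<^sub>\<infinity>p\<in>- F k. cmod (c p) * 1)"
        by (rule infsum_cmult_right')
      also have "\<dots> \<le> 2 ^ k * (1/2) ^ k" by (intro mult_left_mono F(3)) simp
      also have "\<dots> = (1::real)" by (simp add: power_divide)
      finally show "(\<Sum>\<^sub>\<infinity>p. cmod (d p)) \<le> 1" .
    qed
    have "mackey_limit (chain_reps n M) ck c"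
      unfolding mackey_limit_fun[OF Y]
    proof (intro conjI allI bexI[OF _ A] exI[of _ "\<lambda>k. (1/2) ^ k"] half)
      show "ck k \<in> carrier (chain_reps n M)" for k using ckK K(3) by blast
      show "\<exists>w\<in>range z. ck k - c = scl (of_real ((1/2) ^ k)) w" for k
        by (rule bexI[of _ "z k"]) (auto simp: z_def fun_eq_iff power_divide)
    qed (rule c)
    then show "c \<in> K" using K(2) ckK unfolding mackey_closed_def by blast
  qed
qed

end

lemma l1_dirac [simp]: "l1 (dirac p)"
  by (rule l1_finsupp[of _ UNIV]) simp

lemma l1_scl: "l1 c \<Longrightarrow> l1 (scl a c)"
  using fun_subspaceD(3)[OF fun_subspace_l1] by simp

lemma l1_diff: "l1 c \<Longrightarrow> l1 c' \<Longrightarrow> l1 (c - c')"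
  using fun_subspaceD(5)[OF fun_subspace_l1] by simp

lemma pushforward_diff:
  assumes "l1 c" "l1 c'" shows "pushforward h (c - c') = pushforward h c - pushforward h c'"
  using pushforward_add[OF l1_diff[OF assms] assms(2), of h] by (simp add: algebra_simps)

lemma pushforward_finsupp:
  assumes "c \<in> finsupp_funs X" "\<And>p. p \<in> X \<Longrightarrow> h p \<in> Y"
  shows "pushforward h c \<in> finsupp_funs Y"
proof (rule finsupp_induct[where P = "\<lambda>c. pushforward h c \<in> finsupp_funs Y", OF assms(1)])
  fix c c' assume c: "c \<in> finsupp_funs X" "c' \<in> finsupp_funs X"
    "pushforward h c \<in> finsupp_funs Y" "pushforward h c' \<in> finsupp_funs Y"
  show "pushforward h (c + c') \<in> finsupp_funs Y"
    using fun_subspaceD(2)[OF fun_subspace_finsupp c(3,4)]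
    by (simp add: pushforward_add[OF l1_finsupp[OF c(1)] l1_finsupp[OF c(2)]])
next
  fix a c assume "pushforward h c \<in> finsupp_funs Y"
  then show "pushforward h (scl a c) \<in> finsupp_funs Y"
    using fun_subspaceD(3)[OF fun_subspace_finsupp] by (simp add: pushforward_scl)
qed (use assms(2) fun_subspaceD(1)[OF fun_subspace_finsupp] in simp_all)

lemma lin_ext_sum:
  assumes "finite A" "\<And>i. i \<in> A \<Longrightarrow> c i \<in> finsupp_funs X"
  shows "lin_ext e (\<Sum>i\<in>A. scl (a i) (c i)) = (\<Sum>i\<in>A. scl (a i) (lin_ext e (c i)))"
proof -
  let ?P = "\<lambda>A. (\<forall>i\<in>A. c i \<in> finsupp_funs X) \<longrightarrow>
    lin_ext e (\<Sum>i\<in>A. scl (a i) (c i)) = (\<Sum>i\<in>A. scl (a i) (lin_ext e (c i)))"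
  have "?P A"
  proof (rule finite_induct[OF assms(1), where P = ?P])
    fix x F assume F: "finite F" "x \<notin> F" "?P F"
    show "?P (insert x F)"
    proof
      assume c: "\<forall>i\<in>insert x F. c i \<in> finsupp_funs X"
      have s: "scl (a i) (c i) \<in> finsupp_funs X" if "i \<in> insert x F" for i
        by (rule fun_subspaceD(3)[OF fun_subspace_finsupp]) (use c that in blast)
      then have "(\<Sum>i\<in>F. scl (a i) (c i)) \<in> finsupp_funs X"
        by (intro fun_subspace_sum[OF fun_subspace_finsupp]) blast
      from lin_ext_add[OF s[of x] this, of e]
      show "lin_ext e (\<Sum>i\<in>insert x F. scl (a i) (c i)) = (\<Sum>i\<in>insert x F. scl (a i) (lin_ext e (c i)))"
        using F c lin_ext_scl[of "c x" X e "a x"] by (simp only: sum.insert) simp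
    qed
  qed simp
  with assms(2) show ?thesis by blast
qed

lemma bdd_linear_induced:
  assumes Y1: "function_space Y1" and Y2: "function_space Y2" and W: "fun_subspace W1" "fun_subspace W2"
    and Y1b: "\<And>A. A \<in> bornology Y1 \<Longrightarrow> A \<subseteq> carrier Y1"
    and f: "bdd_linear Y1 Y2 f" and F: "\<And>c. c \<in> carrier Y1 \<Longrightarrow> F (W1 +>\<^bsub>Y1\<^esub> c) = W2 +>\<^bsub>Y2\<^esub> f c"
  shows "bdd_linear (born_quotient Y1 W1) (born_quotient Y2 W2) F"
proof -
  note D = function_spaceD[OF Y1] function_spaceD[OF Y2]
  note lin = f[unfolded bdd_linear_def D]
  note ops = born_quotient_add[OF Y1 W(1)] born_quotient_add[OF Y2 W(2)]
    born_quotient_smult[OF Y1 W(1)] born_quotient_smult[OF Y2 W(2)]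
  note S = fun_subspaceD[OF D(1)]
  show ?thesis
    unfolding bdd_linear_def
  proof (intro conjI ballI allI)
    show "F x \<in> carrier (born_quotient Y2 W2)" if "x \<in> carrier (born_quotient Y1 W1)" for x
      using that lin by (auto simp: born_quotient_simps(1) F)
    show "F (x \<oplus>\<^bsub>born_quotient Y1 W1\<^esub> y) = F x \<oplus>\<^bsub>born_quotient Y2 W2\<^esub> F y"
      if "x \<in> carrier (born_quotient Y1 W1)" "y \<in> carrier (born_quotient Y1 W1)" for x y
      using that lin S by (auto simp: born_quotient_simps(1) F ops)
    show "F (a \<odot>\<^bsub>born_quotient Y1 W1\<^esub> x) = a \<odot>\<^bsub>born_quotient Y2 W2\<^esub> F x"
      if "x \<in> carrier (born_quotient Y1 W1)" for a x
      using that lin S by (auto simp: born_quotient_simps(1) F ops)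
    show "F ` A \<in> bornology (born_quotient Y2 W2)" if A: "A \<in> bornology (born_quotient Y1 W1)" for A
    proof -
      obtain A' where A': "A' \<in> bornology Y1" "A = (\<lambda>x. W1 +>\<^bsub>Y1\<^esub> x) ` A'"
        using A by (auto simp: born_quotient_simps(5))
      have "F ` A = (\<lambda>x. W2 +>\<^bsub>Y2\<^esub> x) ` (f ` A')"
        unfolding A'(2) image_image by (rule image_cong) (use F Y1b[OF A'(1)] in auto)
      moreover have "f ` A' \<in> bornology Y2" using lin A'(1) by blast
      ultimately show ?thesis by (auto simp: born_quotient_simps(5))
    qed
  qed
qed

text \<open>The cancellation behind the Leibniz rule for the front-face/back-face cap product.\<close>

lemma alternating_sum_split:
  fixes E A C :: "nat \<Rightarrow> 'x \<Rightarrow> complex"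
  assumes "\<And>j. j \<le> k \<Longrightarrow> E j = A j" "\<And>i. 1 \<le> i \<Longrightarrow> i \<le> r \<Longrightarrow> E (k + i) = C i" "A (Suc k) = C 0"
  shows "(\<Sum>j\<le>k + r. scl ((-1) ^ j) (E j)) =
    (\<Sum>j\<le>Suc k. scl ((-1) ^ j) (A j)) + scl ((-1) ^ k) (\<Sum>i\<le>r. scl ((-1) ^ i) (C i))"
proof
  fix p
  have "(\<Sum>j\<le>k + r. (-1) ^ j * E j p) =
    (\<Sum>j\<le>Suc k. (-1) ^ j * A j p) + (-1) ^ k * (\<Sum>i\<le>r. (-1) ^ i * C i p)"
    using assms(2)
  proof (induction r)
    case 0
    have "(\<Sum>j\<le>k. (-1) ^ j * E j p) = (\<Sum>j\<le>k. (-1) ^ j * A j p)"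
      by (rule sum.cong) (use assms(1) in auto)
    then show ?case using assms(3) by simp
  next
    case (Suc r)
    have "(\<Sum>j\<le>k + r. (-1) ^ j * E j p) =
        (\<Sum>j\<le>Suc k. (-1) ^ j * A j p) + (-1) ^ k * (\<Sum>i\<le>r. (-1) ^ i * C i p)"
      by (rule Suc.IH) (use Suc.prems in auto)
    moreover have "E (Suc (k + r)) = C (Suc r)" using Suc.prems[of "Suc r"] by simp
    ultimately show ?case by (simp add: algebra_simps power_add)
  qed
  then show "(\<Sum>j\<le>k + r. scl ((-1) ^ j) (E j)) p =
    ((\<Sum>j\<le>Suc k. scl ((-1) ^ j) (A j)) + scl ((-1) ^ k) (\<Sum>i\<le>r. scl ((-1) ^ i) (C i))) p"
    by (simp only: sum_fun_apply scl_apply plus_fun_apply)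
qed

context bounded_group
begin

subsection \<open>The boundary on chains with coefficients\<close>

abbreviation chain_bd :: "nat \<Rightarrow> (('g list \<Rightarrow> complex) \<times> 'm \<Rightarrow> complex) \<Rightarrow> ('g list \<Rightarrow> complex) \<times> 'm \<Rightarrow> complex" where
  "chain_bd n \<equiv> pushforward (map_prod (bar_bd n) id)"

lemma bar_bd_finsupp:
  "c \<in> finsupp_funs (tuples G (Suc n)) \<Longrightarrow> bar_bd (Suc n) c \<in> finsupp_funs (tuples G n)"
  unfolding bar_bd_alt
  by (intro fun_subspace_sum[OF fun_subspace_finsupp] fun_subspaceD(3)[OF fun_subspace_finsupp]
      pushforward_finsupp[where X = "tuples G (Suc n)"]) (auto intro: face_tuples)

lemma bdd_linear_chain_bd:
  assumes M: "bornological_module (H_alg B G L) M"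
  shows "bdd_linear (chain_reps (Suc n) M) (chain_reps n M) (chain_bd (Suc n))"
  by (rule pushforward_bounded_l1)
    (use bdd_linear_bar_bd[of n] directed_bornology_BC born_moduleD(2)[OF M] in \<open>auto simp: bdd_linear_def\<close>)

text \<open>The preimage of the closed relations under the bounded boundary map is a Mackey-closed
  subspace, so it is enough to test generators; these are respected because \<open>bar_bd\<close> is
  linear and commutes with the right action.\<close>

lemma chain_bd_rels:
  assumes M: "bornological_module (H_alg B G L) M" and c: "c \<in> chain_rels (Suc n) M"
  shows "chain_bd (Suc n) c \<in> chain_rels n M"
proof -
  let ?Y = "chain_reps (Suc n) M" and ?R = "chain_rels n M"
  note R = chain_rels_properties[OF M, of n]
  let ?K = "{c \<in> carrier ?Y. chain_bd (Suc n) c \<in> ?R}"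
  note pre = mackey_closed_preimage[OF function_space_chain_reps[OF M] function_space_chain_reps[OF M]
      bdd_linear_chain_bd[OF M, of n] bounded_l1_bornology_subset R(4,5)]
  have gen: "bilinear_rels (BC B G L (Suc n)) M \<union> H_rels B G L M (Suc n) \<subseteq> ?K"
  proof (intro Un_least subsetI CollectI conjI)
    fix r assume r: "r \<in> bilinear_rels (BC B G L (Suc n)) M"
    show "r \<in> carrier ?Y"
      using r chain_rels_properties(1,3)[OF M] by blast
    note bs = function_spaceD[OF function_space_BC]
    have bd: "bar_bd (Suc n) x \<in> carrier (BC B G L n)" if "x \<in> carrier (BC B G L (Suc n))" for x
      using bdd_linear_bar_bd that by (auto simp: bdd_linear_def)
    note rel = bilinear_relsD[OF R(1), unfolded bs]
    note simps = pushforward_diff l1_diff l1_scl bs pushforward_scl bar_bd_scl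
    from r show "chain_bd (Suc n) r \<in> ?R"
    proof (cases rule: bilinear_rels_cases)
      case (add1 x x' y)
      then show ?thesis
        using rel(1)[OF bd[OF add1(1)] bd[OF add1(2)] add1(3)]
        by (simp add: simps bar_bd_add[OF l1_BC[OF add1(1)] l1_BC[OF add1(2)]])
    next
      case (add2 x y y')
      then show ?thesis using rel(2)[OF bd[OF add2(1)] add2(2,3)] by (simp add: simps)
    next
      case (scl1 z x y)
      then show ?thesis using rel(3)[OF bd[OF scl1(1)] scl1(2), of z] by (simp add: simps)
    next
      case (scl2 z x y)
      then show ?thesis using rel(4)[OF bd[OF scl2(1)] scl2(2), of z] by (simp add: simps)
    qed
  next
    fix r assume r: "r \<in> H_rels B G L M (Suc n)"
    show "r \<in> carrier ?Y" using r H_rels_sub[OF M] by blast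
    obtain f x y where req: "r = dirac (chain_ract G x f, y) - dirac (x, act M f y)"
      and f: "f \<in> carrier (H_alg B G L)" "x \<in> carrier (BC B G L (Suc n))" "y \<in> carrier M"
      using r unfolding balanced_rels_def fun_diff_def by blast
    have "bar_bd (Suc n) x \<in> carrier (BC B G L n)"
      using bdd_linear_bar_bd f(2) by (auto simp: bdd_linear_def)
    then have "dirac (chain_ract G (bar_bd (Suc n) x) f, y) - dirac (bar_bd (Suc n) x, act M f y) \<in> H_rels B G L M n"
      unfolding balanced_rels_def fun_diff_def using f by blast
    then show "chain_bd (Suc n) r \<in> ?R"
      using R(2) by (auto simp: req pushforward_diff bar_bd_chain_ract[OF f(1,2)])
  qed
  have "chain_rels (Suc n) M \<subseteq> ?K"
    unfolding tensor_rels_def[of "BC B G L (Suc n)"]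
    by (rule closed_span_minimal[OF function_space_chain_reps[OF M] _ pre gen]) blast
  with c show ?thesis by blast
qed

abbreviation bd_map where
  "bd_map M n \<equiv> induced_map (bounded_l1 (BC B G L (n - 1)) M)
     (tensor_rels (BC B G L (n - 1)) M (H_rels B G L M (n - 1))) (pushforward (map_prod (bar_bd n) id))"

lemma bd_map_coset:
  assumes M: "bornological_module (H_alg B G L) M" and c: "c \<in> carrier (chain_reps (Suc n) M)"
  shows "bd_map M (Suc n) (chain_rels (Suc n) M +>\<^bsub>chain_reps (Suc n) M\<^esub> c) =
    chain_rels n M +>\<^bsub>chain_reps n M\<^esub> chain_bd (Suc n) c"
  unfolding diff_Suc_1
proof (rule induced_map_fun_coset)
  show "chain_bd (Suc n) (c + c') = chain_bd (Suc n) c + chain_bd (Suc n) c'"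
    if "c \<in> carrier (chain_reps (Suc n) M)" "c' \<in> carrier (chain_reps (Suc n) M)" for c c'
    using that by (intro pushforward_add bounded_l1_l1)
  show "chain_bd (Suc n) c \<in> carrier (chain_reps n M)" if "c \<in> carrier (chain_reps (Suc n) M)" for c
    using bdd_linear_chain_bd[OF M] that by (auto simp: bdd_linear_def)
qed (use c chain_bd_rels[OF M] chain_rels_properties(3,4)[OF M] function_space_chain_reps[OF M] in auto)

lemma bdd_linear_bd_map:
  assumes M: "bornological_module (H_alg B G L) M"
  shows "bdd_linear (B_chains B G L M (Suc n)) (B_chains B G L M n) (bd_map M (Suc n))"
  unfolding B_chains_eq
  by (rule bdd_linear_induced[OF function_space_chain_reps[OF M] function_space_chain_reps[OF M]
        chain_rels_properties(4)[OF M] chain_rels_properties(4)[OF M] bounded_l1_bornology_subset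
        bdd_linear_chain_bd[OF M] bd_map_coset[OF M]])

text \<open>The set where \<open>f\<close> equals \<open>a\<close> times \<open>h\<close> is Mackey
  closed, the target being a quotient by closed relations, and \<open>chain_reps_dense\<close> makes
  it everything. The scalar \<open>a\<close> accommodates the sign of the Leibniz rule; uniqueness
  of the cap product is the case 1.\<close>

lemma B_chains_eqI:
  assumes M: "bornological_module (H_alg B G L) M" and N: "bornological_module (H_alg B G L) N"
    and f: "bdd_linear (B_chains B G L M m) (B_chains B G L N k) f"
    and h: "bdd_linear (B_chains B G L M m) (B_chains B G L N k) h"
    and eq: "\<And>s x. s \<in> tuples G m \<Longrightarrow> x \<in> carrier M \<Longrightarrow>
      f (B_pure B G L M m (dirac s) x) = a \<odot>\<^bsub>B_chains B G L N k\<^esub> h (B_pure B G L M m (dirac s) x)"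
    and z: "z \<in> carrier (B_chains B G L M m)"
  shows "f z = a \<odot>\<^bsub>B_chains B G L N k\<^esub> h z"
proof -
  let ?Y = "chain_reps m M" and ?R = "chain_rels m M"
  let ?Z = "chain_reps k N" and ?S = "chain_rels k N"
  note Y = function_space_chain_reps[OF M, of m] and Z = function_space_chain_reps[OF N, of k]
  note R = chain_rels_properties[OF M, of m] and S = chain_rels_properties[OF N, of k]
  let ?q = "\<lambda>c. ?R +>\<^bsub>?Y\<^esub> c"
  have q: "bdd_linear ?Y (born_quotient ?Y ?R) ?q" by (rule bdd_linear_quotient[OF Y R(4)])
  have fq: "bdd_linear ?Y (born_quotient ?Z ?S) (\<lambda>c. f (?q c))"
    and hq: "bdd_linear ?Y (born_quotient ?Z ?S) (\<lambda>c. h (?q c))"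
    using bdd_linear_comp[OF q] f h unfolding B_chains_eq by blast+
  have Zb: "\<exists>A''\<in>bornology ?Z. \<forall>x\<in>A. \<forall>y\<in>A'. x - scl a y \<in> A''"
    if A: "A \<in> bornology ?Z" "A' \<in> bornology ?Z" for A A'
  proof -
    have "x - scl a y = x + scl (- a) y" for x y :: "('g list \<Rightarrow> complex) \<times> 'c \<Rightarrow> complex"
      by (auto simp: fun_eq_iff)
    then show ?thesis
      using bounded_l1_bornology_add[OF directed_bornology_BC born_moduleD(2)[OF N] A, of "- a"] by metis
  qed
  let ?K = "{c \<in> carrier ?Y. f (?q c) = a \<odot>\<^bsub>born_quotient ?Z ?S\<^esub> h (?q c)}"
  note K = mackey_closed_equalizer[OF Y Z bounded_l1_bornology_subset S(3-5) Zb fq hq]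
  have "carrier ?Y \<subseteq> ?K"
  proof (rule chain_reps_dense[OF M K])
    show "bilinear_rels (BC B G L m) M \<subseteq> ?K"
    proof
      fix r assume r: "r \<in> bilinear_rels (BC B G L m) M"
      have "?q r = ?q 0" using r R(1) by (auto simp: coset_eq_iff[OF Y R(4)])
      moreover have "0 \<in> ?K" using fun_subspaceD(1)[OF K(1)] .
      moreover have "r \<in> carrier ?Y" using r R(1,3) by blast
      ultimately show "r \<in> ?K" by simp
    qed
    show "dirac (dirac s, x) \<in> ?K" if "s \<in> tuples G m" "x \<in> carrier M" for s x
      using eq[OF that] dirac_bounded_l1[OF directed_bornology_BC born_moduleD(2)[OF M], of "dirac s" m x]
        that finsupp_BC[of m]
      by (auto simp: pure_tensor_def B_chains_eq subset_iff)
  qed (assumption | rule Collect_restrict)+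
  moreover obtain c where "c \<in> carrier ?Y" "z = ?q c"
    using z by (auto simp: B_chains_eq born_quotient_simps(1))
  ultimately show ?thesis by (auto simp: B_chains_eq)
qed

end

section \<open>Pure tensors, and the front and back parts of a tuple\<close>

lemma pure_tensor_relations:
  assumes D: "directed_bornology D" "vector_space_C D" and V: "directed_bornology V" "vector_space_C V"
  defines "T \<equiv> completed_tensor D V {}" and "pt \<equiv> pure_tensor D V {}"
  shows "x \<in> carrier D \<Longrightarrow> v \<in> carrier V \<Longrightarrow> pt x v \<in> carrier T"
    and "x \<in> carrier D \<Longrightarrow> x' \<in> carrier D \<Longrightarrow> v \<in> carrier V \<Longrightarrow> pt (x \<oplus>\<^bsub>D\<^esub> x') v = pt x v \<oplus>\<^bsub>T\<^esub> pt x' v"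
    and "x \<in> carrier D \<Longrightarrow> v \<in> carrier V \<Longrightarrow> v' \<in> carrier V \<Longrightarrow> pt x (v \<oplus>\<^bsub>V\<^esub> v') = pt x v \<oplus>\<^bsub>T\<^esub> pt x v'"
    and "x \<in> carrier D \<Longrightarrow> v \<in> carrier V \<Longrightarrow> pt (z \<odot>\<^bsub>D\<^esub> x) v = z \<odot>\<^bsub>T\<^esub> pt x v"
    and "x \<in> carrier D \<Longrightarrow> v \<in> carrier V \<Longrightarrow> pt x (z \<odot>\<^bsub>V\<^esub> v) = z \<odot>\<^bsub>T\<^esub> pt x v"
proof -
  have F: "function_space (bounded_l1 D V)" by (rule function_space_bounded_l1[OF D(1) V(1)])
  note R = tensor_rels_properties[OF D V empty_subsetI]
  note ops = born_quotient_add[OF F R(4)] born_quotient_smult[OF F R(4)]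
  note rel = bilinear_relsD[OF R(1)]
  note defs = T_def pt_def completed_tensor_def pure_tensor_def ops coset_eq_iff[OF F R(4)]
  show "x \<in> carrier D \<Longrightarrow> v \<in> carrier V \<Longrightarrow> pt x v \<in> carrier T"
    unfolding T_def pt_def completed_tensor_def pure_tensor_def born_quotient_simps(1)
    by (intro imageI dirac_bounded_l1[OF D(1) V(1)])
  show "x \<in> carrier D \<Longrightarrow> x' \<in> carrier D \<Longrightarrow> v \<in> carrier V \<Longrightarrow> pt (x \<oplus>\<^bsub>D\<^esub> x') v = pt x v \<oplus>\<^bsub>T\<^esub> pt x' v"
    unfolding defs using rel(1) by (simp add: diff_diff_eq)
  show "x \<in> carrier D \<Longrightarrow> v \<in> carrier V \<Longrightarrow> v' \<in> carrier V \<Longrightarrow> pt x (v \<oplus>\<^bsub>V\<^esub> v') = pt x v \<oplus>\<^bsub>T\<^esub> pt x v'"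
    unfolding defs using rel(2) by (simp add: diff_diff_eq)
  show "x \<in> carrier D \<Longrightarrow> v \<in> carrier V \<Longrightarrow> pt (z \<odot>\<^bsub>D\<^esub> x) v = z \<odot>\<^bsub>T\<^esub> pt x v"
    unfolding defs using rel(3) by simp
  show "x \<in> carrier D \<Longrightarrow> v \<in> carrier V \<Longrightarrow> pt x (z \<odot>\<^bsub>V\<^esub> v) = z \<odot>\<^bsub>T\<^esub> pt x v"
    unfolding defs using rel(4) by simp
qed

lemma with_action_simps [simp]:
  "carrier (with_action V a) = carrier V" "add (with_action V a) = add V"
  "smult (with_action V a) = smult V" "\<zero>\<^bsub>with_action V a\<^esub> = \<zero>\<^bsub>V\<^esub>"
  "bornology (with_action V a) = bornology V" "act (with_action V a) = a"
  by (simp_all add: with_action_def born_space.defs born_module.defs)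

text \<open>Removing a vertex with index at most \<open>k\<close> affects the front part, a later
  one the back part. By the last two identities, the last face of the longer front part and the
  first face of the back part belong to the same splitting of \<open>s\<close>; the corresponding
  terms cancel in the Leibniz rule.\<close>

lemma face_take_drop:
  assumes "length s = Suc m"
  shows "j \<le> k \<Longrightarrow> k < m \<Longrightarrow> take (Suc k) (face j s) = face j (take (Suc (Suc k)) s)"
    "j \<le> k \<Longrightarrow> k < m \<Longrightarrow> drop k (face j s) = drop (Suc k) s"
    "k < j \<Longrightarrow> j \<le> m \<Longrightarrow> take (Suc k) (face j s) = take (Suc k) s"
    "k < j \<Longrightarrow> j \<le> m \<Longrightarrow> drop k (face j s) = face (j - k) (drop k s)"
    "k < m \<Longrightarrow> face (Suc k) (take (Suc (Suc k)) s) = take (Suc k) s"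
    "face 0 (drop k s) = drop (Suc k) s"
proof -
  show "j \<le> k \<Longrightarrow> k < m \<Longrightarrow> take (Suc k) (face j s) = face j (take (Suc (Suc k)) s)"
    using assms by (simp add: face_def drop_take min_def)
  show "j \<le> k \<Longrightarrow> k < m \<Longrightarrow> drop k (face j s) = drop (Suc k) s"
    using assms by (simp add: face_def)
  show "k < j \<Longrightarrow> j \<le> m \<Longrightarrow> take (Suc k) (face j s) = take (Suc k) s"
    using assms by (simp add: face_def min_def)
  show "k < j \<Longrightarrow> j \<le> m \<Longrightarrow> drop k (face j s) = face (j - k) (drop k s)"
    using assms by (simp add: face_def drop_take)
  show "k < m \<Longrightarrow> face (Suc k) (take (Suc (Suc k)) s) = take (Suc k) s"
    by (simp add: face_def min_def)
  show "face 0 (drop k s) = drop (Suc k) s" by (simp add: face_def)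
qed

section \<open>The cap product\<close>

locale cap_setting = bounded_group G B L
  for G :: "('g, 'r) monoid_scheme" (structure) and B L +
  fixes D :: "('g \<Rightarrow> complex, 'd) born_module" and V :: "('g \<Rightarrow> complex, 'v) born_module"
  assumes D: "bornological_module (H_alg B G L) D" and V: "bornological_module (H_alg B G L) V"
    and cap_ext: "cap_extends B G L D V"
begin

abbreviation E where "E \<equiv> tensor_module B G L D V"
abbreviation pt where "pt \<equiv> pure_tensor D V {}"

lemma diagonal: "diagonal_action B G L D V (SOME a. diagonal_action B G L D V a)"
  by (rule someI_ex[OF conjunct1[OF iffD1[OF cap_extends_def cap_ext]]])

lemma E: "bornological_module (H_alg B G L) E"
  using diagonal unfolding diagonal_action_def tensor_module_def by (rule conjunct1)

lemma E_simps:
  "carrier E = carrier (completed_tensor D V {})" "add E = add (completed_tensor D V {})"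
  "smult E = smult (completed_tensor D V {})"
  by (simp_all add: tensor_module_def)

lemma E_act: "g \<in> carrier G \<Longrightarrow> x \<in> carrier D \<Longrightarrow> v \<in> carrier V \<Longrightarrow>
    act E (dirac g) (pt x v) = pt (act D (dirac g) x) (act V (dirac g) v)"
  using conjunct2[OF iffD1[OF diagonal_action_def diagonal]] by (simp add: tensor_module_def)

lemmas pt_rels = pure_tensor_relations[OF born_moduleD(2,1)[OF D] born_moduleD(2,1)[OF V],
    folded E_simps]

text \<open>Linearity on finite chains without any bound, so that bounded cochains and the possibly
  unbounded \<psi> fall under one notion.\<close>

definition linear_cochain :: "nat \<Rightarrow> (('g list \<Rightarrow> complex) \<Rightarrow> 'v) \<Rightarrow> bool" where
  "linear_cochain k \<psi> \<longleftrightarrow>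
     (\<forall>c\<in>finsupp_funs (tuples G k). \<psi> c \<in> carrier V) \<and>
     (\<forall>c\<in>finsupp_funs (tuples G k). \<forall>c'\<in>finsupp_funs (tuples G k). \<psi> (c + c') = \<psi> c \<oplus>\<^bsub>V\<^esub> \<psi> c') \<and>
     (\<forall>a. \<forall>c\<in>finsupp_funs (tuples G k). \<psi> (scl a c) = a \<odot>\<^bsub>V\<^esub> \<psi> c)"

text \<open>A representative of the front-face/back-face product of \<open>s\<close>, with
  coefficient \<open>x\<close>, and \<psi>. The vertex with index \<open>k\<close> belongs to both
  parts.\<close>

definition cap_rep where
  "cap_rep k \<psi> x s = dirac (dirac (drop k s), pt x (\<psi> (dirac (take (Suc k) s))))"

text \<open>Two linear extensions are nested: a representative is a finite combination of pairs, and
  the chain in each pair is a finite combination of tuples. The result is exactly linear in the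
  chain entry, but linear in the coefficient only modulo \<open>chain_rels\<close>.\<close>

definition cap_sum where
  "cap_sum k \<psi> c = lin_ext (\<lambda>(y, x). lin_ext (cap_rep k \<psi> x) y) c"

section \<open>The cap product on finite representatives and its Leibniz rule\<close>

lemma take_drop_tuples:
  assumes "s \<in> tuples G m" "k \<le> m"
  shows "take (Suc k) s \<in> tuples G k" "drop k s \<in> tuples G (m - k)"
  using assms by (auto simp: tuples_def dest: in_set_takeD in_set_dropD)

lemma linear_cochain_take:
  assumes "linear_cochain k \<psi>" "s \<in> tuples G m" "k \<le> m"
  shows "\<psi> (dirac (take (Suc k) s)) \<in> carrier V"
  using assms take_drop_tuples[OF assms(2,3)] by (simp add: linear_cochain_def)

lemma dirac_BC: "s \<in> tuples G m \<Longrightarrow> dirac s \<in> carrier (BC B G L m)"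
  using finsupp_BC[of m] by (auto simp: subset_iff)

lemmas rels = chain_rels_properties[OF E]
lemmas rels_subspace = fun_subspaceD[OF rels(4)]
lemmas E_relsD = bilinear_relsD[OF rels(1), unfolded function_spaceD[OF function_space_BC]]

lemma cap_rep_mem:
  assumes "linear_cochain k \<psi>" "s \<in> tuples G m" "k \<le> m" "x \<in> carrier D"
  shows "cap_rep k \<psi> x s \<in> carrier (chain_reps (m - k) E)"
  unfolding cap_rep_def
  by (intro dirac_bounded_l1 directed_bornology_BC born_moduleD(2)[OF E] dirac_BC pt_rels(1)
      take_drop_tuples(2)[OF assms(2,3)] linear_cochain_take[OF assms(1-3)] assms(4))

lemma cap_rep_bilinear:
  assumes "linear_cochain k \<psi>" "s \<in> tuples G m" "k \<le> m" "x \<in> carrier D"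
  shows "x' \<in> carrier D \<Longrightarrow> cap_rep k \<psi> (x \<oplus>\<^bsub>D\<^esub> x') s - cap_rep k \<psi> x s - cap_rep k \<psi> x' s \<in> chain_rels (m - k) E"
    "cap_rep k \<psi> (z \<odot>\<^bsub>D\<^esub> x) s - scl z (cap_rep k \<psi> x s) \<in> chain_rels (m - k) E"
proof -
  note v = linear_cochain_take[OF assms(1-3)]
  note s = dirac_BC[OF take_drop_tuples(2)[OF assms(2,3)]]
  show "cap_rep k \<psi> (x \<oplus>\<^bsub>D\<^esub> x') s - cap_rep k \<psi> x s - cap_rep k \<psi> x' s \<in> chain_rels (m - k) E"
    if "x' \<in> carrier D"
    unfolding cap_rep_def pt_rels(2)[OF assms(4) that v]
    by (intro E_relsD s pt_rels(1) assms(4) that v)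
  show "cap_rep k \<psi> (z \<odot>\<^bsub>D\<^esub> x) s - scl z (cap_rep k \<psi> x s) \<in> chain_rels (m - k) E"
    unfolding cap_rep_def pt_rels(4)[OF assms(4) v]
    by (intro E_relsD s pt_rels(1) assms(4) v)
qed

text \<open>A point mass at a chain differs from the combination of point masses at its tuples until
  relations are divided out. \<open>chain_bd\<close> produces the former, whereas the Leibniz rule
  compares individual faces.\<close>

lemma dirac_linear_left:
  assumes c: "c \<in> finsupp_funs (tuples G j)" and w: "w \<in> carrier E"
  shows "dirac (c, w) - lin_ext (\<lambda>s. dirac (dirac s, w)) c \<in> chain_rels j E"
proof (rule finsupp_induct[where P = "\<lambda>c. dirac (c, w) - lin_ext (\<lambda>s. dirac (dirac s, w)) c \<in> chain_rels j E", OF c])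
  show "dirac (0, w) - lin_ext (\<lambda>s. dirac (dirac s, w)) 0 \<in> chain_rels j E"
    using E_relsD(3)[of 0 j w 0] w fun_subspaceD(1)[OF function_spaceD(1)[OF function_space_BC]] by simp
  show "dirac (dirac s, w) - lin_ext (\<lambda>s. dirac (dirac s, w)) (dirac s) \<in> chain_rels j E" for s
    using rels_subspace(1) by simp
next
  fix c c' assume c: "c \<in> finsupp_funs (tuples G j)" "c' \<in> finsupp_funs (tuples G j)"
    "dirac (c, w) - lin_ext (\<lambda>s. dirac (dirac s, w)) c \<in> chain_rels j E"
    "dirac (c', w) - lin_ext (\<lambda>s. dirac (dirac s, w)) c' \<in> chain_rels j E"
  have "dirac (c + c', w) - dirac (c, w) - dirac (c', w) \<in> chain_rels j E"
    using E_relsD(1)[of c j c' w] c finsupp_BC[of j] w by blast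
  from rels_subspace(2)[OF rels_subspace(2)[OF this c(3)] c(4)]
  show "dirac (c + c', w) - lin_ext (\<lambda>s. dirac (dirac s, w)) (c + c') \<in> chain_rels j E"
    unfolding lin_ext_add[OF c(1,2)] by (simp add: algebra_simps)
next
  fix a c assume c: "c \<in> finsupp_funs (tuples G j)"
    "dirac (c, w) - lin_ext (\<lambda>s. dirac (dirac s, w)) c \<in> chain_rels j E"
  have "dirac (scl a c, w) - scl a (dirac (c, w)) \<in> chain_rels j E"
    using E_relsD(3)[of c j w a] c finsupp_BC[of j] w by blast
  from rels_subspace(2)[OF this rels_subspace(3)[OF c(2), of a]]
  show "dirac (scl a c, w) - lin_ext (\<lambda>s. dirac (dirac s, w)) (scl a c) \<in> chain_rels j E"
    unfolding lin_ext_scl[OF c(1)] scl_diff by (simp add: algebra_simps)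
qed

text \<open>The same correction for the coefficient entry, where \<psi> of a boundary has to be
  spread over the faces. For the zero chain, \<open>pt x (\<psi> 0)\<close> is its own multiple by
  0, so the point mass is itself a homogeneity relation.\<close>

lemma dirac_linear_right:
  assumes \<psi>: "linear_cochain k \<psi>" and c: "c \<in> finsupp_funs (tuples G k)" and x: "x \<in> carrier D"
    and y: "y \<in> carrier (BC B G L j)"
  shows "dirac (y, pt x (\<psi> c)) - lin_ext (\<lambda>t. dirac (y, pt x (\<psi> (dirac t)))) c \<in> chain_rels j E"
proof (rule finsupp_induct[where P = "\<lambda>c. dirac (y, pt x (\<psi> c)) -
      lin_ext (\<lambda>t. dirac (y, pt x (\<psi> (dirac t)))) c \<in> chain_rels j E", OF c])
  note psi = \<psi>[unfolded linear_cochain_def]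
  have z: "0 \<in> finsupp_funs (tuples G k)" by (rule fun_subspaceD(1)[OF fun_subspace_finsupp])
  have v: "\<psi> 0 \<in> carrier V" using psi z by blast
  have "\<psi> (scl 0 0) = 0 \<odot>\<^bsub>V\<^esub> \<psi> 0" using psi z by blast
  then have "0 \<odot>\<^bsub>V\<^esub> \<psi> 0 = \<psi> 0" by simp
  then have e: "0 \<odot>\<^bsub>E\<^esub> pt x (\<psi> 0) = pt x (\<psi> 0)" using pt_rels(5)[OF x v, of 0] by simp
  show "dirac (y, pt x (\<psi> 0)) - lin_ext (\<lambda>t. dirac (y, pt x (\<psi> (dirac t)))) 0 \<in> chain_rels j E"
    using E_relsD(4)[OF y pt_rels(1)[OF x v], of 0] unfolding e by simp
  show "dirac (y, pt x (\<psi> (dirac t))) - lin_ext (\<lambda>t. dirac (y, pt x (\<psi> (dirac t)))) (dirac t) \<in> chain_rels j E" for t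
    using rels_subspace(1) by simp
next
  note psi = \<psi>[unfolded linear_cochain_def]
  let ?l = "lin_ext (\<lambda>t. dirac (y, pt x (\<psi> (dirac t))))"
  fix c c' assume c: "c \<in> finsupp_funs (tuples G k)" "c' \<in> finsupp_funs (tuples G k)"
    "dirac (y, pt x (\<psi> c)) - ?l c \<in> chain_rels j E" "dirac (y, pt x (\<psi> c')) - ?l c' \<in> chain_rels j E"
  have v: "\<psi> c \<in> carrier V" "\<psi> c' \<in> carrier V" "\<psi> (c + c') = \<psi> c \<oplus>\<^bsub>V\<^esub> \<psi> c'" using psi c(1,2) by auto
  have "dirac (y, pt x (\<psi> (c + c'))) - dirac (y, pt x (\<psi> c)) - dirac (y, pt x (\<psi> c')) \<in> chain_rels j E"
    unfolding v(3) pt_rels(3)[OF x v(1,2)] by (intro E_relsD y pt_rels(1) x v)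
  from rels_subspace(2)[OF rels_subspace(2)[OF this c(3)] c(4)]
  show "dirac (y, pt x (\<psi> (c + c'))) - ?l (c + c') \<in> chain_rels j E"
    unfolding lin_ext_add[OF c(1,2)] by (simp add: algebra_simps)
next
  note psi = \<psi>[unfolded linear_cochain_def]
  let ?l = "lin_ext (\<lambda>t. dirac (y, pt x (\<psi> (dirac t))))"
  fix a c assume c: "c \<in> finsupp_funs (tuples G k)" "dirac (y, pt x (\<psi> c)) - ?l c \<in> chain_rels j E"
  have v: "\<psi> c \<in> carrier V" "\<psi> (scl a c) = a \<odot>\<^bsub>V\<^esub> \<psi> c" using psi c(1) by auto
  have "dirac (y, pt x (\<psi> (scl a c))) - scl a (dirac (y, pt x (\<psi> c))) \<in> chain_rels j E"
    unfolding v(2) pt_rels(5)[OF x v(1)] by (intro E_relsD y pt_rels(1) x v)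
  from rels_subspace(2)[OF this rels_subspace(3)[OF c(2), of a]]
  show "dirac (y, pt x (\<psi> (scl a c))) - ?l (scl a c) \<in> chain_rels j E"
    unfolding lin_ext_scl[OF c(1)] scl_diff by (simp add: algebra_simps)
qed

text \<open>The faces of \<open>s\<close> split into faces of the front part, the terms
  \<open>A\<close>, and faces of the back part, the terms \<open>C\<close>. The coboundary
  contributes one extra \<open>A\<close> and the boundary one extra \<open>C\<close>; these two
  coincide and carry opposite signs.\<close>

lemma cap_rep_leibniz:
  assumes \<psi>: "linear_cochain k \<psi>" and s: "s \<in> tuples G (Suc m)" and k: "k \<le> m" and x: "x \<in> carrier D"
  shows "lin_ext (cap_rep k \<psi> x) (bar_bd (Suc m) (dirac s)) -
     (cap_rep (Suc k) (\<lambda>c. \<psi> (bar_bd (Suc k) c)) x s +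
      scl ((-1) ^ k) (chain_bd (Suc (m - k)) (cap_rep k \<psi> x s))) \<in> chain_rels (m - k) E"
proof -
  let ?R = "chain_rels (m - k) E"
  let ?\<tau> = "drop (Suc k) s" and ?d = "drop k s" and ?t = "take (Suc (Suc k)) s"
  define w where "w = pt x (\<psi> (dirac (take (Suc k) s)))"
  have len: "length s = Suc (Suc m)" using s by (simp add: tuples_def)
  have w: "w \<in> carrier E" unfolding w_def using linear_cochain_take[OF \<psi> s] k by (intro pt_rels(1) x) simp
  have \<tau>: "dirac ?\<tau> \<in> carrier (BC B G L (m - k))"
    using take_drop_tuples(2)[OF s, of "Suc k"] k by (intro dirac_BC) simp
  have t: "?t \<in> tuples G (Suc k)" using take_drop_tuples(1)[OF s, of "Suc k"] k by simp
  have d: "?d \<in> tuples G (Suc (m - k))" using take_drop_tuples(2)[OF s, of k] k by (simp add: Suc_diff_le)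
  define A where "A j = dirac (dirac ?\<tau>, pt x (\<psi> (dirac (face j ?t))))" for j
  define C where "C i = dirac (dirac (face i ?d), w)" for i
  \<comment> \<open>\<open>cap_rep\<close> puts \<psi> of the whole boundary of the front part into
    one coefficient; linearity of \<psi> distributes it over the faces, modulo relations.\<close>
  have 1: "cap_rep (Suc k) (\<lambda>c. \<psi> (bar_bd (Suc k) c)) x s - (\<Sum>j\<le>Suc k. scl ((-1) ^ j) (A j)) \<in> ?R"
  proof -
    have "dirac (dirac ?\<tau>, pt x (\<psi> (bar_bd (Suc k) (dirac ?t)))) -
        lin_ext (\<lambda>t'. dirac (dirac ?\<tau>, pt x (\<psi> (dirac t')))) (bar_bd (Suc k) (dirac ?t)) \<in> ?R"
      using t by (intro dirac_linear_right[OF \<psi> _ x \<tau>] bar_bd_finsupp) simp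
    moreover have "lin_ext (\<lambda>t'. dirac (dirac ?\<tau>, pt x (\<psi> (dirac t')))) (bar_bd (Suc k) (dirac ?t)) =
        (\<Sum>j\<le>Suc k. scl ((-1) ^ j) (A j))"
      unfolding bar_bd_dirac A_def
      by (subst lin_ext_sum[where X = "tuples G k"]) (use face_tuples[OF t] in auto)
    ultimately show ?thesis by (simp only: cap_rep_def)
  qed
  have 2: "chain_bd (Suc (m - k)) (cap_rep k \<psi> x s) - (\<Sum>i\<le>Suc (m - k). scl ((-1) ^ i) (C i)) \<in> ?R"
  proof -
    have "dirac (bar_bd (Suc (m - k)) (dirac ?d), w) -
        lin_ext (\<lambda>s. dirac (dirac s, w)) (bar_bd (Suc (m - k)) (dirac ?d)) \<in> ?R"
      using d by (intro dirac_linear_left w bar_bd_finsupp) simp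
    moreover have "lin_ext (\<lambda>s. dirac (dirac s, w)) (bar_bd (Suc (m - k)) (dirac ?d)) =
        (\<Sum>i\<le>Suc (m - k). scl ((-1) ^ i) (C i))"
      unfolding bar_bd_dirac C_def
      by (subst lin_ext_sum[where X = "tuples G (m - k)"]) (use face_tuples[OF d] in auto)
    ultimately show ?thesis by (simp only: cap_rep_def pushforward_dirac map_prod_simp id_apply w_def)
  qed
  have "lin_ext (cap_rep k \<psi> x) (bar_bd (Suc m) (dirac s)) =
      (\<Sum>j\<le>Suc m. scl ((-1) ^ j) (cap_rep k \<psi> x (face j s)))"
    unfolding bar_bd_dirac
    by (subst lin_ext_sum[where X = "tuples G m"]) (use face_tuples[OF s] in auto)
  also have "\<dots> = (\<Sum>j\<le>k + Suc (m - k). scl ((-1) ^ j) (cap_rep k \<psi> x (face j s)))"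
    using k by simp
  also have "\<dots> = (\<Sum>j\<le>Suc k. scl ((-1) ^ j) (A j)) + scl ((-1) ^ k) (\<Sum>i\<le>Suc (m - k). scl ((-1) ^ i) (C i))"
  proof (rule alternating_sum_split)
    show "cap_rep k \<psi> x (face j s) = A j" if "j \<le> k" for j
      using that k face_take_drop(1,2)[OF len, of j k] by (simp add: cap_rep_def A_def)
    show "cap_rep k \<psi> x (face (k + i) s) = C i" if "1 \<le> i" "i \<le> Suc (m - k)" for i
      using that k face_take_drop(3,4)[OF len, of k "k + i"] by (simp add: cap_rep_def C_def w_def)
    show "A (Suc k) = C 0"
      using k face_take_drop(5,6)[OF len, of k] by (simp add: A_def C_def w_def)
  qed
  finally have eq: "lin_ext (cap_rep k \<psi> x) (bar_bd (Suc m) (dirac s)) =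
    (\<Sum>j\<le>Suc k. scl ((-1) ^ j) (A j)) + scl ((-1) ^ k) (\<Sum>i\<le>Suc (m - k). scl ((-1) ^ i) (C i))" .
  have "- ((cap_rep (Suc k) (\<lambda>c. \<psi> (bar_bd (Suc k) c)) x s - (\<Sum>j\<le>Suc k. scl ((-1) ^ j) (A j))) +
     scl ((-1) ^ k) (chain_bd (Suc (m - k)) (cap_rep k \<psi> x s) - (\<Sum>i\<le>Suc (m - k). scl ((-1) ^ i) (C i)))) \<in> ?R"
    by (intro rels_subspace(2,3,4) 1 2)
  then show ?thesis
    unfolding eq scl_diff by (simp add: algebra_simps)
qed

text \<open>The defect \<open>F\<close> of the Leibniz rule is linear in \<open>y\<close>, so it
  lies in the relations as soon as it does so at tuples.\<close>

lemma lin_ext_pushforward_leibniz: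
  assumes \<psi>: "linear_cochain k \<psi>" and k: "k \<le> m" and x: "x \<in> carrier D"
    and y: "y \<in> finsupp_funs (tuples G (Suc m))"
  shows "lin_ext (cap_rep k \<psi> x) (bar_bd (Suc m) y) -
     (lin_ext (cap_rep (Suc k) (\<lambda>c. \<psi> (bar_bd (Suc k) c)) x) y +
      scl ((-1) ^ k) (chain_bd (Suc (m - k)) (lin_ext (cap_rep k \<psi> x) y))) \<in> chain_rels (m - k) E"
proof -
  let ?R = "chain_rels (m - k) E"
  define F where "F y = lin_ext (cap_rep k \<psi> x) (bar_bd (Suc m) y) -
    (lin_ext (cap_rep (Suc k) (\<lambda>c. \<psi> (bar_bd (Suc k) c)) x) y +
     scl ((-1) ^ k) (chain_bd (Suc (m - k)) (lin_ext (cap_rep k \<psi> x) y)))" for y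
  have "F y \<in> ?R"
  proof (rule finsupp_induct[where P = "\<lambda>y. F y \<in> ?R", OF y])
    have l1: "l1 (lin_ext (cap_rep k \<psi> x) y)" if "y \<in> finsupp_funs (tuples G (Suc m))" for y
    proof -
      have "lin_ext (cap_rep k \<psi> x) y \<in> carrier (chain_reps (Suc m - k) E)"
        by (rule lin_ext_mem[OF that function_spaceD(1)[OF function_space_chain_reps[OF E]]])
          (use \<psi> k x in \<open>auto intro: cap_rep_mem\<close>)
      then show ?thesis by (rule bounded_l1_l1)
    qed
    have "F 0 = 0" unfolding F_def bar_bd_zero lin_ext_zero pushforward_zero by simp
    then show "F 0 \<in> ?R" using rels_subspace(1)[of "m - k"] by metis
    show "F (dirac s) \<in> ?R" if "s \<in> tuples G (Suc m)" for s
      unfolding F_def lin_ext_dirac by (rule cap_rep_leibniz[OF \<psi> that k x])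
    show "F (y + y') \<in> ?R"
      if y: "y \<in> finsupp_funs (tuples G (Suc m))" "y' \<in> finsupp_funs (tuples G (Suc m))"
        "F y \<in> ?R" "F y' \<in> ?R" for y y'
    proof -
      have "F (y + y') = F y + F y'"
        unfolding F_def bar_bd_add[OF l1_finsupp[OF y(1)] l1_finsupp[OF y(2)]]
          lin_ext_add[OF bar_bd_finsupp[OF y(1)] bar_bd_finsupp[OF y(2)]] lin_ext_add[OF y(1,2)]
          pushforward_add[OF l1[OF y(1)] l1[OF y(2)]] scl_add
        by (simp add: algebra_simps)
      then show ?thesis using rels_subspace(2)[OF y(3,4)] by simp
    qed
    show "F (scl a y) \<in> ?R" if y: "y \<in> finsupp_funs (tuples G (Suc m))" "F y \<in> ?R" for a y
    proof -
      have "F (scl a y) = scl a (F y)"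
        unfolding F_def bar_bd_scl lin_ext_scl[OF bar_bd_finsupp[OF y(1)]] lin_ext_scl[OF y(1)]
          pushforward_scl scl_diff scl_add by (simp add: mult.commute)
      then show ?thesis using rels_subspace(3)[OF y(2), of a] by simp
    qed
  qed
  then show ?thesis by (simp only: F_def)
qed

lemma cap_sum_dirac: "cap_sum k \<psi> (dirac (y, x)) = lin_ext (cap_rep k \<psi> x) y"
  by (simp add: cap_sum_def)

abbreviation alg_chains where
  "alg_chains m \<equiv> finsupp_funs (finsupp_funs (tuples G m) \<times> carrier D)"

lemma cap_sum_mem:
  assumes "linear_cochain k \<psi>" "k \<le> m" "c \<in> alg_chains m"
  shows "cap_sum k \<psi> c \<in> carrier (chain_reps (m - k) E)"
proof -
  note Y = function_spaceD(1)[OF function_space_chain_reps[OF E]]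
  show ?thesis
    unfolding cap_sum_def
  proof (rule lin_ext_mem[OF assms(3) Y])
    fix p assume "p \<in> finsupp_funs (tuples G m) \<times> carrier D"
    then obtain y x where p: "p = (y, x)" "y \<in> finsupp_funs (tuples G m)" "x \<in> carrier D" by blast
    have "lin_ext (cap_rep k \<psi> x) y \<in> carrier (chain_reps (m - k) E)"
      by (rule lin_ext_mem[OF p(2) Y]) (rule cap_rep_mem[OF assms(1) _ assms(2) p(3)])
    then show "(case p of (y, x) \<Rightarrow> lin_ext (cap_rep k \<psi> x) y) \<in> carrier (chain_reps (m - k) E)"
      by (simp add: p)
  qed
qed

lemma chain_bd_alg_chains:
  "c \<in> alg_chains (Suc m) \<Longrightarrow> chain_bd (Suc m) c \<in> alg_chains m"
  by (erule pushforward_finsupp) (auto intro: bar_bd_finsupp)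

text \<open>The same argument for the outer extension: the defect is linear in \<open>c\<close>, and
  at a point mass it is the defect of \<open>lin_ext_pushforward_leibniz\<close>.\<close>

lemma cap_sum_leibniz:
  assumes \<psi>: "linear_cochain k \<psi>" and k: "k \<le> m" and c: "c \<in> alg_chains (Suc m)"
  shows "cap_sum k \<psi> (chain_bd (Suc m) c) -
     (cap_sum (Suc k) (\<lambda>c. \<psi> (bar_bd (Suc k) c)) c +
      scl ((-1) ^ k) (chain_bd (Suc (m - k)) (cap_sum k \<psi> c))) \<in> chain_rels (m - k) E"
proof -
  let ?R = "chain_rels (m - k) E"
  define F where "F c = cap_sum k \<psi> (chain_bd (Suc m) c) -
    (cap_sum (Suc k) (\<lambda>c. \<psi> (bar_bd (Suc k) c)) c +
     scl ((-1) ^ k) (chain_bd (Suc (m - k)) (cap_sum k \<psi> c)))" for c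
  have "F c \<in> ?R"
  proof (rule finsupp_induct[where P = "\<lambda>c. F c \<in> ?R", OF c])
    have l1: "l1 (cap_sum k \<psi> c)" if "c \<in> alg_chains (Suc m)" for c
      by (rule bounded_l1_l1[OF cap_sum_mem[OF \<psi> le_SucI[OF k] that]])
    have "F 0 = 0" unfolding F_def cap_sum_def lin_ext_zero pushforward_zero by simp
    then show "F 0 \<in> ?R" using rels_subspace(1)[of "m - k"] by metis
    show "F (dirac p) \<in> ?R" if "p \<in> finsupp_funs (tuples G (Suc m)) \<times> carrier D" for p
      using that lin_ext_pushforward_leibniz[OF \<psi> k] by (auto simp: cap_sum_dirac F_def)
    show "F (y + y') \<in> ?R"
      if y: "y \<in> alg_chains (Suc m)" "y' \<in> alg_chains (Suc m)" "F y \<in> ?R" "F y' \<in> ?R" for y y'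
    proof -
      have "F (y + y') = F y + F y'"
        using pushforward_add[OF l1[OF y(1)] l1[OF y(2)], of "map_prod (bar_bd (Suc (m - k))) id"]
        unfolding F_def pushforward_add[OF l1_finsupp[OF y(1)] l1_finsupp[OF y(2)]] cap_sum_def
          lin_ext_add[OF chain_bd_alg_chains[OF y(1)] chain_bd_alg_chains[OF y(2)]] lin_ext_add[OF y(1,2)]
        by (simp add: scl_add algebra_simps)
      then show ?thesis using rels_subspace(2)[OF y(3,4)] by simp
    qed
    show "F (scl a y) \<in> ?R" if y: "y \<in> alg_chains (Suc m)" "F y \<in> ?R" for a y
    proof -
      have "F (scl a y) = scl a (F y)"
        unfolding F_def pushforward_scl cap_sum_def lin_ext_scl[OF chain_bd_alg_chains[OF y(1)]]
          lin_ext_scl[OF y(1)] scl_diff scl_add by (simp add: pushforward_scl mult.commute)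
      then show ?thesis using rels_subspace(3)[OF y(2), of a] by simp
    qed
  qed
  then show ?thesis by (simp only: F_def)
qed

section \<open>Ordinary chains and their relations\<close>

lemma function_space_alg_reps: "function_space (fun_space (alg_chains m))"
  by (simp add: fun_subspace_finsupp)

lemma C_alg_simps: "add (C_alg G m) = (+)" "smult (C_alg G m) = scl"
  using function_space_C_alg[of m] by (simp_all add: function_space_def)

lemma finsupp_chain_ract:
  assumes "f \<in> group_algebra G" "c \<in> finsupp_funs (tuples G m)"
  shows "chain_ract G c f \<in> finsupp_funs (tuples G m)"
proof -
  have "(\<lambda>g. if g \<in> carrier G then f (inv g) else 0) \<in> group_algebra G"
  proof -
    have "{g. (if g \<in> carrier G then f (inv g) else 0) \<noteq> 0} \<subseteq> m_inv G ` {g. f g \<noteq> 0}"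
    proof
      fix g assume "g \<in> {g. (if g \<in> carrier G then f (inv g) else 0) \<noteq> 0}"
      then have "g \<in> carrier G" "f (inv g) \<noteq> 0" by (auto split: if_splits)
      then show "g \<in> m_inv G ` {g. f g \<noteq> 0}" by (intro image_eqI[of _ _ "inv g"]) auto
    qed
    moreover have "finite (m_inv G ` {g. f g \<noteq> 0})" using assms(1) by (simp add: finsupp_funs_def)
    ultimately show ?thesis unfolding finsupp_funs_def by (auto intro: finite_subset split: if_splits)
  qed
  then show ?thesis unfolding chain_ract_def by (rule finsupp_chain_act[OF _ assms(2)])
qed

lemma bilinear_rels_alg_chains: "bilinear_rels (C_alg G m) D \<subseteq> alg_chains m"
proof
  fix r assume r: "r \<in> bilinear_rels (C_alg G m) D"
  note A = fun_subspaceD[OF fun_subspace_finsupp[of "finsupp_funs (tuples G m) \<times> carrier D"]]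
  note F = fun_subspaceD[OF fun_subspace_finsupp[of "tuples G m"]]
  note v = vector_space_simps[OF born_moduleD(1)[OF D]]
  from r show "r \<in> alg_chains m"
  proof (cases rule: bilinear_rels_cases)
    case (add1 x x' y)
    then show ?thesis unfolding add1(4) C_alg_simps carrier_C_alg
      by (intro A(5)) (use F in auto)
  next
    case (add2 x y y')
    then show ?thesis unfolding add2(4) C_alg_simps carrier_C_alg
      by (intro A(5)) (use v in auto)
  next
    case (scl1 z x y)
    then show ?thesis unfolding scl1(3) C_alg_simps carrier_C_alg
      by (intro A(3,5)) (use F in auto)
  next
    case (scl2 z x y)
    then show ?thesis unfolding scl2(3) C_alg_simps carrier_C_alg
      by (intro A(3,5)) (use v in auto)
  qed
qed

lemma CG_rels_alg_chains: "CG_rels G D m \<subseteq> alg_chains m"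
proof
  fix r assume "r \<in> CG_rels G D m"
  then obtain f y x where r: "r = dirac (chain_ract G y f, x) - dirac (y, act D f x)"
    and f: "f \<in> group_algebra G" "y \<in> finsupp_funs (tuples G m)" "x \<in> carrier D"
    unfolding balanced_rels_def fun_diff_def carrier_C_alg by blast
  have "act D f x \<in> carrier D" using born_moduleD(3)[OF D _ f(3)] f(1) group_algebra_H_alg by blast
  then show "r \<in> alg_chains m"
    unfolding r using finsupp_chain_ract[OF f(1,2)] f
    by (intro fun_subspaceD(5)[OF fun_subspace_finsupp]) auto
qed

abbreviation alg_rels where
  "alg_rels m \<equiv> alg_tensor_rels (C_alg G m) D (CG_rels G D m)"

lemma alg_rels_properties:
  "bilinear_rels (C_alg G m) D \<subseteq> alg_rels m" "CG_rels G D m \<subseteq> alg_rels m"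
  "alg_rels m \<subseteq> alg_chains m" "fun_subspace (alg_rels m)"
  using vspan_properties[OF function_space_alg_reps[of m], of "bilinear_rels (C_alg G m) D \<union> CG_rels G D m"]
    bilinear_rels_alg_chains[of m] CG_rels_alg_chains[of m]
  unfolding alg_tensor_rels_def carrier_C_alg carrier_fun_space by blast+

text \<open>\<open>vspan\<close> compares with subspaces of the carrier, so \<open>K\<close> is
  first intersected with \<open>alg_chains\<close>; this lets \<open>K\<close> be a subspace of a
  larger space, such as \<open>chain_rels m D\<close>.\<close>

lemma alg_rels_minimal:
  assumes "fun_subspace K" "\<And>r. r \<in> bilinear_rels (C_alg G m) D \<Longrightarrow> r \<in> K"
    "\<And>f y x. f \<in> group_algebra G \<Longrightarrow> y \<in> finsupp_funs (tuples G m) \<Longrightarrow> x \<in> carrier D \<Longrightarrow>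
      dirac (chain_ract G y f, x) - dirac (y, act D f x) \<in> K"
  shows "alg_rels m \<subseteq> K"
proof -
  have "CG_rels G D m \<subseteq> K"
    unfolding balanced_rels_def carrier_C_alg using assms(3) unfolding fun_diff_def by blast
  then have "bilinear_rels (C_alg G m) D \<union> CG_rels G D m \<subseteq> alg_chains m \<inter> K"
    using assms(2) bilinear_rels_alg_chains[of m] CG_rels_alg_chains[of m] by blast
  then have "alg_rels m \<subseteq> alg_chains m \<inter> K"
    unfolding alg_tensor_rels_def carrier_C_alg
    by (intro vspan_minimal[OF function_space_alg_reps] fun_subspace_Int[OF fun_subspace_finsupp assms(1)]) auto
  then show ?thesis by blast
qed

text \<open>The group algebra lies inside \<open>H_alg\<close> and finite chains inside
  \<open>BC\<close>, so ordinary relations are instances of completed ones. This makes the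
  comparison map on chains well defined.\<close>

lemma alg_rels_chain_rels: "alg_rels m \<subseteq> chain_rels m D"
proof (rule alg_rels_minimal)
  show "fun_subspace (chain_rels m D)" by (rule chain_rels_properties(4)[OF D])
  have "bilinear_rels (C_alg G m) D \<subseteq> bilinear_rels (BC B G L m) D"
    by (rule bilinear_rels_mono)
      (use finsupp_BC function_space_BC[of m] in \<open>auto simp: C_alg_simps function_space_def\<close>)
  then show "r \<in> chain_rels m D" if "r \<in> bilinear_rels (C_alg G m) D" for r
    using that chain_rels_properties(1)[OF D] by blast
  show "dirac (chain_ract G y f, x) - dirac (y, act D f x) \<in> chain_rels m D"
    if "f \<in> group_algebra G" "y \<in> finsupp_funs (tuples G m)" "x \<in> carrier D" for f y x
  proof -
    have "dirac (chain_ract G y f, x) - dirac (y, act D f x) \<in> H_rels B G L D m"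
      unfolding balanced_rels_def fun_diff_def using that group_algebra_H_alg finsupp_BC[of m] by blast
    then show ?thesis using chain_rels_properties(2)[OF D] by blast
  qed
qed

lemma alg_chains_chain_reps: "alg_chains m \<subseteq> carrier (chain_reps m D)"
  by (rule finsupp_bounded_l1[OF directed_bornology_BC born_moduleD(2)[OF D] finsupp_BC order_refl])

lemma alg_chain_ract_eq:
  assumes "y \<in> finsupp_funs (tuples G m)"
  shows "chain_ract G y f = pushforward (\<lambda>(h, t). map (\<lambda>z. h \<otimes> z) t)
    (ext_prod (\<lambda>g. if g \<in> carrier G then f (inv g) else 0) y)"
  unfolding chain_ract_def
  by (rule chain_act_eq_pushforward[where n = m]) (use assms in \<open>auto simp: finsupp_funs_def\<close>)

lemma l1_inverse: "f \<in> group_algebra G \<Longrightarrow> l1 (\<lambda>g. if g \<in> carrier G then f (inv g) else 0)"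
  using group_algebra_H_alg by (intro l1_H_alg inverse_H_alg) blast

lemma chain_ract_add_right:
  assumes "f \<in> group_algebra G" "f' \<in> group_algebra G" "y \<in> finsupp_funs (tuples G m)"
  shows "chain_ract G y (f + f') = chain_ract G y f + chain_ract G y f'"
proof -
  have "ext_prod (\<lambda>g. if g \<in> carrier G then (f + f') (inv g) else 0) y =
      ext_prod (\<lambda>g. if g \<in> carrier G then f (inv g) else 0) y +
      ext_prod (\<lambda>g. if g \<in> carrier G then f' (inv g) else 0) y"
    by (auto simp: ext_prod_def fun_eq_iff algebra_simps)
  then show ?thesis
    unfolding alg_chain_ract_eq[OF assms(3)]
    by (simp only: pushforward_add[OF l1_ext_prod[OF l1_inverse[OF assms(1)] l1_finsupp[OF assms(3)]]
          l1_ext_prod[OF l1_inverse[OF assms(2)] l1_finsupp[OF assms(3)]]])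
qed

lemma chain_ract_scl_right:
  assumes "y \<in> finsupp_funs (tuples G m)"
  shows "chain_ract G y (scl a f) = scl a (chain_ract G y f)"
proof -
  have "ext_prod (\<lambda>g. if g \<in> carrier G then (scl a f) (inv g) else 0) y =
      scl a (ext_prod (\<lambda>g. if g \<in> carrier G then f (inv g) else 0) y)"
    by (auto simp: ext_prod_def fun_eq_iff algebra_simps)
  then show ?thesis unfolding alg_chain_ract_eq[OF assms] by (simp only: pushforward_scl)
qed

lemma chain_ract_add_left:
  assumes "f \<in> group_algebra G" "y \<in> finsupp_funs (tuples G m)" "y' \<in> finsupp_funs (tuples G m)"
  shows "chain_ract G (y + y') f = chain_ract G y f + chain_ract G y' f"
  unfolding alg_chain_ract_eq[OF assms(2)] alg_chain_ract_eq[OF assms(3)]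
    alg_chain_ract_eq[OF fun_subspaceD(2)[OF fun_subspace_finsupp assms(2,3)]] ext_prod_add
  by (intro pushforward_add l1_ext_prod l1_inverse assms(1) l1_finsupp[OF assms(2)] l1_finsupp[OF assms(3)])

lemma chain_ract_scl_left:
  assumes "y \<in> finsupp_funs (tuples G m)"
  shows "chain_ract G (scl a y) f = scl a (chain_ract G y f)"
  unfolding alg_chain_ract_eq[OF assms] alg_chain_ract_eq[OF fun_subspaceD(3)[OF fun_subspace_finsupp assms]]
    ext_prod_scl pushforward_scl ..

lemma chain_ract_dirac:
  assumes "g \<in> carrier G" "s \<in> tuples G m"
  shows "chain_ract G (dirac s) (dirac g) = dirac (map (\<lambda>y. inv g \<otimes> y) s)"
proof -
  have "(\<lambda>h. if h \<in> carrier G then dirac g (inv h) else 0) = dirac (inv g)"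
    using assms(1) by (auto simp: dirac_def fun_eq_iff)
  then show ?thesis
    unfolding chain_ract_def using chain_act_dirac[OF inv_closed[OF assms(1)] assms(2)] by simp
qed

text \<open>Cocycle representatives commute with the group action, so the algebraic cap product respects
  the balancing relations.\<close>

lemma cap_sum_alg_rels:
  assumes \<psi>: "linear_cochain k \<psi>" and k: "k \<le> m" and c: "c \<in> alg_rels m"
    and eqv: "\<And>g t. g \<in> carrier G \<Longrightarrow> t \<in> tuples G k \<Longrightarrow>
      \<psi> (dirac (map (\<lambda>y. g \<otimes> y) t)) = act V (dirac g) (\<psi> (dirac t))"
  shows "cap_sum k \<psi> c \<in> chain_rels (m - k) E"
proof -
  let ?R = "chain_rels (m - k) E"
  let ?l = "\<lambda>x. lin_ext (cap_rep k \<psi> x)"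
  note v = vector_space_simps[OF born_moduleD(1)[OF D]]
  have dH: "dirac g \<in> carrier (H_alg B G L)" if "g \<in> carrier G" for g
    using group_algebra_H_alg that by (simp add: subset_iff)
  note adds = cap_rep_bilinear(1)[OF \<psi> _ k] and scls = cap_rep_bilinear(2)[OF \<psi> _ k]
  \<comment> \<open>In the chain entry the cap formula is exactly additive; in the coefficient from
    \<open>D\<close> additivity holds only modulo relations and has to be carried along.\<close>
  have l_add: "?l (x \<oplus>\<^bsub>D\<^esub> x') y - ?l x y - ?l x' y \<in> ?R"
    if y: "y \<in> finsupp_funs (tuples G m)" and x: "x \<in> carrier D" "x' \<in> carrier D" for x x' y
  proof (rule finsupp_induct[where P = "\<lambda>y. ?l (x \<oplus>\<^bsub>D\<^esub> x') y - ?l x y - ?l x' y \<in> ?R", OF y])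
    show "?l (x \<oplus>\<^bsub>D\<^esub> x') 0 - ?l x 0 - ?l x' 0 \<in> ?R"
      unfolding lin_ext_zero diff_zero by (rule rels_subspace(1))
    show "?l (x \<oplus>\<^bsub>D\<^esub> x') (dirac s) - ?l x (dirac s) - ?l x' (dirac s) \<in> ?R" if "s \<in> tuples G m" for s
      unfolding lin_ext_dirac by (rule adds[OF that x])
    fix y y' assume y: "y \<in> finsupp_funs (tuples G m)" "y' \<in> finsupp_funs (tuples G m)"
      "?l (x \<oplus>\<^bsub>D\<^esub> x') y - ?l x y - ?l x' y \<in> ?R" "?l (x \<oplus>\<^bsub>D\<^esub> x') y' - ?l x y' - ?l x' y' \<in> ?R"
    show "?l (x \<oplus>\<^bsub>D\<^esub> x') (y + y') - ?l x (y + y') - ?l x' (y + y') \<in> ?R"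
      using rels_subspace(2)[OF y(3,4)] unfolding lin_ext_add[OF y(1,2)] by (simp add: algebra_simps)
  next
    fix a y assume y: "y \<in> finsupp_funs (tuples G m)" "?l (x \<oplus>\<^bsub>D\<^esub> x') y - ?l x y - ?l x' y \<in> ?R"
    show "?l (x \<oplus>\<^bsub>D\<^esub> x') (scl a y) - ?l x (scl a y) - ?l x' (scl a y) \<in> ?R"
      using rels_subspace(3)[OF y(2), of a] unfolding lin_ext_scl[OF y(1)] scl_diff .
  qed
  have l_scl: "?l (z \<odot>\<^bsub>D\<^esub> x) y - scl z (?l x y) \<in> ?R"
    if y: "y \<in> finsupp_funs (tuples G m)" and x: "x \<in> carrier D" for x z y
  proof (rule finsupp_induct[where P = "\<lambda>y. ?l (z \<odot>\<^bsub>D\<^esub> x) y - scl z (?l x y) \<in> ?R", OF y])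
    show "?l (z \<odot>\<^bsub>D\<^esub> x) 0 - scl z (?l x 0) \<in> ?R"
      unfolding lin_ext_zero diff_zero scl_simps(2) by (rule rels_subspace(1))
    show "?l (z \<odot>\<^bsub>D\<^esub> x) (dirac s) - scl z (?l x (dirac s)) \<in> ?R" if "s \<in> tuples G m" for s
      unfolding lin_ext_dirac by (rule scls[OF that x])
    fix y y' assume y: "y \<in> finsupp_funs (tuples G m)" "y' \<in> finsupp_funs (tuples G m)"
      "?l (z \<odot>\<^bsub>D\<^esub> x) y - scl z (?l x y) \<in> ?R" "?l (z \<odot>\<^bsub>D\<^esub> x) y' - scl z (?l x y') \<in> ?R"
    show "?l (z \<odot>\<^bsub>D\<^esub> x) (y + y') - scl z (?l x (y + y')) \<in> ?R"
      using rels_subspace(2)[OF y(3,4)] unfolding lin_ext_add[OF y(1,2)] scl_add by (simp add: algebra_simps)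
  next
    fix a y assume y: "y \<in> finsupp_funs (tuples G m)" "?l (z \<odot>\<^bsub>D\<^esub> x) y - scl z (?l x y) \<in> ?R"
    show "?l (z \<odot>\<^bsub>D\<^esub> x) (scl a y) - scl z (?l x (scl a y)) \<in> ?R"
      using rels_subspace(3)[OF y(2), of a] unfolding lin_ext_scl[OF y(1)] scl_diff scl_simps(4) mult.commute[of z] .
  qed
  \<comment> \<open>The right action of \<open>g\<close> translates tuples by \<open>inv g\<close>.
    Equivariance of \<psi> turns its value at the moved front part into \<open>inv g\<close> acting
    on \<open>u\<close>. The diagonal action of \<open>g\<close> sends \<open>w\<close>, the tensor
    of \<open>x\<close> with this value, to the tensor of \<open>g\<close> acting on
    \<open>x\<close> with \<open>u\<close>; hence a single balancing relation of \<open>E\<close>,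
    taken at \<open>w\<close>, joins the two sides.\<close>
  have translate: "cap_rep k \<psi> x (map (\<lambda>y. inv g \<otimes> y) s) - cap_rep k \<psi> (act D (dirac g) x) s \<in> ?R"
    if g: "g \<in> carrier G" and s: "s \<in> tuples G m" and x: "x \<in> carrier D" for g s x
  proof -
    define u where "u = \<psi> (dirac (take (Suc k) s))"
    have u: "u \<in> carrier V" unfolding u_def by (rule linear_cochain_take[OF \<psi> s k])
    define w where "w = pt x (act V (dirac (inv g)) u)"
    have au: "act V (dirac (inv g)) u \<in> carrier V" using born_moduleD(3)[OF V dH u] g by simp
    have w: "w \<in> carrier E" unfolding w_def by (rule pt_rels(1)[OF x au])
    have "\<psi> (dirac (take (Suc k) (map (\<lambda>y. inv g \<otimes> y) s))) = act V (dirac (inv g)) u"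
      unfolding take_map u_def using g take_drop_tuples(1)[OF s k] by (intro eqv) auto
    then have 1: "cap_rep k \<psi> x (map (\<lambda>y. inv g \<otimes> y) s) =
        dirac (dirac (map (\<lambda>y. inv g \<otimes> y) (drop k s)), w)"
      by (simp add: cap_rep_def w_def drop_map)
    have "act V (dirac g) (act V (dirac (inv g)) u) = u"
      using born_moduleD(6)[OF V g inv_closed[OF g] u] born_moduleD(7)[OF V u] g by simp
    then have 2: "cap_rep k \<psi> (act D (dirac g) x) s = dirac (dirac (drop k s), act E (dirac g) w)"
      unfolding w_def E_act[OF g x au] by (simp add: cap_rep_def u_def)
    have "chain_ract G (dirac (drop k s)) (dirac g) = dirac (map (\<lambda>y. inv g \<otimes> y) (drop k s))"
      by (rule chain_ract_dirac[OF g take_drop_tuples(2)[OF s k]])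
    then have "dirac (dirac (map (\<lambda>y. inv g \<otimes> y) (drop k s)), w) - dirac (dirac (drop k s), act E (dirac g) w)
        \<in> H_rels B G L E (m - k)"
      unfolding balanced_rels_def fun_diff_def mem_Collect_eq
      using dH[OF g] dirac_BC[OF take_drop_tuples(2)[OF s k]] w by metis
    then show ?thesis using rels(2) unfolding 1 2 by blast
  qed
  have actD: "act D f x \<in> carrier D" if "f \<in> group_algebra G" "x \<in> carrier D" for f x
    using born_moduleD(3)[OF D _ that(2)] that(1) group_algebra_H_alg by blast
  have balanced: "?l x (chain_ract G y f) - ?l (act D f x) y \<in> ?R"
    if f: "f \<in> group_algebra G" and y: "y \<in> finsupp_funs (tuples G m)" and x: "x \<in> carrier D" for f y x
  proof -
    note r_add1 = chain_ract_add_right and r_scl1 = chain_ract_scl_right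
    note r_add2 = chain_ract_add_left and r_scl2 = chain_ract_scl_left
    note r_dirac = chain_ract_dirac and r_fin = finsupp_chain_ract
    \<comment> \<open>First a fixed group element, by induction over the chain \<open>y\<close>; a
      second induction, over \<open>f\<close>, then passes from group elements to the group
      algebra.\<close>
    have gen: "?l x (chain_ract G y (dirac g)) - ?l (act D (dirac g) x) y \<in> ?R"
      if g: "g \<in> carrier G" for g
    proof (rule finsupp_induct[where P = "\<lambda>y. ?l x (chain_ract G y (dirac g)) - ?l (act D (dirac g) x) y \<in> ?R", OF y])
      have gf: "dirac g \<in> group_algebra G" using g by simp
      have z0: "0 \<in> finsupp_funs (tuples G m)" by (rule fun_subspaceD(1)[OF fun_subspace_finsupp])
      have "chain_ract G 0 (dirac g) = 0" using r_scl2[OF z0, of 0 "dirac g"] by simp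
      then show "?l x (chain_ract G 0 (dirac g)) - ?l (act D (dirac g) x) 0 \<in> ?R"
        using rels_subspace(1)[of "m - k"] by simp
      show "?l x (chain_ract G (dirac s) (dirac g)) - ?l (act D (dirac g) x) (dirac s) \<in> ?R"
        if s: "s \<in> tuples G m" for s
        unfolding r_dirac[OF g s] lin_ext_dirac by (rule translate[OF g s x])
      fix y y' assume y: "y \<in> finsupp_funs (tuples G m)" "y' \<in> finsupp_funs (tuples G m)"
        "?l x (chain_ract G y (dirac g)) - ?l (act D (dirac g) x) y \<in> ?R"
        "?l x (chain_ract G y' (dirac g)) - ?l (act D (dirac g) x) y' \<in> ?R"
      show "?l x (chain_ract G (y + y') (dirac g)) - ?l (act D (dirac g) x) (y + y') \<in> ?R"
        using rels_subspace(2)[OF y(3,4)]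
        unfolding r_add2[OF gf y(1,2)] lin_ext_add[OF y(1,2)] lin_ext_add[OF r_fin[OF gf y(1)] r_fin[OF gf y(2)]]
        by (simp add: algebra_simps)
    next
      have gf: "dirac g \<in> group_algebra G" using g by simp
      fix a y assume y: "y \<in> finsupp_funs (tuples G m)"
        "?l x (chain_ract G y (dirac g)) - ?l (act D (dirac g) x) y \<in> ?R"
      show "?l x (chain_ract G (scl a y) (dirac g)) - ?l (act D (dirac g) x) (scl a y) \<in> ?R"
        using rels_subspace(3)[OF y(2), of a]
        unfolding r_scl2[OF y(1)] lin_ext_scl[OF y(1)] lin_ext_scl[OF r_fin[OF gf y(1)]] scl_diff .
    qed
    have H: "f \<in> carrier (H_alg B G L)" if "f \<in> group_algebra G" for f
      using that group_algebra_H_alg by blast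
    show ?thesis
    proof (rule finsupp_induct[where P = "\<lambda>f. ?l x (chain_ract G y f) - ?l (act D f x) y \<in> ?R", OF f])
      have z0: "0 \<in> group_algebra G" by (rule fun_subspaceD(1)[OF fun_subspace_finsupp])
      \<comment> \<open>\<open>act D 0 x\<close> is its own multiple by 0, so homogeneity modulo
        relations puts its contribution into \<open>?R\<close>.\<close>
      have a0: "act D 0 x = 0 \<odot>\<^bsub>D\<^esub> act D 0 x" using born_moduleD(5)[OF D H[OF z0] x, of 0] by simp
      have "chain_ract G y 0 = 0" using r_scl1[OF y, of 0 0] by simp
      moreover have "?l (act D 0 x) y \<in> ?R"
        using l_scl[OF y actD[OF z0 x], of 0] a0[symmetric] by simp
      ultimately show "?l x (chain_ract G y 0) - ?l (act D 0 x) y \<in> ?R"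
        using rels_subspace(4)[of "?l (act D 0 x) y"] by simp
      show "?l x (chain_ract G y (dirac g)) - ?l (act D (dirac g) x) y \<in> ?R" if "g \<in> carrier G" for g
        by (rule gen[OF that])
      fix f f' assume f: "f \<in> group_algebra G" "f' \<in> group_algebra G"
        "?l x (chain_ract G y f) - ?l (act D f x) y \<in> ?R" "?l x (chain_ract G y f') - ?l (act D f' x) y \<in> ?R"
      have "?l x (chain_ract G y (f + f')) - ?l (act D (f + f') x) y =
          (?l x (chain_ract G y f) - ?l (act D f x) y) + (?l x (chain_ract G y f') - ?l (act D f' x) y) -
          (?l (act D f x \<oplus>\<^bsub>D\<^esub> act D f' x) y - ?l (act D f x) y - ?l (act D f' x) y)"
        unfolding r_add1[OF f(1,2) y] lin_ext_add[OF r_fin[OF f(1) y] r_fin[OF f(2) y]]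
          born_moduleD(4)[OF D H[OF f(1)] H[OF f(2)] x] by (simp add: algebra_simps)
      then show "?l x (chain_ract G y (f + f')) - ?l (act D (f + f') x) y \<in> ?R"
        using rels_subspace(5)[OF rels_subspace(2)[OF f(3,4)] l_add[OF y actD[OF f(1) x] actD[OF f(2) x]]] by metis
    next
      fix a f assume f: "f \<in> group_algebra G" "?l x (chain_ract G y f) - ?l (act D f x) y \<in> ?R"
      have "?l x (chain_ract G y (scl a f)) - ?l (act D (scl a f) x) y =
          scl a (?l x (chain_ract G y f) - ?l (act D f x) y) -
          (?l (a \<odot>\<^bsub>D\<^esub> act D f x) y - scl a (?l (act D f x) y))"
        unfolding r_scl1[OF y] lin_ext_scl[OF r_fin[OF f(1) y]] born_moduleD(5)[OF D H[OF f(1)] x] scl_diff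
        by (simp add: algebra_simps)
      then show "?l x (chain_ract G y (scl a f)) - ?l (act D (scl a f) x) y \<in> ?R"
        using rels_subspace(5)[OF rels_subspace(3)[OF f(2), of a] l_scl[OF y actD[OF f(1) x], of a]] by metis
    qed
  qed
  let ?K = "{c \<in> alg_chains m. cap_sum k \<psi> c \<in> ?R}"
  have "alg_rels m \<subseteq> ?K"
  proof (rule alg_rels_minimal)
    have add: "cap_sum k \<psi> (c + c') = cap_sum k \<psi> c + cap_sum k \<psi> c'"
      if "c \<in> alg_chains m" "c' \<in> alg_chains m" for c c'
      unfolding cap_sum_def by (rule lin_ext_add[OF that])
    have sc: "cap_sum k \<psi> (scl a c) = scl a (cap_sum k \<psi> c)" if "c \<in> alg_chains m" for a c
      unfolding cap_sum_def by (rule lin_ext_scl[OF that])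
    have z: "cap_sum k \<psi> 0 = 0" by (simp add: cap_sum_def)
    note A = fun_subspaceD[OF fun_subspace_finsupp[of "finsupp_funs (tuples G m) \<times> carrier D"]]
    show K: "fun_subspace ?K"
      unfolding fun_subspace_def
    proof (intro conjI ballI allI)
      show "0 \<in> ?K" using A(1) z rels_subspace(1)[of "m - k"] by simp
      show "c + c' \<in> ?K" if "c \<in> ?K" "c' \<in> ?K" for c c'
        using that A(2)[of c c'] add[of c c'] rels_subspace(2)[of "cap_sum k \<psi> c" "m - k" "cap_sum k \<psi> c'"] by simp
      show "scl a c \<in> ?K" if "c \<in> ?K" for a c
        using that A(3)[of c a] sc[of c a] rels_subspace(3)[of "cap_sum k \<psi> c" "m - k" a] by simp
    qed
    have diff: "cap_sum k \<psi> (c - c') = cap_sum k \<psi> c - cap_sum k \<psi> c'"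
      if "c \<in> alg_chains m" "c' \<in> alg_chains m" for c c'
      unfolding cap_sum_def by (rule lin_ext_diff[OF that])
    have da: "dirac (y, x) \<in> alg_chains m" if "y \<in> finsupp_funs (tuples G m)" "x \<in> carrier D" for y x
      using that by simp
    note F = fun_subspaceD[OF fun_subspace_finsupp[of "tuples G m"]]
    show "r \<in> ?K" if r: "r \<in> bilinear_rels (C_alg G m) D" for r
    proof -
      have "cap_sum k \<psi> r \<in> ?R"
        using r
      proof (cases rule: bilinear_rels_cases)
        case (add1 y y' x)
        note c = add1(1,2)[unfolded carrier_C_alg] add1(3)
        have "cap_sum k \<psi> r = 0"
          unfolding add1(4) C_alg_simps diff[OF A(5)[OF da[OF F(2)[OF c(1,2)] c(3)] da[OF c(1,3)]] da[OF c(2,3)]]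
            diff[OF da[OF F(2)[OF c(1,2)] c(3)] da[OF c(1,3)]] cap_sum_dirac lin_ext_add[OF c(1,2)] by simp
        then show ?thesis using rels_subspace(1) by metis
      next
        case (add2 y x x')
        note c = add2(1)[unfolded carrier_C_alg] add2(2,3)
        have xx: "x \<oplus>\<^bsub>D\<^esub> x' \<in> carrier D" by (rule v(3)[OF c(2,3)])
        show ?thesis
          unfolding add2(4) diff[OF A(5)[OF da[OF c(1) xx] da[OF c(1,2)]] da[OF c(1,3)]]
            diff[OF da[OF c(1) xx] da[OF c(1,2)]] cap_sum_dirac
          by (rule l_add[OF c])
      next
        case (scl1 z y x)
        note c = scl1(1)[unfolded carrier_C_alg] scl1(2)
        have "cap_sum k \<psi> r = 0"
          unfolding scl1(3) C_alg_simps diff[OF da[OF F(3)[OF c(1)] c(2)] A(3)[OF da[OF c]]] sc[OF da[OF c]]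
            cap_sum_dirac lin_ext_scl[OF c(1)] by simp
        then show ?thesis using rels_subspace(1) by metis
      next
        case (scl2 z y x)
        note c = scl2(1)[unfolded carrier_C_alg] scl2(2)
        show ?thesis
          unfolding scl2(3) diff[OF da[OF c(1) v(4)[OF c(2)]] A(3)[OF da[OF c]]] sc[OF da[OF c]] cap_sum_dirac
          by (rule l_scl[OF c])
      qed
      then show ?thesis using r bilinear_rels_alg_chains[of m] by blast
    qed
    show "dirac (chain_ract G y f, x) - dirac (y, act D f x) \<in> ?K"
      if f: "f \<in> group_algebra G" "y \<in> finsupp_funs (tuples G m)" "x \<in> carrier D" for f y x
    proof -
      note d = da[OF finsupp_chain_ract[OF f(1,2)] f(3)] da[OF f(2) actD[OF f(1,3)]]
      have "cap_sum k \<psi> (dirac (chain_ract G y f, x) - dirac (y, act D f x)) \<in> ?R"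
        unfolding diff[OF d] cap_sum_dirac by (rule balanced[OF f])
      then show ?thesis using A(5)[OF d] by blast
    qed
  qed
  with c show ?thesis by blast
qed

end

section \<open>The extended cap product on completed chains\<close>

context bounded_group
begin

lemma B_chains_vector_space:
  assumes M: "bornological_module (H_alg B G L) M" shows "vector_space_C (B_chains B G L M n)"
  unfolding B_chains_eq
  by (rule born_quotient_vector_space[OF function_space_chain_reps[OF M] chain_rels_properties(4)[OF M]])

abbreviation chain_class where
  "chain_class n M c \<equiv> chain_rels n M +>\<^bsub>chain_reps n M\<^esub> c"

lemma chain_class_simps:
  assumes M: "bornological_module (H_alg B G L) M"
  shows "chain_class n M c \<oplus>\<^bsub>B_chains B G L M n\<^esub> chain_class n M c' = chain_class n M (c + c')"
    "a \<odot>\<^bsub>B_chains B G L M n\<^esub> chain_class n M c = chain_class n M (scl a c)"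
    "chain_class n M c = chain_class n M c' \<longleftrightarrow> c - c' \<in> chain_rels n M"
    "carrier (B_chains B G L M n) = chain_class n M ` carrier (chain_reps n M)"
  unfolding B_chains_eq
  using born_quotient_add[OF function_space_chain_reps[OF M] chain_rels_properties(4)[OF M]]
    born_quotient_smult[OF function_space_chain_reps[OF M] chain_rels_properties(4)[OF M]]
    coset_eq_iff[OF function_space_chain_reps[OF M] chain_rels_properties(4)[OF M]]
  by (simp_all add: born_quotient_simps(1))

lemma B_cochainsD:
  assumes "\<phi> \<in> carrier (B_cochains B G L M n)"
  shows "\<phi> \<in> carrier (BC B G L n) \<rightarrow>\<^sub>E carrier M" "bdd_linear (BC B G L n) M \<phi>"
    "\<And>f c. f \<in> carrier (H_alg B G L) \<Longrightarrow> c \<in> carrier (BC B G L n) \<Longrightarrow> \<phi> (chain_act G f c) = act M f (\<phi> c)"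
proof -
  have p: "\<phi> \<in> bounded_lin_maps (BC B G L n) M"
    and e: "\<forall>f\<in>carrier (H_alg B G L). \<forall>c\<in>carrier (BC B G L n). \<phi> (chain_act G f c) = act M f (\<phi> c)"
    using assms by (simp_all add: B_cochains_def hom_space_def)
  show "\<phi> \<in> carrier (BC B G L n) \<rightarrow>\<^sub>E carrier M"
    using p by (simp add: bounded_lin_maps_def lin_maps_def)
  show "bdd_linear (BC B G L n) M \<phi>" by (rule bounded_lin_maps_bdd_linear[OF p])
  show "\<And>f c. f \<in> carrier (H_alg B G L) \<Longrightarrow> c \<in> carrier (BC B G L n) \<Longrightarrow> \<phi> (chain_act G f c) = act M f (\<phi> c)"
    using e by blast
qed

end

context cap_setting
begin

lemma B_cochains_linear_cochain:
  assumes "\<phi> \<in> carrier (B_cochains B G L V i)" shows "linear_cochain i \<phi>"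
  using B_cochainsD(2)[OF assms] finsupp_BC[of i]
  unfolding linear_cochain_def bdd_linear_def function_spaceD[OF function_space_BC]
  by (meson subsetD)

lemma is_capD:
  assumes "is_cap B G L D V m i \<phi> T"
  shows "bdd_linear (B_chains B G L D m) (B_chains B G L E (m - i)) T"
    "T \<in> carrier (B_chains B G L D m) \<rightarrow>\<^sub>E carrier (B_chains B G L E (m - i))"
    "s \<in> tuples G m \<Longrightarrow> x \<in> carrier D \<Longrightarrow>
      T (chain_class m D (dirac (dirac s, x))) = chain_class (m - i) E (cap_rep i \<phi> x s)"
proof -
  have T: "T \<in> bounded_lin_maps (B_chains B G L D m) (B_chains B G L E (m - i))"
    and p: "\<forall>s\<in>tuples G m. \<forall>x\<in>carrier D. T (B_pure B G L D m (dirac s) x) =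
      B_pure B G L E (m - i) (dirac (drop i s)) (pt x (\<phi> (dirac (take (Suc i) s))))"
    using assms unfolding is_cap_def by (rule conjunct1, rule conjunct2)
  show "bdd_linear (B_chains B G L D m) (B_chains B G L E (m - i)) T"
    by (rule bounded_lin_maps_bdd_linear[OF T])
  show "T \<in> carrier (B_chains B G L D m) \<rightarrow>\<^sub>E carrier (B_chains B G L E (m - i))"
    using T unfolding bounded_lin_maps_def lin_maps_def by blast
  show "T (chain_class m D (dirac (dirac s, x))) = chain_class (m - i) E (cap_rep i \<phi> x s)"
    if "s \<in> tuples G m" "x \<in> carrier D"
    using p[rule_format, OF that] unfolding pure_tensor_def cap_rep_def .
qed

text \<open>Existence is supplied by \<open>cap_extends\<close>. Uniqueness, which
  \<open>THE\<close> requires, comes from the density of pure tensors on the carrier and from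
  extensionality off it.\<close>

lemma cap_chain_is_cap:
  assumes \<phi>: "\<phi> \<in> carrier (B_cochains B G L V i)" and i: "i \<le> m"
  shows "is_cap B G L D V m i \<phi> (cap_chain B G L D V m i \<phi>)"
proof -
  have "\<exists>T. is_cap B G L D V m i \<phi> T"
    using conjunct2[OF iffD1[OF cap_extends_def cap_ext]] \<phi> i by blast
  then obtain T where T: "is_cap B G L D V m i \<phi> T" by blast
  have unique: "T' = T" if T': "is_cap B G L D V m i \<phi> T'" for T'
  proof (rule PiE_ext[OF is_capD(2)[OF T'] is_capD(2)[OF T]])
    fix z assume z: "z \<in> carrier (B_chains B G L D m)"
    have Tz: "T z \<in> carrier (B_chains B G L E (m - i))" if "z \<in> carrier (B_chains B G L D m)" for z
      using is_capD(2)[OF T] that by blast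
    have "T' z = 1 \<odot>\<^bsub>B_chains B G L E (m - i)\<^esub> T z"
    proof (rule B_chains_eqI[OF D E is_capD(1)[OF T'] is_capD(1)[OF T] _ z])
      fix s x assume s: "s \<in> tuples G m" "x \<in> carrier D"
      show "T' (B_pure B G L D m (dirac s) x) =
          1 \<odot>\<^bsub>B_chains B G L E (m - i)\<^esub> T (B_pure B G L D m (dirac s) x)"
        unfolding pure_tensor_def is_capD(3)[OF T' s] is_capD(3)[OF T s] chain_class_simps(2)[OF E] by simp
    qed
    then show "T' z = T z"
      using vector_space_simps(7)[OF B_chains_vector_space[OF E] Tz[OF z]] by simp
  qed
  show ?thesis
    unfolding cap_chain_def by (rule theI[where P = "is_cap B G L D V m i \<phi>", OF T unique])
qed

text \<open>Links the abstract extension with the explicit formula. Both sides agree at tuples by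
  \<open>is_cap\<close>; bilinearity in the completed chains over \<open>D\<close> then carries the
  agreement to finite chains and to finite combinations of pairs.\<close>

lemma cap_alg_chain:
  assumes T: "is_cap B G L D V m i \<phi> T" and \<phi>: "linear_cochain i \<phi>" and i: "i \<le> m" and c: "c \<in> alg_chains m"
  shows "T (chain_class m D c) = chain_class (m - i) E (cap_sum i \<phi> c)"
proof -
  note lin = is_capD(1)[OF T, unfolded bdd_linear_def]
  note Ds = chain_class_simps[OF D] and Es = chain_class_simps[OF E]
  have mem: "chain_class m D c \<in> carrier (B_chains B G L D m)" if "c \<in> carrier (chain_reps m D)" for c
    using that unfolding Ds(4) by (rule imageI)
  have T_add: "T (chain_class m D (c + c')) = chain_class (m - i) E (d + d')"
    if "c \<in> carrier (chain_reps m D)" "c' \<in> carrier (chain_reps m D)"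
      "T (chain_class m D c) = chain_class (m - i) E d" "T (chain_class m D c') = chain_class (m - i) E d'" for c c' d d'
    using lin mem[OF that(1)] mem[OF that(2)] that(3,4) by (simp only: Ds(1)[symmetric] Es(1)[symmetric])
  have T_scl: "T (chain_class m D (scl a c)) = chain_class (m - i) E (scl a d)"
    if "c \<in> carrier (chain_reps m D)" "T (chain_class m D c) = chain_class (m - i) E d" for a c d
    using lin mem[OF that(1)] that(2) by (simp only: Ds(2)[symmetric] Es(2)[symmetric])
  note Y = fun_subspaceD[OF function_spaceD(1)[OF function_space_chain_reps[OF D, of m]]]
  have zero: "T (chain_class m D 0) = chain_class (m - i) E 0"
  proof -
    have "T (chain_class m D 0) \<in> carrier (B_chains B G L E (m - i))" using lin mem[OF Y(1)] by blast
    then obtain d where "T (chain_class m D 0) = chain_class (m - i) E d" unfolding Es(4) by blast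
    from T_scl[OF Y(1) this, of 0] show ?thesis by simp
  qed
  note rel = bilinear_relsD[OF chain_rels_properties(1)[OF D], unfolded function_spaceD[OF function_space_BC]]
  have dY: "dirac (y, x) \<in> carrier (chain_reps m D)" if "y \<in> finsupp_funs (tuples G m)" "x \<in> carrier D" for y x
    using alg_chains_chain_reps[of m] that by (simp add: subset_iff)
  have one: "T (chain_class m D (dirac (y, x))) = chain_class (m - i) E (lin_ext (cap_rep i \<phi> x) y)"
    if y: "y \<in> finsupp_funs (tuples G m)" and x: "x \<in> carrier D" for y x
  proof (rule finsupp_induct[where P = "\<lambda>y. T (chain_class m D (dirac (y, x))) =
        chain_class (m - i) E (lin_ext (cap_rep i \<phi> x) y)", OF y])
    have z: "0 \<in> carrier (BC B G L m)" by (rule fun_subspaceD(1)[OF function_spaceD(1)[OF function_space_BC]])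
    have "dirac (0, x) - 0 \<in> chain_rels m D" using rel(3)[OF z x, of 0] by simp
    then have "chain_class m D (dirac (0, x)) = chain_class m D 0" unfolding Ds(3) .
    then show "T (chain_class m D (dirac (0, x))) = chain_class (m - i) E (lin_ext (cap_rep i \<phi> x) 0)"
      unfolding lin_ext_zero using zero by simp
    show "T (chain_class m D (dirac (dirac s, x))) = chain_class (m - i) E (lin_ext (cap_rep i \<phi> x) (dirac s))"
      if "s \<in> tuples G m" for s
      unfolding lin_ext_dirac by (rule is_capD(3)[OF T that x])
    fix y y' assume y: "y \<in> finsupp_funs (tuples G m)" "y' \<in> finsupp_funs (tuples G m)"
      "T (chain_class m D (dirac (y, x))) = chain_class (m - i) E (lin_ext (cap_rep i \<phi> x) y)"
      "T (chain_class m D (dirac (y', x))) = chain_class (m - i) E (lin_ext (cap_rep i \<phi> x) y')"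
    have "dirac (y + y', x) - (dirac (y, x) + dirac (y', x)) \<in> chain_rels m D"
      using rel(1)[of y m y' x] y(1,2) x finsupp_BC[of m] by (simp add: diff_diff_eq subset_iff)
    then have "chain_class m D (dirac (y + y', x)) = chain_class m D (dirac (y, x) + dirac (y', x))"
      unfolding Ds(3) .
    then show "T (chain_class m D (dirac (y + y', x))) = chain_class (m - i) E (lin_ext (cap_rep i \<phi> x) (y + y'))"
      unfolding lin_ext_add[OF y(1,2)] using T_add[OF dY[OF y(1) x] dY[OF y(2) x] y(3,4)] by simp
  next
    fix a y assume y: "y \<in> finsupp_funs (tuples G m)"
      "T (chain_class m D (dirac (y, x))) = chain_class (m - i) E (lin_ext (cap_rep i \<phi> x) y)"
    have "dirac (scl a y, x) - scl a (dirac (y, x)) \<in> chain_rels m D"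
      using rel(3)[of y m x a] y(1) x finsupp_BC[of m] by (simp add: subset_iff)
    then have "chain_class m D (dirac (scl a y, x)) = chain_class m D (scl a (dirac (y, x)))"
      unfolding Ds(3) .
    then show "T (chain_class m D (dirac (scl a y, x))) = chain_class (m - i) E (lin_ext (cap_rep i \<phi> x) (scl a y))"
      unfolding lin_ext_scl[OF y(1)] using T_scl[OF dY[OF y(1) x] y(2)] by simp
  qed
  show ?thesis
  proof (rule finsupp_induct[where P = "\<lambda>c. T (chain_class m D c) = chain_class (m - i) E (cap_sum i \<phi> c)", OF c])
    show "T (chain_class m D 0) = chain_class (m - i) E (cap_sum i \<phi> 0)"
      unfolding cap_sum_def lin_ext_zero by (rule zero)
    show "T (chain_class m D (dirac p)) = chain_class (m - i) E (cap_sum i \<phi> (dirac p))"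
      if "p \<in> finsupp_funs (tuples G m) \<times> carrier D" for p
      using that one by (cases p) (simp add: cap_sum_dirac)
    fix c c' assume c: "c \<in> alg_chains m" "c' \<in> alg_chains m"
      "T (chain_class m D c) = chain_class (m - i) E (cap_sum i \<phi> c)"
      "T (chain_class m D c') = chain_class (m - i) E (cap_sum i \<phi> c')"
    show "T (chain_class m D (c + c')) = chain_class (m - i) E (cap_sum i \<phi> (c + c'))"
      using T_add[OF subsetD[OF alg_chains_chain_reps c(1)] subsetD[OF alg_chains_chain_reps c(2)] c(3,4)]
      unfolding cap_sum_def lin_ext_add[OF c(1,2)] .
  next
    fix a c assume c: "c \<in> alg_chains m"
      "T (chain_class m D c) = chain_class (m - i) E (cap_sum i \<phi> c)"
    show "T (chain_class m D (scl a c)) = chain_class (m - i) E (cap_sum i \<phi> (scl a c))"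
      using T_scl[OF subsetD[OF alg_chains_chain_reps c(1)] c(2), of a]
      unfolding cap_sum_def lin_ext_scl[OF c(1)] .
  qed
qed

text \<open>A pure tensor with a zero entry is its own multiple by 0, so the point mass there is
  itself a homogeneity relation.\<close>

lemma cap_rep_zero:
  assumes "\<psi> (dirac (take (Suc k) s)) = \<zero>\<^bsub>V\<^esub>" "s \<in> tuples G m" "k \<le> m" "x \<in> carrier D"
  shows "cap_rep k \<psi> x s \<in> chain_rels (m - k) E"
proof -
  note v = vector_space_simps[OF born_moduleD(1)[OF V]]
  have "pt x (0 \<odot>\<^bsub>V\<^esub> \<zero>\<^bsub>V\<^esub>) = 0 \<odot>\<^bsub>E\<^esub> pt x \<zero>\<^bsub>V\<^esub>" by (rule pt_rels(5)[OF assms(4) v(2)])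
  then have e: "0 \<odot>\<^bsub>E\<^esub> pt x \<zero>\<^bsub>V\<^esub> = pt x \<zero>\<^bsub>V\<^esub>" unfolding v(6) by simp
  show ?thesis
    using E_relsD(4)[OF dirac_BC[OF take_drop_tuples(2)[OF assms(2,3)]] pt_rels(1)[OF assms(4) v(2)], of 0]
    unfolding e cap_rep_def assms(1) by simp
qed

text \<open>Both sides are bounded and linear in \<open>z\<close>, so pure tensors decide. There the
  identity is \<open>cap_rep_leibniz\<close>, whose coboundary term is a relation by
  \<open>cap_rep_zero\<close>. Consequently capping with a bounded cocycle sends boundaries to
  boundaries.\<close>

lemma cap_cocycle_boundary:
  assumes \<theta>: "\<theta> \<in> carrier (B_cochains B G L V i)"
    and cocycle: "\<And>c. c \<in> carrier (BC B G L (Suc i)) \<Longrightarrow> \<theta> (bar_bd (Suc i) c) = \<zero>\<^bsub>V\<^esub>"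
    and i: "i \<le> m" and z: "z \<in> carrier (B_chains B G L D (Suc m))"
  shows "cap_chain B G L D V m i \<theta> (bd_map D (Suc m) z) =
    (-1) ^ i \<odot>\<^bsub>B_chains B G L E (m - i)\<^esub> bd_map E (Suc (m - i)) (cap_chain B G L D V (Suc m) i \<theta> z)"
proof -
  let ?T = "cap_chain B G L D V m i \<theta>" and ?T' = "cap_chain B G L D V (Suc m) i \<theta>"
  note T = cap_chain_is_cap[OF \<theta> i] and T' = cap_chain_is_cap[OF \<theta> le_SucI[OF i]]
  note \<theta>lin = B_cochains_linear_cochain[OF \<theta>]
  have Suc: "Suc m - i = Suc (m - i)" using i by (rule Suc_diff_le)
  show ?thesis
  proof (rule B_chains_eqI[OF D E _ _ _ z])
    show "bdd_linear (B_chains B G L D (Suc m)) (B_chains B G L E (m - i)) (\<lambda>z. ?T (bd_map D (Suc m) z))"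
      by (rule bdd_linear_comp[OF bdd_linear_bd_map[OF D] is_capD(1)[OF T]])
    show "bdd_linear (B_chains B G L D (Suc m)) (B_chains B G L E (m - i)) (\<lambda>z. bd_map E (Suc (m - i)) (?T' z))"
      by (rule bdd_linear_comp[OF is_capD(1)[OF T', unfolded Suc] bdd_linear_bd_map[OF E]])
    fix s x assume s: "s \<in> tuples G (Suc m)" and x: "x \<in> carrier D"
    have dA: "dirac (dirac s, x) \<in> alg_chains (Suc m)" using s x by simp
    have bA: "dirac (bar_bd (Suc m) (dirac s), x) \<in> alg_chains m" using s x bar_bd_finsupp[of "dirac s" m] by simp
    have 1: "?T (bd_map D (Suc m) (chain_class (Suc m) D (dirac (dirac s, x)))) =
        chain_class (m - i) E (lin_ext (cap_rep i \<theta> x) (bar_bd (Suc m) (dirac s)))"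
    proof -
      have "bd_map D (Suc m) (chain_class (Suc m) D (dirac (dirac s, x))) =
          chain_class m D (dirac (bar_bd (Suc m) (dirac s), x))"
        using bd_map_coset[OF D, of "dirac (dirac s, x)" m] dA alg_chains_chain_reps[of "Suc m"]
        by (simp add: subset_iff)
      then show ?thesis using cap_alg_chain[OF T \<theta>lin i bA] by (simp only: cap_sum_dirac)
    qed
    have crm: "cap_rep i \<theta> x s \<in> carrier (chain_reps (Suc (m - i)) E)"
      using cap_rep_mem[OF \<theta>lin s le_SucI[OF i] x] unfolding Suc .
    have 2: "bd_map E (Suc (m - i)) (?T' (chain_class (Suc m) D (dirac (dirac s, x)))) =
        chain_class (m - i) E (chain_bd (Suc (m - i)) (cap_rep i \<theta> x s))"
      using is_capD(3)[OF T' s x] bd_map_coset[OF E crm] unfolding Suc by simp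
    have t: "take (Suc (Suc i)) s \<in> tuples G (Suc i)" using take_drop_tuples(1)[OF s, of "Suc i"] i by simp
    have "cap_rep (Suc i) (\<lambda>c. \<theta> (bar_bd (Suc i) c)) x s \<in> chain_rels (Suc m - Suc i) E"
      by (rule cap_rep_zero) (use i s x cocycle[OF dirac_BC[OF t]] in simp_all)
    then have z: "cap_rep (Suc i) (\<lambda>c. \<theta> (bar_bd (Suc i) c)) x s \<in> chain_rels (m - i) E" by simp
    have "lin_ext (cap_rep i \<theta> x) (bar_bd (Suc m) (dirac s)) -
        scl ((-1) ^ i) (chain_bd (Suc (m - i)) (cap_rep i \<theta> x s)) \<in> chain_rels (m - i) E"
      using rels_subspace(2)[OF cap_rep_leibniz[OF \<theta>lin s i x] z] by (simp add: algebra_simps)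
    then show "?T (bd_map D (Suc m) (B_pure B G L D (Suc m) (dirac s) x)) =
      (-1) ^ i \<odot>\<^bsub>B_chains B G L E (m - i)\<^esub>
        bd_map E (Suc (m - i)) (?T' (B_pure B G L D (Suc m) (dirac s) x))"
      unfolding pure_tensor_def 1 2 chain_class_simps(2,3)[OF E] .
  qed
qed

text \<open>The cochain \<open>\<psi>\<close> may be unbounded; its cap product with \<open>c\<close> nevertheless makes sense because \<open>c\<close> is
  finitely supported.\<close>

lemma cap_sum_homologous:
  assumes \<phi>: "linear_cochain i \<phi>" "linear_cochain i \<phi>'" and i: "i \<le> n" and c: "c \<in> alg_chains n"
    and cycle: "n = 0 \<or> chain_bd n c \<in> alg_rels (n - 1)"
    and eq: "if i = 0 then \<forall>t\<in>tuples G i. \<phi> (dirac t) = \<phi>' (dirac t)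
      else \<exists>\<psi>\<in>carrier (cochains G V (i - 1)). \<forall>t\<in>tuples G i.
        \<phi> (dirac t) = \<psi> (bar_bd i (dirac t)) \<oplus>\<^bsub>V\<^esub> \<phi>' (dirac t)"
  shows "\<exists>d\<in>carrier (chain_reps (Suc (n - i)) E).
    cap_sum i \<phi> c - (chain_bd (Suc (n - i)) d + cap_sum i \<phi>' c) \<in> chain_rels (n - i) E"
proof (cases i)
  \<comment> \<open>Degree 0 has no nonzero coboundaries: the two cochains agree on tuples, and the
    bounding chain is 0.\<close>
  case 0
  have "cap_sum i \<phi> c - cap_sum i \<phi>' c \<in> chain_rels (n - i) E"
    unfolding cap_sum_def
  proof (rule lin_ext_diff_mem[OF c rels(4)])
    fix p assume "p \<in> finsupp_funs (tuples G n) \<times> carrier D"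
    then obtain y x where p: "p = (y, x)" "y \<in> finsupp_funs (tuples G n)" "x \<in> carrier D" by blast
    have "lin_ext (cap_rep i \<phi> x) y - lin_ext (cap_rep i \<phi>' x) y \<in> chain_rels (n - i) E"
    proof (rule lin_ext_diff_mem[OF p(2) rels(4)])
      fix s assume s: "s \<in> tuples G n"
      have "cap_rep i \<phi> x s = cap_rep i \<phi>' x s"
        using eq take_drop_tuples(1)[OF s i] 0 by (simp add: cap_rep_def)
      then show "cap_rep i \<phi> x s - cap_rep i \<phi>' x s \<in> chain_rels (n - i) E"
        using rels_subspace(1) by simp
    qed
    then show "(case p of (y, x) \<Rightarrow> lin_ext (cap_rep i \<phi> x) y) -
        (case p of (y, x) \<Rightarrow> lin_ext (cap_rep i \<phi>' x) y) \<in> chain_rels (n - i) E"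
      by (simp add: p)
  qed
  moreover have "0 \<in> carrier (chain_reps (Suc (n - i)) E)"
    by (rule fun_subspaceD(1)[OF function_spaceD(1)[OF function_space_chain_reps[OF E]]])
  ultimately show ?thesis by (intro bexI[of _ 0]) simp_all
next
  case (Suc k)
  then obtain \<psi> where \<psi>: "\<psi> \<in> carrier (cochains G V k)" and eq: "\<And>t. t \<in> tuples G i \<Longrightarrow>
      \<phi> (dirac t) = \<psi> (bar_bd i (dirac t)) \<oplus>\<^bsub>V\<^esub> \<phi>' (dirac t)"
    using eq by auto
  obtain m where n: "n = Suc m" and k: "k \<le> m" using i Suc by (cases n) auto
  have ni: "n - i = m - k" by (simp add: n Suc)
  have \<psi>lin: "linear_cochain k \<psi>"
    using \<psi> by (auto simp: cochains_def hom_space_def lin_maps_def linear_cochain_def C_alg_simps)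
  have eqv: "\<psi> (dirac (map (\<lambda>y. g \<otimes> y) t)) = act V (dirac g) (\<psi> (dirac t))"
    if "g \<in> carrier G" "t \<in> tuples G k" for g t
  proof -
    have "\<forall>f\<in>group_algebra G. \<forall>c\<in>carrier (C_alg G k). \<psi> (chain_act G f c) = act V f (\<psi> c)"
      using \<psi> by (simp add: cochains_def hom_space_def)
    then have "\<psi> (chain_act G (dirac g) (dirac t)) = act V (dirac g) (\<psi> (dirac t))"
      using that by simp
    then show ?thesis by (simp only: chain_act_dirac[OF that])
  qed
  let ?R = "chain_rels (m - k) E"
  define \<delta> where "\<delta> = (\<lambda>c. \<psi> (bar_bd (Suc k) c))"
  \<comment> \<open>Additivity of the coefficient modulo relations separates the coboundary of
    \<psi> from \<phi>'.\<close>
  have diff: "cap_sum i \<phi> c - (cap_sum (Suc k) \<delta> c + cap_sum i \<phi>' c) \<in> ?R"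
  proof -
    have s: "lin_ext e c + lin_ext e' c = lin_ext (\<lambda>p. e p + e' p) c"
      for e e' :: "'p \<Rightarrow> 'q \<Rightarrow> complex" and c
      unfolding lin_ext_def sum.distrib[symmetric] scl_add ..
    have "lin_ext (\<lambda>(y, x). lin_ext (cap_rep i \<phi> x) y) c -
        lin_ext (\<lambda>p. (case p of (y, x) \<Rightarrow> lin_ext (cap_rep (Suc k) \<delta> x) y) +
          (case p of (y, x) \<Rightarrow> lin_ext (cap_rep i \<phi>' x) y)) c \<in> ?R"
    proof (rule lin_ext_diff_mem[OF c rels(4)])
      fix p assume "p \<in> finsupp_funs (tuples G n) \<times> carrier D"
      then obtain y x where p: "p = (y, x)" "y \<in> finsupp_funs (tuples G n)" "x \<in> carrier D" by blast
      have "lin_ext (cap_rep i \<phi> x) y - lin_ext (\<lambda>s. cap_rep (Suc k) \<delta> x s + cap_rep i \<phi>' x s) y \<in> ?R"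
      proof (rule lin_ext_diff_mem[OF p(2) rels(4)])
        fix s assume s: "s \<in> tuples G n"
        let ?t = "take (Suc i) s" and ?y = "dirac (drop i s)"
        have t: "?t \<in> tuples G i" by (rule take_drop_tuples(1)[OF s i])
        have y: "?y \<in> carrier (BC B G L (m - k))" using dirac_BC[OF take_drop_tuples(2)[OF s i]] unfolding ni .
        have "bar_bd (Suc k) (dirac ?t) \<in> finsupp_funs (tuples G k)"
          using t by (intro bar_bd_finsupp) (simp add: Suc)
        then have dv: "\<delta> (dirac ?t) \<in> carrier V" using \<psi>lin by (simp add: \<delta>_def linear_cochain_def)
        have v: "\<phi>' (dirac ?t) \<in> carrier V" by (rule linear_cochain_take[OF \<phi>(2) s i])
        have ph: "\<phi> (dirac ?t) = \<delta> (dirac ?t) \<oplus>\<^bsub>V\<^esub> \<phi>' (dirac ?t)" using eq[OF t] by (simp add: \<delta>_def Suc)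
        have "dirac (?y, pt x (\<phi> (dirac ?t))) - dirac (?y, pt x (\<delta> (dirac ?t))) -
            dirac (?y, pt x (\<phi>' (dirac ?t))) \<in> ?R"
          unfolding ph pt_rels(3)[OF p(3) dv v] by (intro E_relsD y pt_rels(1) p(3) dv v)
        then show "cap_rep i \<phi> x s - (cap_rep (Suc k) \<delta> x s + cap_rep i \<phi>' x s) \<in> ?R"
          by (simp add: cap_rep_def Suc diff_diff_eq)
      qed
      then show "(case p of (y, x) \<Rightarrow> lin_ext (cap_rep i \<phi> x) y) -
          ((case p of (y, x) \<Rightarrow> lin_ext (cap_rep (Suc k) \<delta> x) y) +
          (case p of (y, x) \<Rightarrow> lin_ext (cap_rep i \<phi>' x) y)) \<in> ?R"
        unfolding p(1) prod.case s .
    qed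
    then show ?thesis unfolding cap_sum_def s .
  qed
  \<comment> \<open>The boundary of \<open>c\<close> lies in \<open>alg_rels\<close>, and an
    equivariant \<psi> sends these finite relations into \<open>chain_rels\<close> whatever its
    growth.\<close>
  have killed: "cap_sum k \<psi> (chain_bd (Suc m) c) \<in> ?R"
    by (rule cap_sum_alg_rels[OF \<psi>lin k _ eqv]) (use cycle n in auto)
  note leib = cap_sum_leibniz[OF \<psi>lin k c[unfolded n], folded \<delta>_def]
  \<comment> \<open>Solving the Leibniz rule for the coboundary term, and dropping the term with the
    boundary of \<open>c\<close>, leaves the boundary of \<open>- ((-1) ^ k)\<close> times
    \<open>cap_sum k \<psi> c\<close>.\<close>
  define d where "d = scl (- ((-1) ^ k)) (cap_sum k \<psi> c)"
  have cm: "cap_sum k \<psi> c \<in> carrier (chain_reps (Suc (m - k)) E)"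
    using cap_sum_mem[OF \<psi>lin le_SucI[OF k] c[unfolded n]] Suc_diff_le[OF k] by simp
  show ?thesis
  proof (rule bexI[of _ d])
    show "d \<in> carrier (chain_reps (Suc (n - i)) E)"
      unfolding d_def ni by (rule fun_subspaceD(3)[OF function_spaceD(1)[OF function_space_chain_reps[OF E]] cm])
    have "cap_sum i \<phi> c - (chain_bd (Suc (m - k)) d + cap_sum i \<phi>' c) =
        (cap_sum i \<phi> c - (cap_sum (Suc k) \<delta> c + cap_sum i \<phi>' c)) +
        (cap_sum k \<psi> (chain_bd (Suc m) c) -
          (cap_sum k \<psi> (chain_bd (Suc m) c) -
            (cap_sum (Suc k) \<delta> c + scl ((-1) ^ k) (chain_bd (Suc (m - k)) (cap_sum k \<psi> c)))))"
      unfolding d_def pushforward_scl by (auto simp: fun_eq_iff algebra_simps)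
    also have "\<dots> \<in> ?R"
      by (intro rels_subspace(2)[OF diff] rels_subspace(5)[OF killed leib])
    finally show "cap_sum i \<phi> c - (chain_bd (Suc (n - i)) d + cap_sum i \<phi>' c) \<in> chain_rels (n - i) E"
      unfolding ni .
  qed
qed

end

section \<open>The square of the bar differential vanishes\<close>

lemma face_face:
  assumes "j < i" shows "face j (face i s) = face (i - 1) (face j s)"
  using assms
proof (induction s arbitrary: i j)
  case (Cons a s)
  obtain i' where i: "i = Suc i'" using Cons.prems by (cases i) auto
  show ?case
  proof (cases j)
    case 0 then show ?thesis by (simp add: i face_def)
  next
    case (Suc j')
    then obtain i'' where i': "i' = Suc i''" using Cons.prems i by (cases i') auto
    have "face j' (face i' s) = face i'' (face j' s)" using Cons.IH[of j' i'] Cons.prems i i' Suc by simp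
    moreover have "face (Suc l) (b # t) = b # face l t" for l b and t :: "'a list" by (simp add: face_def)
    ultimately show ?thesis by (simp add: i Suc i')
  qed
qed (simp add: face_def)

text \<open>The index pairs with \<open>j < i\<close> are matched with the remaining ones by sending
  \<open>(j, i)\<close> to \<open>(i - 1, j)\<close>. Matched entries agree, while the exponent
  \<open>j + i\<close> drops by 1, so they cancel.\<close>

lemma alternating_double_sum:
  fixes A :: "nat \<Rightarrow> nat \<Rightarrow> complex"
  assumes "\<And>i j. j < i \<Longrightarrow> A j i = A (i - 1) j"
  shows "(\<Sum>j\<le>n. \<Sum>i\<le>Suc n. (-1) ^ j * (-1) ^ i * A j i) = 0"
proof -
  let ?g = "\<lambda>(j, i). (-1) ^ j * (-1) ^ i * A j i"
  let ?P = "{..n} \<times> {..Suc n}"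
  let ?L = "{(j, i). j \<le> n \<and> i \<le> Suc n \<and> j < i}" and ?U = "{(j, i). j \<le> n \<and> i \<le> Suc n \<and> i \<le> j}"
  have fin: "finite ?L" "finite ?U"
    by (rule finite_subset[of _ ?P]; auto)+
  have "sum ?g ?L = (\<Sum>p\<in>?U. - ?g p)"
    by (rule sum.reindex_bij_witness[of _ "\<lambda>(j, i). (i, Suc j)" "\<lambda>(j, i). (i - 1, j)"])
      (use assms in \<open>auto simp: power_add elim!: less_natE\<close>)
  then have "sum ?g ?L + sum ?g ?U = 0" by (simp add: sum_negf)
  moreover have "?P = ?L \<union> ?U" by auto
  moreover have "?L \<inter> ?U = {}" by auto
  ultimately have "sum ?g ?P = 0" using sum.union_disjoint[OF fin, of ?g] by simp
  then show ?thesis by (simp only: sum.cartesian_product)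
qed

text \<open>Needed to see that adding a bounded coboundary to a cocycle gives a cocycle again.
  Summability of \<open>c\<close> allows the push-forwards along two faces to be composed.\<close>

lemma bar_bd_bar_bd:
  fixes c :: "'g list \<Rightarrow> complex"
  assumes "l1 c" shows "bar_bd n (bar_bd (Suc n) c) = 0"
proof
  fix p
  have l: "l1 (scl a (pushforward (face i) c))" for a i
    by (rule l1_scl[OF pushforward_l1(1)[OF assms]])
  have "bar_bd n (bar_bd (Suc n) c) =
      (\<Sum>j\<le>n. \<Sum>i\<le>Suc n. scl ((-1) ^ j * (-1) ^ i) (pushforward (face j \<circ> face i) c))"
    unfolding bar_bd_alt
    by (subst pushforward_sum)
      (simp_all only: finite_atMost l pushforward_scl pushforward_comp[OF assms] scl_sum scl_simps)
  then have "bar_bd n (bar_bd (Suc n) c) p =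
      (\<Sum>j\<le>n. \<Sum>i\<le>Suc n. (-1) ^ j * (-1) ^ i * pushforward (face j \<circ> face i) c p)"
    by (simp only: sum_fun_apply scl_apply)
  also have "\<dots> = 0"
  proof (rule alternating_double_sum)
    fix i j :: nat assume "j < i"
    then have "face j \<circ> face i = (face (i - 1) \<circ> face j :: 'g list \<Rightarrow> 'g list)" by (auto simp: fun_eq_iff face_face)
    then show "pushforward (face j \<circ> face i) c p = pushforward (face (i - 1) \<circ> face j) c p"
      by (simp only:)
  qed
  finally show "bar_bd n (bar_bd (Suc n) c) p = 0 p" by simp
qed

section \<open>Subquotients and induced maps\<close>

lemma linear_image_additive_subgroup:
  assumes U: "vector_space_C U" and V: "vector_space_C V"
    and f: "\<And>x. x \<in> carrier U \<Longrightarrow> f x \<in> carrier V"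
      "\<And>x y. x \<in> carrier U \<Longrightarrow> y \<in> carrier U \<Longrightarrow> f (x \<oplus>\<^bsub>U\<^esub> y) = f x \<oplus>\<^bsub>V\<^esub> f y"
      "\<And>a x. x \<in> carrier U \<Longrightarrow> f (a \<odot>\<^bsub>U\<^esub> x) = a \<odot>\<^bsub>V\<^esub> f x"
  shows "additive_subgroup (f ` carrier U) V"
proof (rule additive_subgroup.intro, rule subgroup.intro)
  note u = vector_space_simps[OF U] and v = vector_space_simps[OF V]
  show "f ` carrier U \<subseteq> carrier (add_monoid V)" using f(1) by auto
  show "x \<otimes>\<^bsub>add_monoid V\<^esub> y \<in> f ` carrier U" if xy: "x \<in> f ` carrier U" "y \<in> f ` carrier U" for x y
  proof -
    obtain a b where "a \<in> carrier U" "b \<in> carrier U" "x = f a" "y = f b" using xy by blast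
    then show ?thesis using f(2)[of a b] u(3) by (auto intro!: image_eqI[of _ _ "a \<oplus>\<^bsub>U\<^esub> b"])
  qed
  have "f \<zero>\<^bsub>U\<^esub> = \<zero>\<^bsub>V\<^esub>"
    using f(3)[OF u(2), of 0] v(5)[OF f(1)[OF u(2)]] u(6)[of 0] by simp
  then show "\<one>\<^bsub>add_monoid V\<^esub> \<in> f ` carrier U" using u(2) by (auto intro!: image_eqI[of _ _ "\<zero>\<^bsub>U\<^esub>"])
  show "inv\<^bsub>add_monoid V\<^esub> x \<in> f ` carrier U" if x: "x \<in> f ` carrier U" for x
  proof -
    obtain a where a: "a \<in> carrier U" "x = f a" using x by blast
    have "inv\<^bsub>add_monoid V\<^esub> x = (-1) \<odot>\<^bsub>V\<^esub> f a"
      using vector_space_minus[OF V f(1)[OF a(1)]] by (simp add: a(2) a_inv_def)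
    also have "\<dots> = f ((-1) \<odot>\<^bsub>U\<^esub> a)" using f(3)[OF a(1)] by simp
    finally show ?thesis using u(4)[OF a(1)] by simp
  qed
qed

lemma zero_additive_subgroup:
  assumes "vector_space_C V" shows "additive_subgroup {\<zero>\<^bsub>V\<^esub>} V"
proof -
  interpret abelian_group V by (rule vector_space_simps(1)[OF assms])
  show ?thesis
    by (rule additive_subgroup.intro, rule subgroup.intro) (auto simp: a_inv_def[symmetric])
qed

lemma coset_absorb:
  assumes "vector_space_C V" "additive_subgroup W V" "w \<in> W" "x \<in> carrier V"
  shows "W +>\<^bsub>V\<^esub> (w \<oplus>\<^bsub>V\<^esub> x) = W +>\<^bsub>V\<^esub> x"
proof -
  have "w \<oplus>\<^bsub>V\<^esub> x \<in> W +>\<^bsub>V\<^esub> x" unfolding a_r_coset_def' using assms(3) by blast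
  then show ?thesis
    using abelian_group.a_repr_independence[OF vector_space_simps(1)[OF assms(1)] _ assms(4)]
      additive_subgroup.a_subgroup[OF assms(2)] by metis
qed

lemma subspace_zero_mem: "additive_subgroup W V \<Longrightarrow> \<zero>\<^bsub>V\<^esub> \<in> W"
  using subgroup.one_closed[OF additive_subgroup.a_subgroup] by fastforce

lemma hom_space_simps [simp]:
  "carrier (hom_space F C V) = F" "\<zero>\<^bsub>hom_space F C V\<^esub> = (\<lambda>c\<in>C. \<zero>\<^bsub>V\<^esub>)"
  "\<phi> \<oplus>\<^bsub>hom_space F C V\<^esub> \<psi> = (\<lambda>c\<in>C. \<phi> c \<oplus>\<^bsub>V\<^esub> \<psi> c)"
  "a \<odot>\<^bsub>hom_space F C V\<^esub> \<phi> = (\<lambda>c\<in>C. a \<odot>\<^bsub>V\<^esub> \<phi> c)"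
  by (simp_all add: hom_space_def)

lemma hom_space_vector_space:
  assumes V: "vector_space_C V" and F: "F \<subseteq> C \<rightarrow>\<^sub>E carrier V"
    and closed: "(\<lambda>c\<in>C. \<zero>\<^bsub>V\<^esub>) \<in> F" "\<And>\<phi> \<psi>. \<phi> \<in> F \<Longrightarrow> \<psi> \<in> F \<Longrightarrow> (\<lambda>c\<in>C. \<phi> c \<oplus>\<^bsub>V\<^esub> \<psi> c) \<in> F"
      "\<And>a \<phi>. \<phi> \<in> F \<Longrightarrow> (\<lambda>c\<in>C. a \<odot>\<^bsub>V\<^esub> \<phi> c) \<in> F"
  shows "vector_space_C (hom_space F C V)"
proof -
  interpret module complex_field V by (rule V)
  note v = vector_space_simps[OF V]
  have mem: "\<phi> c \<in> carrier V" if "\<phi> \<in> F" "c \<in> C" for \<phi> c using F that by blast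
  have ext: "\<phi> \<in> extensional C" if "\<phi> \<in> F" for \<phi>
    using subsetD[OF F that] by (simp add: PiE_iff)
  have minus: "(-1) \<odot>\<^bsub>V\<^esub> x \<oplus>\<^bsub>V\<^esub> x = \<zero>\<^bsub>V\<^esub>" if "x \<in> carrier V" for x
    using v(9)[OF that, of "-1" 1] v(5,7)[OF that] by simp
  show ?thesis
  proof (rule vector_space_CI, unfold hom_space_simps)
    fix x y z assume xyz: "x \<in> F" "y \<in> F" "z \<in> F"
    show "(\<lambda>c\<in>C. (\<lambda>c\<in>C. x c \<oplus>\<^bsub>V\<^esub> y c) c \<oplus>\<^bsub>V\<^esub> z c) = (\<lambda>c\<in>C. x c \<oplus>\<^bsub>V\<^esub> (\<lambda>c\<in>C. y c \<oplus>\<^bsub>V\<^esub> z c) c)"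
      by (rule restrict_ext) (use xyz mem in \<open>simp add: M.a_assoc\<close>)
  next
    fix x y assume xy: "x \<in> F" "y \<in> F"
    show "(\<lambda>c\<in>C. x c \<oplus>\<^bsub>V\<^esub> y c) = (\<lambda>c\<in>C. y c \<oplus>\<^bsub>V\<^esub> x c)"
      by (rule restrict_ext) (use xy mem in \<open>simp add: M.a_comm\<close>)
  next
    fix x assume x: "x \<in> F"
    show "(\<lambda>c\<in>C. (\<lambda>c\<in>C. \<zero>\<^bsub>V\<^esub>) c \<oplus>\<^bsub>V\<^esub> x c) = x"
      by (rule extensionalityI[OF restrict_extensional ext[OF x]]) (use x mem in simp)
    show "(\<lambda>c\<in>C. (\<lambda>c\<in>C. - 1 \<odot>\<^bsub>V\<^esub> x c) c \<oplus>\<^bsub>V\<^esub> x c) = (\<lambda>c\<in>C. \<zero>\<^bsub>V\<^esub>)"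
      by (rule restrict_ext) (use x mem in \<open>simp add: minus\<close>)
    show "(\<lambda>c\<in>C. 1 \<odot>\<^bsub>V\<^esub> x c) = x"
      by (rule extensionalityI[OF restrict_extensional ext[OF x]]) (use x mem in \<open>simp add: v(7)\<close>)
  next
    fix a b x assume x: "x \<in> F"
    show "(\<lambda>c\<in>C. (a + b) \<odot>\<^bsub>V\<^esub> x c) = (\<lambda>c\<in>C. (\<lambda>c\<in>C. a \<odot>\<^bsub>V\<^esub> x c) c \<oplus>\<^bsub>V\<^esub> (\<lambda>c\<in>C. b \<odot>\<^bsub>V\<^esub> x c) c)"
      by (rule restrict_ext) (use x mem in \<open>simp add: v(9)\<close>)
    show "(\<lambda>c\<in>C. a * b \<odot>\<^bsub>V\<^esub> x c) = (\<lambda>c\<in>C. a \<odot>\<^bsub>V\<^esub> (\<lambda>c\<in>C. b \<odot>\<^bsub>V\<^esub> x c) c)"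
      by (rule restrict_ext) (use x mem in \<open>simp add: v(8)\<close>)
  next
    fix a x y assume xy: "x \<in> F" "y \<in> F"
    show "(\<lambda>c\<in>C. a \<odot>\<^bsub>V\<^esub> (\<lambda>c\<in>C. x c \<oplus>\<^bsub>V\<^esub> y c) c) = (\<lambda>c\<in>C. (\<lambda>c\<in>C. a \<odot>\<^bsub>V\<^esub> x c) c \<oplus>\<^bsub>V\<^esub> (\<lambda>c\<in>C. a \<odot>\<^bsub>V\<^esub> y c) c)"
      by (rule restrict_ext) (use xy mem in \<open>simp add: v(10)\<close>)
  qed (use closed in auto)
qed

section \<open>Spaces of bounded and of ordinary cochains\<close>

context bounded_group
begin

lemma born_module_act_add:
  assumes "bornological_module (H_alg B G L) M" "f \<in> carrier (H_alg B G L)" "x \<in> carrier M" "y \<in> carrier M"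
  shows "act M f (x \<oplus>\<^bsub>M\<^esub> y) = act M f x \<oplus>\<^bsub>M\<^esub> act M f y"
  using conjunct1[OF conjunct2[OF conjunct2[OF conjunct2[OF assms(1)[unfolded bornological_module_def]]]]]
    assms(2-4) by blast

lemma born_module_act_smult:
  assumes "bornological_module (H_alg B G L) M" "f \<in> carrier (H_alg B G L)" "x \<in> carrier M"
  shows "act M f (z \<odot>\<^bsub>M\<^esub> x) = z \<odot>\<^bsub>M\<^esub> act M f x"
  using conjunct1[OF conjunct2[OF conjunct2[OF conjunct2[OF conjunct2[OF assms(1)[unfolded bornological_module_def]]]]]]
    assms(2,3) by blast

lemma born_module_bornology:
  assumes "bornological_module (H_alg B G L) M"
  shows "A \<in> bornology M \<Longrightarrow> A' \<subseteq> A \<Longrightarrow> A' \<in> bornology M"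
    "A \<in> bornology M \<Longrightarrow> A' \<in> bornology M \<Longrightarrow> set_add M A ((\<lambda>x. a \<odot>\<^bsub>M\<^esub> x) ` A') \<in> bornology M"
proof -
  have "complete_bornological_space M"
    using assms unfolding bornological_module_def by (rule conjunct1)
  then have c: "convex_bornology M" by (simp add: complete_bornological_space_def)
  note * = c[unfolded convex_bornology_def]
  show "A \<in> bornology M \<Longrightarrow> A' \<subseteq> A \<Longrightarrow> A' \<in> bornology M"
    using conjunct1[OF conjunct2[OF conjunct2[OF *]]] by blast
  show "A \<in> bornology M \<Longrightarrow> A' \<in> bornology M \<Longrightarrow> set_add M A ((\<lambda>x. a \<odot>\<^bsub>M\<^esub> x) ` A') \<in> bornology M"
    using conjunct1[OF conjunct2[OF conjunct2[OF conjunct2[OF *]]]] by blast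
qed

lemma B_cochainsI:
  assumes "\<phi> \<in> carrier (BC B G L n) \<rightarrow>\<^sub>E carrier M" "bdd_linear (BC B G L n) M \<phi>"
    "\<And>f c. f \<in> carrier (H_alg B G L) \<Longrightarrow> c \<in> carrier (BC B G L n) \<Longrightarrow> \<phi> (chain_act G f c) = act M f (\<phi> c)"
  shows "\<phi> \<in> carrier (B_cochains B G L M n)"
  using assms by (simp add: B_cochains_def bounded_lin_maps_def lin_maps_def bdd_linear_def)

lemma bdd_linear_restrict:
  assumes f: "bdd_linear U W f" and U: "\<And>A. A \<in> bornology U \<Longrightarrow> A \<subseteq> carrier U"
    and c: "\<And>x y. x \<in> carrier U \<Longrightarrow> y \<in> carrier U \<Longrightarrow> x \<oplus>\<^bsub>U\<^esub> y \<in> carrier U"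
      "\<And>a x. x \<in> carrier U \<Longrightarrow> a \<odot>\<^bsub>U\<^esub> x \<in> carrier U"
  shows "bdd_linear U W (restrict f (carrier U))"
proof -
  have "restrict f (carrier U) ` A = f ` A" if "A \<in> bornology U" for A
    by (rule image_cong) (use U[OF that] in auto)
  then show ?thesis using f c by (simp add: bdd_linear_def)
qed

lemma BC_closed:
  "x \<in> carrier (BC B G L n) \<Longrightarrow> y \<in> carrier (BC B G L n) \<Longrightarrow> x \<oplus>\<^bsub>BC B G L n\<^esub> y \<in> carrier (BC B G L n)"
  "x \<in> carrier (BC B G L n) \<Longrightarrow> a \<odot>\<^bsub>BC B G L n\<^esub> x \<in> carrier (BC B G L n)"
  using vector_space_simps(3,4)[OF BC_vector_space[of n]] by blast+

lemma bar_bd_BC: "c \<in> carrier (BC B G L (Suc n)) \<Longrightarrow> bar_bd (Suc n) c \<in> carrier (BC B G L n)"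
  using bdd_linear_bar_bd[of n] by (simp add: bdd_linear_def)

lemma B_cochains_coboundary:
  assumes \<eta>: "\<eta> \<in> carrier (B_cochains B G L M n)"
  shows "(\<lambda>c\<in>carrier (BC B G L (Suc n)). \<eta> (bar_bd (Suc n) c)) \<in> carrier (B_cochains B G L M (Suc n))"
proof (rule B_cochainsI)
  have lin: "bdd_linear (BC B G L (Suc n)) M (\<lambda>c. \<eta> (bar_bd (Suc n) c))"
    by (rule bdd_linear_comp[OF bdd_linear_bar_bd B_cochainsD(2)[OF \<eta>]])
  then show "bdd_linear (BC B G L (Suc n)) M (\<lambda>c\<in>carrier (BC B G L (Suc n)). \<eta> (bar_bd (Suc n) c))"
    by (rule bdd_linear_restrict) (use directed_bornologyD(2)[OF directed_bornology_BC] BC_closed in auto)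
  show "(\<lambda>c\<in>carrier (BC B G L (Suc n)). \<eta> (bar_bd (Suc n) c)) \<in> carrier (BC B G L (Suc n)) \<rightarrow>\<^sub>E carrier M"
    using lin by (simp add: bdd_linear_def)
  fix f c assume "f \<in> carrier (H_alg B G L)" "c \<in> carrier (BC B G L (Suc n))"
  then show "(\<lambda>c\<in>carrier (BC B G L (Suc n)). \<eta> (bar_bd (Suc n) c)) (chain_act G f c) =
      act M f ((\<lambda>c\<in>carrier (BC B G L (Suc n)). \<eta> (bar_bd (Suc n) c)) c)"
    using chain_act_BC[of f c "Suc n"] bar_bd_chain_act[of f c n] B_cochainsD(3)[OF \<eta>, of f "bar_bd (Suc n) c"]
      bar_bd_BC[of c n] by simp
qed

lemma B_cochains_add:
  assumes M: "bornological_module (H_alg B G L) M"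
    and \<phi>: "\<phi> \<in> carrier (B_cochains B G L M n)" and \<psi>: "\<psi> \<in> carrier (B_cochains B G L M n)"
  shows "(\<lambda>c\<in>carrier (BC B G L n). \<phi> c \<oplus>\<^bsub>M\<^esub> \<psi> c) \<in> carrier (B_cochains B G L M n)"
proof (rule B_cochainsI)
  note v = vector_space_simps[OF born_moduleD(1)[OF M]]
  interpret MM: abelian_group M by (rule v(1))
  note p = B_cochainsD(2)[OF \<phi>, unfolded bdd_linear_def] B_cochainsD(2)[OF \<psi>, unfolded bdd_linear_def]
  have mem: "\<phi> c \<in> carrier M" "\<psi> c \<in> carrier M" if "c \<in> carrier (BC B G L n)" for c using p that by auto
  have lin: "bdd_linear (BC B G L n) M (\<lambda>c. \<phi> c \<oplus>\<^bsub>M\<^esub> \<psi> c)"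
    unfolding bdd_linear_def
  proof (intro conjI ballI allI)
    show "\<phi> x \<oplus>\<^bsub>M\<^esub> \<psi> x \<in> carrier M" if "x \<in> carrier (BC B G L n)" for x using mem[OF that] by simp
    show "\<phi> (x \<oplus>\<^bsub>BC B G L n\<^esub> y) \<oplus>\<^bsub>M\<^esub> \<psi> (x \<oplus>\<^bsub>BC B G L n\<^esub> y) =
        (\<phi> x \<oplus>\<^bsub>M\<^esub> \<psi> x) \<oplus>\<^bsub>M\<^esub> (\<phi> y \<oplus>\<^bsub>M\<^esub> \<psi> y)"
      if xy: "x \<in> carrier (BC B G L n)" "y \<in> carrier (BC B G L n)" for x y
    proof -
      have "\<phi> (x \<oplus>\<^bsub>BC B G L n\<^esub> y) = \<phi> x \<oplus>\<^bsub>M\<^esub> \<phi> y" "\<psi> (x \<oplus>\<^bsub>BC B G L n\<^esub> y) = \<psi> x \<oplus>\<^bsub>M\<^esub> \<psi> y"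
        using p xy by auto
      then show ?thesis using mem[OF xy(1)] mem[OF xy(2)] by (simp add: MM.a_ac)
    qed
    show "\<phi> (a \<odot>\<^bsub>BC B G L n\<^esub> x) \<oplus>\<^bsub>M\<^esub> \<psi> (a \<odot>\<^bsub>BC B G L n\<^esub> x) = a \<odot>\<^bsub>M\<^esub> (\<phi> x \<oplus>\<^bsub>M\<^esub> \<psi> x)"
      if x: "x \<in> carrier (BC B G L n)" for a x
    proof -
      have "\<phi> (a \<odot>\<^bsub>BC B G L n\<^esub> x) = a \<odot>\<^bsub>M\<^esub> \<phi> x" "\<psi> (a \<odot>\<^bsub>BC B G L n\<^esub> x) = a \<odot>\<^bsub>M\<^esub> \<psi> x"
        using p x by auto
      then show ?thesis using v(10)[OF mem[OF x], of a] by simp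
    qed
    show "(\<lambda>c. \<phi> c \<oplus>\<^bsub>M\<^esub> \<psi> c) ` A \<in> bornology M" if A: "A \<in> bornology (BC B G L n)" for A
    proof (rule born_module_bornology(1)[OF M])
      have "\<phi> ` A \<in> bornology M" "\<psi> ` A \<in> bornology M" using p A by auto
      \<comment> \<open>The axiom on bornologies provides sums with a scalar multiple of the second
        set; the scalar is taken to be 1 and removed by the module law.\<close>
      then show "set_add M (\<phi> ` A) ((\<lambda>x. 1 \<odot>\<^bsub>M\<^esub> x) ` (\<psi> ` A)) \<in> bornology M"
        by (rule born_module_bornology(2)[OF M])
      show "(\<lambda>c. \<phi> c \<oplus>\<^bsub>M\<^esub> \<psi> c) ` A \<subseteq> set_add M (\<phi> ` A) ((\<lambda>x. 1 \<odot>\<^bsub>M\<^esub> x) ` (\<psi> ` A))"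
      proof
        fix u assume "u \<in> (\<lambda>c. \<phi> c \<oplus>\<^bsub>M\<^esub> \<psi> c) ` A"
        then obtain c where c: "c \<in> A" "u = \<phi> c \<oplus>\<^bsub>M\<^esub> \<psi> c" by blast
        have "c \<in> carrier (BC B G L n)" using directed_bornologyD(2)[OF directed_bornology_BC A] c(1) by blast
        then have "1 \<odot>\<^bsub>M\<^esub> \<psi> c = \<psi> c" using v(7) mem(2) by blast
        then have "\<psi> c \<in> (\<lambda>x. 1 \<odot>\<^bsub>M\<^esub> x) ` (\<psi> ` A)" using c(1) by (metis imageI)
        then show "u \<in> set_add M (\<phi> ` A) ((\<lambda>x. 1 \<odot>\<^bsub>M\<^esub> x) ` (\<psi> ` A))"
          unfolding set_add_def' using c by blast
      qed
    qed
  qed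
  then show "bdd_linear (BC B G L n) M (\<lambda>c\<in>carrier (BC B G L n). \<phi> c \<oplus>\<^bsub>M\<^esub> \<psi> c)"
    by (rule bdd_linear_restrict) (use directed_bornologyD(2)[OF directed_bornology_BC] BC_closed in auto)
  show "(\<lambda>c\<in>carrier (BC B G L n). \<phi> c \<oplus>\<^bsub>M\<^esub> \<psi> c) \<in> carrier (BC B G L n) \<rightarrow>\<^sub>E carrier M"
    using mem by simp
  fix f c assume f: "f \<in> carrier (H_alg B G L)" and c: "c \<in> carrier (BC B G L n)"
  show "(\<lambda>c\<in>carrier (BC B G L n). \<phi> c \<oplus>\<^bsub>M\<^esub> \<psi> c) (chain_act G f c) =
      act M f ((\<lambda>c\<in>carrier (BC B G L n). \<phi> c \<oplus>\<^bsub>M\<^esub> \<psi> c) c)"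
    using chain_act_BC[OF f c] B_cochainsD(3)[OF \<phi> f c] B_cochainsD(3)[OF \<psi> f c] c
      born_module_act_add[OF M f mem[OF c]] by simp
qed

lemma act_zero:
  assumes M: "bornological_module (H_alg B G L) M" and f: "f \<in> carrier (H_alg B G L)"
  shows "act M f \<zero>\<^bsub>M\<^esub> = \<zero>\<^bsub>M\<^esub>"
proof -
  note v = vector_space_simps[OF born_moduleD(1)[OF M]]
  have "act M f (0 \<odot>\<^bsub>M\<^esub> \<zero>\<^bsub>M\<^esub>) = 0 \<odot>\<^bsub>M\<^esub> act M f \<zero>\<^bsub>M\<^esub>" by (rule born_module_act_smult[OF M f v(2)])
  then show ?thesis using v(5)[OF born_moduleD(3)[OF M f v(2)]] v(6) by simp
qed

lemma B_cochains_zero: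
  assumes M: "bornological_module (H_alg B G L) M"
  shows "(\<lambda>c\<in>carrier (BC B G L n). \<zero>\<^bsub>M\<^esub>) \<in> carrier (B_cochains B G L M n)"
proof (rule B_cochainsI)
  note v = vector_space_simps[OF born_moduleD(1)[OF M]]
  interpret MM: abelian_group M by (rule v(1))
  have "(\<lambda>c. \<zero>\<^bsub>M\<^esub>) ` A \<in> bornology M" for A :: "('g list \<Rightarrow> complex) set"
    by (rule born_module_bornology(1)[OF M directed_bornologyD(3)[OF born_moduleD(2)[OF M] v(2)]]) auto
  then have "bdd_linear (BC B G L n) M (\<lambda>c. \<zero>\<^bsub>M\<^esub>)"
    using v(2) by (simp add: bdd_linear_def v(6))
  then show "bdd_linear (BC B G L n) M (\<lambda>c\<in>carrier (BC B G L n). \<zero>\<^bsub>M\<^esub>)"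
    by (rule bdd_linear_restrict) (use directed_bornologyD(2)[OF directed_bornology_BC] BC_closed in auto)
  show "(\<lambda>c\<in>carrier (BC B G L n). \<zero>\<^bsub>M\<^esub>) \<in> carrier (BC B G L n) \<rightarrow>\<^sub>E carrier M" using v(2) by simp
  fix f c assume f: "f \<in> carrier (H_alg B G L)" and c: "c \<in> carrier (BC B G L n)"
  then show "(\<lambda>c\<in>carrier (BC B G L n). \<zero>\<^bsub>M\<^esub>) (chain_act G f c) = act M f ((\<lambda>c\<in>carrier (BC B G L n). \<zero>\<^bsub>M\<^esub>) c)"
    using chain_act_BC[OF f c] act_zero[OF M f] by simp
qed

lemma cochains_iff:
  "\<psi> \<in> carrier (cochains G M n) \<longleftrightarrow>
     \<psi> \<in> finsupp_funs (tuples G n) \<rightarrow>\<^sub>E carrier M \<and>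
     (\<forall>c\<in>finsupp_funs (tuples G n). \<forall>c'\<in>finsupp_funs (tuples G n). \<psi> (c + c') = \<psi> c \<oplus>\<^bsub>M\<^esub> \<psi> c') \<and>
     (\<forall>a. \<forall>c\<in>finsupp_funs (tuples G n). \<psi> (scl a c) = a \<odot>\<^bsub>M\<^esub> \<psi> c) \<and>
     (\<forall>f\<in>group_algebra G. \<forall>c\<in>finsupp_funs (tuples G n). \<psi> (chain_act G f c) = act M f (\<psi> c))"
  using function_space_C_alg[of n]
  by (auto simp: cochains_def lin_maps_def function_space_def)

lemma cochains_vector_space:
  assumes M: "bornological_module (H_alg B G L) M"
  shows "vector_space_C (cochains G M n)"
  unfolding cochains_def
proof (rule hom_space_vector_space[OF born_moduleD(1)[OF M]])
  note v = vector_space_simps[OF born_moduleD(1)[OF M]]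
  interpret MM: abelian_group M by (rule v(1))
  let ?C = "finsupp_funs (tuples G n)"
  let ?F = "{\<phi> \<in> lin_maps (C_alg G n) M.
      \<forall>f\<in>group_algebra G. \<forall>c\<in>carrier (C_alg G n). \<phi> (chain_act G f c) = act M f (\<phi> c)}"
  have F: "\<psi> \<in> ?F \<longleftrightarrow> \<psi> \<in> carrier (cochains G M n)" for \<psi> by (simp add: cochains_def)
  note C = fun_subspaceD[OF fun_subspace_finsupp[of "tuples G n"]]
  have H: "f \<in> carrier (H_alg B G L)" if "f \<in> group_algebra G" for f using that group_algebra_H_alg by blast
  show "?F \<subseteq> carrier (C_alg G n) \<rightarrow>\<^sub>E carrier M" by (auto simp: lin_maps_def)
  show "(\<lambda>c\<in>carrier (C_alg G n). \<zero>\<^bsub>M\<^esub>) \<in> ?F"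
    unfolding F unfolding cochains_iff carrier_C_alg
    using C act_zero[OF M] H finsupp_chain_act v(2,6) by simp
  show "(\<lambda>c\<in>carrier (C_alg G n). \<phi> c \<oplus>\<^bsub>M\<^esub> \<psi> c) \<in> ?F" if "\<phi> \<in> ?F" "\<psi> \<in> ?F" for \<phi> \<psi>
  proof -
    have p: "\<phi> \<in> carrier (cochains G M n)" "\<psi> \<in> carrier (cochains G M n)" using that F by auto
    note p = p[unfolded cochains_iff]
    have mem: "\<phi> c \<in> carrier M" "\<psi> c \<in> carrier M" if "c \<in> ?C" for c using p that by auto
    show ?thesis
      unfolding F unfolding cochains_iff carrier_C_alg
      using p mem C finsupp_chain_act born_module_act_add[OF M H] v(10) by (simp add: MM.a_ac)
  qed
  show "(\<lambda>c\<in>carrier (C_alg G n). a \<odot>\<^bsub>M\<^esub> \<phi> c) \<in> ?F" if "\<phi> \<in> ?F" for a \<phi>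
  proof -
    have p: "\<phi> \<in> carrier (cochains G M n)" using that F by auto
    note p = p[unfolded cochains_iff]
    have mem: "\<phi> c \<in> carrier M" if "c \<in> ?C" for c using p that by auto
    have sw: "a \<odot>\<^bsub>M\<^esub> (b \<odot>\<^bsub>M\<^esub> x) = b \<odot>\<^bsub>M\<^esub> (a \<odot>\<^bsub>M\<^esub> x)" if "x \<in> carrier M" for b x
      using v(8)[OF that] by (metis mult.commute)
    show ?thesis
      unfolding F unfolding cochains_iff carrier_C_alg
      using p mem C finsupp_chain_act born_module_act_smult[OF M H] v(4,10) sw by simp
  qed
qed

lemma cochains_coboundary:
  assumes \<psi>: "\<psi> \<in> carrier (cochains G M n)"
  shows "(\<lambda>c\<in>carrier (C_alg G (Suc n)). \<psi> (bar_bd (Suc n) c)) \<in> carrier (cochains G M (Suc n))"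
proof -
  note p = \<psi>[unfolded cochains_iff]
  note C = fun_subspaceD[OF fun_subspace_finsupp[of "tuples G (Suc n)"]]
  have eqv: "bar_bd (Suc n) (chain_act G f c) = chain_act G f (bar_bd (Suc n) c)"
    if "f \<in> group_algebra G" "c \<in> finsupp_funs (tuples G (Suc n))" for f c
    using bar_bd_chain_act[of f c n] that group_algebra_H_alg finsupp_BC[of "Suc n"] by blast
  have add: "bar_bd (Suc n) (c + c') = bar_bd (Suc n) c + bar_bd (Suc n) c'"
    if "c \<in> finsupp_funs (tuples G (Suc n))" "c' \<in> finsupp_funs (tuples G (Suc n))" for c c'
    by (rule bar_bd_add[OF l1_finsupp[OF that(1)] l1_finsupp[OF that(2)]])
  show ?thesis
    unfolding cochains_iff carrier_C_alg
    using p C finsupp_chain_act bar_bd_finsupp[of _ n] eqv add by (auto simp: bar_bd_scl)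
qed

lemma restrict_cochains:
  assumes \<phi>: "\<phi> \<in> carrier (B_cochains B G L M n)"
  shows "restrict \<phi> (carrier (C_alg G n)) \<in> carrier (cochains G M n)"
proof -
  note p = B_cochainsD(2)[OF \<phi>, unfolded bdd_linear_def function_spaceD[OF function_space_BC]]
  note C = fun_subspaceD[OF fun_subspace_finsupp[of "tuples G n"]]
  have B: "c \<in> carrier (BC B G L n)" if "c \<in> finsupp_funs (tuples G n)" for c using that finsupp_BC by blast
  have H: "f \<in> carrier (H_alg B G L)" if "f \<in> group_algebra G" for f using that group_algebra_H_alg by blast
  show ?thesis
    unfolding cochains_iff carrier_C_alg
    using p B H C finsupp_chain_act B_cochainsD(3)[OF \<phi>] by simp
qed

end

lemma coset_self: "vector_space_C V \<Longrightarrow> additive_subgroup W V \<Longrightarrow> x \<in> carrier V \<Longrightarrow> x \<in> W +>\<^bsub>V\<^esub> x"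
proof -
  assume V: "vector_space_C V" and W: "additive_subgroup W V" and x: "x \<in> carrier V"
  interpret abelian_group V by (rule vector_space_simps(1)[OF V])
  have "\<zero>\<^bsub>V\<^esub> \<oplus>\<^bsub>V\<^esub> x \<in> W +>\<^bsub>V\<^esub> x"
    unfolding a_r_coset_def' using subspace_zero_mem[OF W] by blast
  then show ?thesis using x by simp
qed

lemma (in bounded_group) BH_simps:
  "\<zero>\<^bsub>BH B G L M n\<^esub> = bd_map M (Suc n) ` carrier (B_chains B G L M (Suc n))"
  by (simp add: BH_def homology_def subquotient_def)

lemma (in bounded_group) BH_zero_additive_subgroup:
  assumes M: "bornological_module (H_alg B G L) M"
  shows "additive_subgroup \<zero>\<^bsub>BH B G L M n\<^esub> (B_chains B G L M n)"
  unfolding BH_simps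
  using bdd_linear_bd_map[OF M, of n] unfolding bdd_linear_def
  by (intro linear_image_additive_subgroup B_chains_vector_space[OF M]) auto

section \<open>The comparison maps\<close>

context cap_setting
begin

lemma H_co_zero:
  "\<zero>\<^bsub>H_co G V 0\<^esub> = {\<zero>\<^bsub>cochains G V 0\<^esub>}"
  "\<zero>\<^bsub>H_co G V (Suc k)\<^esub> =
     (\<lambda>\<psi>. \<lambda>c\<in>carrier (C_alg G (Suc k)). \<psi> (bar_bd (Suc k) c)) ` carrier (cochains G V k)"
  by (simp_all add: H_co_def cohomology_def subquotient_def)

lemma cochains_simps:
  "\<zero>\<^bsub>cochains G V n\<^esub> = (\<lambda>c\<in>carrier (C_alg G n). \<zero>\<^bsub>V\<^esub>)"
  "\<phi> \<oplus>\<^bsub>cochains G V n\<^esub> \<psi> = (\<lambda>c\<in>carrier (C_alg G n). \<phi> c \<oplus>\<^bsub>V\<^esub> \<psi> c)"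
  "a \<odot>\<^bsub>cochains G V n\<^esub> \<phi> = (\<lambda>c\<in>carrier (C_alg G n). a \<odot>\<^bsub>V\<^esub> \<phi> c)"
  by (simp_all add: cochains_def)

lemma B_cochains_simps:
  "\<zero>\<^bsub>B_cochains B G L V n\<^esub> = (\<lambda>c\<in>carrier (BC B G L n). \<zero>\<^bsub>V\<^esub>)"
  "\<phi> \<oplus>\<^bsub>B_cochains B G L V n\<^esub> \<psi> = (\<lambda>c\<in>carrier (BC B G L n). \<phi> c \<oplus>\<^bsub>V\<^esub> \<psi> c)"
  by (simp_all add: B_cochains_def)

lemma H_co_zero_additive_subgroup: "additive_subgroup \<zero>\<^bsub>H_co G V i\<^esub> (cochains G V i)"
proof (cases i)
  case 0
  show ?thesis unfolding 0 H_co_zero by (rule zero_additive_subgroup[OF cochains_vector_space[OF V]])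
next
  case (Suc k)
  show ?thesis
    unfolding Suc H_co_zero
  proof (rule linear_image_additive_subgroup[OF cochains_vector_space[OF V] cochains_vector_space[OF V]])
    show "(\<lambda>c\<in>carrier (C_alg G (Suc k)). \<psi> (bar_bd (Suc k) c)) \<in> carrier (cochains G V (Suc k))"
      if "\<psi> \<in> carrier (cochains G V k)" for \<psi>
      by (rule cochains_coboundary[OF that])
    have b: "bar_bd (Suc k) c \<in> finsupp_funs (tuples G k)" if "c \<in> finsupp_funs (tuples G (Suc k))" for c
      by (rule bar_bd_finsupp[OF that])
    show "(\<lambda>c\<in>carrier (C_alg G (Suc k)). (\<phi> \<oplus>\<^bsub>cochains G V k\<^esub> \<psi>) (bar_bd (Suc k) c)) =
        (\<lambda>c\<in>carrier (C_alg G (Suc k)). \<phi> (bar_bd (Suc k) c)) \<oplus>\<^bsub>cochains G V (Suc k)\<^esub>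
        (\<lambda>c\<in>carrier (C_alg G (Suc k)). \<psi> (bar_bd (Suc k) c))" for \<phi> \<psi>
      unfolding cochains_simps by (rule restrict_ext) (use b in simp)
    show "(\<lambda>c\<in>carrier (C_alg G (Suc k)). (a \<odot>\<^bsub>cochains G V k\<^esub> \<psi>) (bar_bd (Suc k) c)) =
        a \<odot>\<^bsub>cochains G V (Suc k)\<^esub> (\<lambda>c\<in>carrier (C_alg G (Suc k)). \<psi> (bar_bd (Suc k) c))" for a \<psi>
      unfolding cochains_simps by (rule restrict_ext) (use b in simp)
  qed
qed

lemma coset_memI: "a \<in> A \<Longrightarrow> a \<oplus>\<^bsub>R\<^esub> b \<in> A +>\<^bsub>R\<^esub> b"
  unfolding a_r_coset_def' by blast

definition B_cocycle where
  "B_cocycle i \<phi> \<longleftrightarrow> \<phi> \<in> carrier (B_cochains B G L V i) \<and>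
     (\<forall>c\<in>carrier (BC B G L (Suc i)). \<phi> (bar_bd (Suc i) c) = \<zero>\<^bsub>V\<^esub>)"

text \<open>The members of a bounded class differ by bounded coboundaries. These are killed by the
  differential, so every member is a cocycle; restricted to finite chains they are ordinary
  coboundaries, so \<open>the_elem\<close> in \<open>comparison_co\<close> is taken of a
  singleton.\<close>

lemma BH_co_class:
  assumes X: "X \<in> carrier (BH_co B G L V i)"
  shows "X \<noteq> {}" "\<And>\<phi>. \<phi> \<in> X \<Longrightarrow> B_cocycle i \<phi>"
    "\<And>\<phi>. \<phi> \<in> X \<Longrightarrow> comparison_co G V i X =
      \<zero>\<^bsub>H_co G V i\<^esub> +>\<^bsub>cochains G V i\<^esub> restrict \<phi> (carrier (C_alg G i))"
proof -
  let ?C = "B_cochains B G L V"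
  let ?r = "\<lambda>\<phi>. restrict \<phi> (carrier (C_alg G i))" and ?W = "\<zero>\<^bsub>H_co G V i\<^esub>"
  \<comment> \<open>The bounded coboundaries, spelled the way \<open>cohomology\<close> unfolds:
    only zero in degree 0, and \<open>Suc (i - 1)\<close> in place of \<open>i\<close>
    otherwise.\<close>
  define W where "W = (if i = 0 then {\<zero>\<^bsub>?C 0\<^esub>}
    else (\<lambda>\<phi>. \<lambda>c\<in>carrier (BC B G L (Suc (i - 1))). \<phi> (bar_bd (Suc (i - 1)) c)) ` carrier (?C (i - 1)))"
  note v = vector_space_simps[OF born_moduleD(1)[OF V]]
  interpret VV: abelian_group V by (rule v(1))
  obtain \<phi>0 where \<phi>0: "\<phi>0 \<in> carrier (?C i)"
      "(\<lambda>c\<in>carrier (BC B G L (Suc i)). \<phi>0 (bar_bd (Suc i) c)) = \<zero>\<^bsub>?C (Suc i)\<^esub>"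
    and X_eq: "X = W +>\<^bsub>?C i\<^esub> \<phi>0"
    using X unfolding BH_co_def cohomology_def subquotient_def W_def by auto
  have cyc0: "\<phi>0 (bar_bd (Suc i) c) = \<zero>\<^bsub>V\<^esub>" if "c \<in> carrier (BC B G L (Suc i))" for c
    using fun_cong[OF \<phi>0(2), of c] that by (simp add: B_cochains_simps)
  have mem0: "\<phi>0 c \<in> carrier V" if "c \<in> carrier (BC B G L i)" for c
    using B_cochainsD(1)[OF \<phi>0(1)] that by blast
  have rB: "c \<in> carrier (BC B G L j)" if "c \<in> finsupp_funs (tuples G j)" for c j
    using finsupp_BC that by blast
  have main: "B_cocycle i \<phi> \<and> ?W +>\<^bsub>cochains G V i\<^esub> ?r \<phi> = ?W +>\<^bsub>cochains G V i\<^esub> ?r \<phi>0" if \<phi>: "\<phi> \<in> X" for \<phi>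
  proof -
    obtain w where w: "w \<in> W" "\<phi> = w \<oplus>\<^bsub>?C i\<^esub> \<phi>0" using \<phi> unfolding X_eq a_r_coset_def' by blast
    show ?thesis
    proof (cases i)
      case 0
      then have "w = \<zero>\<^bsub>?C i\<^esub>" using w(1) by (simp add: W_def)
      then have "\<phi> = (\<lambda>c\<in>carrier (BC B G L i). \<zero>\<^bsub>V\<^esub> \<oplus>\<^bsub>V\<^esub> \<phi>0 c)"
        unfolding w(2) B_cochains_simps by (auto simp: fun_eq_iff)
      also have "\<dots> = \<phi>0"
        by (rule extensionalityI[where A = "carrier (BC B G L i)"])
          (use B_cochainsD(1)[OF \<phi>0(1)] mem0 in \<open>auto simp: PiE_iff\<close>)
      finally show ?thesis using \<phi>0(1) cyc0 by (simp add: B_cocycle_def)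
    next
      case (Suc k)
      obtain \<eta> where \<eta>: "\<eta> \<in> carrier (?C k)" "w = (\<lambda>c\<in>carrier (BC B G L (Suc k)). \<eta> (bar_bd (Suc k) c))"
        using w(1) by (auto simp: W_def Suc)
      have wC: "w \<in> carrier (?C i)" unfolding \<eta>(2) Suc by (rule B_cochains_coboundary[OF \<eta>(1)])
      have \<phi>C: "\<phi> \<in> carrier (?C i)"
        unfolding w(2) B_cochains_simps by (rule B_cochains_add[OF V wC \<phi>0(1)])
      have \<phi>_eq: "\<phi> c = \<eta> (bar_bd (Suc k) c) \<oplus>\<^bsub>V\<^esub> \<phi>0 c" if "c \<in> carrier (BC B G L i)" for c
        using that unfolding w(2) \<eta>(2) B_cochains_simps Suc by simp
      \<comment> \<open>Homogeneity at the scalar 0 gives that \<eta> vanishes at 0, the value that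
        the twofold boundary takes in the cocycle condition.\<close>
      have "\<eta> (scl 0 0) = 0 \<odot>\<^bsub>V\<^esub> \<eta> 0"
        using B_cochains_linear_cochain[OF \<eta>(1)] fun_subspaceD(1)[OF fun_subspace_finsupp]
        unfolding linear_cochain_def by blast
      moreover have "\<eta> 0 \<in> carrier V"
        using B_cochains_linear_cochain[OF \<eta>(1)] fun_subspaceD(1)[OF fun_subspace_finsupp]
        unfolding linear_cochain_def by blast
      ultimately have \<eta>0: "\<eta> 0 = \<zero>\<^bsub>V\<^esub>" using v(5) by simp
      have "\<phi> (bar_bd (Suc i) c) = \<zero>\<^bsub>V\<^esub>" if c: "c \<in> carrier (BC B G L (Suc i))" for c
        using bar_bd_BC[OF c] cyc0[OF c] bar_bd_bar_bd[OF l1_BC[OF c], of i] \<eta>0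
        by (simp add: \<phi>_eq Suc)
      then have 1: "B_cocycle i \<phi>" using \<phi>C by (simp add: B_cocycle_def)
      \<comment> \<open>The bounded primitive \<eta>, restricted to finite chains, is an ordinary
        primitive, so the correction disappears modulo the coboundaries in
        \<open>H_co\<close>.\<close>
      let ?w = "\<lambda>c\<in>carrier (C_alg G (Suc k)). (restrict \<eta> (carrier (C_alg G k))) (bar_bd (Suc k) c)"
      have "?w \<in> ?W" unfolding Suc H_co_zero by (rule imageI[OF restrict_cochains[OF \<eta>(1)]])
      moreover have "?r \<phi> = ?w \<oplus>\<^bsub>cochains G V i\<^esub> ?r \<phi>0"
        unfolding cochains_simps Suc
        by (rule restrict_ext) (use rB bar_bd_finsupp \<phi>_eq Suc in auto)
      ultimately have "?W +>\<^bsub>cochains G V i\<^esub> ?r \<phi> = ?W +>\<^bsub>cochains G V i\<^esub> ?r \<phi>0"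
        using coset_absorb[OF cochains_vector_space[OF V] H_co_zero_additive_subgroup _ restrict_cochains[OF \<phi>0(1)]]
        by metis
      with 1 show ?thesis ..
    qed
  qed
  have "W \<noteq> {}"
    using B_cochains_zero[OF V, of "i - 1"] unfolding W_def by auto
  then show ne: "X \<noteq> {}" unfolding X_eq a_r_coset_def' by auto
  show "\<And>\<phi>. \<phi> \<in> X \<Longrightarrow> B_cocycle i \<phi>" using main by blast
  have "(\<lambda>\<phi>. ?W +>\<^bsub>cochains G V i\<^esub> ?r \<phi>) ` X = {?W +>\<^bsub>cochains G V i\<^esub> ?r \<phi>0}"
    using ne main by blast
  then have "comparison_co G V i X = ?W +>\<^bsub>cochains G V i\<^esub> ?r \<phi>0"
    by (simp only: comparison_co_def induced_map_def the_elem_eq)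
  then show "\<And>\<phi>. \<phi> \<in> X \<Longrightarrow> comparison_co G V i X = ?W +>\<^bsub>cochains G V i\<^esub> ?r \<phi>"
    using main by metis
qed

text \<open>The algebraic counterpart of \<open>chain_bd_rels\<close>: the relations form a plain
  span here, so minimality of the span reduces the claim to generators.\<close>

lemma chain_bd_alg_rels:
  assumes "c \<in> alg_rels (Suc m)" shows "chain_bd (Suc m) c \<in> alg_rels m"
proof -
  note P = alg_rels_properties[of m]
  note W = fun_subspaceD[OF P(4)]
  let ?K = "{c \<in> alg_chains (Suc m). chain_bd (Suc m) c \<in> alg_rels m}"
  note A = fun_subspaceD[OF fun_subspace_finsupp[of "finsupp_funs (tuples G (Suc m)) \<times> carrier D"]]
  note rel = bilinear_relsD[OF P(1), unfolded C_alg_simps carrier_C_alg]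
  note simps = pushforward_diff l1_diff l1_scl pushforward_scl bar_bd_scl C_alg_simps
  have "alg_rels (Suc m) \<subseteq> ?K"
  proof (rule alg_rels_minimal)
    show "fun_subspace ?K"
      unfolding fun_subspace_def
    proof (intro conjI ballI allI)
      show "0 \<in> ?K" using A(1) W(1) by simp
      show "c + c' \<in> ?K" if c: "c \<in> ?K" and c': "c' \<in> ?K" for c c'
      proof -
        have "c + c' \<in> alg_chains (Suc m)" by (rule A(2)) (use c c' in blast)+
        moreover have "chain_bd (Suc m) (c + c') = chain_bd (Suc m) c + chain_bd (Suc m) c'"
          by (rule pushforward_add; rule l1_finsupp) (use c c' in blast)+
        moreover have "chain_bd (Suc m) c + chain_bd (Suc m) c' \<in> alg_rels m"
          by (rule W(2)) (use c c' in blast)+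
        ultimately show ?thesis unfolding mem_Collect_eq by metis
      qed
      show "scl a c \<in> ?K" if "c \<in> ?K" for a c
        using that A(3)[of c a] W(3) by (simp add: pushforward_scl)
    qed
    show "r \<in> ?K" if r: "r \<in> bilinear_rels (C_alg G (Suc m)) D" for r
    proof -
      have "chain_bd (Suc m) r \<in> alg_rels m"
        using r
      proof (cases rule: bilinear_rels_cases)
        case (add1 x x' y)
        then show ?thesis
          using rel(1)[OF bar_bd_finsupp bar_bd_finsupp, of x x' y] bar_bd_add[OF l1_finsupp l1_finsupp, of x _ x']
          by (simp add: simps)
      next
        case (add2 x y y')
        then show ?thesis using rel(2)[OF bar_bd_finsupp, of x y y'] by (simp add: simps)
      next
        case (scl1 z x y)
        then show ?thesis using rel(3)[OF bar_bd_finsupp, of x y z] by (simp add: simps)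
      next
        case (scl2 z x y)
        then show ?thesis using rel(4)[OF bar_bd_finsupp, of x y z] by (simp add: simps)
      qed
      then show ?thesis using r bilinear_rels_alg_chains by blast
    qed
    show "dirac (chain_ract G y f, x) - dirac (y, act D f x) \<in> ?K"
      if f: "f \<in> group_algebra G" "y \<in> finsupp_funs (tuples G (Suc m))" "x \<in> carrier D" for f y x
    proof -
      have "dirac (chain_ract G y f, x) - dirac (y, act D f x) \<in> CG_rels G D (Suc m)"
        unfolding balanced_rels_def fun_diff_def carrier_C_alg using f by blast
      then have 1: "dirac (chain_ract G y f, x) - dirac (y, act D f x) \<in> alg_chains (Suc m)"
        using CG_rels_alg_chains by blast
      have e: "bar_bd (Suc m) (chain_ract G y f) = chain_ract G (bar_bd (Suc m) y) f"
        by (rule bar_bd_chain_ract) (use f group_algebra_H_alg finsupp_BC[of "Suc m"] in blast)+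
      have "dirac (chain_ract G (bar_bd (Suc m) y) f, x) - dirac (bar_bd (Suc m) y, act D f x) \<in> CG_rels G D m"
        unfolding balanced_rels_def fun_diff_def carrier_C_alg using f bar_bd_finsupp by blast
      then have "chain_bd (Suc m) (dirac (chain_ract G y f, x) - dirac (y, act D f x)) \<in> alg_rels m"
        using P(2) by (auto simp: pushforward_diff e)
      with 1 show ?thesis by blast
    qed
  qed
  with assms show ?thesis by blast
qed

section \<open>The comparison map in homology and the injectivity argument\<close>

abbreviation alg_class where
  "alg_class m c \<equiv> alg_rels m +>\<^bsub>fun_space (alg_chains m)\<^esub> c"

lemma chains_simps:
  "carrier (chains G D m) = alg_class m ` alg_chains m" "\<zero>\<^bsub>chains G D m\<^esub> = alg_rels m"
  "add (chains G D m) = set_add (fun_space (alg_chains m))"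
  by (simp_all add: chains_def alg_tensor_def subquotient_def)

text \<open>The differential is written as \<open>H_ord\<close> unfolds in degree
  \<open>Suc m\<close>, with the lower degree appearing as \<open>Suc m - 1\<close>.\<close>

lemma alg_bd_class:
  assumes "c \<in> alg_chains (Suc m)"
  shows "induced_map (fun_space (finsupp_funs (carrier (C_alg G (Suc m - 1)) \<times> carrier D)))
      (alg_tensor_rels (C_alg G (Suc m - 1)) D (CG_rels G D (Suc m - 1)))
      (pushforward (map_prod (bar_bd (Suc m)) id)) (alg_class (Suc m) c) = alg_class m (chain_bd (Suc m) c)"
  unfolding diff_Suc_1 carrier_C_alg
proof (rule induced_map_fun_coset[OF function_space_alg_reps function_space_alg_reps])
  show "chain_bd (Suc m) (c + c') = chain_bd (Suc m) c + chain_bd (Suc m) c'"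
    if "c \<in> carrier (fun_space (alg_chains (Suc m)))" "c' \<in> carrier (fun_space (alg_chains (Suc m)))" for c c'
    using that by (intro pushforward_add) (auto intro: l1_finsupp)
qed (use assms alg_rels_properties chain_bd_alg_chains chain_bd_alg_rels in auto)

lemma comparison_chain_class:
  assumes "c \<in> alg_chains m"
  shows "induced_map (bounded_l1 (BC B G L m) D) (chain_rels m D) id (alg_class m c) = chain_class m D c"
proof -
  have "induced_map (chain_reps m D) (chain_rels m D) id (alg_class m c) = chain_class m D (id c)"
    by (rule induced_map_fun_coset[OF function_space_alg_reps function_space_chain_reps[OF D]])
      (use assms alg_rels_properties[of m] chain_rels_properties(3,4)[OF D] alg_rels_chain_rels[of m]
        alg_chains_chain_reps[of m] in auto)
  then show ?thesis by simp
qed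

text \<open>Extracts a finite representative of the fundamental class. Its boundary need not vanish
  as a function, only lie in \<open>alg_rels\<close>; in degree 0 there is no cycle condition, in
  accordance with \<open>homology\<close>.\<close>

lemma comparison_image:
  assumes "\<mu> \<in> comparison B G L D n ` carrier (H_ord G D n)"
  obtains c where "c \<in> alg_chains n" "n = 0 \<or> chain_bd n c \<in> alg_rels (n - 1)"
    "\<mu> = \<zero>\<^bsub>BH B G L D n\<^esub> +>\<^bsub>B_chains B G L D n\<^esub> chain_class n D c"
proof -
  let ?d = "\<lambda>n. induced_map (fun_space (finsupp_funs (carrier (C_alg G (n - 1)) \<times> carrier D)))
            (alg_tensor_rels (C_alg G (n - 1)) D (CG_rels G D (n - 1)))
            (pushforward (map_prod (bar_bd n) id))"
  let ?U = "?d (Suc n) ` carrier (chains G D (Suc n))"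
  let ?Z = "\<zero>\<^bsub>BH B G L D n\<^esub>"
  let ?J = "induced_map (bounded_l1 (BC B G L n) D) (chain_rels n D) id"
  obtain X where X: "X \<in> carrier (H_ord G D n)" and \<mu>: "\<mu> = comparison B G L D n X" using assms by blast
  obtain z where z: "z \<in> carrier (chains G D n)" "n = 0 \<or> ?d n z = \<zero>\<^bsub>chains G D (n - 1)\<^esub>"
    and Xz: "X = ?U +>\<^bsub>chains G D n\<^esub> z"
    using X unfolding H_ord_def homology_def subquotient_def by auto
  obtain c where c: "c \<in> alg_chains n" "z = alg_class n c" using z(1) unfolding chains_simps by blast
  have cyc: "n = 0 \<or> chain_bd n c \<in> alg_rels (n - 1)"
  proof (cases n)
    case (Suc m)
    have "alg_class m (chain_bd (Suc m) c) = alg_rels m"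
      using z(2) alg_bd_class[of c m] c unfolding Suc chains_simps by simp
    also have "\<dots> = alg_class m 0" by (auto simp: coset_eq_image[OF function_space_alg_reps])
    finally have "chain_bd (Suc m) c - 0 \<in> alg_rels m"
      unfolding coset_eq_iff[OF function_space_alg_reps alg_rels_properties(4)] .
    then show ?thesis by (simp add: Suc)
  qed simp
  have cm: "chain_class n D c \<in> carrier (B_chains B G L D n)"
    using c(1) alg_chains_chain_reps[of n] unfolding chain_class_simps(4)[OF D] by blast
  have "comparison B G L D n X = ?Z +>\<^bsub>B_chains B G L D n\<^esub> ?J z"
    unfolding comparison_def Xz
  proof (rule induced_map_coset)
    show "abelian_group (B_chains B G L D n)" by (rule vector_space_simps(1)[OF B_chains_vector_space[OF D]])
    show "additive_subgroup ?Z (B_chains B G L D n)" by (rule BH_zero_additive_subgroup[OF D])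
    show "?J z \<in> carrier (B_chains B G L D n)" unfolding c(2) comparison_chain_class[OF c(1)] by (rule cm)
    have "0 \<in> alg_chains (Suc n)" by (rule fun_subspaceD(1)[OF fun_subspace_finsupp])
    then show "?U \<noteq> {}" unfolding chains_simps by blast
    \<comment> \<open>Another chain in the ordinary class differs by an ordinary boundary, which the
      comparison map sends to a boundary of the completed complex.\<close>
    fix u assume "u \<in> ?U"
    then obtain e where e: "e \<in> alg_chains (Suc n)" "u = alg_class n (chain_bd (Suc n) e)"
      unfolding chains_simps using alg_bd_class by blast
    have ez: "u \<oplus>\<^bsub>chains G D n\<^esub> z = alg_class n (chain_bd (Suc n) e + c)"
      unfolding e(2) c(2) chains_simps by (rule coset_add[OF function_space_alg_reps alg_rels_properties(4)])
    have ec: "chain_bd (Suc n) e + c \<in> alg_chains n"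
      by (rule fun_subspaceD(2)[OF fun_subspace_finsupp chain_bd_alg_chains[OF e(1)] c(1)])
    have eY: "e \<in> carrier (chain_reps (Suc n) D)" using e(1) alg_chains_chain_reps[of "Suc n"] by blast
    have "chain_class n D (chain_bd (Suc n) e) = bd_map D (Suc n) (chain_class (Suc n) D e)"
      by (rule bd_map_coset[OF D eY, symmetric])
    then have "chain_class n D (chain_bd (Suc n) e) \<in> ?Z"
      unfolding BH_simps chain_class_simps(4)[OF D] using eY by blast
    then have "chain_class n D (chain_bd (Suc n) e) \<oplus>\<^bsub>B_chains B G L D n\<^esub> chain_class n D c
        \<in> ?Z +>\<^bsub>B_chains B G L D n\<^esub> chain_class n D c"
      by (rule coset_memI)
    then show "?J (u \<oplus>\<^bsub>chains G D n\<^esub> z) \<in> ?Z +>\<^bsub>B_chains B G L D n\<^esub> ?J z"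
      unfolding ez comparison_chain_class[OF ec] chain_class_simps(1)[OF D]
      unfolding c(2) comparison_chain_class[OF c(1)] .
  qed
  then have "\<mu> = ?Z +>\<^bsub>B_chains B G L D n\<^esub> chain_class n D c"
    unfolding \<mu> c(2) comparison_chain_class[OF c(1)] .
  with c(1) cyc show ?thesis by (rule that)
qed

text \<open>The cap product of a bounded class with \<mu> is determined by the ordinary class under
  it, so the cap product factors through the comparison map; injectivity of the composite forces
  injectivity of the first factor.\<close>

lemma comparison_co_inj:
  assumes \<mu>: "\<mu> \<in> comparison B G L D n ` carrier (H_ord G D n)" and i: "i \<le> n"
    and inj: "inj_on (cap_product B G L D V n i \<mu>) (carrier (BH_co B G L V i))"
  shows "inj_on (comparison_co G V i) (carrier (BH_co B G L V i))"
proof (rule inj_onI)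
  fix X Y assume X: "X \<in> carrier (BH_co B G L V i)" and Y: "Y \<in> carrier (BH_co B G L V i)"
    and XY: "comparison_co G V i X = comparison_co G V i Y"
  obtain c where c: "c \<in> alg_chains n" and cyc: "n = 0 \<or> chain_bd n c \<in> alg_rels (n - 1)"
    and \<mu>c: "\<mu> = \<zero>\<^bsub>BH B G L D n\<^esub> +>\<^bsub>B_chains B G L D n\<^esub> chain_class n D c"
    by (rule comparison_image[OF \<mu>])
  let ?C = "\<lambda>M n. B_chains B G L M n"
  let ?Z = "\<zero>\<^bsub>BH B G L E (n - i)\<^esub>"
  let ?cap = "\<lambda>\<phi>. cap_chain B G L D V n i \<phi>"
  note absorb = coset_absorb[OF B_chains_vector_space[OF E] BH_zero_additive_subgroup[OF E]]
  have bd_Z: "bd_map E (Suc (n - i)) w \<in> ?Z" if "w \<in> carrier (?C E (Suc (n - i)))" for w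
    unfolding BH_simps using that by (rule imageI)
  have cs: "chain_class (n - i) E (cap_sum i \<phi> c) \<in> carrier (?C E (n - i))" if "linear_cochain i \<phi>" for \<phi>
    unfolding chain_class_simps(4)[OF E] by (rule imageI[OF cap_sum_mem[OF that i c]])
  \<comment> \<open>Independence of the representative of \<mu>: \<open>z\<close> is the class of
    \<open>c\<close> plus a boundary, and capping that boundary with a cocycle yields a boundary
    again, the sign \<open>(-1) ^ i\<close> being absorbed by linearity.\<close>
  have cap_class: "?Z +>\<^bsub>?C E (n - i)\<^esub> ?cap \<phi> z = ?Z +>\<^bsub>?C E (n - i)\<^esub> chain_class (n - i) E (cap_sum i \<phi> c)"
    if \<phi>: "B_cocycle i \<phi>" and z: "z \<in> \<mu>" for \<phi> z
  proof -
    have \<phi>C: "\<phi> \<in> carrier (B_cochains B G L V i)"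
      and \<phi>0: "\<And>c. c \<in> carrier (BC B G L (Suc i)) \<Longrightarrow> \<phi> (bar_bd (Suc i) c) = \<zero>\<^bsub>V\<^esub>"
      using \<phi> by (auto simp: B_cocycle_def)
    note lin = B_cochains_linear_cochain[OF \<phi>C]
    note T = cap_chain_is_cap[OF \<phi>C i] and T' = cap_chain_is_cap[OF \<phi>C le_SucI[OF i]]
    obtain w where w: "w \<in> carrier (?C D (Suc n))" "z = bd_map D (Suc n) w \<oplus>\<^bsub>?C D n\<^esub> chain_class n D c"
      using z unfolding \<mu>c a_r_coset_def' BH_simps by blast
    have bw: "bd_map D (Suc n) w \<in> carrier (?C D n)"
      using bdd_linear_bd_map[OF D, of n] w(1) unfolding bdd_linear_def by blast
    have cm: "chain_class n D c \<in> carrier (?C D n)"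
      using c alg_chains_chain_reps[of n] unfolding chain_class_simps(4)[OF D] by blast
    have "?cap \<phi> z = ?cap \<phi> (bd_map D (Suc n) w) \<oplus>\<^bsub>?C E (n - i)\<^esub> ?cap \<phi> (chain_class n D c)"
      using is_capD(1)[OF T] bw cm unfolding w(2) bdd_linear_def by blast
    also have "?cap \<phi> (chain_class n D c) = chain_class (n - i) E (cap_sum i \<phi> c)"
      by (rule cap_alg_chain[OF T lin i c])
    finally have eq: "?cap \<phi> z = ?cap \<phi> (bd_map D (Suc n) w) \<oplus>\<^bsub>?C E (n - i)\<^esub> chain_class (n - i) E (cap_sum i \<phi> c)" .
    let ?u = "cap_chain B G L D V (Suc n) i \<phi> w"
    have u: "?u \<in> carrier (?C E (Suc (n - i)))"
      using is_capD(2)[OF T'] w(1) unfolding Suc_diff_le[OF i] by blast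
    have "?cap \<phi> (bd_map D (Suc n) w) = (-1) ^ i \<odot>\<^bsub>?C E (n - i)\<^esub> bd_map E (Suc (n - i)) ?u"
      by (rule cap_cocycle_boundary[OF \<phi>C \<phi>0 i w(1)])
    also have "\<dots> = bd_map E (Suc (n - i)) ((-1) ^ i \<odot>\<^bsub>?C E (Suc (n - i))\<^esub> ?u)"
      using bdd_linear_bd_map[OF E, of "n - i"] u unfolding bdd_linear_def by simp
    also have "\<dots> \<in> ?Z"
      by (rule bd_Z[OF vector_space_simps(4)[OF B_chains_vector_space[OF E] u]])
    finally show ?thesis unfolding eq by (rule absorb[OF _ cs[OF lin]])
  qed
  \<comment> \<open>Equality of ordinary cohomology classes is turned into a primitive \<psi>, with
    no bound on it, which \<open>cap_sum_homologous\<close> converts into a bounding chain for the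
    difference of the two cap products.\<close>
  have indep: "?Z +>\<^bsub>?C E (n - i)\<^esub> chain_class (n - i) E (cap_sum i \<phi> c) =
      ?Z +>\<^bsub>?C E (n - i)\<^esub> chain_class (n - i) E (cap_sum i \<phi>' c)"
    if \<phi>: "B_cocycle i \<phi>" "B_cocycle i \<phi>'"
      and cl: "\<zero>\<^bsub>H_co G V i\<^esub> +>\<^bsub>cochains G V i\<^esub> restrict \<phi> (carrier (C_alg G i)) =
        \<zero>\<^bsub>H_co G V i\<^esub> +>\<^bsub>cochains G V i\<^esub> restrict \<phi>' (carrier (C_alg G i))" for \<phi> \<phi>'
  proof -
    have \<phi>C: "\<phi> \<in> carrier (B_cochains B G L V i)" "\<phi>' \<in> carrier (B_cochains B G L V i)"
      using \<phi> by (auto simp: B_cocycle_def)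
    note lin = B_cochains_linear_cochain[OF \<phi>C(1)] B_cochains_linear_cochain[OF \<phi>C(2)]
    have "restrict \<phi> (carrier (C_alg G i)) \<in> \<zero>\<^bsub>H_co G V i\<^esub> +>\<^bsub>cochains G V i\<^esub> restrict \<phi>' (carrier (C_alg G i))"
      unfolding cl[symmetric]
      by (rule coset_self[OF cochains_vector_space[OF V] H_co_zero_additive_subgroup restrict_cochains[OF \<phi>C(1)]])
    then obtain w where w: "w \<in> \<zero>\<^bsub>H_co G V i\<^esub>"
      "restrict \<phi> (carrier (C_alg G i)) = w \<oplus>\<^bsub>cochains G V i\<^esub> restrict \<phi>' (carrier (C_alg G i))"
      unfolding a_r_coset_def' by blast
    have pt: "\<phi> (dirac t) = w (dirac t) \<oplus>\<^bsub>V\<^esub> \<phi>' (dirac t)" if "t \<in> tuples G i" for t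
      using fun_cong[OF w(2), of "dirac t"] that by (simp add: cochains_simps)
    interpret VV: abelian_group V by (rule vector_space_simps(1)[OF born_moduleD(1)[OF V]])
    have "if i = 0 then \<forall>t\<in>tuples G i. \<phi> (dirac t) = \<phi>' (dirac t)
      else \<exists>\<psi>\<in>carrier (cochains G V (i - 1)). \<forall>t\<in>tuples G i.
        \<phi> (dirac t) = \<psi> (bar_bd i (dirac t)) \<oplus>\<^bsub>V\<^esub> \<phi>' (dirac t)"
    proof (cases i)
      case 0
      have "\<phi> (dirac t) = \<phi>' (dirac t)" if t: "t \<in> tuples G i" for t
      proof -
        have "w (dirac t) = \<zero>\<^bsub>V\<^esub>" using w(1) t unfolding 0 H_co_zero by (simp add: cochains_simps)
        moreover have "\<phi>' (dirac t) \<in> carrier V" using lin(2) t by (simp add: linear_cochain_def)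
        ultimately show ?thesis using pt[OF t] by simp
      qed
      then show ?thesis by (simp add: 0)
    next
      case (Suc k)
      obtain \<psi> where \<psi>: "\<psi> \<in> carrier (cochains G V k)"
        "w = (\<lambda>c\<in>carrier (C_alg G (Suc k)). \<psi> (bar_bd (Suc k) c))"
        using w(1) unfolding Suc H_co_zero by blast
      have "\<phi> (dirac t) = \<psi> (bar_bd i (dirac t)) \<oplus>\<^bsub>V\<^esub> \<phi>' (dirac t)" if "t \<in> tuples G i" for t
        using pt[OF that] that by (simp add: \<psi>(2) Suc)
      then show ?thesis using \<psi>(1) by (auto simp: Suc)
    qed
    from cap_sum_homologous[OF lin i c cyc this] obtain d where d: "d \<in> carrier (chain_reps (Suc (n - i)) E)"
      "cap_sum i \<phi> c - (chain_bd (Suc (n - i)) d + cap_sum i \<phi>' c) \<in> chain_rels (n - i) E" by blast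
    have "chain_class (n - i) E (cap_sum i \<phi> c) =
        bd_map E (Suc (n - i)) (chain_class (Suc (n - i)) E d) \<oplus>\<^bsub>?C E (n - i)\<^esub>
        chain_class (n - i) E (cap_sum i \<phi>' c)"
      unfolding bd_map_coset[OF E d(1)] chain_class_simps(1,3)[OF E] by (rule d(2))
    moreover have "bd_map E (Suc (n - i)) (chain_class (Suc (n - i)) E d) \<in> ?Z"
      by (rule bd_Z) (unfold chain_class_simps(4)[OF E], rule imageI[OF d(1)])
    ultimately show ?thesis using absorb[OF _ cs[OF lin(2)]] by metis
  qed
  obtain \<phi>X \<phi>Y where \<phi>X: "\<phi>X \<in> X" and \<phi>Y: "\<phi>Y \<in> Y" using BH_co_class(1)[OF X] BH_co_class(1)[OF Y] by blast
  \<comment> \<open>\<open>cap_product\<close> is \<open>the_elem\<close> of a set of cosets. For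
    both \<open>X\<close> and \<open>Y\<close> this set is the singleton of \<open>K\<close>; the
    members \<open>\<phi>X\<close>, \<open>\<phi>Y\<close> and the class of \<open>c\<close> in
    \<mu> ensure that it is nonempty.\<close>
  define K where "K = ?Z +>\<^bsub>?C E (n - i)\<^esub> chain_class (n - i) E (cap_sum i \<phi>X c)"
  have K: "?Z +>\<^bsub>?C E (n - i)\<^esub> ?cap \<phi> z = K" if \<phi>: "\<phi> \<in> X \<or> \<phi> \<in> Y" and z: "z \<in> \<mu>" for \<phi> z
  proof -
    have "B_cocycle i \<phi>" using \<phi> BH_co_class(2)[OF X] BH_co_class(2)[OF Y] by blast
    moreover have "\<zero>\<^bsub>H_co G V i\<^esub> +>\<^bsub>cochains G V i\<^esub> restrict \<phi> (carrier (C_alg G i)) =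
        \<zero>\<^bsub>H_co G V i\<^esub> +>\<^bsub>cochains G V i\<^esub> restrict \<phi>X (carrier (C_alg G i))"
      using \<phi> BH_co_class(3)[OF X] BH_co_class(3)[OF Y] \<phi>X XY by metis
    ultimately show ?thesis
      unfolding K_def using cap_class[OF _ z, of \<phi>] indep[of \<phi> \<phi>X] BH_co_class(2)[OF X \<phi>X] by simp
  qed
  have "chain_class n D c \<in> \<mu>"
    unfolding \<mu>c
    by (rule coset_self[OF B_chains_vector_space[OF D] BH_zero_additive_subgroup[OF D]])
      (use c alg_chains_chain_reps[of n] chain_class_simps(4)[OF D, of n] in blast)
  then have "{?Z +>\<^bsub>?C E (n - i)\<^esub> ?cap \<phi> z | \<phi> z. \<phi> \<in> X \<and> z \<in> \<mu>} = {K}"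
    "{?Z +>\<^bsub>?C E (n - i)\<^esub> ?cap \<phi> z | \<phi> z. \<phi> \<in> Y \<and> z \<in> \<mu>} = {K}"
    using K \<phi>X \<phi>Y by blast+
  then have "cap_product B G L D V n i \<mu> X = cap_product B G L D V n i \<mu> Y"
    by (simp only: cap_product_def)
  then show "X = Y" by (rule inj_onD[OF inj _ X Y])
qed

end

theorem theorem17:
  fixes B :: "(real \<Rightarrow> real) set" and G :: "('g, 'r) monoid_scheme" and L :: "'g \<Rightarrow> real"
    and n :: nat and D :: "('g \<Rightarrow> complex, 'd) born_module"
    and \<mu> :: "(('g list \<Rightarrow> complex) \<times> 'd \<Rightarrow> complex) set set"
  assumes "bounding_class B"
    and "group G" and "word_length_function G L"
    and "B_duality_group TYPE('v) B G L n D \<mu>"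
    and "\<mu> \<in> comparison B G L D n ` carrier (H_ord G D n)"
  shows "(finite_dimensional D \<longrightarrow> strongly_monocohomological TYPE('v) B G L) \<and>
    (\<not> finite_dimensional D \<longrightarrow>
      (\<forall>V :: ('g \<Rightarrow> complex, 'v) born_module.
        bornological_module (H_alg B G L) V \<and> finite_dimensional V \<longrightarrow>
          monocohomological_for B G L V))"
proof -
  have "monocohomological_for B G L V" if V: "bornological_module (H_alg B G L) V"
    for V :: "('g \<Rightarrow> complex, 'v) born_module"
    unfolding monocohomological_for_def
  proof
    fix i
    have D: "bornological_module (H_alg B G L) D"
      and dual: "cap_extends B G L D V"
        "\<forall>i\<le>n. lin_iso (BH_co B G L V i) (BH B G L (tensor_module B G L D V) (n - i))
                  (cap_product B G L D V n i \<mu>)"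
        "\<forall>i>n. carrier (BH_co B G L V i) = {\<zero>\<^bsub>BH_co B G L V i\<^esub>}"
      using assms(4) V unfolding B_duality_group_def by blast+
    interpret group G by fact
    interpret cap_setting G B L D V
      by unfold_locales (use assms(1,3) D V dual(1) in auto)
    show "inj_on (comparison_co G V i) (carrier (BH_co B G L V i))"
    proof (cases "i \<le> n")
      case True
      then have "inj_on (cap_product B G L D V n i \<mu>) (carrier (BH_co B G L V i))"
        using dual(2) by (auto simp: lin_iso_def bij_betw_def)
      then show ?thesis by (rule comparison_co_inj[OF assms(5) True])
    next
      \<comment> \<open>Above the dimension the bounded cohomology is a single point, on which every
        map is injective.\<close>
      case False
      then show ?thesis using dual(3) by simp
    qed
  qed
  then show ?thesis by (auto simp: strongly_monocohomological_def)
qed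

end
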